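(* Let $R$ be an étale $\mathbb{Z}[t^{\pm1}]$-algebra and suppose that the ring homomorphism $\mathrm{ev}_{t=1}:\mathbb{Z}[t^{\pm1}]\to\mathbb{Z}$ extends to a ring homomorphism $\mathrm{ev}_{t=1}:R\to\mathbb{Z}$. Then there is an injective map $$\mathcal{H}_{R/\mathbb{Z}[t^{\pm1}]}\hookrightarrow\varprojlim_n\mathcal{H}_{\mathbb{Z}}[t^{\pm1}]/(t^{-1};q)_n .$$ Moreover, if $f(t,q)\in\mathcal{H}_{R/\mathbb{Z}[t^{\pm1}]}$ satisfies $f(q^{n-1},q)\in\mathbb{Z}[q^{\pm1}]$ for all integers $n>0$, then its image under this map lies in the subring $\varprojlim_n\mathbb{Z}[t^{\pm1},q^{\pm1}]/(t^{-1};q)_n$.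
   Context: Notation: $(a;q)_n=\prod_{i=0}^{n-1}(1-aq^i)$. Roots of unity: fix primitive $m$-th roots of unity $\zeta_m$ ($m\ge1$) with $\zeta_{mm'}=\zeta_m\zeta_{m'}$ if $\gcd(m,m')=1$ and $(\zeta_{p^r})^p=\zeta_{p^{r-1}}$ for primes $p$, $r\ge1$. Then $\zeta_{pm}-\zeta_m$ is topologically nilpotent in $\mathbb{Z}_p[\zeta_{pm}]$, so power series in $q-\zeta_m=(q-\zeta_{pm})+(\zeta_{pm}-\zeta_m)$ can be re-expanded in $q-\zeta_{pm}$ after $p$-adic completion. Habiro ring: for an étale $\mathbb{Z}[t^{\pm1}]$-algebra $R$ and $p$ prime let $R_p=\varprojlim_n R/p^nR$ and let $\varphi_p:R_p\to R_p$ be the Frobenius lift (a ring homomorphism congruent to the $p$-th power map mod $p$) with $\varphi_p(t)=t^p$; extend it by $t^{1/(pm)}\mapsto t^{1/m}$, $\varphi_p(q)=q$, $\varphi_p(\zeta)=\zeta$ for roots of unity $\zeta$. Then $\mathcal{H}_{R/\mathbb{Z}[t^{\pm1}]}$ is the ring of all collections $(f_m)_{m\ge1}\in\prod_{m\ge1}R[\zeta_m,t^{1/m}][\![q-\zeta_m]\!]$ such that for all $m\ge1$ and all primes $p$, $f_m$ re-expanded at $q=\zeta_{pm}$ equals $\varphi_p f_{pm}$ in $R_p[\zeta_{pm},t^{1/m}][\![q-\zeta_{pm}]\!]$. Similarly $\mathcal{H}_{\mathbb{Z}}$ is the ring of collections $(f_m)_m\in\prod_m\mathbb{Z}[\zeta_m][\![q-\zeta_m]\!]$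 with $f_m$ re-expanded at $\zeta_{pm}$ equal to $f_{pm}$ in $\mathbb{Z}_p[\zeta_{pm}][\![q-\zeta_{pm}]\!]$; it is isomorphic to $\varprojlim_n\mathbb{Z}[q]/(q;q)_n$ and contains $\mathbb{Z}[q^{\pm1}]$ by Taylor expansion at each $\zeta_m$. Specialization: for $n\in\mathbb{Z}$, $f(t,q)\mapsto f(q^n,q)\in\mathcal{H}_{\mathbb{Z}}$ is given on the $m$-th component by the substitution $t^{1/m}\mapsto q^n$ (so $t\mapsto q^{mn}\equiv1$ modulo $q-\zeta_m$), extended to $R$ as the unique lift (using that $R$ is étale) to $\mathbb{Z}[\zeta_m][\![q-\zeta_m]\!]$ of $\mathrm{ev}_{t=1}:R\to\mathbb{Z}\subset\mathbb{Z}[\zeta_m]$.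
   Formalization: Injectivity of the natural ring map (with values f(q^i,q) at t=q^i) is stated for R an integral domain; it fails for R=Z[t^±1]×Z[t^±1], whose Habiro ring has zero divisors while the target has none. For general R only an injective map of sets is asserted. *)

theory Defs
  imports Complex_Main "HOL-Library.Poly_Mapping" "HOL-Algebra.Algebra"
    "HOL-Computational_Algebra.Primes" "HOL-Computational_Algebra.Polynomial"
begin

section \<open>Ring constructions\<close>

text \<open>The ring of finitely supported functions on a commutative monoid, with convolution;
  \<open>f k\<close> is the coefficient of the monomial with exponent \<open>k\<close>.\<close>

definition monoid_algebra :: "('a, 'm) ring_scheme \<Rightarrow> ('g::comm_monoid_add \<Rightarrow> 'a) ring" where
  "monoid_algebra A =
    \<lparr>carrier = {f. (\<forall>k. f k \<in> carrier A) \<and> finite {k. f k \<noteq> \<zero>\<^bsub>A\<^esub>}},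
     monoid.mult = (\<lambda>f g k. \<Oplus>\<^bsub>A\<^esub> ij \<in> {(i, j). f i \<noteq> \<zero>\<^bsub>A\<^esub> \<and> g j \<noteq> \<zero>\<^bsub>A\<^esub> \<and> i + j = k}.
                f (fst ij) \<otimes>\<^bsub>A\<^esub> g (snd ij)),
     monoid.one = (\<lambda>k. if k = 0 then \<one>\<^bsub>A\<^esub> else \<zero>\<^bsub>A\<^esub>),
     ring.zero = (\<lambda>k. \<zero>\<^bsub>A\<^esub>),
     ring.add = (\<lambda>f g k. f k \<oplus>\<^bsub>A\<^esub> g k)\<rparr>"

definition monomial :: "('a, 'm) ring_scheme \<Rightarrow> 'a \<Rightarrow> 'g \<Rightarrow> 'g \<Rightarrow> 'a" where
  "monomial A a k = (\<lambda>j. if j = k then a else \<zero>\<^bsub>A\<^esub>)"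

abbreviation laurent :: "('a, 'm) ring_scheme \<Rightarrow> (int \<Rightarrow> 'a) ring" where
  "laurent A \<equiv> monoid_algebra A"

text \<open>\<open>A[x\<^sub>0, \<dots>, x\<^sub>N\<^sub>-\<^sub>1]\<close>\<close>

definition mpoly_ring :: "nat \<Rightarrow> ('a, 'm) ring_scheme \<Rightarrow> ((nat \<Rightarrow>\<^sub>0 nat) \<Rightarrow> 'a) ring" where
  "mpoly_ring N A = (monoid_algebra A)
     \<lparr>carrier := {f \<in> carrier (monoid_algebra A). \<forall>k. f k \<noteq> \<zero>\<^bsub>A\<^esub> \<longrightarrow> Poly_Mapping.keys k \<subseteq> {..<N}}\<rparr>"

text \<open>The value at \<open>t = u\<close> of a Laurent polynomial over \<open>A\<close>, its coefficients being mapped to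
  \<open>S\<close> by \<open>h\<close>; \<open>u\<close> has to be a unit of \<open>S\<close>.\<close>

definition laurent_eval ::
  "('a, 'm) ring_scheme \<Rightarrow> ('b, 'n) ring_scheme \<Rightarrow> ('a \<Rightarrow> 'b) \<Rightarrow> 'b \<Rightarrow> (int \<Rightarrow> 'a) \<Rightarrow> 'b" where
  "laurent_eval A S h u P = (\<Oplus>\<^bsub>S\<^esub> k \<in> {k. P k \<noteq> \<zero>\<^bsub>A\<^esub>}. h (P k) \<otimes>\<^bsub>S\<^esub> u [^]\<^bsub>S\<^esub> k)"

definition pseries :: "('a, 'm) ring_scheme \<Rightarrow> (nat \<Rightarrow> 'a) ring" where
  "pseries A =
    \<lparr>carrier = {f. \<forall>k. f k \<in> carrier A},
     monoid.mult = (\<lambda>f g k. \<Oplus>\<^bsub>A\<^esub> i \<in> {..k}. f i \<otimes>\<^bsub>A\<^esub> g (k - i)),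
     monoid.one = (\<lambda>k. if k = 0 then \<one>\<^bsub>A\<^esub> else \<zero>\<^bsub>A\<^esub>),
     ring.zero = (\<lambda>k. \<zero>\<^bsub>A\<^esub>),
     ring.add = (\<lambda>f g k. f k \<oplus>\<^bsub>A\<^esub> g k)\<rparr>"

definition prod_ring :: "'i set \<Rightarrow> ('i \<Rightarrow> ('a, 'm) ring_scheme) \<Rightarrow> ('i \<Rightarrow> 'a) ring" where
  "prod_ring I G =
    \<lparr>carrier = (\<Pi>\<^sub>E i\<in>I. carrier (G i)),
     monoid.mult = (\<lambda>x y. \<lambda>i\<in>I. x i \<otimes>\<^bsub>G i\<^esub> y i),
     monoid.one = (\<lambda>i\<in>I. \<one>\<^bsub>G i\<^esub>),
     ring.zero = (\<lambda>i\<in>I. \<zero>\<^bsub>G i\<^esub>),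
     ring.add = (\<lambda>x y. \<lambda>i\<in>I. x i \<oplus>\<^bsub>G i\<^esub> y i)\<rparr>"

text \<open>\<open>lim\<^sub>n A/I\<^sub>n\<close> for a decreasing sequence of ideals. For cosets, \<open>x (n+1) \<subseteq> x n\<close> says that
  the projection maps \<open>x (n+1)\<close> to \<open>x n\<close>.\<close>

definition lim_quot :: "('a, 'm) ring_scheme \<Rightarrow> (nat \<Rightarrow> 'a set) \<Rightarrow> (nat \<Rightarrow> 'a set) ring" where
  "lim_quot A I =
    \<lparr>carrier = {x. \<forall>n. x n \<in> carrier (A Quot I n) \<and> x (Suc n) \<subseteq> x n},
     monoid.mult = (\<lambda>x y n. x n \<otimes>\<^bsub>A Quot I n\<^esub> y n),
     monoid.one = (\<lambda>n. \<one>\<^bsub>A Quot I n\<^esub>),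
     ring.zero = (\<lambda>n. \<zero>\<^bsub>A Quot I n\<^esub>),
     ring.add = (\<lambda>x y n. x n \<oplus>\<^bsub>A Quot I n\<^esub> y n)\<rparr>"

definition int_in :: "('a, 'm) ring_scheme \<Rightarrow> int \<Rightarrow> 'a" where
  "int_in A c = add_pow A c \<one>\<^bsub>A\<^esub>"

definition padic_ideal :: "('a, 'm) ring_scheme \<Rightarrow> nat \<Rightarrow> nat \<Rightarrow> 'a set" where
  "padic_ideal A p n = PIdl\<^bsub>A\<^esub> (int_in A (int p ^ n))"

definition completion :: "('a, 'm) ring_scheme \<Rightarrow> nat \<Rightarrow> (nat \<Rightarrow> 'a set) ring" where
  "completion A p = lim_quot A (padic_ideal A p)"

definition to_completion :: "('a, 'm) ring_scheme \<Rightarrow> nat \<Rightarrow> 'a \<Rightarrow> nat \<Rightarrow> 'a set" where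
  "to_completion A p a = (\<lambda>n. padic_ideal A p n +>\<^bsub>A\<^esub> a)"

definition padic_sums :: "('a, 'm) ring_scheme \<Rightarrow> nat \<Rightarrow> (nat \<Rightarrow> 'a) \<Rightarrow> 'a \<Rightarrow> bool" where
  "padic_sums A p a s \<longleftrightarrow>
    (\<forall>n. \<exists>K0. \<forall>K\<ge>K0. (\<Oplus>\<^bsub>A\<^esub> k \<in> {..K}. a k) \<ominus>\<^bsub>A\<^esub> s \<in> padic_ideal A p n)"


section \<open>Etale algebras\<close>

definition finitely_presented ::
  "('a, 'm) ring_scheme \<Rightarrow> ('b, 'n) ring_scheme \<Rightarrow> ('a \<Rightarrow> 'b) \<Rightarrow> bool" where
  "finitely_presented A R \<eta> \<longleftrightarrow>
    (\<exists>N h S. h \<in> ring_hom (mpoly_ring N A) R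
        \<and> h ` carrier (mpoly_ring N A) = carrier R
        \<and> (\<forall>a\<in>carrier A. h (monomial A a 0) = \<eta> a)
        \<and> finite S \<and> S \<subseteq> carrier (mpoly_ring N A)
        \<and> a_kernel (mpoly_ring N A) R h = Idl\<^bsub>mpoly_ring N A\<^esub> S)"

text \<open>Unique infinitesimal lifting. Lifting problems over rings with carrier in the type
  \<open>'a + 'b + nat\<close> suffice: any lifting problem, and any two solutions of it, restrict to a subring of
  \<open>B\<close> generated by at most as many elements as \<open>A\<close>, \<open>R\<close> and \<open>nat\<close> have together, and such a subring
  is isomorphic to a ring with carrier in this type.\<close>

definition formally_etale ::
  "('a, 'm) ring_scheme \<Rightarrow> ('b, 'n) ring_scheme \<Rightarrow> ('a \<Rightarrow> 'b) \<Rightarrow> bool" where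
  "formally_etale A R \<eta> \<longleftrightarrow>
    (\<forall>(B :: ('a + 'b + nat) ring) J \<alpha> \<beta>.
      cring B \<and> ideal J B \<and> (\<forall>x\<in>J. \<forall>y\<in>J. x \<otimes>\<^bsub>B\<^esub> y = \<zero>\<^bsub>B\<^esub>)
      \<and> \<alpha> \<in> ring_hom A B \<and> \<beta> \<in> ring_hom R (B Quot J)
      \<and> (\<forall>a\<in>carrier A. \<beta> (\<eta> a) = J +>\<^bsub>B\<^esub> \<alpha> a)
      \<longrightarrow> (\<exists>!\<gamma>. \<gamma> \<in> ring_hom R B \<and> \<gamma> \<in> extensional (carrier R)
            \<and> (\<forall>a\<in>carrier A. \<gamma> (\<eta> a) = \<alpha> a)
            \<and> (\<forall>r\<in>carrier R. J +>\<^bsub>B\<^esub> \<gamma> r = \<beta> r)))"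

definition etale_algebra ::
  "('a, 'm) ring_scheme \<Rightarrow> ('b, 'n) ring_scheme \<Rightarrow> ('a \<Rightarrow> 'b) \<Rightarrow> bool" where
  "etale_algebra A R \<eta> \<longleftrightarrow>
    cring A \<and> cring R \<and> \<eta> \<in> ring_hom A R \<and> finitely_presented A R \<eta> \<and> formally_etale A R \<eta>"


section \<open>Adjoining roots of unity and of \<open>t\<close>\<close>

definition root_of_unity_system :: "(nat \<Rightarrow> complex) \<Rightarrow> bool" where
  "root_of_unity_system \<zeta> \<longleftrightarrow>
    (\<forall>m\<ge>1. \<forall>k. \<zeta> m ^ k = 1 \<longleftrightarrow> m dvd k)
    \<and> (\<forall>m\<ge>1. \<forall>n\<ge>1. coprime m n \<longrightarrow> \<zeta> (m * n) = \<zeta> m * \<zeta> n)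
    \<and> (\<forall>p r. Factorial_Ring.prime p \<and> r \<ge> 1 \<longrightarrow> \<zeta> (p ^ r) ^ p = \<zeta> (p ^ (r - 1)))"

definition ipoly :: "int poly \<Rightarrow> complex \<Rightarrow> complex" where
  "ipoly P z = poly (map_poly of_int P) z"

definition poly_in :: "('a, 'm) ring_scheme \<Rightarrow> int poly \<Rightarrow> nat \<Rightarrow> 'a" where
  "poly_in A P = (\<lambda>i. int_in A (Polynomial.coeff P i))"

text \<open>\<open>A[\<zeta>\<^sub>k]\<close> is the tensor product of \<open>A\<close> and \<open>\<int>[\<zeta>\<^sub>k]\<close> over \<open>\<int>\<close>. As \<open>\<int>[\<zeta>\<^sub>k]\<close> is \<open>\<int>[X]\<close> modulo the
  integer polynomials vanishing at \<open>\<zeta>\<^sub>k\<close>, it is \<open>A[X]\<close> modulo the ideal generated by these.\<close>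

definition cyc_ideal :: "(nat \<Rightarrow> complex) \<Rightarrow> ('a, 'm) ring_scheme \<Rightarrow> nat \<Rightarrow> (nat \<Rightarrow> 'a) set" where
  "cyc_ideal \<zeta> A k = Idl\<^bsub>UP A\<^esub> (poly_in A ` {P. ipoly P (\<zeta> k) = 0})"

definition cyc :: "(nat \<Rightarrow> complex) \<Rightarrow> ('a, 'm) ring_scheme \<Rightarrow> nat \<Rightarrow> (nat \<Rightarrow> 'a) set ring" where
  "cyc \<zeta> A k = UP A Quot cyc_ideal \<zeta> A k"

definition cyc_const ::
  "(nat \<Rightarrow> complex) \<Rightarrow> ('a, 'm) ring_scheme \<Rightarrow> nat \<Rightarrow> 'a \<Rightarrow> (nat \<Rightarrow> 'a) set" where
  "cyc_const \<zeta> A k a = cyc_ideal \<zeta> A k +>\<^bsub>UP A\<^esub> up_ring.monom (UP A) a 0"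

text \<open>The image in \<open>A[\<zeta>\<^sub>k]\<close> of a complex number \<open>z\<close> that lies in \<open>\<int>[\<zeta>\<^sub>k]\<close>\<close>

definition cyc_num ::
  "(nat \<Rightarrow> complex) \<Rightarrow> ('a, 'm) ring_scheme \<Rightarrow> nat \<Rightarrow> complex \<Rightarrow> (nat \<Rightarrow> 'a) set" where
  "cyc_num \<zeta> A k z = cyc_ideal \<zeta> A k +>\<^bsub>UP A\<^esub> poly_in A (SOME P. ipoly P (\<zeta> k) = z)"

text \<open>\<open>B[b\<^sup>1\<^sup>/\<^sup>d] = B[Y]/(Y\<^sup>d - b)\<close>\<close>

definition root_ideal :: "('a, 'm) ring_scheme \<Rightarrow> 'a \<Rightarrow> nat \<Rightarrow> (nat \<Rightarrow> 'a) set" where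
  "root_ideal B b d =
    PIdl\<^bsub>UP B\<^esub> (up_ring.monom (UP B) \<one>\<^bsub>B\<^esub> d \<ominus>\<^bsub>UP B\<^esub> up_ring.monom (UP B) b 0)"

text \<open>\<open>ext \<zeta> A \<tau> k d\<close> is \<open>A[\<zeta>\<^sub>k, \<tau>\<^sup>1\<^sup>/\<^sup>d]\<close>.\<close>

definition ext_ideal ::
  "(nat \<Rightarrow> complex) \<Rightarrow> ('a, 'm) ring_scheme \<Rightarrow> 'a \<Rightarrow> nat \<Rightarrow> nat \<Rightarrow> (nat \<Rightarrow> (nat \<Rightarrow> 'a) set) set" where
  "ext_ideal \<zeta> A \<tau> k d = root_ideal (cyc \<zeta> A k) (cyc_const \<zeta> A k \<tau>) d"

definition ext ::
  "(nat \<Rightarrow> complex) \<Rightarrow> ('a, 'm) ring_scheme \<Rightarrow> 'a \<Rightarrow> nat \<Rightarrow> nat \<Rightarrow> (nat \<Rightarrow> (nat \<Rightarrow> 'a) set) set ring" where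
  "ext \<zeta> A \<tau> k d = UP (cyc \<zeta> A k) Quot ext_ideal \<zeta> A \<tau> k d"

definition ext_of_cyc ::
  "(nat \<Rightarrow> complex) \<Rightarrow> ('a, 'm) ring_scheme \<Rightarrow> 'a \<Rightarrow> nat \<Rightarrow> nat \<Rightarrow> (nat \<Rightarrow> 'a) set
    \<Rightarrow> (nat \<Rightarrow> (nat \<Rightarrow> 'a) set) set" where
  "ext_of_cyc \<zeta> A \<tau> k d c =
    ext_ideal \<zeta> A \<tau> k d +>\<^bsub>UP (cyc \<zeta> A k)\<^esub> up_ring.monom (UP (cyc \<zeta> A k)) c 0"

definition ext_const ::
  "(nat \<Rightarrow> complex) \<Rightarrow> ('a, 'm) ring_scheme \<Rightarrow> 'a \<Rightarrow> nat \<Rightarrow> nat \<Rightarrow> 'a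
    \<Rightarrow> (nat \<Rightarrow> (nat \<Rightarrow> 'a) set) set" where
  "ext_const \<zeta> A \<tau> k d a = ext_of_cyc \<zeta> A \<tau> k d (cyc_const \<zeta> A k a)"

definition ext_num ::
  "(nat \<Rightarrow> complex) \<Rightarrow> ('a, 'm) ring_scheme \<Rightarrow> 'a \<Rightarrow> nat \<Rightarrow> nat \<Rightarrow> complex
    \<Rightarrow> (nat \<Rightarrow> (nat \<Rightarrow> 'a) set) set" where
  "ext_num \<zeta> A \<tau> k d z = ext_of_cyc \<zeta> A \<tau> k d (cyc_num \<zeta> A k z)"

definition ext_root ::
  "(nat \<Rightarrow> complex) \<Rightarrow> ('a, 'm) ring_scheme \<Rightarrow> 'a \<Rightarrow> nat \<Rightarrow> nat
    \<Rightarrow> (nat \<Rightarrow> (nat \<Rightarrow> 'a) set) set" where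
  "ext_root \<zeta> A \<tau> k d =
    ext_ideal \<zeta> A \<tau> k d +>\<^bsub>UP (cyc \<zeta> A k)\<^esub> up_ring.monom (UP (cyc \<zeta> A k)) \<one>\<^bsub>cyc \<zeta> A k\<^esub> 1"

text \<open>Homomorphisms out of a quotient of \<open>A[X]\<close>, given by \<open>h\<close> on \<open>A\<close> and by \<open>X \<mapsto> x\<close>, evaluated
  on a representative of the coset\<close>

definition coset_eval ::
  "('a, 'm) ring_scheme \<Rightarrow> ('b, 'n) ring_scheme \<Rightarrow> ('a \<Rightarrow> 'b) \<Rightarrow> 'b \<Rightarrow> (nat \<Rightarrow> 'a) set \<Rightarrow> 'b" where
  "coset_eval A T h x C = UnivPoly.eval A T h x (SOME F. F \<in> C)"

definition cyc_map ::
  "('a, 'm) ring_scheme \<Rightarrow> ('b, 'n) ring_scheme \<Rightarrow> ('a \<Rightarrow> 'b) \<Rightarrow> 'b \<Rightarrow> (nat \<Rightarrow> 'a) set \<Rightarrow> 'b" where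
  "cyc_map A T h z = coset_eval A T h z"

text \<open>The homomorphism \<open>A[\<zeta>\<^sub>k, \<tau>\<^sup>1\<^sup>/\<^sup>d] \<rightarrow> T\<close> given by \<open>h\<close> on \<open>A\<close>, \<open>\<zeta>\<^sub>k \<mapsto> z\<close> and \<open>\<tau>\<^sup>1\<^sup>/\<^sup>d \<mapsto> y\<close>\<close>

definition ext_map ::
  "(nat \<Rightarrow> complex) \<Rightarrow> ('a, 'm) ring_scheme \<Rightarrow> nat \<Rightarrow> ('b, 'n) ring_scheme \<Rightarrow> ('a \<Rightarrow> 'b) \<Rightarrow> 'b \<Rightarrow> 'b
    \<Rightarrow> (nat \<Rightarrow> (nat \<Rightarrow> 'a) set) set \<Rightarrow> 'b" where
  "ext_map \<zeta> A k T h z y = coset_eval (cyc \<zeta> A k) T (cyc_map A T h z) y"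


section \<open>Habiro rings\<close>

text \<open>A power series in \<open>q - \<zeta>\<close> is the sequence of its coefficients. \<open>reexpands S p d a b\<close> says that
  \<open>\<Sum>\<^sub>k a\<^sub>k (h + d)\<^sup>k = \<Sum>\<^sub>j b\<^sub>j h\<^sup>j\<close>, coefficientwise in the \<open>p\<close>-adic topology of \<open>S\<close>; with
  \<open>h = q - \<zeta>\<^sub>p\<^sub>m\<close> and \<open>d = \<zeta>\<^sub>p\<^sub>m - \<zeta>\<^sub>m\<close> the left-hand side is \<open>\<Sum>\<^sub>k a\<^sub>k (q - \<zeta>\<^sub>m)\<^sup>k\<close>. The terms with
  \<open>k < j\<close> vanish because of the binomial coefficient.\<close>

definition reexpands ::
  "('a, 'm) ring_scheme \<Rightarrow> nat \<Rightarrow> 'a \<Rightarrow> (nat \<Rightarrow> 'a) \<Rightarrow> (nat \<Rightarrow> 'a) \<Rightarrow> bool" where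
  "reexpands S p d a b \<longleftrightarrow>
    (\<forall>j. padic_sums S p
           (\<lambda>k. int_in S (int (k choose j)) \<otimes>\<^bsub>S\<^esub> (a k \<otimes>\<^bsub>S\<^esub> d [^]\<^bsub>S\<^esub> (k - j))) (b j))"

definition frobenius_lift ::
  "('a, 'm) ring_scheme \<Rightarrow> 'a \<Rightarrow> nat \<Rightarrow> ((nat \<Rightarrow> 'a set) \<Rightarrow> nat \<Rightarrow> 'a set) \<Rightarrow> bool" where
  "frobenius_lift R \<tau> p \<phi> \<longleftrightarrow>
    \<phi> \<in> ring_hom (completion R p) (completion R p)
    \<and> (\<forall>x\<in>carrier (completion R p).
          \<phi> x \<ominus>\<^bsub>completion R p\<^esub> x [^]\<^bsub>completion R p\<^esub> p \<in> padic_ideal (completion R p) p 1)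
    \<and> \<phi> (to_completion R p \<tau>) = to_completion R p \<tau> [^]\<^bsub>completion R p\<^esub> p"

text \<open>For etale \<open>R\<close> the Frobenius lift exists and is unique on the carrier.\<close>

definition frob :: "('a, 'm) ring_scheme \<Rightarrow> 'a \<Rightarrow> nat \<Rightarrow> (nat \<Rightarrow> 'a set) \<Rightarrow> nat \<Rightarrow> 'a set" where
  "frob R \<tau> p = (SOME \<phi>. frobenius_lift R \<tau> p \<phi>)"

text \<open>\<open>f\<^sub>m\<close> re-expanded at \<open>\<zeta>\<^sub>p\<^sub>m\<close> equals \<open>\<phi>\<^sub>p f\<^sub>p\<^sub>m\<close> over \<open>R\<^sub>p[\<zeta>\<^sub>p\<^sub>m, t\<^sup>1\<^sup>/\<^sup>m]\<close>.\<close>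

definition habiro_compatible ::
  "(nat \<Rightarrow> complex) \<Rightarrow> ('a, 'm) ring_scheme \<Rightarrow> 'a \<Rightarrow> nat \<Rightarrow> nat
    \<Rightarrow> (nat \<Rightarrow> (nat \<Rightarrow> (nat \<Rightarrow> 'a) set) set) \<Rightarrow> (nat \<Rightarrow> (nat \<Rightarrow> (nat \<Rightarrow> 'a) set) set) \<Rightarrow> bool" where
  "habiro_compatible \<zeta> R \<tau> p m fm fpm \<longleftrightarrow>
    (let Rp = completion R p;
         \<iota> = to_completion R p;
         S = ext \<zeta> Rp (\<iota> \<tau>) (p * m) m;
         c = ext_const \<zeta> Rp (\<iota> \<tau>) (p * m) m;
         z = ext_num \<zeta> Rp (\<iota> \<tau>) (p * m) m;
         y = ext_root \<zeta> Rp (\<iota> \<tau>) (p * m) m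
     in reexpands S p (z (\<zeta> (p * m)) \<ominus>\<^bsub>S\<^esub> z (\<zeta> m))
          (\<lambda>k. ext_map \<zeta> R m S (\<lambda>r. c (\<iota> r)) (z (\<zeta> m)) y (fm k))
          (\<lambda>k. ext_map \<zeta> R (p * m) S (\<lambda>r. c (frob R \<tau> p (\<iota> r))) (z (\<zeta> (p * m))) y (fpm k)))"

text \<open>The structure map \<open>\<eta>\<close> from \<open>\<int>[t\<^sup>\<plusminus>\<^sup>1]\<close> enters only through the image of \<open>t\<close>.\<close>

abbreviation img_t :: "((int \<Rightarrow> int) \<Rightarrow> 'a) \<Rightarrow> 'a" where
  "img_t \<eta> \<equiv> \<eta> (monomial \<Z> 1 1)"

definition habiro_ext ::
  "(nat \<Rightarrow> complex) \<Rightarrow> ('a, 'm) ring_scheme \<Rightarrow> ((int \<Rightarrow> int) \<Rightarrow> 'a)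
    \<Rightarrow> (nat \<Rightarrow> nat \<Rightarrow> (nat \<Rightarrow> (nat \<Rightarrow> 'a) set) set) ring" where
  "habiro_ext \<zeta> R \<eta> =
    (let P = prod_ring {1..} (\<lambda>m. pseries (ext \<zeta> R (img_t \<eta>) m m))
     in P\<lparr>carrier := {f \<in> carrier P. \<forall>m\<ge>1. \<forall>p. Factorial_Ring.prime p \<longrightarrow>
            habiro_compatible \<zeta> R (img_t \<eta>) p m (f m) (f (p * m))}\<rparr>)"

definition habiro_Z_compatible ::
  "(nat \<Rightarrow> complex) \<Rightarrow> nat \<Rightarrow> nat \<Rightarrow> (nat \<Rightarrow> (nat \<Rightarrow> int) set) \<Rightarrow> (nat \<Rightarrow> (nat \<Rightarrow> int) set) \<Rightarrow> bool" where
  "habiro_Z_compatible \<zeta> p m fm fpm \<longleftrightarrow>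
    (let Zp = completion \<Z> p;
         S = cyc \<zeta> Zp (p * m);
         h = (\<lambda>r. cyc_const \<zeta> Zp (p * m) (to_completion \<Z> p r));
         z = cyc_num \<zeta> Zp (p * m)
     in reexpands S p (z (\<zeta> (p * m)) \<ominus>\<^bsub>S\<^esub> z (\<zeta> m))
          (\<lambda>k. cyc_map \<Z> S h (z (\<zeta> m)) (fm k))
          (\<lambda>k. cyc_map \<Z> S h (z (\<zeta> (p * m))) (fpm k)))"

definition habiro_Z :: "(nat \<Rightarrow> complex) \<Rightarrow> (nat \<Rightarrow> nat \<Rightarrow> (nat \<Rightarrow> int) set) ring" where
  "habiro_Z \<zeta> =
    (let P = prod_ring {1..} (\<lambda>m. pseries (cyc \<zeta> \<Z> m))
     in P\<lparr>carrier := {f \<in> carrier P. \<forall>m\<ge>1. \<forall>p. Factorial_Ring.prime p \<longrightarrow>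
            habiro_Z_compatible \<zeta> p m (f m) (f (p * m))}\<rparr>)"

text \<open>The Taylor expansion \<open>q = \<zeta>\<^sub>m + (q - \<zeta>\<^sub>m)\<close>\<close>

definition q_at :: "(nat \<Rightarrow> complex) \<Rightarrow> nat \<Rightarrow> nat \<Rightarrow> (nat \<Rightarrow> int) set" where
  "q_at \<zeta> m = (\<lambda>k. if k = 0 then cyc_num \<zeta> \<Z> m (\<zeta> m)
                   else if k = 1 then \<one>\<^bsub>cyc \<zeta> \<Z> m\<^esub> else \<zero>\<^bsub>cyc \<zeta> \<Z> m\<^esub>)"

definition habiro_q :: "(nat \<Rightarrow> complex) \<Rightarrow> nat \<Rightarrow> nat \<Rightarrow> (nat \<Rightarrow> int) set" where
  "habiro_q \<zeta> = (\<lambda>m\<in>{1..}. q_at \<zeta> m)"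

text \<open>\<open>\<int>[q\<^sup>\<plusminus>\<^sup>1]\<close> as a subset of \<open>habiro_Z \<zeta>\<close>\<close>

definition q_laurent :: "(nat \<Rightarrow> complex) \<Rightarrow> (nat \<Rightarrow> nat \<Rightarrow> (nat \<Rightarrow> int) set) set" where
  "q_laurent \<zeta> =
    laurent_eval \<Z> (habiro_Z \<zeta>) (int_in (habiro_Z \<zeta>)) (habiro_q \<zeta>) ` carrier (laurent \<Z>)"


section \<open>Specialization at \<open>t = q\<^sup>n\<close>\<close>

text \<open>The lift of \<open>ev\<close> to a homomorphism from \<open>R\<close> to \<open>\<int>[\<zeta>\<^sub>m][[q - \<zeta>\<^sub>m]]\<close> with \<open>t \<mapsto> q\<^sup>m\<^sup>n\<close>; for etale
  \<open>R\<close> it exists and is unique on the carrier.\<close>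

definition ev_lift ::
  "(nat \<Rightarrow> complex) \<Rightarrow> ('a, 'm) ring_scheme \<Rightarrow> ((int \<Rightarrow> int) \<Rightarrow> 'a) \<Rightarrow> ('a \<Rightarrow> int) \<Rightarrow> nat \<Rightarrow> int
    \<Rightarrow> 'a \<Rightarrow> nat \<Rightarrow> (nat \<Rightarrow> int) set" where
  "ev_lift \<zeta> R \<eta> ev m n =
    (SOME l. l \<in> ring_hom R (pseries (cyc \<zeta> \<Z> m))
           \<and> l (img_t \<eta>) = q_at \<zeta> m [^]\<^bsub>pseries (cyc \<zeta> \<Z> m)\<^esub> (int m * n)
           \<and> (\<forall>r\<in>carrier R. l r 0 = int_in (cyc \<zeta> \<Z> m) (ev r)))"

text \<open>If \<open>f\<^sub>m = \<Sum>\<^sub>k a\<^sub>k (q - \<zeta>\<^sub>m)\<^sup>k\<close> and \<open>\<sigma>\<close> is the substitution on coefficients, the \<open>m\<close>-th component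
  of \<open>f(q\<^sup>n, q)\<close> is \<open>\<Sum>\<^sub>k \<sigma>(a\<^sub>k) (q - \<zeta>\<^sub>m)\<^sup>k\<close>, where \<open>\<sigma>(a\<^sub>k)\<close> is itself a power series.\<close>

definition specialize ::
  "(nat \<Rightarrow> complex) \<Rightarrow> ('a, 'm) ring_scheme \<Rightarrow> ((int \<Rightarrow> int) \<Rightarrow> 'a) \<Rightarrow> ('a \<Rightarrow> int) \<Rightarrow> int
    \<Rightarrow> (nat \<Rightarrow> nat \<Rightarrow> (nat \<Rightarrow> (nat \<Rightarrow> 'a) set) set) \<Rightarrow> nat \<Rightarrow> nat \<Rightarrow> (nat \<Rightarrow> int) set" where
  "specialize \<zeta> R \<eta> ev n f =
    (\<lambda>m\<in>{1..}.
      let T = pseries (cyc \<zeta> \<Z> m);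
          z = (\<lambda>k. if k = 0 then cyc_num \<zeta> \<Z> m (\<zeta> m) else \<zero>\<^bsub>cyc \<zeta> \<Z> m\<^esub>);
          \<sigma> = ext_map \<zeta> R m T (ev_lift \<zeta> R \<eta> ev m n) z (q_at \<zeta> m [^]\<^bsub>T\<^esub> n)
      in (\<lambda>j. \<Oplus>\<^bsub>cyc \<zeta> \<Z> m\<^esub> k \<in> {..j}. \<sigma> (f m k) (j - k)))"


section \<open>The inverse limits\<close>

definition qpoch :: "('a, 'm) ring_scheme \<Rightarrow> 'a \<Rightarrow> 'a \<Rightarrow> nat \<Rightarrow> 'a" where
  "qpoch S a q n = (\<Otimes>\<^bsub>S\<^esub> i \<in> {..<n}. \<one>\<^bsub>S\<^esub> \<ominus>\<^bsub>S\<^esub> a \<otimes>\<^bsub>S\<^esub> q [^]\<^bsub>S\<^esub> i)"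

text \<open>The ideal of \<open>A[t\<^sup>\<plusminus>\<^sup>1]\<close> generated by \<open>(t\<^sup>-\<^sup>1; q)\<^sub>n\<close>\<close>

definition tq_ideal :: "('a, 'm) ring_scheme \<Rightarrow> 'a \<Rightarrow> nat \<Rightarrow> (int \<Rightarrow> 'a) set" where
  "tq_ideal A q n =
    PIdl\<^bsub>laurent A\<^esub> (qpoch (laurent A) (monomial A \<one>\<^bsub>A\<^esub> (-1)) (monomial A q 0) n)"

definition habiro_lim ::
  "(nat \<Rightarrow> complex) \<Rightarrow> (nat \<Rightarrow> (int \<Rightarrow> nat \<Rightarrow> nat \<Rightarrow> (nat \<Rightarrow> int) set) set) ring" where
  "habiro_lim \<zeta> = lim_quot (laurent (habiro_Z \<zeta>)) (tq_ideal (habiro_Z \<zeta>) (habiro_q \<zeta>))"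

text \<open>The image in \<open>habiro_lim \<zeta>\<close> of the corresponding limit over \<open>\<int>[q\<^sup>\<plusminus>\<^sup>1]\<close>; the natural map
  sends a coset \<open>x n\<close> of the smaller ideal to the coset of the larger ideal containing it.\<close>

definition q_laurent_lim ::
  "(nat \<Rightarrow> complex) \<Rightarrow> (nat \<Rightarrow> (int \<Rightarrow> nat \<Rightarrow> nat \<Rightarrow> (nat \<Rightarrow> int) set) set) set" where
  "q_laurent_lim \<zeta> =
    (let H = habiro_Z \<zeta>; L = H\<lparr>carrier := q_laurent \<zeta>\<rparr>
     in (\<lambda>x n. tq_ideal H (habiro_q \<zeta>) n <+>\<^bsub>laurent H\<^esub> x n)
          ` carrier (lim_quot (laurent L) (tq_ideal L (habiro_q \<zeta>))))"

text \<open>The element \<open>F\<close> of the limit has the value \<open>f(q\<^sup>i, q)\<close> at \<open>t = q\<^sup>i\<close> for all \<open>i \<ge> 0\<close>. The value at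
  \<open>t = q\<^sup>i\<close> is well defined modulo \<open>(t\<^sup>-\<^sup>1; q)\<^sub>N\<close> for \<open>N > i\<close>. For given \<open>f\<close> there is at most one such \<open>F\<close>. The resulting
  homomorphism \<open>f \<mapsto> F\<close> need not be injective if \<open>R\<close> has zero divisors: for
  \<open>R = \<int>[t\<^sup>\<plusminus>\<^sup>1] \<times> \<int>[t\<^sup>\<plusminus>\<^sup>1]\<close>, with \<open>ev\<close> factoring through the first factor, it kills the
  second one.\<close>

definition interpolates ::
  "(nat \<Rightarrow> complex) \<Rightarrow> ('a, 'm) ring_scheme \<Rightarrow> ((int \<Rightarrow> int) \<Rightarrow> 'a) \<Rightarrow> ('a \<Rightarrow> int)
    \<Rightarrow> (nat \<Rightarrow> nat \<Rightarrow> (nat \<Rightarrow> (nat \<Rightarrow> 'a) set) set)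
    \<Rightarrow> (nat \<Rightarrow> (int \<Rightarrow> nat \<Rightarrow> nat \<Rightarrow> (nat \<Rightarrow> int) set) set) \<Rightarrow> bool" where
  "interpolates \<zeta> R \<eta> ev f F \<longleftrightarrow>
    (\<forall>N. \<forall>i<N. \<forall>P \<in> F N.
      laurent_eval (habiro_Z \<zeta>) (habiro_Z \<zeta>) id (habiro_q \<zeta> [^]\<^bsub>habiro_Z \<zeta>\<^esub> i) P
        = specialize \<zeta> R \<eta> ev (int i) f)"

end

theory Submission
  imports Defs "HOL-Computational_Algebra.Computational_Algebra" "HOL-Library.Countable_Set"
begin

text \<open>
  An element \<open>f\<close> is sent, at level \<open>N\<close>, to the set of Laurent polynomials \<open>P\<close> over the Habiro ring with
  \<open>P(q\<^sup>i) = f(q\<^sup>i, q)\<close> for all \<open>i < N\<close>; by the factor theorem this is a coset of the ideal of \<open>(t\<inverse>; q)\<^sub>N\<close>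
  as soon as it is nonempty. Such \<open>P\<close> exist because the specializations have a Newton expansion
  \<open>f(q\<^sup>i, q) = \<Sum>\<^sub>l c\<^sub>l \<Prod>\<^sub>j (q\<^sup>i - q\<^sup>j)\<close>, \<open>j\<close> ranging over \<open>0, \<dots>, l - 1\<close>. Its coefficients converge \<open>(q - \<zeta>\<^sub>m)\<close>-adically at
  each \<open>\<zeta>\<^sub>m\<close>, and they are compatible because the factors \<open>q\<^sup>i - q\<^sup>j\<close> can be cancelled from the compatibility
  conditions. If the specializations lie in \<open>\<int>[q\<^sup>\<plusminus>\<^sup>1]\<close>, then so do the \<open>c\<^sub>l\<close>: by the irreducibility of the cyclotomic
  polynomials, \<open>\<int>[q\<^sup>\<plusminus>\<^sup>1]\<close> is closed under division by \<open>q\<^sup>l - 1\<close> in the Habiro ring.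

  Suppose that all specializations of \<open>f\<close> vanish. Along a residue class modulo \<open>m\<close> the coefficients of
  \<open>f\<^sub>m(q\<^sup>i, q)\<close> are polynomials in \<open>i\<close>, and their leading terms force \<open>f\<^sub>m\<close> to vanish at \<open>q = \<zeta>\<^sub>m\<close> after passing from \<open>R\<close>
  to \<open>\<int>[[t - 1]]\<close>. For a domain \<open>R\<close> this passage is injective by Krull's intersection theorem.

  In general \<open>R\<close> is at least countable, so that \<open>f\<close> can be encoded by a sequence of natural numbers; using
  this sequence as Newton coefficients gives an injective map.
\<close>

text \<open>Infinitesimal lifting along \<open>R\<close> is given only for rings that fit into the
  type \<open>(int => int) + 'a + nat\<close>. Every ring used for lifting is therefore injected
  into it: \<open>R\<close> itself, integer power series, quotients through representatives, and
  Z[zeta_m][[q - zeta_m]] because Z[zeta_m] is countable. That a specialization is compatible at m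
  and pm is an identity derived from one over R_p[zeta_pm, t^(1/m)]. It is obtained by mapping that
  ring to Z[zeta_pm][[q - zeta_pm]] modulo a power of (p, q - zeta_pm), where p is nilpotent and
  re-expansion is a finite sum. The arithmetical core is that the Frobenius lift followed by the
  substitution at m is the substitution at pm: both send t to q^(pmi), both agree modulo p, q -
  zeta_pm and zeta_pm - zeta_m by Fermat's little theorem, and unique lifting makes them equal. The
  Newton coefficients are found at each zeta_m separately, so their compatibility has to be
  recovered afterwards; this is why q^i - q^j must be cancellable with a controlled loss of
  precision.\<close>

unbundle fps_syntax

section \<open>Subrings of commutative type class rings as ring records\<close>

definition rg :: "'a::comm_ring_1 set => 'a ring" where
  "rg S = \<lparr>carrier = S, monoid.mult = (*), one = 1, ring.zero = 0, add = (+)\<rparr>"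

definition subring_set :: "'a::comm_ring_1 set => bool" where
  "subring_set S \<longleftrightarrow> 0 \<in> S & 1 \<in> S & (\<forall>x\<in>S. \<forall>y\<in>S. x + y \<in> S & x * y \<in> S) & (\<forall>x\<in>S. - x \<in> S)"

lemma rg_simps [simp]:
  "carrier (rg S) = S" "x \<otimes>\<^bsub>rg S\<^esub> y = x * y" "x \<oplus>\<^bsub>rg S\<^esub> y = x + y" "\<zero>\<^bsub>rg S\<^esub> = 0" "\<one>\<^bsub>rg S\<^esub> = 1"
  by (simp_all add: rg_def)

lemma subring_setD:
  assumes "subring_set S"
  shows "0 \<in> S" "1 \<in> S" "x \<in> S ==> y \<in> S ==> x + y \<in> S" "x \<in> S ==> y \<in> S ==> x * y \<in> S"
    "x \<in> S ==> - x \<in> S" "x \<in> S ==> y \<in> S ==> x - y \<in> S" "x \<in> S ==> x ^ n \<in> S"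
    "of_int c \<in> S" "of_nat n \<in> S" "(!!i. i \<in> A ==> f i \<in> S) ==> sum f A \<in> S"
    "(!!i. i \<in> A ==> f i \<in> S) ==> prod f A \<in> S"
proof -
  show *: "0 \<in> S" "1 \<in> S" "x \<in> S ==> y \<in> S ==> x + y \<in> S" "x \<in> S ==> y \<in> S ==> x * y \<in> S"
    "x \<in> S ==> - x \<in> S" for x y using assms by (auto simp: subring_set_def)
  show "x \<in> S ==> y \<in> S ==> x - y \<in> S" using *(3)[of x "- y"] *(5)[of y] by simp
  show "x \<in> S ==> x ^ n \<in> S" by (induction n) (auto intro: *)
  show nat: "of_nat n \<in> S" for n by (induction n) (auto intro: *)
  show "of_int c \<in> S" by (cases c) (use nat *(5) in \<open>auto simp del: of_nat_Suc\<close>)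
  show "(!!i. i \<in> A ==> f i \<in> S) ==> sum f A \<in> S"
    by (induction A rule: infinite_finite_induct) (auto intro: *)
  show "(!!i. i \<in> A ==> f i \<in> S) ==> prod f A \<in> S"
    by (induction A rule: infinite_finite_induct) (auto intro: *)
qed

lemma subring_set_UNIV [simp]: "subring_set UNIV" by (simp add: subring_set_def)

lemma cring_rg:
  assumes "subring_set S" shows "cring (rg S)"
proof (intro cringI abelian_groupI comm_monoidI)
  fix x assume "x \<in> carrier (rg S)"
  then show "\<exists>y\<in>carrier (rg S). y \<oplus>\<^bsub>rg S\<^esub> x = \<zero>\<^bsub>rg S\<^esub>"
    using subring_setD(5)[OF assms, of x] by (intro bexI[of _ "- x"]) auto
qed (use subring_setD(1-4)[OF assms] in \<open>simp_all add: algebra_simps\<close>)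

lemma a_inv_rg: "subring_set S ==> x \<in> S ==> \<ominus>\<^bsub>rg S\<^esub> x = - x"
  using abelian_group.minus_equality[of "rg S" "- x" x] cring_rg[of S]
  by (auto simp: subring_setD cring_def ring_def)

lemma minus_rg: "subring_set S ==> x \<in> S ==> y \<in> S ==> x \<ominus>\<^bsub>rg S\<^esub> y = x - y"
  by (simp add: a_minus_def a_inv_rg)

lemma nat_pow_rg [simp]: "x [^]\<^bsub>rg S\<^esub> (n::nat) = x ^ n"
  by (induction n) (auto simp: nat_pow_def mult.commute)

lemma finsum_rg:
  assumes "subring_set S" "!!i. i \<in> A ==> f i \<in> S"
  shows "finsum (rg S) f A = sum f A"
proof -
  interpret cring "rg S" by (rule cring_rg) fact
  show ?thesis using assms(2) by (induction A rule: infinite_finite_induct) (auto simp: Pi_def)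
qed

lemma finprod_rg:
  assumes "subring_set S" "!!i. i \<in> A ==> f i \<in> S"
  shows "finprod (rg S) f A = prod f A"
proof -
  interpret cring "rg S" by (rule cring_rg) fact
  show ?thesis using assms(2) by (induction A rule: infinite_finite_induct) (auto simp: Pi_def)
qed

lemma int_ring_eq: "\<Z> = rg UNIV" by (simp add: rg_def)

lemma cring_int: "cring \<Z>" by (simp add: int_ring_eq cring_rg del: rg_simps)

text \<open>Jointly injective structure preserving maps into commutative rings of a type class reflect the ring axioms.\<close>

lemma cring_transfer:
  fixes A :: "('a, 'm) ring_scheme" and h :: "'i => 'a => 'b::comm_ring_1"
  assumes inj: "!!x y. x \<in> carrier A ==> y \<in> carrier A ==> (!!i. i \<in> I ==> h i x = h i y) ==> x = y"
    and closed: "\<zero>\<^bsub>A\<^esub> \<in> carrier A" "\<one>\<^bsub>A\<^esub> \<in> carrier A"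
      "!!x y. x \<in> carrier A ==> y \<in> carrier A ==> x \<oplus>\<^bsub>A\<^esub> y \<in> carrier A"
      "!!x y. x \<in> carrier A ==> y \<in> carrier A ==> x \<otimes>\<^bsub>A\<^esub> y \<in> carrier A"
      "!!x. x \<in> carrier A ==> \<exists>y\<in>carrier A. \<forall>i\<in>I. h i y = - h i x"
    and hom: "!!i. i \<in> I ==> h i \<zero>\<^bsub>A\<^esub> = 0" "!!i. i \<in> I ==> h i \<one>\<^bsub>A\<^esub> = 1"
      "!!i x y. i \<in> I ==> x \<in> carrier A ==> y \<in> carrier A ==> h i (x \<oplus>\<^bsub>A\<^esub> y) = h i x + h i y"
      "!!i x y. i \<in> I ==> x \<in> carrier A ==> y \<in> carrier A ==> h i (x \<otimes>\<^bsub>A\<^esub> y) = h i x * h i y"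
  shows "cring A"
proof (intro cringI abelian_groupI comm_monoidI)
  fix x assume x: "x \<in> carrier A"
  then obtain y where y: "y \<in> carrier A" "\<forall>i\<in>I. h i y = - h i x" using closed(5) by blast
  show "\<exists>y\<in>carrier A. y \<oplus>\<^bsub>A\<^esub> x = \<zero>\<^bsub>A\<^esub>"
    by (rule bexI[of _ y], rule inj) (use x y closed hom in auto)
qed (rule inj closed; (simp add: closed hom algebra_simps)?)+

lemma int_in_simps [simp]:
  "int_in A 0 = \<zero>\<^bsub>A\<^esub>" by (simp add: int_in_def add_pow_def int_pow_def2)

context
  fixes A :: "('a, 'm) ring_scheme" and B :: "('b, 'n) ring_scheme" and h
  assumes A: "cring A" and B: "cring B" and h: "h \<in> ring_hom A B"
begin

interpretation ring_hom_cring A B h using A B h by (simp add: ring_hom_cring_def ring_hom_cring_axioms_def)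

lemma ring_hom_a_inv: "x \<in> carrier A ==> h (\<ominus>\<^bsub>A\<^esub> x) = \<ominus>\<^bsub>B\<^esub> h x"
  by simp

lemma ring_hom_minus: "x \<in> carrier A ==> y \<in> carrier A ==> h (x \<ominus>\<^bsub>A\<^esub> y) = h x \<ominus>\<^bsub>B\<^esub> h y"
  by (simp add: a_minus_def)

lemma ring_hom_nat_pow: "x \<in> carrier A ==> h (x [^]\<^bsub>A\<^esub> (n::nat)) = h x [^]\<^bsub>B\<^esub> n"
  by simp

lemma ring_hom_0: "h \<zero>\<^bsub>A\<^esub> = \<zero>\<^bsub>B\<^esub>" by simp

lemma ring_hom_finsum: "f \<in> I \<rightarrow> carrier A ==> h (finsum A f I) = finsum B (%i. h (f i)) I"
  by (subst hom_finsum) (auto simp: o_def)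

lemma ring_hom_finprod: "f \<in> I \<rightarrow> carrier A ==> h (finprod A f I) = finprod B (%i. h (f i)) I"
  by (subst hom_finprod) (auto simp: o_def)

lemma ring_hom_Units:
  assumes "u \<in> Units A" shows "h u \<in> Units B"
proof -
  have "h u \<otimes>\<^bsub>B\<^esub> h (inv\<^bsub>A\<^esub> u) = \<one>\<^bsub>B\<^esub>"
    using assms by (simp flip: hom_mult add: R.Units_closed)
  moreover have "h (inv\<^bsub>A\<^esub> u) \<otimes>\<^bsub>B\<^esub> h u = \<one>\<^bsub>B\<^esub>"
    using assms by (simp flip: hom_mult add: R.Units_closed)
  moreover have "h u \<in> carrier B" "h (inv\<^bsub>A\<^esub> u) \<in> carrier B"
    using assms R.Units_closed by auto
  ultimately show ?thesis unfolding Units_def by blast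
qed

lemma ring_hom_inv:
  assumes "u \<in> Units A" shows "h (inv\<^bsub>A\<^esub> u) = inv\<^bsub>B\<^esub> h u"
proof -
  have "h u \<otimes>\<^bsub>B\<^esub> h (inv\<^bsub>A\<^esub> u) = \<one>\<^bsub>B\<^esub>"
    using assms by (simp flip: hom_mult add: R.Units_closed)
  then show ?thesis using S.comm_inv_char[of "h u" "h (inv\<^bsub>A\<^esub> u)"] assms R.Units_closed by simp
qed

lemma ring_hom_int_pow:
  assumes "u \<in> Units A" shows "h (u [^]\<^bsub>A\<^esub> (k::int)) = h u [^]\<^bsub>B\<^esub> k"
proof -
  have "h (inv\<^bsub>A\<^esub> (u [^]\<^bsub>A\<^esub> (n::nat))) = inv\<^bsub>B\<^esub> (h u [^]\<^bsub>B\<^esub> n)" for n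
    by (subst ring_hom_inv) (use assms in \<open>simp_all add: R.Units_pow_closed R.Units_closed\<close>)
  note i = this
  have n: "h (u [^]\<^bsub>A\<^esub> (n::nat)) = h u [^]\<^bsub>B\<^esub> n" for n
    using assms by (simp add: R.Units_closed)
  show ?thesis unfolding int_pow_def2 by (cases "k < 0") (simp_all only: if_True if_False i n)
qed

lemma ring_hom_int_in: "h (int_in A c) = int_in B c"
proof -
  have n: "h (add_pow A (n::nat) \<one>\<^bsub>A\<^esub>) = add_pow B n \<one>\<^bsub>B\<^esub>" for n
    by (induction n) simp_all
  have m: "h (\<ominus>\<^bsub>A\<^esub> (add_pow A (n::nat) \<one>\<^bsub>A\<^esub>)) = \<ominus>\<^bsub>B\<^esub> (add_pow B n \<one>\<^bsub>B\<^esub>)" for n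
    by (simp only: hom_a_inv R.add.nat_pow_closed[OF R.one_closed] n)
  show ?thesis
  proof (cases "c < 0")
    case True
    show ?thesis unfolding int_in_def add_pow_int_lt[OF True] by (rule m)
  next
    case False
    then have c: "c \<ge> 0" by simp
    show ?thesis unfolding int_in_def add_pow_int_ge[OF c] by (rule n)
  qed
qed

end

lemma (in cring) int_in_closed [simp]: "int_in R c \<in> carrier R" by (simp add: int_in_def)

lemma (in cring) int_in_hom: "int_in R \<in> ring_hom \<Z> R"
proof (rule ring_hom_memI)
  show "int_in R (x \<oplus>\<^bsub>\<Z>\<^esub> y) = int_in R x \<oplus> int_in R y" for x y
    using add.int_pow_mult[OF one_closed, of x y] by (simp add: int_in_def add_pow_def)
  show "int_in R (x \<otimes>\<^bsub>\<Z>\<^esub> y) = int_in R x \<otimes> int_in R y" for x y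
  proof -
    have "int_in R x \<otimes> int_in R y = add_pow R x (add_pow R y \<one>)"
      using add_pow_ldistr_int[of \<one> "add_pow R y \<one>" x] by (simp add: int_in_def)
    also have "... = add_pow R (y * x) \<one>"
      using add.int_pow_pow[OF one_closed, of x y] by (simp add: add_pow_def mult.commute)
    finally show ?thesis by (simp add: int_in_def mult.commute)
  qed
qed (auto simp: int_in_def)

lemma (in cring) int_in_add: "int_in R (a + b) = int_in R a \<oplus> int_in R b"
  using ring_hom_add[OF int_in_hom] by simp

lemma (in cring) int_in_mult: "int_in R (a * b) = int_in R a \<otimes> int_in R b"
  using ring_hom_mult[OF int_in_hom] by simp

lemma (in cring) int_in_one: "int_in R 1 = \<one>" using ring_hom_one[OF int_in_hom] by simp

lemma (in cring) int_in_zero: "int_in R 0 = \<zero>" by simp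

lemma int_in_rg: "subring_set S ==> int_in (rg S) c = of_int c"
proof -
  assume S: "subring_set S"
  interpret cring "rg S" by (rule cring_rg) fact
  have "int_in (rg S) (int n) = of_nat n" for n by (induction n) (simp_all add: int_in_add int_in_one)
  moreover have "int_in (rg S) (- int n) = - int_in (rg S) (int n)" for n
    using int_in_add[of "- int n" "int n"] by (simp add: eq_neg_iff_add_eq_0)
  ultimately show ?thesis by (cases c rule: int_cases2) auto
qed

lemma int_in_Z [simp]: "int_in \<Z> c = c"
  unfolding int_ring_eq using int_in_rg[OF subring_set_UNIV, of c] by (metis of_int_eq_id id_apply)

section \<open>Cosets and quotient rings\<close>

lemma (in ideal) Quot_carrierE:
  assumes "x \<in> carrier (R Quot I)"
  obtains a where "a \<in> carrier R" "x = I +> a" using assms by (auto simp: FactRing_def A_RCOSETS_def')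

lemma (in ideal) Quot_closed: "a \<in> carrier R ==> I +> a \<in> carrier (R Quot I)"
  by (auto simp: FactRing_def A_RCOSETS_def')

lemma (in ideal) mem_coset_iff:
  assumes "a \<in> carrier R" "b \<in> carrier R"
  shows "b \<in> I +> a \<longleftrightarrow> b \<ominus> a \<in> I"
  using a_rcos_module_minus[OF ring_axioms assms] .

lemma (in ideal) coset_eq_iff:
  assumes "a \<in> carrier R" "b \<in> carrier R"
  shows "I +> a = I +> b \<longleftrightarrow> a \<ominus> b \<in> I"
proof
  assume "I +> a = I +> b"
  then have "a \<in> I +> b" using a_rcos_self[OF assms(1)] by simp
  then show "a \<ominus> b \<in> I" using mem_coset_iff[OF assms(2,1)] by simp
next
  assume "a \<ominus> b \<in> I"
  then have "a \<in> I +> b" using mem_coset_iff[OF assms(2,1)] by simp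
  then show "I +> a = I +> b" using a_repr_independence'[OF _ assms(2)] by simp
qed

lemma (in ideal) coset_memE:
  assumes "x \<in> carrier (R Quot I)" "b \<in> x"
  shows "b \<in> carrier R" "x = I +> b"
proof -
  obtain a where a: "a \<in> carrier R" "x = I +> a" using assms(1) by (rule Quot_carrierE)
  show "b \<in> carrier R" using a assms(2) a_r_coset_subset_G[OF a_subset] by auto
  show "x = I +> b" using a assms(2) a_repr_independence'[of b a] by simp
qed

lemma (in ideal) coset_nonempty: "x \<in> carrier (R Quot I) ==> x ~= {}"
  by (erule Quot_carrierE) (auto dest: a_rcos_self)

lemma (in ideal) coset_some:
  assumes "x \<in> carrier (R Quot I)"
  shows "(SOME a. a \<in> x) \<in> x" "(SOME a. a \<in> x) \<in> carrier R" "x = I +> (SOME a. a \<in> x)"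
proof -
  show *: "(SOME a. a \<in> x) \<in> x" using coset_nonempty[OF assms] by (simp add: some_in_eq)
  show "(SOME a. a \<in> x) \<in> carrier R" "x = I +> (SOME a. a \<in> x)" using coset_memE[OF assms *] by auto
qed

lemma (in ideal) coset_zero_iff:
  assumes "a \<in> carrier R"
  shows "I +> a = \<zero>\<^bsub>R Quot I\<^esub> \<longleftrightarrow> a \<in> I"
proof -
  have "\<zero>\<^bsub>R Quot I\<^esub> = I" by (simp add: FactRing_def)
  then show ?thesis using a_rcos_const[of a] a_rcos_self[OF assms] by auto
qed

lemma surj_image_carrier:
  fixes R (structure)
  assumes "ideal I R" shows "(%r. I +> r) ` carrier R = carrier (R Quot I)"
proof
  show "carrier (R Quot I) <= (%r. I +> r) ` carrier R" by (rule subsetI) (erule ideal.Quot_carrierE[OF assms], simp)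
qed (use ideal.Quot_closed[OF assms] in blast)

text \<open>Choosing representatives makes a quotient no larger than the ring, so a quotient of a
  ring that embeds into the type of the lifting property embeds there too.\<close>

lemma inj_Quot_some: "ideal I A ==> inj_on e (carrier A) ==> inj_on (%C. e (SOME a. a \<in> C)) (carrier (A Quot I))"
  by (rule inj_onI) (metis ideal.coset_some(2,3) inj_onD)

lemma (in abelian_monoid) finsum_neutral_left:
  "finite B ==> A <= B ==> (!!i. i \<in> B - A ==> f i = \<zero>) ==> (!!i. i \<in> B ==> f i \<in> carrier G)
    ==> finsum G f A = finsum G f B" by (rule add.finprod_mono_neutral_cong_left) auto

section \<open>Monoid algebras and Laurent polynomials\<close>

lemma laurent_simps:
  "carrier (monoid_algebra A) = {f. (\<forall>k. f k \<in> carrier A) & finite {k. f k ~= \<zero>\<^bsub>A\<^esub>}}"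
  "\<zero>\<^bsub>monoid_algebra A\<^esub> = (%k. \<zero>\<^bsub>A\<^esub>)"
  "\<one>\<^bsub>monoid_algebra A\<^esub> = monomial A \<one>\<^bsub>A\<^esub> 0"
  "f \<oplus>\<^bsub>monoid_algebra A\<^esub> g = (%k. f k \<oplus>\<^bsub>A\<^esub> g k)"
  by (auto simp: monoid_algebra_def monomial_def fun_eq_iff)

context cring
begin

abbreviation (input) MA :: "('g::comm_monoid_add => 'a) ring" where "MA \<equiv> monoid_algebra R"

lemma monomial_closed: "a \<in> carrier R ==> monomial R a k \<in> carrier MA"
  by (auto simp: laurent_simps monomial_def)

lemma monomial_add:
  "a \<in> carrier R ==> b \<in> carrier R ==> monomial R a k \<oplus>\<^bsub>MA\<^esub> monomial R b k = monomial R (a \<oplus> b) k"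
  by (intro ext) (auto simp: laurent_simps monomial_def)

lemma monoid_algebra_add_closed: "f \<in> carrier MA ==> g \<in> carrier MA ==> f \<oplus>\<^bsub>MA\<^esub> g \<in> carrier MA"
  by (auto simp: laurent_simps intro!: finite_subset[of _ "{k. f k ~= \<zero>} \<union> {k. g k ~= \<zero>}"])

text \<open>The added monomial is a term of \<open>f\<close>, and \<open>g\<close> stays within the
  support of \<open>f\<close>. This lets an induction respect a restriction on exponents such as the
  one in \<open>mpoly_ring\<close>.\<close>

lemma monoid_algebra_induct [consumes 1, case_names zero add]:
  assumes f: "f \<in> carrier MA" and z: "Q (%k. \<zero>)"
    and a: "!!g k. g \<in> carrier MA ==> (!!j. g j ~= \<zero> ==> f j ~= \<zero>) ==> f k ~= \<zero> ==> Q g ==> Q (monomial R (f k) k \<oplus>\<^bsub>MA\<^esub> g)"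
  shows "Q f"
proof -
  have fc: "f k \<in> carrier R" for k using f by (simp add: laurent_simps)
  have "finite {k. f k ~= \<zero>}" using f by (simp add: laurent_simps)
  then have "Q (%k. if k \<in> {k. f k ~= \<zero>} then f k else \<zero>)"
  proof (induction rule: finite_subset_induct'[OF _ order.refl, consumes 1, case_names empty 2])
    case (2 i F)
    have eq: "(%k. if k \<in> insert i F then f k else \<zero>) = monomial R (f i) i \<oplus>\<^bsub>MA\<^esub> (%k. if k \<in> F then f k else \<zero>)"
      using 2(4) fc by (auto simp: laurent_simps monomial_def)
    have "finite {k. (if k \<in> F then f k else \<zero>) ~= \<zero>}" using 2(1) by (rule rev_finite_subset) auto
    then show ?case unfolding eq by (intro a 2) (use 2 fc in \<open>auto simp: laurent_simps split: if_splits\<close>)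
  qed (simp add: z)
  moreover have "(%k. if k \<in> {k. f k ~= \<zero>} then f k else \<zero>) = f" by auto
  ultimately show ?thesis by simp
qed

lemma laurent_induct [consumes 1, case_names zero monomial add]:
  assumes "f \<in> carrier MA" and "Q \<zero>\<^bsub>MA\<^esub>" and "!!a k. a \<in> carrier R ==> Q (monomial R a k)"
    and "!!f g. f \<in> carrier MA ==> g \<in> carrier MA ==> Q f ==> Q g ==> Q (f \<oplus>\<^bsub>MA\<^esub> g)"
  shows "Q f" using assms(1)
proof (induction rule: monoid_algebra_induct)
  case (add g k)
  have "f k \<in> carrier R" using assms(1) by (simp add: laurent_simps)
  then show ?case by (intro assms(3,4) monomial_closed add)
qed (use assms(2) in \<open>simp add: laurent_simps\<close>)

text \<open>The index sets may exceed the supports, so that several products can be summed over one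
  common set.\<close>

lemma monoid_algebra_mult:
  assumes c: "f \<in> carrier MA" "g \<in> carrier MA" and F: "finite F" "!!k. f k ~= \<zero> ==> k \<in> F"
    and G: "finite G" "!!k. g k ~= \<zero> ==> k \<in> G"
  shows "(f \<otimes>\<^bsub>MA\<^esub> g) k = finsum R (%(i, j). if i + j = k then f i \<otimes> g j else \<zero>) (F \<times> G)"
proof -
  have "f i \<in> carrier R" "g i \<in> carrier R" for i using c by (simp_all add: laurent_simps)
  then show ?thesis unfolding monoid_algebra_def monoid.select_convs
    by (intro add.finprod_mono_neutral_cong_left) (use F G in \<open>auto split: if_splits\<close>)
qed

lemma monoid_algebra_mult_closed:
  assumes c: "f \<in> carrier MA" "g \<in> carrier MA" shows "f \<otimes>\<^bsub>MA\<^esub> g \<in> carrier MA"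
proof -
  let ?F = "{k. f k ~= \<zero>}" and ?G = "{k. g k ~= \<zero>}"
  have fc: "f i \<in> carrier R" "g i \<in> carrier R" for i using c by (simp_all add: laurent_simps)
  have fin: "finite ?F" "finite ?G" using c by (auto simp: laurent_simps)
  have eq: "(f \<otimes>\<^bsub>MA\<^esub> g) k = finsum R (%(i, j). if i + j = k then f i \<otimes> g j else \<zero>) (?F \<times> ?G)" for k
    by (rule monoid_algebra_mult[OF c fin(1) _ fin(2)]) auto
  have "{k. (f \<otimes>\<^bsub>MA\<^esub> g) k ~= \<zero>} <= (%(i, j). i + j) ` (?F \<times> ?G)"
    unfolding eq by (rule subsetI, rule ccontr) (auto intro!: add.finprod_one_eqI)
  then show ?thesis
    unfolding laurent_simps using fin fc by (auto simp: eq intro!: finsum_closed elim!: finite_subset)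
qed

lemma monoid_algebra_comm:
  assumes c: "f \<in> carrier MA" "g \<in> carrier MA" shows "f \<otimes>\<^bsub>MA\<^esub> g = g \<otimes>\<^bsub>MA\<^esub> f"
proof
  fix k
  let ?F = "{k. f k ~= \<zero>}" and ?G = "{k. g k ~= \<zero>}" and ?t = "%(i, j). if i + j = k then f i \<otimes> g j else \<zero>"
  have fc: "f i \<in> carrier R" "g i \<in> carrier R" for i using c by (simp_all add: laurent_simps)
  have fin: "finite ?F" "finite ?G" using c by (auto simp: laurent_simps)
  have "(f \<otimes>\<^bsub>MA\<^esub> g) k = finsum R ?t (prod.swap ` (?G \<times> ?F))"
    unfolding product_swap by (rule monoid_algebra_mult[OF c fin(1) _ fin(2)]) auto
  also have "... = finsum R (%x. ?t (prod.swap x)) (?G \<times> ?F)" by (rule finsum_reindex) (auto simp: fc)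
  also have "... = finsum R (%(i, j). if i + j = k then g i \<otimes> f j else \<zero>) (?G \<times> ?F)"
    by (rule finsum_cong') (auto simp: fc m_comm add.commute)
  also have "... = (g \<otimes>\<^bsub>MA\<^esub> f) k"
    by (rule monoid_algebra_mult[OF c(2,1) fin(2) _ fin(1), symmetric]) auto
  finally show "(f \<otimes>\<^bsub>MA\<^esub> g) k = (g \<otimes>\<^bsub>MA\<^esub> f) k" .
qed

lemma monoid_algebra_distr:
  assumes c: "f \<in> carrier MA" "g \<in> carrier MA" "h \<in> carrier MA"
  shows "(f \<oplus>\<^bsub>MA\<^esub> g) \<otimes>\<^bsub>MA\<^esub> h = f \<otimes>\<^bsub>MA\<^esub> h \<oplus>\<^bsub>MA\<^esub> g \<otimes>\<^bsub>MA\<^esub> h"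
proof
  fix k
  let ?F = "{k. f k ~= \<zero>} \<union> {k. g k ~= \<zero>}" and ?H = "{k. h k ~= \<zero>}"
  have fc: "f i \<in> carrier R" "g i \<in> carrier R" "h i \<in> carrier R" for i using c by (simp_all add: laurent_simps)
  have fin: "finite ?F" "finite ?H" using c by (auto simp: laurent_simps)
  have e: "(f' \<otimes>\<^bsub>MA\<^esub> h) k = finsum R (%(i, j). if i + j = k then f' i \<otimes> h j else \<zero>) (?F \<times> ?H)"
    if "f' \<in> {f, g, f \<oplus>\<^bsub>MA\<^esub> g}" for f'
    by (rule monoid_algebra_mult[OF _ c(3) fin(1) _ fin(2)])
      (use that c monoid_algebra_add_closed in \<open>auto simp: laurent_simps(4)\<close>)
  show "((f \<oplus>\<^bsub>MA\<^esub> g) \<otimes>\<^bsub>MA\<^esub> h) k = (f \<otimes>\<^bsub>MA\<^esub> h \<oplus>\<^bsub>MA\<^esub> g \<otimes>\<^bsub>MA\<^esub> h) k"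
    unfolding laurent_simps(4)[of _ "f \<otimes>\<^bsub>MA\<^esub> h"] e[OF insertI1] e[OF insertI2[OF insertI1]] e[OF insertI2[OF insertI2[OF insertI1]]]
    by (subst finsum_addf[symmetric]) (auto simp: fc laurent_simps(4) l_distr intro!: finsum_cong')
qed

lemma monomial_mult:
  assumes "a \<in> carrier R" "b \<in> carrier R"
  shows "monomial R a k \<otimes>\<^bsub>MA\<^esub> monomial R b j = monomial R (a \<otimes> b) (k + j)"
proof
  fix l show "(monomial R a k \<otimes>\<^bsub>MA\<^esub> monomial R b j) l = monomial R (a \<otimes> b) (k + j) l"
    by (subst monoid_algebra_mult[where F = "{k}" and G = "{j}"]) (use assms in \<open>auto simp: monomial_closed\<close>, auto simp: monomial_def split: if_splits)
qed

text \<open>By additivity in each factor, associativity and the unit law need only be checked on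
  monomials.\<close>

lemma cring_laurent: "cring (MA :: ('g::comm_monoid_add => 'a) ring)"
proof (intro cringI abelian_groupI comm_monoidI)
  note ops = monoid_algebra_add_closed monoid_algebra_mult_closed monoid_algebra_distr
  show z: "\<zero>\<^bsub>MA\<^esub> \<in> carrier MA" "\<one>\<^bsub>MA\<^esub> \<in> carrier MA" by (auto simp: laurent_simps monomial_def)
  fix f g h :: "'g => 'a" assume f: "f \<in> carrier MA"
  \<comment> \<open>Absorption by zero is shown directly: it starts the inductions below, before the
    ring laws are available.\<close>
  have l0: "\<zero>\<^bsub>MA\<^esub> \<otimes>\<^bsub>MA\<^esub> g = \<zero>\<^bsub>MA\<^esub>" if "g \<in> carrier MA" for g
  proof
    fix k show "(\<zero>\<^bsub>MA\<^esub> \<otimes>\<^bsub>MA\<^esub> g) k = \<zero>\<^bsub>MA\<^esub> k"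
      by (subst monoid_algebra_mult[where F = "{}" and G = "{k. g k ~= \<zero>}"]) (use that z in \<open>auto simp: laurent_simps\<close>)
  qed
  have r: "g \<otimes>\<^bsub>MA\<^esub> \<zero>\<^bsub>MA\<^esub> = \<zero>\<^bsub>MA\<^esub>" "h \<in> carrier MA ==> h' \<in> carrier MA ==> g \<otimes>\<^bsub>MA\<^esub> (h \<oplus>\<^bsub>MA\<^esub> h') = g \<otimes>\<^bsub>MA\<^esub> h \<oplus>\<^bsub>MA\<^esub> g \<otimes>\<^bsub>MA\<^esub> h'"
    if g: "g \<in> carrier MA" for g h h' by (simp_all add: monoid_algebra_comm[OF g] z l0 g ops)
  show "\<exists>g\<in>carrier MA. g \<oplus>\<^bsub>MA\<^esub> f = \<zero>\<^bsub>MA\<^esub>"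
    using f finite_subset[of "{k. \<ominus> f k ~= \<zero>}" "{k. f k ~= \<zero>}"]
    by (intro bexI[of _ "%k. \<ominus> f k"]) (auto simp: laurent_simps l_neg)
  show "\<one>\<^bsub>MA\<^esub> \<otimes>\<^bsub>MA\<^esub> f = f"
    using f by (induction rule: laurent_induct) (simp_all add: z r, simp add: laurent_simps(3) monomial_mult)
  assume g: "g \<in> carrier MA" and h: "h \<in> carrier MA"
  show "f \<otimes>\<^bsub>MA\<^esub> g \<otimes>\<^bsub>MA\<^esub> h = f \<otimes>\<^bsub>MA\<^esub> (g \<otimes>\<^bsub>MA\<^esub> h)"
    using f
  proof (induction rule: laurent_induct)
    case f: (monomial a i)
    show ?case using g
    proof (induction rule: laurent_induct)
      case b: (monomial b j)
      show ?case using h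
        by (induction rule: laurent_induct) (use b f in \<open>simp_all add: monomial_closed monomial_mult r ops m_assoc add.assoc\<close>)
    qed (use f h in \<open>simp_all add: monomial_closed l0 r ops\<close>)
  qed (use g h in \<open>simp_all add: l0 ops\<close>)
qed ((rule monoid_algebra_comm monoid_algebra_distr monoid_algebra_mult_closed monoid_algebra_add_closed; assumption) |
  (simp add: laurent_simps a_ac; fail))+

end

section \<open>Units, integral powers and evaluation of Laurent polynomials\<close>

lemma (in monoid) Units_int_pow:
  assumes "u \<in> Units G"
  shows "u [^] (k::int) \<in> Units G" "u [^] (j + k) = u [^] j \<otimes> u [^] k" "u [^] (1::int) = u"
    "u [^] (- k) = inv (u [^] k)" "u [^] k \<in> carrier G"
proof -
  \<comment> \<open>Integral powers are compared with those in the group of units, where the power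
    laws hold.\<close>
  interpret U: group "units_of G" by (rule units_group)
  have n: "u [^]\<^bsub>units_of G\<^esub> (n::nat) = u [^] n" for n by (simp add: units_of_def nat_pow_def)
  have "u [^] (n::nat) \<in> Units G" for n using assms by (rule Units_pow_closed)
  then have i: "u [^]\<^bsub>units_of G\<^esub> (k::int) = u [^] k" for k
    unfolding int_pow_def2 n by (simp only: units_of_inv)
  have u: "u \<in> carrier (units_of G)" using assms by (simp add: units_of_carrier)
  show k: "u [^] (k::int) \<in> Units G" using U.int_pow_closed[OF u, of k] by (simp add: i units_of_carrier)
  show "u [^] (j + k) = u [^] j \<otimes> u [^] k"
    using U.int_pow_mult[OF u, of j k] by (simp add: i units_of_mult)
  show "u [^] (1::int) = u" using U.int_pow_1[OF u] by (simp add: i)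
  show "u [^] (- k) = inv (u [^] k)" using U.int_pow_neg[OF u, of k] k by (simp add: i units_of_inv)
  show "u [^] k \<in> carrier G" using k by (rule Units_closed)
qed

context
  fixes A :: "('a, 'm) ring_scheme" and S :: "('b, 'n) ring_scheme" and h u
  assumes A: "cring A" and S: "cring S" and h: "h \<in> ring_hom A S" and u: "u \<in> Units S"
begin

interpretation A: cring A by (rule A)
interpretation S: cring S by (rule S)
interpretation h: ring_hom_cring A S h using h by unfold_locales

private abbreviation (input) "e \<equiv> laurent_eval A S h u"

lemma laurent_eval_superset:
  assumes "P \<in> carrier (laurent A)" "finite K" "!!k. P k ~= \<zero>\<^bsub>A\<^esub> ==> k \<in> K"
  shows "e P = finsum S (%k. h (P k) \<otimes>\<^bsub>S\<^esub> u [^]\<^bsub>S\<^esub> k) K"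
  unfolding laurent_eval_def
  by (rule S.finsum_neutral_left) (use assms S.Units_int_pow(5)[OF u] in \<open>auto simp: laurent_simps\<close>)

lemma laurent_eval_monomial:
  "a \<in> carrier A ==> e (monomial A a k) = h a \<otimes>\<^bsub>S\<^esub> u [^]\<^bsub>S\<^esub> k"
  by (subst laurent_eval_superset[where K = "{k}"])
    (simp_all add: A.monomial_closed, simp_all add: S.Units_int_pow(5)[OF u] monomial_def split: if_splits)

lemma laurent_eval_hom: "e \<in> ring_hom (laurent A) S"
proof (rule ring_hom_memI)
  interpret L: cring "laurent A" by (rule A.cring_laurent)
  note uc = S.Units_int_pow(5)[OF u]
  show ec: "e P \<in> carrier S" if "P \<in> carrier (laurent A)" for P
    unfolding laurent_eval_def by (rule S.finsum_closed) (use that in \<open>auto simp: uc laurent_simps\<close>)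
  show "e \<one>\<^bsub>laurent A\<^esub> = \<one>\<^bsub>S\<^esub>" by (simp add: laurent_simps(3) laurent_eval_monomial)
  have z: "e \<zero>\<^bsub>laurent A\<^esub> = \<zero>\<^bsub>S\<^esub>" by (simp add: laurent_eval_def laurent_simps)
  show add: "e (P \<oplus>\<^bsub>laurent A\<^esub> Q) = e P \<oplus>\<^bsub>S\<^esub> e Q"
    if P: "P \<in> carrier (laurent A)" and Q: "Q \<in> carrier (laurent A)" for P Q
  proof -
    let ?K = "{k. P k ~= \<zero>\<^bsub>A\<^esub>} \<union> {k. Q k ~= \<zero>\<^bsub>A\<^esub>}"
    have K: "finite ?K" using P Q by (auto simp: laurent_simps)
    have c: "P k \<in> carrier A" "Q k \<in> carrier A" for k using P Q by (simp_all add: laurent_simps)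
    have e: "e F = finsum S (%k. h (F k) \<otimes>\<^bsub>S\<^esub> u [^]\<^bsub>S\<^esub> k) ?K" if "F \<in> {P, Q, P \<oplus>\<^bsub>laurent A\<^esub> Q}" for F
      by (rule laurent_eval_superset[OF _ K]) (use that P Q L.a_closed[OF P Q] in \<open>auto simp: laurent_simps(4)\<close>)
    show ?thesis unfolding e[OF insertI1] e[OF insertI2[OF insertI1]] e[OF insertI2[OF insertI2[OF insertI1]]]
      by (subst S.finsum_addf[symmetric]) (auto simp: uc c laurent_simps(4) S.l_distr intro!: S.finsum_cong')
  qed
  fix P Q assume P: "P \<in> carrier (laurent A)" and Q: "Q \<in> carrier (laurent A)"
  show "e (P \<otimes>\<^bsub>laurent A\<^esub> Q) = e P \<otimes>\<^bsub>S\<^esub> e Q" using P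
  proof (induction rule: A.laurent_induct)
    case a: (monomial a k)
    show ?case using Q by (induction rule: A.laurent_induct)
        (use a in \<open>simp_all add: z add ec L.r_distr S.r_distr S.m_ac uc A.monomial_closed A.monomial_mult laurent_eval_monomial S.Units_int_pow(2)[OF u]\<close>)
  qed (use Q in \<open>simp_all add: z add ec L.l_distr S.l_distr\<close>)
qed

end

lemma monomial_Units:
  assumes "cring A" shows "monomial A \<one>\<^bsub>A\<^esub> (k::int) \<in> Units (laurent A)"
proof -
  interpret A: cring A by fact
  show ?thesis unfolding Units_def
    by (auto intro!: bexI[of _ "monomial A \<one>\<^bsub>A\<^esub> (-k)"] simp: A.monomial_mult A.monomial_closed laurent_simps(3))
qed

lemma monomial_int_pow:
  assumes "cring A" shows "monomial A \<one>\<^bsub>A\<^esub> (1::int) [^]\<^bsub>laurent A\<^esub> (k::int) = monomial A \<one>\<^bsub>A\<^esub> k"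
proof -
  interpret A: cring A by fact
  interpret L: cring "laurent A" by (rule A.cring_laurent)
  have n: "monomial A \<one>\<^bsub>A\<^esub> (1::int) [^]\<^bsub>laurent A\<^esub> (n::nat) = monomial A \<one>\<^bsub>A\<^esub> (int n)" for n
    by (induction n) (simp_all add: laurent_simps(3) A.monomial_mult add.commute)
  have i: "inv\<^bsub>laurent A\<^esub> (monomial A \<one>\<^bsub>A\<^esub> (int n)) = monomial A \<one>\<^bsub>A\<^esub> (- int n)" for n
    by (rule L.comm_inv_char) (simp_all add: A.monomial_mult A.monomial_closed laurent_simps(3))
  show ?thesis
    by (cases k rule: int_cases2) (simp_all only: int_pow_int n L.Units_int_pow(4)[OF monomial_Units[OF assms]] i)
qed

text \<open>\<open>laurent \<Z>\<close> is generated by the integers and the powers of t, so the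
  image of t, a unit, determines the homomorphism. Lifting problems over it can then be stated in
  terms of a unit alone.\<close>

lemma laurent_Z_hom_unique:
  assumes S: "cring S" and h: "h \<in> ring_hom (laurent \<Z>) S"
    and u: "u = h (monomial \<Z> 1 1)"
  shows "u \<in> Units S" and "P \<in> carrier (laurent \<Z>) ==> h P = laurent_eval \<Z> S (int_in S) u P"
proof -
  interpret S: cring S by (rule S)
  interpret L: cring "laurent \<Z>" by (rule int.cring_laurent)
  interpret h: ring_hom_cring "laurent \<Z>" S h using h by unfold_locales
  note mU = monomial_Units[OF cring_int, of 1, simplified]
  show un: "u \<in> Units S" using ring_hom_Units[OF L.is_cring S h mU] u by simp
  interpret e: ring_hom_cring "laurent \<Z>" S "laurent_eval \<Z> S (int_in S) u"
    using laurent_eval_hom[OF cring_int S S.int_in_hom un] by unfold_locales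
  show "h P = laurent_eval \<Z> S (int_in S) u P" if "P \<in> carrier (laurent \<Z>)" using that
  proof (induction rule: int.laurent_induct)
    case (monomial a k)
    have "(%a. h (monomial \<Z> a 0)) \<in> ring_hom \<Z> S"
      using int.monomial_add[of _ _ "0::int"] int.monomial_mult[of _ _ "0::int" 0] int.monomial_closed[of _ "0::int"]
      by (intro ring_hom_memI) (simp_all flip: h.hom_add h.hom_mult add: laurent_simps(3)[of \<Z>, simplified, symmetric])
    from ring_hom_int_in[OF cring_int S this, of a]
    have c: "h (monomial \<Z> a 0) = int_in S a" by simp
    have "monomial \<Z> a k = monomial \<Z> a 0 \<otimes>\<^bsub>laurent \<Z>\<^esub> monomial \<Z> 1 1 [^]\<^bsub>laurent \<Z>\<^esub> k"
      using monomial_int_pow[OF cring_int, of k] int.monomial_mult[of a 1 0 k] by simp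
    then have "h (monomial \<Z> a k) = int_in S a \<otimes>\<^bsub>S\<^esub> u [^]\<^bsub>S\<^esub> k"
      using ring_hom_int_pow[OF L.is_cring S h mU, of k] L.Units_int_pow(5)[OF mU, of k] u by (simp add: int.monomial_closed c)
    then show ?case by (simp add: laurent_eval_monomial[OF cring_int S S.int_in_hom un])
  qed simp_all
qed

text \<open>The factored map evaluates on a \<open>SOME\<close> representative because
  \<open>coset_eval\<close> and the maps out of a completion are written that way; vanishing on
  \<open>K\<close> makes the value independent of the choice.\<close>

lemma factor_hom:
  assumes T: "cring T" and S: "cring S" and K: "ideal K T" and g: "g \<in> ring_hom T S"
    and ker: "!!k. k \<in> K ==> g k = \<zero>\<^bsub>S\<^esub>"
  shows "(%C. g (SOME a. a \<in> C)) \<in> ring_hom (T Quot K) S"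
    and "!!a. a \<in> carrier T ==> g (SOME b. b \<in> K +>\<^bsub>T\<^esub> a) = g a"
proof -
  interpret K: ideal K T by (rule K)
  interpret S: cring S by (rule S)
  interpret g: ring_hom_cring T S g using T S g by (simp add: ring_hom_cring_def ring_hom_cring_axioms_def)
  show *: "g (SOME b. b \<in> K +>\<^bsub>T\<^esub> a) = g a" if a: "a \<in> carrier T" for a
  proof -
    note b = K.coset_some(1,2)[OF K.Quot_closed[OF a]]
    then show ?thesis using ker[of "(SOME b. b \<in> K +>\<^bsub>T\<^esub> a) \<ominus>\<^bsub>T\<^esub> a"] K.mem_coset_iff[OF a b(2)] a
      by (simp add: ring_hom_minus[OF T S g] S.r_right_minus_eq)
  qed
  note h = K.rcos_ring_hom
  show "(%C. g (SOME a. a \<in> C)) \<in> ring_hom (T Quot K) S"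
  proof (rule ring_hom_memI)
    fix x y assume "x \<in> carrier (T Quot K)" "y \<in> carrier (T Quot K)"
    then obtain a b where ab: "a \<in> carrier T" "x = K +>\<^bsub>T\<^esub> a" "b \<in> carrier T" "y = K +>\<^bsub>T\<^esub> b"
      by (metis K.Quot_carrierE)
    show "g (SOME a. a \<in> x \<otimes>\<^bsub>T Quot K\<^esub> y) = g (SOME a. a \<in> x) \<otimes>\<^bsub>S\<^esub> g (SOME a. a \<in> y)"
      "g (SOME a. a \<in> x \<oplus>\<^bsub>T Quot K\<^esub> y) = g (SOME a. a \<in> x) \<oplus>\<^bsub>S\<^esub> g (SOME a. a \<in> y)"
      unfolding ab ring_hom_mult[OF h ab(1,3), symmetric] ring_hom_add[OF h ab(1,3), symmetric] using ab by (simp_all add: *)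
  qed (use K.coset_some in \<open>auto simp: * simp flip: ring_hom_one[OF h]\<close>)
qed

section \<open>Square-zero extensions and etale lifting\<close>

lemma surj_image_ideal:
  assumes T: "cring T" and B: "cring B" and p: "p \<in> ring_hom T B" "p ` carrier T = carrier B"
    and K: "ideal K T"
  shows "ideal (p ` K) B"
proof -
  interpret p: ring_hom_cring T B p using T B p by (simp add: ring_hom_cring_def ring_hom_cring_axioms_def)
  interpret K: ideal K T by (rule K)
  show ?thesis
  proof (rule idealI)
    show "ring B" by (rule p.S.ring_axioms)
    show "subgroup (p ` K) (add_monoid B)" by (rule ring_hom_ring.img_is_add_subgroup[OF _ K.a_subgroup])
        (simp add: p.R.ring_axioms p.S.ring_axioms p(1) ring_hom_ringI2)
    fix a x assume a: "a \<in> p ` K" and x: "x \<in> carrier B"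
    then obtain k y where "k \<in> K" "a = p k" "y \<in> carrier T" "x = p y" using p(2) by blast
    then show "x \<otimes>\<^bsub>B\<^esub> a \<in> p ` K" "a \<otimes>\<^bsub>B\<^esub> x \<in> p ` K"
      using K.I_l_closed[of k y] K.I_r_closed[of k y] by (auto simp flip: p.hom_mult simp: K.a_Hcarr)
  qed
qed

text \<open>\<open>B\<close> is a copy of \<open>T Quot K2\<close> whose carrier lies in the type for which infinitesimal lifting is assumed.\<close>

lemma square_zero_model:
  fixes T :: "('c, 'm) ring_scheme" and e :: "'c => 'x"
  assumes T: "cring T" and e: "inj_on e (carrier T)" and K: "ideal K1 T" "ideal K2 T"
    and sq: "!!x y. x \<in> K1 ==> y \<in> K1 ==> x \<otimes>\<^bsub>T\<^esub> y \<in> K2"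
  obtains B :: "'x ring" and p where "cring B" "p \<in> ring_hom T B" "p ` carrier T = carrier B"
    "!!a b. a \<in> carrier T ==> b \<in> carrier T ==> p a = p b \<longleftrightarrow> a \<ominus>\<^bsub>T\<^esub> b \<in> K2"
    "ideal (p ` K1) B" "!!x y. x \<in> p ` K1 ==> y \<in> p ` K1 ==> x \<otimes>\<^bsub>B\<^esub> y = \<zero>\<^bsub>B\<^esub>"
proof -
  interpret T: cring T by (rule T)
  interpret K1: ideal K1 T by (rule K)
  interpret K: ideal K2 T by (rule K)
  let ?Q = "T Quot K2"
  define d where "d = (%C. e (SOME a. a \<in> C))"
  have d: "inj_on d (carrier ?Q)" unfolding d_def by (rule inj_Quot_some[OF K(2) e])
  interpret Q: cring ?Q by (rule K.quotient_is_cring[OF T])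
  define B where "B = image_ring d ?Q"
  have iso: "d \<in> ring_iso ?Q B" unfolding B_def by (rule inj_imp_image_ring_iso[OF d])
  \<comment> \<open>The transported ring has its zero set to the image of zero, which is the zero
    that \<open>image_ring\<close> already has.\<close>
  have "cring (B\<lparr>zero := d \<zero>\<^bsub>?Q\<^esub>\<rparr>)" by (rule Q.ring_iso_imp_img_cring[OF iso])
  moreover have "B\<lparr>zero := d \<zero>\<^bsub>?Q\<^esub>\<rparr> = B"
    by (simp add: B_def image_ring_def image_group_def monoid.defs)
  ultimately have B: "cring B" by simp
  define p where "p = (%a. d (K2 +>\<^bsub>T\<^esub> a))"
  have p: "p \<in> ring_hom T B"
    unfolding p_def using ring_hom_trans[OF K.rcos_ring_hom, of d B] iso by (simp add: o_def ring_iso_def)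
  have ps: "p ` carrier T = carrier B"
    unfolding p_def image_image[symmetric] surj_image_carrier[OF K(2)] using iso by (auto simp: ring_iso_def bij_betw_def)
  have pe: "p a = p b \<longleftrightarrow> a \<ominus>\<^bsub>T\<^esub> b \<in> K2" if "a \<in> carrier T" "b \<in> carrier T" for a b
    using that K.coset_eq_iff[OF that] inj_on_eq_iff[OF d] K.Quot_closed by (simp add: p_def)
  interpret p: ring_hom_cring T B p using T B p by (simp add: ring_hom_cring_def ring_hom_cring_axioms_def)
  have "p k = \<zero>\<^bsub>B\<^esub>" if "k \<in> K2" for k
    using pe[of k "\<zero>\<^bsub>T\<^esub>"] that K.Icarr by (simp add: a_minus_def)
  then have "x \<otimes>\<^bsub>B\<^esub> y = \<zero>\<^bsub>B\<^esub>" if "x \<in> p ` K1" "y \<in> p ` K1" for x y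
    using that by (auto simp: sq K1.Icarr simp flip: p.hom_mult)
  then show thesis using that[OF B p ps pe surj_image_ideal[OF T B p ps K(1)]] by blast
qed

locale etale_over_laurent =
  fixes R :: "('a, 'm) ring_scheme" and \<eta> :: "(int => int) => 'a"
  assumes etale: "etale_algebra (laurent \<Z>) R \<eta>"
begin

abbreviation (input) \<tau> :: 'a where "\<tau> \<equiv> img_t \<eta>"

lemma cring_R: "cring R" and eta_hom: "\<eta> \<in> ring_hom (laurent \<Z>) R"
  using etale by (auto simp: etale_algebra_def)

sublocale R: cring R by (rule cring_R)

lemma tau_Units: "\<tau> \<in> Units R" by (rule laurent_Z_hom_unique(1)[OF cring_R eta_hom refl])

lemma eta_eval:
  assumes B: "cring B" and g: "g \<in> ring_hom R B" and P: "P \<in> carrier (laurent \<Z>)"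
  shows "g (\<eta> P) = laurent_eval \<Z> B (int_in B) (g \<tau>) P"
  using laurent_Z_hom_unique(2)[OF B ring_hom_trans[OF eta_hom g] refl P] by simp

context
  fixes B :: "((int => int) + 'a + nat) ring" and J \<beta> u
  assumes B: "cring B" and J: "ideal J B" and JJ: "!!x y. x \<in> J ==> y \<in> J ==> x \<otimes>\<^bsub>B\<^esub> y = \<zero>\<^bsub>B\<^esub>"
    and \<beta>: "\<beta> \<in> ring_hom R (B Quot J)" and u: "u \<in> Units B" "\<beta> \<tau> = J +>\<^bsub>B\<^esub> u"
begin

text \<open>Formal etaleness with the map on \<open>laurent \<Z>\<close> replaced by the unit to
  which t goes: a lifting problem is a homomorphism \<beta> together with a unit that lifts its
  value at \<tau>.\<close>

private lemma square_zero_ex1: "\<exists>!\<gamma>. \<gamma> \<in> ring_hom R B & \<gamma> \<in> extensional (carrier R)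
    & (\<forall>P\<in>carrier (laurent \<Z>). \<gamma> (\<eta> P) = laurent_eval \<Z> B (int_in B) u P) & (\<forall>r\<in>carrier R. J +>\<^bsub>B\<^esub> \<gamma> r = \<beta> r)"
proof -
  interpret B: cring B by (rule B)
  have BJ: "cring (B Quot J)" by (rule ideal.quotient_is_cring[OF J B])
  note \<alpha> = laurent_eval_hom[OF cring_int B B.int_in_hom u(1)]
  have "\<beta> (\<eta> P) = J +>\<^bsub>B\<^esub> laurent_eval \<Z> B (int_in B) u P" if P: "P \<in> carrier (laurent \<Z>)" for P
    using laurent_Z_hom_unique(2)[OF BJ ring_hom_trans[OF \<alpha> ideal.rcos_ring_hom[OF J]] refl P] eta_eval[OF BJ \<beta> P]
      laurent_eval_monomial[OF cring_int B B.int_in_hom u(1), of 1 1] u(2) B.Units_int_pow(3)[OF u(1)] B.Units_closed[OF u(1)]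
    by (simp add: B.int_in_one)
  then have "cring B & ideal J B & (\<forall>x\<in>J. \<forall>y\<in>J. x \<otimes>\<^bsub>B\<^esub> y = \<zero>\<^bsub>B\<^esub>)
      & laurent_eval \<Z> B (int_in B) u \<in> ring_hom (laurent \<Z>) B & \<beta> \<in> ring_hom R (B Quot J)
      & (\<forall>a\<in>carrier (laurent \<Z>). \<beta> (\<eta> a) = J +>\<^bsub>B\<^esub> laurent_eval \<Z> B (int_in B) u a)"
    using B J JJ \<alpha> \<beta> by blast
  then show ?thesis using etale unfolding etale_algebra_def formally_etale_def by blast
qed

lemma square_zero_lift:
  obtains \<gamma> where "\<gamma> \<in> ring_hom R B" "\<gamma> \<tau> = u" "!!r. r \<in> carrier R ==> J +>\<^bsub>B\<^esub> \<gamma> r = \<beta> r"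
proof -
  interpret B: cring B by (rule B)
  obtain \<gamma> where \<gamma>: "\<gamma> \<in> ring_hom R B" "!!P. P \<in> carrier (laurent \<Z>) ==> \<gamma> (\<eta> P) = laurent_eval \<Z> B (int_in B) u P"
    "!!r. r \<in> carrier R ==> J +>\<^bsub>B\<^esub> \<gamma> r = \<beta> r" using square_zero_ex1 by blast
  have "\<gamma> \<tau> = u"
    using \<gamma>(2)[of "monomial \<Z> 1 1"] int.monomial_closed[of 1 "1::int"] laurent_eval_monomial[OF cring_int B B.int_in_hom u(1), of 1 1]
      B.Units_int_pow(3)[OF u(1)] B.Units_closed[OF u(1)] by (simp add: B.int_in_one)
  then show thesis using that \<gamma> by blast
qed

lemma square_zero_unique:
  assumes g: "g \<in> ring_hom R B" "g' \<in> ring_hom R B" and t: "g \<tau> = u" "g' \<tau> = u"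
    and e: "!!r. r \<in> carrier R ==> J +>\<^bsub>B\<^esub> g r = \<beta> r" "!!r. r \<in> carrier R ==> J +>\<^bsub>B\<^esub> g' r = \<beta> r"
    and r: "r \<in> carrier R"
  shows "g r = g' r"
proof -
  have ec: "\<eta> P \<in> carrier R" if "P \<in> carrier (laurent \<Z>)" for P
    using eta_hom that by (rule ring_hom_closed)
  \<comment> \<open>Uniqueness is stated for extensional maps, hence the restrictions.\<close>
  have res: "restrict f (carrier R) \<in> ring_hom R B" if "f \<in> ring_hom R B" for f
    using that by (intro ring_hom_memI) (auto simp: ring_hom_closed ring_hom_mult ring_hom_add ring_hom_one)
  have "restrict g (carrier R) = restrict g' (carrier R)"
    by (rule ex1_iff_ex_Uniq[THEN iffD1, THEN conjunct2, OF square_zero_ex1, THEN Uniq_D]; intro conjI res g restrict_extensional)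
      (use e eta_eval[OF B g(1)] eta_eval[OF B g(2)] in \<open>auto simp: t ec\<close>)
  then show ?thesis using r by (metis restrict_apply')
qed

end

text \<open>The image of \<open>K1\<close> in T modulo \<open>K2\<close> has square zero, so two
  homomorphisms that have the same value at t and agree modulo \<open>K1\<close> agree modulo
  \<open>K2\<close>. Iteration along a filtration gives the uniqueness statements below.\<close>

lemma unique_step:
  fixes T :: "('c, 'k) ring_scheme" and e :: "'c => (int => int) + 'a + nat"
  assumes T: "cring T" and e: "inj_on e (carrier T)" and K: "ideal K1 T" "ideal K2 T"
    and sq: "!!x y. x \<in> K1 ==> y \<in> K1 ==> x \<otimes>\<^bsub>T\<^esub> y \<in> K2"
    and g: "g \<in> ring_hom R T" "g' \<in> ring_hom R T" "g \<tau> = g' \<tau>"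
    and K1: "!!r. r \<in> carrier R ==> g r \<ominus>\<^bsub>T\<^esub> g' r \<in> K1" and r: "r \<in> carrier R"
  shows "g r \<ominus>\<^bsub>T\<^esub> g' r \<in> K2"
proof -
  obtain B :: "((int => int) + 'a + nat) ring" and p where B: "cring B" and p: "p \<in> ring_hom T B" and "p ` carrier T = carrier B"
    and pe: "!!a b. a \<in> carrier T ==> b \<in> carrier T ==> p a = p b \<longleftrightarrow> a \<ominus>\<^bsub>T\<^esub> b \<in> K2"
    and J: "ideal (p ` K1) B" "!!x y. x \<in> p ` K1 ==> y \<in> p ` K1 ==> x \<otimes>\<^bsub>B\<^esub> y = \<zero>\<^bsub>B\<^esub>"
    by (rule square_zero_model[OF T e K]) (blast intro: sq that)+
  have pg: "p \<circ> g \<in> ring_hom R B" "p \<circ> g' \<in> ring_hom R B"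
    using g p by (auto intro: ring_hom_trans)
  have gc: "g r \<in> carrier T" "g' r \<in> carrier T" if "r \<in> carrier R" for r
    using g that by (auto simp: ring_hom_closed)
  have "(p \<circ> g) r = (p \<circ> g') r"
  proof (rule square_zero_unique[OF B J ring_hom_trans[OF pg(1) ideal.rcos_ring_hom[OF J(1)]] ring_hom_Units[OF cring_R B pg(1) tau_Units] _ pg _ _ _ _ r])
    fix r assume r: "r \<in> carrier R"
    have "p (g r) \<ominus>\<^bsub>B\<^esub> p (g' r) \<in> p ` K1"
      using K1[OF r] gc[OF r] by (auto simp flip: ring_hom_minus[OF T B p])
    then show "p ` K1 +>\<^bsub>B\<^esub> (p \<circ> g') r = ((+>\<^bsub>B\<^esub>) (p ` K1) \<circ> (p \<circ> g)) r"
      using ideal.coset_eq_iff[OF J(1), of "p (g r)" "p (g' r)"] ring_hom_closed[OF p] gc[OF r] by simp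
  qed (simp_all add: g)
  then show ?thesis using pe gc[OF r] by simp
qed

text \<open>The lifting takes place in the small model \<open>B\<close> of T modulo
  \<open>K2\<close>. The inclusion of cosets in the conclusion says that the new map reduces to the
  old one.\<close>

lemma lift_step:
  fixes T :: "('c, 'k) ring_scheme" and e :: "'c => (int => int) + 'a + nat"
  assumes T: "cring T" and e: "inj_on e (carrier T)" and K: "ideal K1 T" "ideal K2 T" "K2 <= K1"
    and sq: "!!x y. x \<in> K1 ==> y \<in> K1 ==> x \<otimes>\<^bsub>T\<^esub> y \<in> K2"
    and u: "u \<in> Units T"
    and b: "b \<in> ring_hom R (T Quot K1)" "b \<tau> = K1 +>\<^bsub>T\<^esub> u"
  obtains b' where "b' \<in> ring_hom R (T Quot K2)" "b' \<tau> = K2 +>\<^bsub>T\<^esub> u"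
    "!!r. r \<in> carrier R ==> b' r <= b r"
proof -
  interpret T: cring T by (rule T)
  obtain B :: "((int => int) + 'a + nat) ring" and p where B: "cring B"
    and p: "p \<in> ring_hom T B" "p ` carrier T = carrier B"
    and pe: "!!a b. a \<in> carrier T ==> b \<in> carrier T ==> p a = p b \<longleftrightarrow> a \<ominus>\<^bsub>T\<^esub> b \<in> K2"
    and J: "ideal (p ` K1) B" "!!x y. x \<in> p ` K1 ==> y \<in> p ` K1 ==> x \<otimes>\<^bsub>B\<^esub> y = \<zero>\<^bsub>B\<^esub>"
    by (rule square_zero_model[OF T e K(1,2)]) (blast intro: sq that)+
  interpret p: ring_hom_cring T B p using T B p(1) by (simp add: ring_hom_cring_def ring_hom_cring_axioms_def)
  interpret K1: ideal K1 T by (rule K)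
  interpret K2: ideal K2 T by (rule K)
  interpret J: ideal "p ` K1" B by (rule J)
  have BJ: "cring (B Quot p ` K1)" by (rule J.quotient_is_cring[OF B])
  define q where "q = (%a. p ` K1 +>\<^bsub>B\<^esub> p a)"
  have q: "q \<in> ring_hom T (B Quot p ` K1)"
    using ring_hom_trans[OF p(1) J.rcos_ring_hom] by (simp add: q_def o_def)
  have qk: "q k = \<zero>\<^bsub>B Quot p ` K1\<^esub>" if "k \<in> K1" for k
    using J.coset_zero_iff[of "p k"] that by (auto simp: q_def K1.Icarr)
  define \<beta> where "\<beta> = (%r. q (SOME a. a \<in> b r))"
  note fh = factor_hom[OF T BJ K(1) q qk]
  have \<beta>: "\<beta> \<in> ring_hom R (B Quot p ` K1)"
    using ring_hom_trans[OF b(1) fh(1)] by (simp add: \<beta>_def o_def)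
  have pu: "p u \<in> Units B" by (rule ring_hom_Units[OF T B p(1) u])
  have "\<beta> \<tau> = p ` K1 +>\<^bsub>B\<^esub> p u" using fh(2)[of u] u by (simp add: \<beta>_def b(2) q_def T.Units_closed)
  then obtain \<gamma> where \<gamma>: "\<gamma> \<in> ring_hom R B" "\<gamma> \<tau> = p u" "!!r. r \<in> carrier R ==> p ` K1 +>\<^bsub>B\<^esub> \<gamma> r = \<beta> r"
    using square_zero_lift[OF B J \<beta> pu] by blast
  \<comment> \<open>The isomorphism from \<open>B\<close> back to T modulo \<open>K2\<close>,
    inverse to the one induced by \<open>p\<close>.\<close>
  define s where "s = (%x. K2 +>\<^bsub>T\<^esub> inv_into (carrier T) p x)"
  have sp: "s (p a) = K2 +>\<^bsub>T\<^esub> a" if "a \<in> carrier T" for a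
    using pe that f_inv_into_f[of "p a" p "carrier T"] inv_into_into[of "p a" p "carrier T"] by (simp add: s_def K2.coset_eq_iff)
  have s: "s \<in> ring_hom B (T Quot K2)"
  proof (rule ring_hom_memI)
    fix x y assume "x \<in> carrier B" "y \<in> carrier B"
    then obtain a c where "a \<in> carrier T" "c \<in> carrier T" "x = p a" "y = p c" using p(2) by blast
    then show "s x \<in> carrier (T Quot K2)" "s (x \<otimes>\<^bsub>B\<^esub> y) = s x \<otimes>\<^bsub>T Quot K2\<^esub> s y" "s (x \<oplus>\<^bsub>B\<^esub> y) = s x \<oplus>\<^bsub>T Quot K2\<^esub> s y"
      using ring_hom_mult[OF K2.rcos_ring_hom] ring_hom_add[OF K2.rcos_ring_hom] K2.Quot_closed
      by (simp_all add: sp flip: p.hom_mult p.hom_add)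
  qed (use sp[OF T.one_closed] ring_hom_one[OF K2.rcos_ring_hom] in simp)
  show thesis
  proof (rule that[of "s \<circ> \<gamma>"])
    show "s \<circ> \<gamma> \<in> ring_hom R (T Quot K2)" by (rule ring_hom_trans[OF \<gamma>(1) s])
    show "(s \<circ> \<gamma>) \<tau> = K2 +>\<^bsub>T\<^esub> u" using sp u by (simp add: \<gamma>(2) T.Units_closed)
    fix r assume r: "r \<in> carrier R"
    obtain a where a: "a \<in> carrier T" "\<gamma> r = p a" using ring_hom_closed[OF \<gamma>(1) r] p(2) by blast
    obtain c where c: "c \<in> carrier T" "b r = K1 +>\<^bsub>T\<^esub> c" "\<beta> r = q c"
      using K1.coset_some[OF ring_hom_closed[OF b(1) r]] by (auto simp: \<beta>_def)
    have "p a \<ominus>\<^bsub>B\<^esub> p c \<in> p ` K1" using \<gamma>(3)[OF r] a c J.coset_eq_iff by (simp add: q_def)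
    then obtain k where k: "k \<in> K1" "p (a \<ominus>\<^bsub>T\<^esub> c) = p k"
      using a c by (auto simp flip: ring_hom_minus[OF T B p(1)])
    \<comment> \<open>\<open>p\<close> determines elements modulo \<open>K2\<close> only, so a - c
      equals k up to an element of \<open>K2\<close>, which lies in \<open>K1\<close>.\<close>
    then have "(a \<ominus>\<^bsub>T\<^esub> c) \<ominus>\<^bsub>T\<^esub> k \<in> K1"
      using pe[of "a \<ominus>\<^bsub>T\<^esub> c" k] a c K(3) K1.Icarr by auto
    then have "(a \<ominus>\<^bsub>T\<^esub> c) \<ominus>\<^bsub>T\<^esub> k \<oplus>\<^bsub>T\<^esub> k \<in> K1" using k by simp
    moreover have "(a \<ominus>\<^bsub>T\<^esub> c) \<ominus>\<^bsub>T\<^esub> k \<oplus>\<^bsub>T\<^esub> k = a \<ominus>\<^bsub>T\<^esub> c"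
      using a c K1.Icarr[OF k(1)] by algebra
    ultimately have "b r = K1 +>\<^bsub>T\<^esub> a" using K1.coset_eq_iff[OF a(1) c(1)] c by simp
    then show "(s \<circ> \<gamma>) r <= b r" using a sp K(3) by (auto simp: a_r_coset_def r_coset_def)
  qed
qed

end

section \<open>Completions and Frobenius lifts\<close>

lemma (in cring) binomial_expansion:
  assumes a: "a \<in> carrier R" and b: "b \<in> carrier R"
  shows "(a \<oplus> b) [^] (n::nat)
    = finsum R (%k. int_in R (int (n choose k)) \<otimes> (a [^] k \<otimes> b [^] (n - k))) {..n}"
proof (induction n)
  case 0
  show ?case by (simp add: int_in_one)
next
  case (Suc n)
  define t where "t = (%n k. int_in R (int (n choose k)) \<otimes> (a [^] k \<otimes> b [^] (n - k)))"
  have t: "t n k \<in> carrier R" for n k using a b by (simp add: t_def)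
  have rec: "t (Suc n) (Suc k) = a \<otimes> t n k \<oplus> b \<otimes> t n (Suc k)" if "k \<le> n" for k
  proof (cases "k = n")
    case True
    then show ?thesis using a b by (simp add: t_def int_in_one m_comm binomial_eq_0)
  next
    case False
    then have "n - k = Suc (n - Suc k)" using that by simp
    then show ?thesis using a b that by (simp add: t_def int_in_add l_distr r_distr m_ac del: nat_pow_Suc)
  qed
  have rec0: "t (Suc n) 0 = b \<otimes> t n 0" using a b by (simp add: t_def int_in_one m_comm)
  have t0: "t n (Suc n) = \<zero>" using a b by (simp add: t_def binomial_eq_0)
  have "finsum R (t (Suc n)) {..Suc n} = finsum R (%k. t (Suc n) (Suc k)) {..n} \<oplus> t (Suc n) 0"
    by (rule finsum_Suc2) (simp add: t)
  also have "finsum R (%k. t (Suc n) (Suc k)) {..n} = finsum R (%k. a \<otimes> t n k \<oplus> b \<otimes> t n (Suc k)) {..n}"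
    using rec a b t by (intro finsum_cong') auto
  also have "... = finsum R (%k. a \<otimes> t n k) {..n} \<oplus> finsum R (%k. b \<otimes> t n (Suc k)) {..n}"
    using a b t by (intro finsum_addf) auto
  also have "finsum R (%k. a \<otimes> t n k) {..n} = a \<otimes> finsum R (t n) {..n}"
    using a t by (intro finsum_rdistr[symmetric]) auto
  also have "finsum R (%k. b \<otimes> t n (Suc k)) {..n} = b \<otimes> finsum R (%k. t n (Suc k)) {..n}"
    using b t by (intro finsum_rdistr[symmetric]) auto
  also have "a \<otimes> finsum R (t n) {..n} \<oplus> b \<otimes> finsum R (%k. t n (Suc k)) {..n} \<oplus> t (Suc n) 0
      = a \<otimes> finsum R (t n) {..n} \<oplus> b \<otimes> (finsum R (%k. t n (Suc k)) {..n} \<oplus> t n 0)"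
    using a b t by (simp add: rec0 r_distr a_assoc finsum_closed)
  also have "finsum R (%k. t n (Suc k)) {..n} \<oplus> t n 0 = finsum R (t n) {..Suc n}"
    by (rule finsum_Suc2[symmetric]) (simp add: t)
  also have "... = finsum R (t n) {..n}" using t t0 by (simp add: finsum_Suc finsum_closed)
  also have "a \<otimes> finsum R (t n) {..n} \<oplus> b \<otimes> finsum R (t n) {..n} = (a \<oplus> b) [^] Suc n"
  proof -
    have IH: "(a \<oplus> b) [^] n = finsum R (t n) {..n}" using Suc by (simp add: t_def)
    have c: "finsum R (t n) {..n} \<in> carrier R" using t by (intro finsum_closed) auto
    show ?thesis using a b c by (simp add: IH l_distr[symmetric] m_comm)
  qed
  finally show ?case by (simp add: t_def)
qed

lemma (in ideal) finsum_mem: "(!!i. i \<in> A ==> f i \<in> I) ==> finsum R f A \<in> I"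
proof (induction A rule: infinite_finite_induct)
  case (insert i A)
  then show ?case by (subst finsum_insert) (auto simp: Icarr)
qed (auto simp: finsum_infinite finsum_empty)

text \<open>All binomial coefficients except the two outer ones are divisible by p.\<close>

lemma (in cring) freshman:
  assumes a: "a \<in> carrier R" and b: "b \<in> carrier R" and p: "Factorial_Ring.prime p"
  shows "(a \<oplus> b) [^] p \<ominus> (a [^] p \<oplus> b [^] p) \<in> PIdl (int_in R (int p))"
proof -
  define t where "t = (%k. int_in R (int (p choose k)) \<otimes> (a [^] k \<otimes> b [^] (p - k)))"
  have t: "t k \<in> carrier R" for k using a b by (simp add: t_def)
  interpret I: ideal "PIdl (int_in R (int p))" R by (rule cgenideal_ideal) simp
  have p0: "p > 0" using p by (rule prime_gt_0_nat)
  obtain q where q: "p = Suc q" using p0 by (cases p) auto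
  \<comment> \<open>Writing p as r + 2 lets both outer terms be split off, which leaves the index
    range up to r.\<close>
  then obtain r where r: "p = Suc (Suc r)" using prime_gt_1_nat[OF p] by (cases q) auto
  have qr: "q = Suc r" using q r by simp
  have mem: "t (Suc k) \<in> PIdl (int_in R (int p))" if k: "k < q" for k
  proof -
    have "p dvd (p choose Suc k)" by (rule dvd_choose_prime) (use k q p in auto)
    then obtain c where "p choose Suc k = p * c" by (auto elim: dvdE)
    then have "t (Suc k) = (int_in R (int c) \<otimes> (a [^] (Suc k) \<otimes> b [^] (p - Suc k))) \<otimes> int_in R (int p)"
      unfolding t_def using a b by (simp add: int_in_mult m_ac del: nat_pow_Suc)
    moreover have "int_in R (int c) \<otimes> (a [^] (Suc k) \<otimes> b [^] (p - Suc k)) \<in> carrier R"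
      using a b by simp
    ultimately show ?thesis unfolding cgenideal_def by (intro CollectI exI conjI)
  qed
  have "(a \<oplus> b) [^] p = finsum R t {..Suc q}" using binomial_expansion[OF a b, of p] by (simp add: t_def q)
  also have "... = finsum R (%k. t (Suc k)) {..q} \<oplus> t 0" by (rule finsum_Suc2) (simp add: t)
  also have "finsum R (%k. t (Suc k)) {..q} = t (Suc q) \<oplus> finsum R (%k. t (Suc k)) {..r}"
    unfolding qr by (rule finsum_Suc) (simp add: t)
  finally have "(a \<oplus> b) [^] p = t p \<oplus> finsum R (%k. t (Suc k)) {..r} \<oplus> t 0" by (simp add: q)
  moreover have "t p = a [^] p" "t 0 = b [^] p" using a b by (simp_all add: t_def int_in_one)
  moreover have "finsum R (%k. t (Suc k)) {..r} \<in> carrier R" using t by (intro finsum_closed) auto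
  moreover have "x \<oplus> s \<oplus> y \<ominus> (x \<oplus> y) = s"
    if "x \<in> carrier R" "y \<in> carrier R" "s \<in> carrier R" for x y s using that by algebra
  ultimately have "(a \<oplus> b) [^] p \<ominus> (a [^] p \<oplus> b [^] p) = finsum R (%k. t (Suc k)) {..r}"
    using a b by simp
  also have "... \<in> PIdl (int_in R (int p))" by (rule I.finsum_mem) (use mem q r in auto)
  finally show ?thesis .
qed

section \<open>Inverse limits and p-adic completions\<close>

lemma lim_quot_simps:
  "carrier (lim_quot A I) = {x. \<forall>n. x n \<in> carrier (A Quot I n) & x (Suc n) <= x n}"
  "x \<otimes>\<^bsub>lim_quot A I\<^esub> y = (%n. x n \<otimes>\<^bsub>A Quot I n\<^esub> y n)"
  "\<one>\<^bsub>lim_quot A I\<^esub> = (%n. \<one>\<^bsub>A Quot I n\<^esub>)"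
  "\<zero>\<^bsub>lim_quot A I\<^esub> = (%n. \<zero>\<^bsub>A Quot I n\<^esub>)"
  "x \<oplus>\<^bsub>lim_quot A I\<^esub> y = (%n. x n \<oplus>\<^bsub>A Quot I n\<^esub> y n)"
  by (simp_all add: lim_quot_def)

locale ideal_chain = cring A for A (structure) +
  fixes I :: "nat => 'a set"
  assumes ideal_I: "ideal (I n) A" and decreasing: "I (Suc n) <= I n"
begin

lemma coset_chain: "a \<in> carrier A ==> I (Suc n) +> a <= I n +> a"
  using decreasing[of n] by (auto simp: a_r_coset_def r_coset_def)

text \<open>The cosets are nested, so a member of the one at level \<open>Suc n\<close> represents
  both levels.\<close>

lemma lim_quot_rep:
  assumes "x \<in> carrier (lim_quot A I)"
  obtains a where "a \<in> carrier A" "x n = I n +> a" "x (Suc n) = I (Suc n) +> a"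
proof -
  interpret I: ideal "I n" A by (rule ideal_I)
  interpret J: ideal "I (Suc n)" A by (rule ideal_I)
  have x: "x n \<in> carrier (A Quot I n)" "x (Suc n) \<in> carrier (A Quot I (Suc n))" "x (Suc n) <= x n"
    using assms by (auto simp: lim_quot_simps)
  obtain a where a: "a \<in> x (Suc n)" using J.coset_nonempty[OF x(2)] by blast
  show thesis by (rule that[of a]) (use a x J.coset_memE[OF x(2) a] I.coset_memE[OF x(1), of a] in auto)
qed

lemma cring_Quot: "cring (A Quot I n)" by (rule ideal.quotient_is_cring[OF ideal_I is_cring])

lemma cosets_closed: "a \<in> carrier A ==> (%n. I n +> a) \<in> carrier (lim_quot A I)"
  using ideal.Quot_closed[OF ideal_I] coset_chain by (auto simp: lim_quot_simps)

lemma coset_ops: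
  assumes "a \<in> carrier A" "b \<in> carrier A"
  shows "(I n +> a) \<otimes>\<^bsub>A Quot I n\<^esub> (I n +> b) = I n +> (a \<otimes> b)"
    "(I n +> a) \<oplus>\<^bsub>A Quot I n\<^esub> (I n +> b) = I n +> (a \<oplus> b)"
    "\<ominus>\<^bsub>A Quot I n\<^esub> (I n +> a) = I n +> (\<ominus> a)"
    "\<one>\<^bsub>A Quot I n\<^esub> = I n +> \<one>" "\<zero>\<^bsub>A Quot I n\<^esub> = I n +> \<zero>"
proof -
  interpret I: ideal "I n" A by (rule ideal_I)
  note h = I.rcos_ring_hom
  show "(I n +> a) \<otimes>\<^bsub>A Quot I n\<^esub> (I n +> b) = I n +> (a \<otimes> b)"
    "(I n +> a) \<oplus>\<^bsub>A Quot I n\<^esub> (I n +> b) = I n +> (a \<oplus> b)"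
    "\<ominus>\<^bsub>A Quot I n\<^esub> (I n +> a) = I n +> (\<ominus> a)"
    "\<one>\<^bsub>A Quot I n\<^esub> = I n +> \<one>" "\<zero>\<^bsub>A Quot I n\<^esub> = I n +> \<zero>"
    using ring_hom_mult[OF h] ring_hom_add[OF h] ring_hom_a_inv[OF is_cring cring_Quot h]
      ring_hom_one[OF h] ring_hom_0[OF is_cring cring_Quot h] assms by auto
qed

lemma cring_lim_quot: "cring (lim_quot A I)"
proof (intro cringI abelian_groupI comm_monoidI)
  fix x y assume x: "x \<in> carrier (lim_quot A I)" and y: "y \<in> carrier (lim_quot A I)"
  have "(x n \<otimes>\<^bsub>A Quot I n\<^esub> y n) \<in> carrier (A Quot I n) & (x n \<oplus>\<^bsub>A Quot I n\<^esub> y n) \<in> carrier (A Quot I n) &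
    (x (Suc n) \<otimes>\<^bsub>A Quot I (Suc n)\<^esub> y (Suc n)) <= (x n \<otimes>\<^bsub>A Quot I n\<^esub> y n) &
    (x (Suc n) \<oplus>\<^bsub>A Quot I (Suc n)\<^esub> y (Suc n)) <= (x n \<oplus>\<^bsub>A Quot I n\<^esub> y n)" for n
  proof -
    obtain a where a: "a \<in> carrier A" "x n = I n +> a" "x (Suc n) = I (Suc n) +> a"
      by (rule lim_quot_rep[OF x])
    obtain b where b: "b \<in> carrier A" "y n = I n +> b" "y (Suc n) = I (Suc n) +> b"
      by (rule lim_quot_rep[OF y])
    show ?thesis unfolding a(2,3) b(2,3) coset_ops[OF a(1) b(1)]
      by (intro conjI ideal.Quot_closed[OF ideal_I] coset_chain m_closed a_closed a(1) b(1))
  qed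
  then show "x \<otimes>\<^bsub>lim_quot A I\<^esub> y \<in> carrier (lim_quot A I)" "x \<oplus>\<^bsub>lim_quot A I\<^esub> y \<in> carrier (lim_quot A I)"
    by (auto simp: lim_quot_simps)
next
  fix x assume x: "x \<in> carrier (lim_quot A I)"
  show "\<exists>y\<in>carrier (lim_quot A I). y \<oplus>\<^bsub>lim_quot A I\<^esub> x = \<zero>\<^bsub>lim_quot A I\<^esub>"
  proof (rule bexI[of _ "%n. \<ominus>\<^bsub>A Quot I n\<^esub> x n"])
    have xn: "x n \<in> carrier (A Quot I n)" for n using x by (auto simp: lim_quot_simps)
    have "(\<ominus>\<^bsub>A Quot I n\<^esub> x n) \<in> carrier (A Quot I n) &
      (\<ominus>\<^bsub>A Quot I (Suc n)\<^esub> x (Suc n)) <= \<ominus>\<^bsub>A Quot I n\<^esub> x n" for n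
    proof -
      obtain a where a: "a \<in> carrier A" "x n = I n +> a" "x (Suc n) = I (Suc n) +> a"
        by (rule lim_quot_rep[OF x])
      show ?thesis unfolding a(2,3) coset_ops(3)[OF a(1) a(1)]
        by (intro conjI ideal.Quot_closed[OF ideal_I] coset_chain a_inv_closed a(1))
    qed
    then show "(%n. \<ominus>\<^bsub>A Quot I n\<^esub> x n) \<in> carrier (lim_quot A I)" by (auto simp: lim_quot_simps)
    show "(%n. \<ominus>\<^bsub>A Quot I n\<^esub> x n) \<oplus>\<^bsub>lim_quot A I\<^esub> x = \<zero>\<^bsub>lim_quot A I\<^esub>"
      using xn abelian_group.l_neg[OF ring.is_abelian_group[OF cring.axioms(1)[OF cring_Quot]]]
      by (auto simp: lim_quot_simps)
  qed
next
  interpret Q: cring "A Quot I n" for n by (rule cring_Quot)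
  have c: "x n \<in> carrier (A Quot I n)" if "x \<in> carrier (lim_quot A I)" for x n
    using that by (auto simp: lim_quot_simps)
  show "\<zero>\<^bsub>lim_quot A I\<^esub> \<in> carrier (lim_quot A I)" "\<one>\<^bsub>lim_quot A I\<^esub> \<in> carrier (lim_quot A I)"
    using cosets_closed by (simp_all add: lim_quot_simps(3,4) coset_ops(4,5)[OF zero_closed zero_closed])
  fix x y z assume x: "x \<in> carrier (lim_quot A I)" and y: "y \<in> carrier (lim_quot A I)"
    and z: "z \<in> carrier (lim_quot A I)"
  show "x \<oplus>\<^bsub>lim_quot A I\<^esub> y \<oplus>\<^bsub>lim_quot A I\<^esub> z = x \<oplus>\<^bsub>lim_quot A I\<^esub> (y \<oplus>\<^bsub>lim_quot A I\<^esub> z)"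
    "x \<otimes>\<^bsub>lim_quot A I\<^esub> y \<otimes>\<^bsub>lim_quot A I\<^esub> z = x \<otimes>\<^bsub>lim_quot A I\<^esub> (y \<otimes>\<^bsub>lim_quot A I\<^esub> z)"
    "(x \<oplus>\<^bsub>lim_quot A I\<^esub> y) \<otimes>\<^bsub>lim_quot A I\<^esub> z = x \<otimes>\<^bsub>lim_quot A I\<^esub> z \<oplus>\<^bsub>lim_quot A I\<^esub> y \<otimes>\<^bsub>lim_quot A I\<^esub> z"
    using c[OF x] c[OF y] c[OF z] by (simp_all add: lim_quot_simps Q.a_assoc Q.m_assoc Q.l_distr)
next
  interpret Q: cring "A Quot I n" for n by (rule cring_Quot)
  have c: "x n \<in> carrier (A Quot I n)" if "x \<in> carrier (lim_quot A I)" for x n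
    using that by (auto simp: lim_quot_simps)
  fix x y assume x: "x \<in> carrier (lim_quot A I)" and y: "y \<in> carrier (lim_quot A I)"
  show "x \<oplus>\<^bsub>lim_quot A I\<^esub> y = y \<oplus>\<^bsub>lim_quot A I\<^esub> x" "x \<otimes>\<^bsub>lim_quot A I\<^esub> y = y \<otimes>\<^bsub>lim_quot A I\<^esub> x"
    using c[OF x] c[OF y] by (simp_all add: lim_quot_simps Q.a_comm Q.m_comm)
  show "\<zero>\<^bsub>lim_quot A I\<^esub> \<oplus>\<^bsub>lim_quot A I\<^esub> x = x" "\<one>\<^bsub>lim_quot A I\<^esub> \<otimes>\<^bsub>lim_quot A I\<^esub> x = x"
    using c[OF x] by (simp_all add: lim_quot_simps)
qed

lemma lim_quot_proj_hom: "(%x. x n) \<in> ring_hom (lim_quot A I) (A Quot I n)"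
  by (rule ring_hom_memI) (auto simp: lim_quot_simps)

lemma cosets_hom: "(%a n. I n +> a) \<in> ring_hom A (lim_quot A I)" by (rule ring_hom_memI)
    (auto simp: cosets_closed lim_quot_simps(2-5) coset_ops coset_ops(4)[OF zero_closed zero_closed])

lemma lim_quot_hom:
  assumes S: "cring S" and g: "!!n. g n \<in> ring_hom S (A Quot I n)"
    and chain: "!!n x. x \<in> carrier S ==> g (Suc n) x <= g n x"
  shows "(%x n. g n x) \<in> ring_hom S (lim_quot A I)" by (rule ring_hom_memI)
    (use assms g[THEN ring_hom_closed] g[THEN ring_hom_mult] g[THEN ring_hom_add] g[THEN ring_hom_one]
      in \<open>auto simp: lim_quot_simps\<close>)

end

lemma (in cring) padic_ideal_iff:
  "x \<in> padic_ideal R p n \<longleftrightarrow> (\<exists>a\<in>carrier R. x = a \<otimes> int_in R (int p ^ n))"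
  by (auto simp: padic_ideal_def cgenideal_def)

lemma (in cring) ideal_padic: "ideal (padic_ideal R p n) R"
  unfolding padic_ideal_def by (rule cgenideal_ideal) simp

lemma (in cring) padic_ideal_mult:
  assumes "x \<in> padic_ideal R p m" "y \<in> padic_ideal R p n" shows "x \<otimes> y \<in> padic_ideal R p (m + n)"
proof -
  obtain a b where "a \<in> carrier R" "x = a \<otimes> int_in R (int p ^ m)" "b \<in> carrier R" "y = b \<otimes> int_in R (int p ^ n)"
    using assms by (auto simp: padic_ideal_iff)
  then have "x \<otimes> y = (a \<otimes> b) \<otimes> int_in R (int p ^ (m + n))" "a \<otimes> b \<in> carrier R"
    by (simp_all add: power_add int_in_mult m_ac)
  then show ?thesis unfolding padic_ideal_iff by blast
qed

lemma (in cring) padic_ideal_antimono: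
  assumes "m \<le> n" shows "padic_ideal R p n <= padic_ideal R p m"
proof
  fix x assume "x \<in> padic_ideal R p n"
  then obtain a where a: "a \<in> carrier R" "x = a \<otimes> int_in R (int p ^ n)" by (auto simp: padic_ideal_iff)
  have "int_in R (int p ^ n) = int_in R (int p ^ (n - m)) \<otimes> int_in R (int p ^ m)"
    using assms by (simp flip: power_add int_in_mult)
  then have "x = (a \<otimes> int_in R (int p ^ (n - m))) \<otimes> int_in R (int p ^ m)"
    using a by (simp only: m_assoc int_in_closed)
  then show "x \<in> padic_ideal R p m" unfolding padic_ideal_iff by (rule rev_bexI[rotated]) (use a in simp)
qed

lemma (in cring) padic_chain: "ideal_chain R (padic_ideal R p)"
  using ideal_padic padic_ideal_antimono[of n "Suc n" for n] is_cring
  by (simp add: ideal_chain_def ideal_chain_axioms_def)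

lemma (in cring) padic_ideal_0: "padic_ideal R p 0 = carrier R"
proof -
  have "x \<in> padic_ideal R p 0 \<longleftrightarrow> x \<in> carrier R" for x
    unfolding padic_ideal_iff by (auto simp: int_in_one)
  then show ?thesis by blast
qed

lemma (in cring) cring_completion: "cring (completion R p)"
  unfolding completion_def by (rule ideal_chain.cring_lim_quot[OF padic_chain])

lemma (in cring) to_completion_hom: "to_completion R p \<in> ring_hom R (completion R p)"
proof -
  have "to_completion R p = (%a n. padic_ideal R p n +> a)" by (simp add: to_completion_def fun_eq_iff)
  then show ?thesis unfolding completion_def using ideal_chain.cosets_hom[OF padic_chain] by simp
qed

lemma padic_hom_zero:
  assumes R: "cring R" and T: "cring T" and g: "g \<in> ring_hom R T"
    and 0: "int_in T (int p ^ n) = \<zero>\<^bsub>T\<^esub>" and k: "k \<in> padic_ideal R p n"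
  shows "g k = \<zero>\<^bsub>T\<^esub>"
proof -
  interpret cring R by fact
  interpret T: cring T by fact
  obtain a where "a \<in> carrier R" "k = a \<otimes>\<^bsub>R\<^esub> int_in R (int p ^ n)"
    using k by (auto simp: padic_ideal_iff)
  then show ?thesis using ring_hom_mult[OF g] ring_hom_int_in[OF R T g] ring_hom_closed[OF g] by (simp add: 0)
qed

text \<open>A ring in which p^n = 0 only sees level n of the completion. In this way maps on
  \<open>R\<close> are extended to R_p without forming p-adic limits in the target.\<close>

lemma completion_hom:
  assumes R: "cring R" and T: "cring T" and g: "g \<in> ring_hom R T"
    and 0: "int_in T (int p ^ n) = \<zero>\<^bsub>T\<^esub>"
  shows "(%x. g (SOME a. a \<in> x n)) \<in> ring_hom (completion R p) T"
    and "!!a. a \<in> carrier R ==> g (SOME b. b \<in> to_completion R p a n) = g a"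
proof -
  interpret cring R by (rule R)
  note fh = factor_hom[OF R T ideal_padic[of p n] g padic_hom_zero[OF R T g 0]]
  show "(%x. g (SOME a. a \<in> x n)) \<in> ring_hom (completion R p) T" unfolding completion_def
    using ring_hom_trans[OF ideal_chain.lim_quot_proj_hom[OF padic_chain] fh(1)] by (simp add: o_def)
  show "!!a. a \<in> carrier R ==> g (SOME b. b \<in> to_completion R p a n) = g a"
    using fh(2) by (simp add: to_completion_def)
qed

lemma (in cring) to_completion_closed: "a \<in> carrier R ==> to_completion R p a \<in> carrier (completion R p)"
  by (rule ring_hom_closed[OF to_completion_hom])

text \<open>The quotient by \<open>p\<close> is built as a \<open>p\<close>-adic series, so no torsion freeness is needed.\<close>

lemma (in cring) completion_divisible:
  assumes x: "x \<in> carrier (completion R p)" and x1: "x 1 = padic_ideal R p 1"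
  shows "x \<in> padic_ideal (completion R p) p 1"
proof -
  let ?I = "padic_ideal R p" and ?P = "int_in R (int p)"
  interpret ideal_chain R ?I by (rule padic_chain)
  interpret C: cring "completion R p" by (rule cring_completion)
  have "\<exists>a\<in>carrier R. x n = ?I n +> a & x (Suc n) = ?I (Suc n) +> a" for n
  proof -
    obtain a where "a \<in> carrier R" "x n = ?I n +> a" "x (Suc n) = ?I (Suc n) +> a"
      using x unfolding completion_def by (rule lim_quot_rep)
    then show ?thesis by blast
  qed
  then obtain r where r: "!!n. r n \<in> carrier R" "!!n. x n = ?I n +> r n" "!!n. x (Suc n) = ?I (Suc n) +> r n"
    by metis
  \<comment> \<open>\<open>r n\<close> also represents x at level n + 1, so \<open>r (Suc n)\<close>
    differs from it by a multiple of p^(n+1).\<close>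
  have "\<exists>s\<in>carrier R. r (Suc n) = r n \<oplus> s \<otimes> int_in R (int p ^ Suc n)" for n
  proof -
    have "?I (Suc n) +> r (Suc n) = ?I (Suc n) +> r n" using r(2,3) by metis
    then have "r (Suc n) \<ominus> r n \<in> ?I (Suc n)" using ideal.coset_eq_iff[OF ideal_padic] r(1) by blast
    then obtain s where s: "s \<in> carrier R" "r (Suc n) \<ominus> r n = s \<otimes> int_in R (int p ^ Suc n)"
      unfolding padic_ideal_iff by blast
    have "r (Suc n) = r n \<oplus> (r (Suc n) \<ominus> r n)" using r(1)[of n] r(1)[of "Suc n"] by algebra
    then show ?thesis using s by auto
  qed
  then obtain s where s: "!!n. s n \<in> carrier R" "!!n. r (Suc n) = r n \<oplus> s n \<otimes> int_in R (int p ^ Suc n)"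
    by metis
  have "\<zero>\<^bsub>R Quot ?I 1\<^esub> = ?I 1" by (simp add: FactRing_def)
  then have "r 0 \<in> ?I 1" using x1 r(3)[of 0] ideal.coset_zero_iff[OF ideal_padic r(1)[of 0], of p 1] by simp
  then obtain s' where s': "s' \<in> carrier R" "r 0 = s' \<otimes> ?P" by (auto simp: padic_ideal_iff)
  \<comment> \<open>The partial sums s' + s_0 + s_1 p + ... of x divided by p: p times
    \<open>w n\<close> is \<open>r n\<close>, and \<open>w (Suc n)\<close> agrees with
    \<open>w n\<close> modulo p^n.\<close>
  define w where "w = rec_nat s' (%n w. w \<oplus> s n \<otimes> int_in R (int p ^ n))"
  have w0: "w 0 = s'" and wS: "w (Suc n) = w n \<oplus> s n \<otimes> int_in R (int p ^ n)" for n
    by (simp_all add: w_def)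
  have w: "w n \<in> carrier R" for n by (induction n) (simp_all add: w0 wS s s')
  have Pw: "w n \<otimes> ?P = r n" for n
  proof (induction n)
    case (Suc n)
    have "w (Suc n) \<otimes> ?P = w n \<otimes> ?P \<oplus> s n \<otimes> (int_in R (int p ^ n) \<otimes> ?P)"
      using w s by (simp add: wS l_distr m_assoc)
    also have "int_in R (int p ^ n) \<otimes> ?P = int_in R (int p ^ Suc n)"
      by (simp add: mult.commute flip: int_in_mult)
    finally show ?case by (simp only: Suc s(2))
  qed (simp add: w0 s')
  define y where "y = (%n. ?I n +> w n)"
  have y: "y \<in> carrier (completion R p)" unfolding completion_def lim_quot_simps
  proof (intro CollectI allI conjI)
    fix n
    show "y n \<in> carrier (R Quot ?I n)" by (simp add: y_def ideal.Quot_closed[OF ideal_padic] w)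
    have "w (Suc n) \<ominus> w n = s n \<otimes> int_in R (int p ^ n)"
      using w[of n] s(1)[of n] int_in_closed[of "int p ^ n"] unfolding wS by algebra
    then have "w (Suc n) \<ominus> w n \<in> ?I n" using s by (auto simp: padic_ideal_iff)
    then have "?I n +> w (Suc n) = y n" using ideal.coset_eq_iff[OF ideal_padic w w] unfolding y_def by blast
    then show "y (Suc n) <= y n" using coset_chain[OF w, of n "Suc n"] by (simp only: y_def)
  qed
  have "int_in (completion R p) (int p ^ 1) = to_completion R p ?P"
    using ring_hom_int_in[OF is_cring cring_completion to_completion_hom] by simp
  then have "y \<otimes>\<^bsub>completion R p\<^esub> int_in (completion R p) (int p ^ 1) = (%n. ?I n +> (w n \<otimes> ?P))"
    by (simp add: completion_def lim_quot_simps to_completion_def y_def coset_ops w)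
  then have "x = y \<otimes>\<^bsub>completion R p\<^esub> int_in (completion R p) (int p ^ 1)"
    by (simp add: Pw r(2) fun_eq_iff)
  then show ?thesis using y unfolding C.padic_ideal_iff by blast
qed

context etale_over_laurent
begin

text \<open>Dependent choice of successive lifts. They are kept as a nested family of cosets rather
  than as one map into a limit of \<open>T\<close>.\<close>

lemma lift_limit:
  fixes T :: "('c, 'k) ring_scheme" and e :: "'c => (int => int) + 'a + nat"
  assumes T: "cring T" and e: "inj_on e (carrier T)" and K: "ideal_chain T K"
    and sq: "!!n x y. x \<in> K n ==> y \<in> K n ==> x \<otimes>\<^bsub>T\<^esub> y \<in> K (Suc n)"
    and u: "u \<in> Units T"
    and b: "b \<in> ring_hom R (T Quot K 0)" "b \<tau> = K 0 +>\<^bsub>T\<^esub> u"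
  obtains g where "!!n. g n \<in> ring_hom R (T Quot K n)" "!!n. g n \<tau> = K n +>\<^bsub>T\<^esub> u"
    "!!n r. r \<in> carrier R ==> g (Suc n) r <= g n r" "g 0 = b"
proof -
  interpret K: ideal_chain T K by (rule K)
  define Q where "Q = (%n g. g \<in> ring_hom R (T Quot K n) & g \<tau> = K n +>\<^bsub>T\<^esub> u & (n = 0 --> g = b))"
  have "\<exists>g. \<forall>n. Q n (g n) & (\<forall>r\<in>carrier R. g (Suc n) r <= g n r)"
  proof (rule dependent_nat_choice)
    show "\<exists>g. Q 0 g" using b by (auto simp: Q_def)
    fix g n assume g: "Q n g"
    obtain g' where "g' \<in> ring_hom R (T Quot K (Suc n))" "g' \<tau> = K (Suc n) +>\<^bsub>T\<^esub> u"
      "!!r. r \<in> carrier R ==> g' r <= g r"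
      by (rule lift_step[OF T e K.ideal_I K.ideal_I K.decreasing sq u, of n g]) (use g in \<open>auto simp: Q_def\<close>)
    then show "\<exists>g'. Q (Suc n) g' & (\<forall>r\<in>carrier R. g' r <= g r)" by (auto simp: Q_def)
  qed
  then obtain g where g: "!!n. Q n (g n)" "!!n r. r \<in> carrier R ==> g (Suc n) r <= g n r" by blast
  show thesis by (rule that[of g]) (use g in \<open>auto simp: Q_def\<close>)
qed

lemma frobenius_mod_p:
  assumes p: "Factorial_Ring.prime p"
  shows "(%r. padic_ideal R p 1 +>\<^bsub>R\<^esub> (r [^]\<^bsub>R\<^esub> p)) \<in> ring_hom R (R Quot padic_ideal R p 1)"
proof -
  interpret I: ideal_chain R "padic_ideal R p" by (rule R.padic_chain)
  note ops = I.coset_ops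
  show ?thesis
  proof (rule ring_hom_memI)
    fix x y assume x: "x \<in> carrier R" and y: "y \<in> carrier R"
    show "padic_ideal R p 1 +>\<^bsub>R\<^esub> (x [^]\<^bsub>R\<^esub> p) \<in> carrier (R Quot padic_ideal R p 1)"
      using x by (simp add: ideal.Quot_closed[OF R.ideal_padic])
    show "padic_ideal R p 1 +>\<^bsub>R\<^esub> ((x \<otimes>\<^bsub>R\<^esub> y) [^]\<^bsub>R\<^esub> p) =
        (padic_ideal R p 1 +>\<^bsub>R\<^esub> (x [^]\<^bsub>R\<^esub> p)) \<otimes>\<^bsub>R Quot padic_ideal R p 1\<^esub> (padic_ideal R p 1 +>\<^bsub>R\<^esub> (y [^]\<^bsub>R\<^esub> p))"
      using x y by (simp add: ops R.nat_pow_distrib)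
    have "padic_ideal R p 1 +>\<^bsub>R\<^esub> ((x \<oplus>\<^bsub>R\<^esub> y) [^]\<^bsub>R\<^esub> p)
        = padic_ideal R p 1 +>\<^bsub>R\<^esub> (x [^]\<^bsub>R\<^esub> p \<oplus>\<^bsub>R\<^esub> y [^]\<^bsub>R\<^esub> p)"
      using R.freshman[OF x y p] x y by (subst ideal.coset_eq_iff[OF R.ideal_padic]) (auto simp: padic_ideal_def)
    then show "padic_ideal R p 1 +>\<^bsub>R\<^esub> ((x \<oplus>\<^bsub>R\<^esub> y) [^]\<^bsub>R\<^esub> p) =
        (padic_ideal R p 1 +>\<^bsub>R\<^esub> (x [^]\<^bsub>R\<^esub> p)) \<oplus>\<^bsub>R Quot padic_ideal R p 1\<^esub> (padic_ideal R p 1 +>\<^bsub>R\<^esub> (y [^]\<^bsub>R\<^esub> p))"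
      using x y by (simp add: ops)
  qed (simp add: ops(4)[OF R.zero_closed R.zero_closed])
qed

text \<open>The p-th power map modulo p is lifted to all powers of p, with \<tau> going to its p-th
  power, and is then extended from \<open>R\<close> to its completion level by level.\<close>

lemma frobenius_lift_exists:
  assumes p: "Factorial_Ring.prime p"
  shows "\<exists>\<phi>. frobenius_lift R \<tau> p \<phi>"
proof -
  let ?I = "padic_ideal R p" and ?C = "completion R p"
  interpret I: ideal_chain R ?I by (rule R.padic_chain)
  interpret C: cring ?C by (rule R.cring_completion)
  have K: "ideal_chain R (%n. ?I (Suc n))"
    unfolding ideal_chain_def ideal_chain_axioms_def using I.ideal_I I.decreasing cring_R by blast
  have e: "inj_on (%r. Inr (Inl r) :: (int => int) + 'a + nat) (carrier R)" by (simp add: inj_on_def)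
  have sq: "x \<otimes>\<^bsub>R\<^esub> y \<in> ?I (Suc (Suc n))" if "x \<in> ?I (Suc n)" "y \<in> ?I (Suc n)" for x y n
    using R.padic_ideal_mult[OF that] R.padic_ideal_antimono[of "Suc (Suc n)" "Suc n + Suc n" p] by auto
  have u: "\<tau> [^]\<^bsub>R\<^esub> p \<in> Units R" using tau_Units by (rule R.Units_pow_closed)
  obtain g where g: "!!n. g n \<in> ring_hom R (R Quot ?I (Suc n))" "!!n. g n \<tau> = ?I (Suc n) +>\<^bsub>R\<^esub> (\<tau> [^]\<^bsub>R\<^esub> p)"
    "!!n r. r \<in> carrier R ==> g (Suc n) r <= g n r" "g 0 = (%r. ?I (Suc 0) +>\<^bsub>R\<^esub> (r [^]\<^bsub>R\<^esub> p))"
    by (rule lift_limit[OF cring_R e K sq u, of "%r. ?I (Suc 0) +>\<^bsub>R\<^esub> (r [^]\<^bsub>R\<^esub> p)"])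
      (use frobenius_mod_p[OF p] in auto)
  \<comment> \<open>The lifts start modulo p. Level 0, whose quotient is the zero ring, is put in
    front of them.\<close>
  define b where "b = (%n. case n of 0 => (%r. ?I 0 +>\<^bsub>R\<^esub> r) | Suc n => g n)"
  have b: "b n \<in> ring_hom R (R Quot ?I n)" for n
    using g(1) ideal.rcos_ring_hom[OF R.ideal_padic[of p 0]] by (auto simp: b_def split: nat.split)
  have bc: "b (Suc n) r <= b n r" if r: "r \<in> carrier R" for n r
  proof (cases n)
    case 0
    have "b 1 r <= carrier R"
      using ring_hom_closed[OF b r, of 1] ideal.coset_memE(1)[OF R.ideal_padic, of "b 1 r"] by blast
    moreover have "b 0 r = carrier R"
      using R.a_rcos_zero[OF R.ideal_padic[of p 0], of r] r by (simp add: b_def R.padic_ideal_0)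
    ultimately show ?thesis using 0 by simp
  qed (use g(3) r in \<open>simp add: b_def\<close>)
  have zero: "int_in (R Quot ?I n) (int p ^ n) = \<zero>\<^bsub>R Quot ?I n\<^esub>" for n
  proof -
    have "int_in R (int p ^ n) \<in> ?I n" using R.one_closed by (force simp: R.padic_ideal_iff)
    then show ?thesis
      using ring_hom_int_in[OF cring_R I.cring_Quot ideal.rcos_ring_hom[OF R.ideal_padic[of p n]], of "int p ^ n"]
        ideal.coset_zero_iff[OF R.ideal_padic, of "int_in R (int p ^ n)" p n] by simp
  qed
  define \<phi> where "\<phi> = (%x n. b n (SOME a. a \<in> x n))"
  note ch = completion_hom[OF cring_R I.cring_Quot b zero]
  have bn: "b n a = \<phi> x n" if x: "x \<in> carrier ?C" and a: "a \<in> carrier R" "x n = ?I n +>\<^bsub>R\<^esub> a" for x a n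
    using ch(2)[OF a(1), of n] a by (simp add: \<phi>_def to_completion_def)
  have \<phi>: "\<phi> \<in> ring_hom ?C ?C" unfolding \<phi>_def completion_def
  proof (rule I.lim_quot_hom)
    show "cring (lim_quot R ?I)" by (rule I.cring_lim_quot)
    show "(%x. b n (SOME a. a \<in> x n)) \<in> ring_hom (lim_quot R ?I) (R Quot ?I n)" for n
      using ch(1)[of n] by (simp add: completion_def)
    fix n x assume x: "x \<in> carrier (lim_quot R ?I)"
    obtain a where a: "a \<in> carrier R" "x n = ?I n +>\<^bsub>R\<^esub> a" "x (Suc n) = ?I (Suc n) +>\<^bsub>R\<^esub> a"
      by (rule I.lim_quot_rep[OF x])
    have "\<phi> x (Suc n) <= \<phi> x n"
      using bc[OF a(1), of n] bn[OF _ a(1), of x] a x by (simp add: completion_def)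
    then show "b (Suc n) (SOME a. a \<in> x (Suc n)) <= b n (SOME a. a \<in> x n)" by (simp add: \<phi>_def)
  qed
  have "frobenius_lift R \<tau> p \<phi>" unfolding frobenius_lift_def
  proof (intro conjI ballI)
    show "\<phi> \<in> ring_hom ?C ?C" by (rule \<phi>)
    have "\<phi> (to_completion R p \<tau>) = (%n. b n \<tau>)"
      using ch(2) tau_Units by (auto simp: \<phi>_def R.Units_closed)
    also have "... = to_completion R p (\<tau> [^]\<^bsub>R\<^esub> p)"
    proof
      fix n show "b n \<tau> = to_completion R p (\<tau> [^]\<^bsub>R\<^esub> p) n"
        by (cases n) (use tau_Units R.Units_closed in \<open>auto simp: b_def g(2) to_completion_def
              R.padic_ideal_0 ideal.coset_eq_iff[OF R.ideal_padic[of p 0, unfolded R.padic_ideal_0]]\<close>)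
    qed
    also have "... = to_completion R p \<tau> [^]\<^bsub>?C\<^esub> p"
      by (rule ring_hom_nat_pow[OF cring_R R.cring_completion R.to_completion_hom])
        (use tau_Units R.Units_closed in auto)
    finally show "\<phi> (to_completion R p \<tau>) = to_completion R p \<tau> [^]\<^bsub>?C\<^esub> p" .
    fix x assume x: "x \<in> carrier ?C"
    show "\<phi> x \<ominus>\<^bsub>?C\<^esub> x [^]\<^bsub>?C\<^esub> p \<in> padic_ideal ?C p 1"
    \<comment> \<open>Divisibility by p in the completion is visible at level 1, where both terms
      are the p-th power.\<close>
    proof (rule R.completion_divisible)
      show xc: "\<phi> x \<ominus>\<^bsub>?C\<^esub> x [^]\<^bsub>?C\<^esub> p \<in> carrier ?C"
        using x \<phi> by (simp add: ring_hom_closed)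
      have pr: "(%x. x 1) \<in> ring_hom ?C (R Quot ?I 1)" unfolding completion_def by (rule I.lim_quot_proj_hom)
      obtain a where a: "a \<in> carrier R" "x 1 = ?I 1 +>\<^bsub>R\<^esub> a" "x (Suc 1) = ?I (Suc 1) +>\<^bsub>R\<^esub> a"
        using x unfolding completion_def by (rule I.lim_quot_rep)
      have "(x [^]\<^bsub>?C\<^esub> p) 1 = x 1 [^]\<^bsub>R Quot ?I 1\<^esub> p"
        using ring_hom_nat_pow[OF R.cring_completion I.cring_Quot pr x] .
      also have "... = ?I 1 +>\<^bsub>R\<^esub> (a [^]\<^bsub>R\<^esub> p)"
        using ring_hom_nat_pow[OF cring_R I.cring_Quot ideal.rcos_ring_hom[OF R.ideal_padic[of p 1]] a(1), of p] a by simp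
      also have "... = \<phi> x 1" using bn[OF x a(1,2)] g(4) by (simp add: b_def)
      finally have "(\<phi> x \<ominus>\<^bsub>?C\<^esub> x [^]\<^bsub>?C\<^esub> p) 1 = \<phi> x 1 \<ominus>\<^bsub>R Quot ?I 1\<^esub> \<phi> x 1"
        using ring_hom_minus[OF R.cring_completion I.cring_Quot pr, of "\<phi> x" "x [^]\<^bsub>?C\<^esub> p"] x \<phi>
        by (simp add: ring_hom_closed)
      also have "... = \<zero>\<^bsub>R Quot ?I 1\<^esub>"
      proof -
        interpret Q: cring "R Quot ?I 1" by (rule I.cring_Quot)
        have "\<phi> x 1 \<in> carrier (R Quot ?I 1)" using ring_hom_closed[OF pr ring_hom_closed[OF \<phi> x]] .
        then show ?thesis unfolding a_minus_def by (rule Q.r_neg)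
      qed
      finally show "(\<phi> x \<ominus>\<^bsub>?C\<^esub> x [^]\<^bsub>?C\<^esub> p) 1 = ?I 1" by (simp add: FactRing_def)
    qed
  qed
  then show ?thesis by blast
qed

lemma frob: "Factorial_Ring.prime p ==> frobenius_lift R \<tau> p (frob R \<tau> p)"
  unfolding frob_def by (rule someI_ex[OF frobenius_lift_exists])

end

section \<open>Adjoining roots\<close>

lemma UP_record_simps:
  "carrier (UP A) = up A"
  "p \<in> up A ==> q \<in> up A ==> p \<oplus>\<^bsub>UP A\<^esub> q = (%i. p i \<oplus>\<^bsub>A\<^esub> q i)"
  "p \<in> up A ==> q \<in> up A ==> p \<otimes>\<^bsub>UP A\<^esub> q = (%n. finsum A (%i. p i \<otimes>\<^bsub>A\<^esub> q (n - i)) {..n})"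
  "\<one>\<^bsub>UP A\<^esub> = (%i. if i = 0 then \<one>\<^bsub>A\<^esub> else \<zero>\<^bsub>A\<^esub>)"
  "a \<in> carrier A ==> up_ring.monom (UP A) a n = (%i. if i = n then a else \<zero>\<^bsub>A\<^esub>)"
  by (simp_all add: UP_def)

context
  fixes A :: "('a, 'm) ring_scheme"
  assumes A: "cring A"
begin

interpretation A: UP_cring A "UP A" using A by (simp add: UP_cring_def)

lemma UP_mon_closed: "a \<in> carrier A ==> up_ring.monom (UP A) a n \<in> carrier (UP A)" by (rule A.monom_closed)

lemma UP_const_hom: "(%a. up_ring.monom (UP A) a 0) \<in> ring_hom A (UP A)" by (rule A.const_ring_hom)

lemma UP_mon_mult:
  "a \<in> carrier A ==> b \<in> carrier A ==> up_ring.monom (UP A) a n \<otimes>\<^bsub>UP A\<^esub> up_ring.monom (UP A) b m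
    = up_ring.monom (UP A) (a \<otimes>\<^bsub>A\<^esub> b) (n + m)" by (simp add: A.monom_mult)

lemma UP_mon_pow: "up_ring.monom (UP A) \<one>\<^bsub>A\<^esub> n = up_ring.monom (UP A) \<one>\<^bsub>A\<^esub> 1 [^]\<^bsub>UP A\<^esub> n"
  by (simp add: A.monom_pow A.R.nat_pow_one)

lemma UP_mon_eq:
  "a \<in> carrier A ==> up_ring.monom (UP A) a n
    = up_ring.monom (UP A) a 0 \<otimes>\<^bsub>UP A\<^esub> up_ring.monom (UP A) \<one>\<^bsub>A\<^esub> 1 [^]\<^bsub>UP A\<^esub> n"
  unfolding UP_mon_pow[symmetric] by (simp add: UP_mon_mult)

lemma UP_induct [consumes 1, case_names monom add]:
  assumes "p \<in> carrier (UP A)"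
    and m: "!!a n. a \<in> carrier A ==> Q (up_ring.monom (UP A) a n)"
    and a: "!!p q. p \<in> carrier (UP A) ==> q \<in> carrier (UP A) ==> Q p ==> Q q ==> Q (p \<oplus>\<^bsub>UP A\<^esub> q)"
  shows "Q p"
proof -
  have z: "Q \<zero>\<^bsub>UP A\<^esub>" using m[of "\<zero>\<^bsub>A\<^esub>" 0] by simp
  have c: "up_ring.coeff (UP A) p i \<in> carrier A" for i using assms(1) by (rule A.coeff_closed)
  have "Q (finsum (UP A) (%i. up_ring.monom (UP A) (up_ring.coeff (UP A) p i) i) {..n})" for n
    by (induction n) (use c m a in \<open>auto intro!: a A.P.finsum_closed simp: A.P.finsum_Suc A.P.finsum_insert\<close>)
  then show ?thesis using A.up_repr[OF assms(1)] by metis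
qed

context
  fixes T :: "('b, 'n) ring_scheme" and h x
  assumes T: "cring T" and h: "h \<in> ring_hom A T" and x: "x \<in> carrier T"
begin

interpretation E: UP_pre_univ_prop A T h "UP A"
  using A T h by (simp add: UP_pre_univ_prop_def UP_cring_def ring_hom_cringI)

lemma eval_hom: "UnivPoly.eval A T h x \<in> ring_hom (UP A) T" by (rule E.eval_ring_hom[OF x])

lemma eval_mon: "a \<in> carrier A ==> UnivPoly.eval A T h x (up_ring.monom (UP A) a n) = h a \<otimes>\<^bsub>T\<^esub> x [^]\<^bsub>T\<^esub> n"
  by (rule E.eval_monom[OF _ x])

lemma coset_eval_hom:
  assumes I: "ideal I (UP A)" and ker: "!!F. F \<in> I ==> UnivPoly.eval A T h x F = \<zero>\<^bsub>T\<^esub>"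
  shows "coset_eval A T h x \<in> ring_hom (UP A Quot I) T"
    and "F \<in> carrier (UP A) ==> coset_eval A T h x (I +>\<^bsub>UP A\<^esub> F) = UnivPoly.eval A T h x F"
  using factor_hom[OF A.UP_cring T I eval_hom ker] by (simp_all add: coset_eval_def[abs_def])

end

end

section \<open>The subring Z[zeta_k] of the complex numbers; universal properties of A[zeta_k] and
  A[zeta_k, tau^(1/d)]\<close>

definition Zz :: "(nat => complex) => nat => complex set" where
  "Zz \<zeta> k = range (%P. ipoly P (\<zeta> k))"

lemma ipoly_simps [simp]:
  "ipoly (P + Q) z = ipoly P z + ipoly Q z" "ipoly (P * Q) z = ipoly P z * ipoly Q z"
  "ipoly 0 z = 0" "ipoly 1 z = 1" "ipoly (- P) z = - ipoly P z" "ipoly (P - Q) z = ipoly P z - ipoly Q z"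
  "ipoly [:c:] z = of_int c" "ipoly (pCons c P) z = of_int c + z * ipoly P z" "ipoly (P ^ n) z = ipoly P z ^ n"
  "ipoly (Polynomial.monom c n) z = of_int c * z ^ n"
proof -
  show pc: "ipoly (pCons c P) z = of_int c + z * ipoly P z" for c P by (simp add: ipoly_def map_poly_pCons)
  show 0: "ipoly 0 z = 0" by (simp add: ipoly_def)
  show 1: "ipoly [:c:] z = of_int c" for c by (simp add: pc 0)
  show a: "ipoly (P + Q) z = ipoly P z + ipoly Q z" for P Q
  proof (induction P arbitrary: Q)
    case (pCons c P)
    show ?case by (cases Q) (simp add: pc pCons.IH distrib_left)
  qed (simp add: 0)
  have s: "ipoly (smult c P) z = of_int c * ipoly P z" for c P by (induction P) (simp_all add: 0 pc algebra_simps)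
  show m: "ipoly (P * Q) z = ipoly P z * ipoly Q z" for P Q by (induction P) (simp_all add: 0 pc a s algebra_simps)
  show o: "ipoly 1 z = 1" using 1[of 1] by (simp add: one_pCons)
  show n: "ipoly (- P) z = - ipoly P z" for P using s[of "-1" P] by simp
  show "ipoly (P - Q) z = ipoly P z - ipoly Q z" using a[of P "- Q"] n[of Q] by simp
  show "ipoly (P ^ n) z = ipoly P z ^ n" by (induction n) (simp_all add: o m)
  show "ipoly (Polynomial.monom c n) z = of_int c * z ^ n"
    by (induction n) (simp_all add: monom_0 monom_Suc pc 0 1 algebra_simps)
qed

lemma subring_Zz: "subring_set (Zz \<zeta> k)" unfolding subring_set_def Zz_def
  by (auto simp: image_iff simp flip: ipoly_simps) (metis ipoly_simps)+

lemma Zz_ipoly [simp]: "ipoly P (\<zeta> k) \<in> Zz \<zeta> k" by (simp add: Zz_def)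

lemma Zz_zeta [simp]: "\<zeta> k \<in> Zz \<zeta> k" using Zz_ipoly[of "[:0, 1:]" \<zeta> k] by simp

lemma of_int_poly_const: "(of_int c :: int poly) = [:c:]" by (simp add: of_int_poly)

lemma int_poly_hom_eq:
  assumes T: "cring T" and G: "G \<in> ring_hom (rg (UNIV :: int poly set)) T" "H \<in> ring_hom (rg (UNIV :: int poly set)) T"
    and eq: "G [:0, 1:] = H [:0, 1:]"
  shows "G P = H P"
proof (induction P)
  case 0
  show ?case using ring_hom_0[OF cring_rg[OF subring_set_UNIV] T G(1)] ring_hom_0[OF cring_rg[OF subring_set_UNIV] T G(2)] by simp
next
  case (pCons c P)
  have "F (pCons c P) = int_in T c \<oplus>\<^bsub>T\<^esub> F [:0, 1:] \<otimes>\<^bsub>T\<^esub> F P" if "F \<in> ring_hom (rg (UNIV :: int poly set)) T" for F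
  proof -
    have "F [:c:] = int_in T c" using ring_hom_int_in[OF cring_rg[OF subring_set_UNIV] T that, of c]
      by (simp add: int_in_rg of_int_poly_const)
    moreover have "F ([:c:] + [:0, 1:] * P) = F [:c:] \<oplus>\<^bsub>T\<^esub> F [:0, 1:] \<otimes>\<^bsub>T\<^esub> F P"
      using ring_hom_add[OF that, of "[:c:]" "[:0, 1:] * P"] ring_hom_mult[OF that, of "[:0, 1:]" P] by simp
    moreover have "[:c:] + [:0, 1:] * P = pCons c P" by simp
    ultimately show ?thesis by simp
  qed
  from this[OF G(1)] this[OF G(2)] show ?case using eq pCons.IH by simp
qed

context
  fixes A :: "('a, 'm) ring_scheme"
  assumes A: "cring A"
begin

interpretation A: UP_cring A "UP A" using A by (simp add: UP_cring_def)

lemma poly_in_closed: "poly_in A P \<in> carrier (UP A)"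
proof -
  have "bound \<zero>\<^bsub>A\<^esub> (degree P) (poly_in A P)"
    by (rule bound.intro) (simp add: poly_in_def coeff_eq_0)
  then show ?thesis by (auto simp: UP_def up_def poly_in_def)
qed

lemma poly_in_hom: "poly_in A \<in> ring_hom (rg UNIV) (UP A)"
proof (rule ring_hom_memI)
  fix P Q :: "int poly"
  have up: "poly_in A P \<in> up A" for P using poly_in_closed[of P] by (simp add: UP_def)
  show "poly_in A P \<in> carrier (UP A)" by (rule poly_in_closed)
  show "poly_in A (P \<oplus>\<^bsub>rg UNIV\<^esub> Q) = poly_in A P \<oplus>\<^bsub>UP A\<^esub> poly_in A Q"
    unfolding UP_record_simps(2)[OF up up] by (rule ext) (simp add: poly_in_def A.R.int_in_add)
  show "poly_in A (P \<otimes>\<^bsub>rg UNIV\<^esub> Q) = poly_in A P \<otimes>\<^bsub>UP A\<^esub> poly_in A Q"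
  proof
    fix n
    have "poly_in A (P * Q) n = int_in A (\<Sum>i\<le>n. Polynomial.coeff P i * Polynomial.coeff Q (n - i))"
      by (simp add: poly_in_def Polynomial.coeff_mult)
    also have "... = finsum A (%i. int_in A (Polynomial.coeff P i * Polynomial.coeff Q (n - i))) {..n}"
      using ring_hom_finsum[OF cring_int A A.R.int_in_hom, of "%i. Polynomial.coeff P i * Polynomial.coeff Q (n - i)" "{..n}"]
        finsum_rg[OF subring_set_UNIV, of "{..n}" "%i. Polynomial.coeff P i * Polynomial.coeff Q (n - i)"]
      by (simp add: rg_def)
    finally show "poly_in A (P \<otimes>\<^bsub>rg UNIV\<^esub> Q) n = (poly_in A P \<otimes>\<^bsub>UP A\<^esub> poly_in A Q) n"
      unfolding UP_record_simps(3)[OF up up] by (simp add: poly_in_def A.R.int_in_mult)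
  qed
qed (auto simp: UP_record_simps(4) poly_in_def A.R.int_in_one)

lemma poly_in_var: "poly_in A [:0, 1:] = up_ring.monom (UP A) \<one>\<^bsub>A\<^esub> 1"
  unfolding UP_record_simps(5)[OF A.R.one_closed]
  by (rule ext) (simp add: poly_in_def A.R.int_in_one coeff_pCons split: nat.split)

lemma ideal_cyc: "ideal (cyc_ideal \<zeta> A k) (UP A)"
  unfolding cyc_ideal_def by (rule A.P.genideal_ideal) (auto intro: poly_in_closed)

lemma cyc_ideal_mem: "ipoly P (\<zeta> k) = 0 ==> poly_in A P \<in> cyc_ideal \<zeta> A k" unfolding cyc_ideal_def
  using A.P.genideal_self[of "poly_in A ` {P. ipoly P (\<zeta> k) = 0}"] poly_in_closed by auto

lemma cring_cyc: "cring (cyc \<zeta> A k)"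
  unfolding cyc_def by (rule ideal.quotient_is_cring[OF ideal_cyc A.UP_cring])

lemma cyc_proj_hom: "(+>\<^bsub>UP A\<^esub>) (cyc_ideal \<zeta> A k) \<in> ring_hom (UP A) (cyc \<zeta> A k)"
  unfolding cyc_def by (rule ideal.rcos_ring_hom[OF ideal_cyc])

lemma cyc_const_hom: "cyc_const \<zeta> A k \<in> ring_hom A (cyc \<zeta> A k)"
  using ring_hom_trans[OF UP_const_hom[OF A] cyc_proj_hom] by (simp add: o_def cyc_const_def[abs_def])

text \<open>Two integer polynomials with the same value at \<open>\<zeta> k\<close> differ by a
  generator of \<open>cyc_ideal\<close>, so the choice made in \<open>cyc_num\<close> has no
  effect.\<close>

lemma cyc_num_ipoly: "cyc_num \<zeta> A k (ipoly P (\<zeta> k)) = cyc_ideal \<zeta> A k +>\<^bsub>UP A\<^esub> poly_in A P"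
proof -
  define Q where "Q = (SOME Q. ipoly Q (\<zeta> k) = ipoly P (\<zeta> k))"
  have "ipoly Q (\<zeta> k) = ipoly P (\<zeta> k)" unfolding Q_def by (rule someI) simp
  then have "poly_in A (Q - P) \<in> cyc_ideal \<zeta> A k" by (intro cyc_ideal_mem) simp
  moreover have "poly_in A (Q - P) = poly_in A Q \<ominus>\<^bsub>UP A\<^esub> poly_in A P"
    using ring_hom_minus[OF cring_rg[OF subring_set_UNIV] A.UP_cring poly_in_hom, of Q P] by (simp add: minus_rg)
  ultimately show ?thesis using ideal.coset_eq_iff[OF ideal_cyc poly_in_closed poly_in_closed]
    by (simp add: cyc_num_def Q_def)
qed

lemma cyc_num_hom: "cyc_num \<zeta> A k \<in> ring_hom (rg (Zz \<zeta> k)) (cyc \<zeta> A k)"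
proof -
  have "(%P. cyc_num \<zeta> A k (ipoly P (\<zeta> k))) \<in> ring_hom (rg UNIV) (cyc \<zeta> A k)"
    using ring_hom_trans[OF poly_in_hom cyc_proj_hom] by (simp add: cyc_num_ipoly o_def)
  note h = ring_hom_closed[OF this] ring_hom_mult[OF this] ring_hom_add[OF this] ring_hom_one[OF this]
  show ?thesis by (rule ring_hom_memI) (use h in \<open>auto simp: Zz_def simp flip: ipoly_simps(1,2)\<close>)
qed

lemma cyc_num_zeta: "cyc_num \<zeta> A k (\<zeta> k) = cyc_ideal \<zeta> A k +>\<^bsub>UP A\<^esub> up_ring.monom (UP A) \<one>\<^bsub>A\<^esub> 1"
  using cyc_num_ipoly[of \<zeta> k "[:0, 1:]"] by (simp add: poly_in_var)

lemma cyc_induct [consumes 1, case_names monom add]: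
  assumes x: "x \<in> carrier (cyc \<zeta> A k)"
    and m: "!!a n. a \<in> carrier A ==> Q (cyc_const \<zeta> A k a \<otimes>\<^bsub>cyc \<zeta> A k\<^esub> cyc_num \<zeta> A k (\<zeta> k) [^]\<^bsub>cyc \<zeta> A k\<^esub> (n::nat))"
    and a: "!!x y. x \<in> carrier (cyc \<zeta> A k) ==> y \<in> carrier (cyc \<zeta> A k) ==> Q x ==> Q y ==> Q (x \<oplus>\<^bsub>cyc \<zeta> A k\<^esub> y)"
  shows "Q x"
proof -
  obtain p where p: "p \<in> carrier (UP A)" "x = cyc_ideal \<zeta> A k +>\<^bsub>UP A\<^esub> p"
    using x ideal.Quot_carrierE[OF ideal_cyc] unfolding cyc_def by metis
  have "Q (cyc_ideal \<zeta> A k +>\<^bsub>UP A\<^esub> p)" using p(1)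
  proof (induction rule: UP_induct[OF A, consumes 1, case_names monom add])
    case (monom b n)
    have "cyc_ideal \<zeta> A k +>\<^bsub>UP A\<^esub> up_ring.monom (UP A) b n
      = cyc_const \<zeta> A k b \<otimes>\<^bsub>cyc \<zeta> A k\<^esub> cyc_num \<zeta> A k (\<zeta> k) [^]\<^bsub>cyc \<zeta> A k\<^esub> n"
      using monom ring_hom_mult[OF cyc_proj_hom] ring_hom_nat_pow[OF A.UP_cring cring_cyc cyc_proj_hom]
      by (subst UP_mon_eq[OF A monom]) (simp add: cyc_num_zeta cyc_const_def UP_mon_closed[OF A])
    then show ?case using m[OF monom] by simp
  next
    case (add p q)
    then show ?case
      using ring_hom_add[OF cyc_proj_hom add(1,2)] a[of "cyc_ideal \<zeta> A k +>\<^bsub>UP A\<^esub> p" "cyc_ideal \<zeta> A k +>\<^bsub>UP A\<^esub> q"]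
        ring_hom_closed[OF cyc_proj_hom] by simp
  qed
  then show ?thesis using p(2) by simp
qed

context
  fixes T :: "('b, 'n) ring_scheme" and h \<theta> \<zeta> k
  assumes T: "cring T" and h: "h \<in> ring_hom A T" and \<theta>: "\<theta> \<in> ring_hom (rg (Zz \<zeta> k)) T"
begin

lemma theta_zeta_closed: "\<theta> (\<zeta> k) \<in> carrier T" using \<theta> by (rule ring_hom_closed) simp

lemma eval_poly_in: "UnivPoly.eval A T h (\<theta> (\<zeta> k)) (poly_in A P) = \<theta> (ipoly P (\<zeta> k))"
proof (rule int_poly_hom_eq[OF T])
  let ?e = "UnivPoly.eval A T h (\<theta> (\<zeta> k))"
  note eh = eval_hom[OF A T h theta_zeta_closed]
  show "(%P. ?e (poly_in A P)) \<in> ring_hom (rg UNIV) T"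
    using ring_hom_trans[OF poly_in_hom eh] by (simp add: o_def)
  have "(%P. ipoly P (\<zeta> k)) \<in> ring_hom (rg UNIV) (rg (Zz \<zeta> k))" by (rule ring_hom_memI) auto
  from ring_hom_trans[OF this \<theta>]
  show "(%P. \<theta> (ipoly P (\<zeta> k))) \<in> ring_hom (rg UNIV) T" by (simp add: o_def)
  interpret T: cring T by (rule T)
  show "?e (poly_in A [:0, 1:]) = \<theta> (ipoly [:0, 1:] (\<zeta> k))" unfolding poly_in_var
    using eval_mon[OF A T h theta_zeta_closed A.R.one_closed, of 1] ring_hom_one[OF h] theta_zeta_closed by simp
qed

text \<open>The image of zeta_k is given as the value of a homomorphism \<theta> on all of
  Z[zeta_k]. This encodes every relation in \<open>cyc_ideal\<close>, so the evaluation map kills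
  that ideal.\<close>

lemma cyc_map:
  shows "cyc_map A T h (\<theta> (\<zeta> k)) \<in> ring_hom (cyc \<zeta> A k) T"
    and "a \<in> carrier A ==> cyc_map A T h (\<theta> (\<zeta> k)) (cyc_const \<zeta> A k a) = h a"
    and "w \<in> Zz \<zeta> k ==> cyc_map A T h (\<theta> (\<zeta> k)) (cyc_num \<zeta> A k w) = \<theta> w"
proof -
  interpret T: cring T by (rule T)
  let ?e = "UnivPoly.eval A T h (\<theta> (\<zeta> k))"
  note eh = eval_hom[OF A T h theta_zeta_closed]
  have kid: "ideal (a_kernel (UP A) T ?e) (UP A)"
    by (rule ring_hom_ring.kernel_is_ideal[OF ring_hom_ringI2[OF A.P.ring_axioms T.ring_axioms eh]])
  have mem: "poly_in A P \<in> a_kernel (UP A) T ?e" if "ipoly P (\<zeta> k) = 0" for P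
    using ring_hom_0[OF cring_rg[OF subring_Zz] T \<theta>] eval_poly_in[of P] that poly_in_closed[of P]
    unfolding a_kernel_def' by simp
  have ker: "?e F = \<zero>\<^bsub>T\<^esub>" if "F \<in> cyc_ideal \<zeta> A k" for F
  proof -
    have "cyc_ideal \<zeta> A k <= a_kernel (UP A) T ?e"
      unfolding cyc_ideal_def by (intro A.P.genideal_minimal kid) (use mem in blast)
    then show ?thesis using that unfolding a_kernel_def' by blast
  qed
  note ce = coset_eval_hom[OF A T h theta_zeta_closed ideal_cyc ker]
  show "cyc_map A T h (\<theta> (\<zeta> k)) \<in> ring_hom (cyc \<zeta> A k) T"
    using ce(1) by (simp add: cyc_map_def cyc_def)
  show "cyc_map A T h (\<theta> (\<zeta> k)) (cyc_const \<zeta> A k a) = h a" if "a \<in> carrier A"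
    using that ring_hom_closed[OF h that] theta_zeta_closed
    by (simp add: cyc_map_def cyc_const_def ce(2) UP_mon_closed[OF A] eval_mon[OF A T h])
  show "cyc_map A T h (\<theta> (\<zeta> k)) (cyc_num \<zeta> A k w) = \<theta> w" if w: "w \<in> Zz \<zeta> k"
  proof -
    obtain P where P: "w = ipoly P (\<zeta> k)" using w by (auto simp: Zz_def)
    show ?thesis unfolding P cyc_num_ipoly by (simp add: cyc_map_def ce(2) poly_in_closed eval_poly_in)
  qed
qed

end

context
  fixes \<zeta> :: "nat => complex" and k d :: nat and \<tau> :: 'a
  assumes \<tau>: "\<tau> \<in> carrier A"
begin

private abbreviation "B \<equiv> cyc \<zeta> A k"
private abbreviation "E \<equiv> ext \<zeta> A \<tau> k d"

interpretation B: UP_cring B "UP B" using cring_cyc by (simp add: UP_cring_def)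

private lemma tau_B: "cyc_const \<zeta> A k \<tau> \<in> carrier B"
  by (rule ring_hom_closed[OF cyc_const_hom \<tau>])

lemma ideal_ext: "ideal (ext_ideal \<zeta> A \<tau> k d) (UP B)" unfolding ext_ideal_def root_ideal_def
  by (rule B.P.cgenideal_ideal) (intro B.P.minus_closed UP_mon_closed[OF cring_cyc] B.R.one_closed tau_B)

lemma cring_ext: "cring E" unfolding ext_def by (rule ideal.quotient_is_cring[OF ideal_ext B.UP_cring])

lemma ext_proj_hom: "(+>\<^bsub>UP B\<^esub>) (ext_ideal \<zeta> A \<tau> k d) \<in> ring_hom (UP B) E"
  unfolding ext_def by (rule ideal.rcos_ring_hom[OF ideal_ext])

lemma ext_of_cyc_hom: "ext_of_cyc \<zeta> A \<tau> k d \<in> ring_hom B E"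
  using ring_hom_trans[OF UP_const_hom[OF cring_cyc] ext_proj_hom] by (simp add: o_def ext_of_cyc_def[abs_def])

lemma ext_const_hom: "ext_const \<zeta> A \<tau> k d \<in> ring_hom A E"
  using ring_hom_trans[OF cyc_const_hom ext_of_cyc_hom] by (simp add: o_def ext_const_def[abs_def])

lemma ext_num_hom: "ext_num \<zeta> A \<tau> k d \<in> ring_hom (rg (Zz \<zeta> k)) E"
  using ring_hom_trans[OF cyc_num_hom ext_of_cyc_hom] by (simp add: o_def ext_num_def[abs_def])

lemma ext_root_closed: "ext_root \<zeta> A \<tau> k d \<in> carrier E"
  unfolding ext_root_def by (rule ring_hom_closed[OF ext_proj_hom]) (rule UP_mon_closed[OF cring_cyc B.R.one_closed])

lemma ext_root_pow: "ext_root \<zeta> A \<tau> k d [^]\<^bsub>E\<^esub> d = ext_const \<zeta> A \<tau> k d \<tau>"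
proof -
  let ?F = "up_ring.monom (UP B) \<one>\<^bsub>B\<^esub> d" and ?G = "up_ring.monom (UP B) (cyc_const \<zeta> A k \<tau>) 0"
  have F: "?F \<in> carrier (UP B)" and G: "?G \<in> carrier (UP B)"
    by (intro UP_mon_closed[OF cring_cyc] B.R.one_closed tau_B)+
  have "?F \<ominus>\<^bsub>UP B\<^esub> ?G \<in> ext_ideal \<zeta> A \<tau> k d"
    unfolding ext_ideal_def root_ideal_def by (rule B.P.cgenideal_self) (intro B.P.minus_closed F G)
  then have "ext_ideal \<zeta> A \<tau> k d +>\<^bsub>UP B\<^esub> ?F = ext_ideal \<zeta> A \<tau> k d +>\<^bsub>UP B\<^esub> ?G"
    using ideal.coset_eq_iff[OF ideal_ext F G] by simp
  moreover have "ext_root \<zeta> A \<tau> k d [^]\<^bsub>E\<^esub> d = ext_ideal \<zeta> A \<tau> k d +>\<^bsub>UP B\<^esub> ?F"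
    unfolding ext_root_def
    using ring_hom_nat_pow[OF B.UP_cring cring_ext ext_proj_hom UP_mon_closed[OF cring_cyc B.R.one_closed, of 1], of d]
      UP_mon_pow[OF cring_cyc, of \<zeta> k d] by simp
  ultimately show ?thesis by (simp add: ext_const_def ext_of_cyc_def)
qed

lemma ext_induct [consumes 1, case_names monom add]:
  assumes x: "x \<in> carrier E"
    and m: "!!a i j. a \<in> carrier A ==> Q (ext_const \<zeta> A \<tau> k d a \<otimes>\<^bsub>E\<^esub> ext_num \<zeta> A \<tau> k d (\<zeta> k) [^]\<^bsub>E\<^esub> (i::nat)
        \<otimes>\<^bsub>E\<^esub> ext_root \<zeta> A \<tau> k d [^]\<^bsub>E\<^esub> (j::nat))"
    and a: "!!x y. x \<in> carrier E ==> y \<in> carrier E ==> Q x ==> Q y ==> Q (x \<oplus>\<^bsub>E\<^esub> y)"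
  shows "Q x"
proof -
  interpret E: cring E by (rule cring_ext)
  let ?y = "ext_root \<zeta> A \<tau> k d" and ?c = "ext_of_cyc \<zeta> A \<tau> k d"
  have 1: "Q (?c b \<otimes>\<^bsub>E\<^esub> ?y [^]\<^bsub>E\<^esub> n)" if "b \<in> carrier B" for b and n :: nat
    using that
  proof (induction rule: cyc_induct)
    case (monom a i)
    have "cyc_num \<zeta> A k (\<zeta> k) \<in> carrier B" "cyc_const \<zeta> A k a \<in> carrier B"
      using ring_hom_closed[OF cyc_num_hom] ring_hom_closed[OF cyc_const_hom monom] by auto
    then have "?c (cyc_const \<zeta> A k a \<otimes>\<^bsub>B\<^esub> cyc_num \<zeta> A k (\<zeta> k) [^]\<^bsub>B\<^esub> i)
        = ext_const \<zeta> A \<tau> k d a \<otimes>\<^bsub>E\<^esub> ext_num \<zeta> A \<tau> k d (\<zeta> k) [^]\<^bsub>E\<^esub> i"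
      using ring_hom_mult[OF ext_of_cyc_hom] ring_hom_nat_pow[OF cring_cyc cring_ext ext_of_cyc_hom]
      by (simp add: ext_const_def ext_num_def)
    then show ?case using m[OF monom] by simp
  next
    case (add b b')
    have "?c b \<in> carrier E" "?c b' \<in> carrier E" using add ring_hom_closed[OF ext_of_cyc_hom] by auto
    then show ?case using add ring_hom_add[OF ext_of_cyc_hom add(1,2)] ext_root_closed
        a[of "?c b \<otimes>\<^bsub>E\<^esub> ?y [^]\<^bsub>E\<^esub> n" "?c b' \<otimes>\<^bsub>E\<^esub> ?y [^]\<^bsub>E\<^esub> n"] by (simp add: E.l_distr)
  qed
  obtain p where p: "p \<in> carrier (UP B)" "x = ext_ideal \<zeta> A \<tau> k d +>\<^bsub>UP B\<^esub> p"
    using x ideal.Quot_carrierE[OF ideal_ext] unfolding ext_def by metis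
  have "Q (ext_ideal \<zeta> A \<tau> k d +>\<^bsub>UP B\<^esub> p)" using p(1)
  proof (induction rule: UP_induct[OF cring_cyc, consumes 1, case_names monom add])
    case (monom b n)
    have "ext_ideal \<zeta> A \<tau> k d +>\<^bsub>UP B\<^esub> up_ring.monom (UP B) b n = ?c b \<otimes>\<^bsub>E\<^esub> ?y [^]\<^bsub>E\<^esub> n"
      using monom ring_hom_mult[OF ext_proj_hom] ring_hom_nat_pow[OF B.UP_cring cring_ext ext_proj_hom]
      by (subst UP_mon_eq[OF cring_cyc monom]) (simp add: ext_root_def ext_of_cyc_def UP_mon_closed[OF cring_cyc])
    then show ?case using \<open>!!n b. b \<in> carrier B ==> Q (?c b \<otimes>\<^bsub>E\<^esub> ?y [^]\<^bsub>E\<^esub> n)\<close>[OF monom] by simp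
  next
    case (add p q)
    then show ?case
      using ring_hom_add[OF ext_proj_hom add(1,2)] a[of "ext_ideal \<zeta> A \<tau> k d +>\<^bsub>UP B\<^esub> p" "ext_ideal \<zeta> A \<tau> k d +>\<^bsub>UP B\<^esub> q"]
        ring_hom_closed[OF ext_proj_hom] by simp
  qed
  then show ?thesis using p(2) by simp
qed

lemma ext_hom_unique:
  assumes T: "cring T" and G: "G \<in> ring_hom E T" "H \<in> ring_hom E T"
    and "!!a. a \<in> carrier A ==> G (ext_const \<zeta> A \<tau> k d a) = H (ext_const \<zeta> A \<tau> k d a)"
    and "G (ext_num \<zeta> A \<tau> k d (\<zeta> k)) = H (ext_num \<zeta> A \<tau> k d (\<zeta> k))"
    and "G (ext_root \<zeta> A \<tau> k d) = H (ext_root \<zeta> A \<tau> k d)"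
    and x: "x \<in> carrier E"
  shows "G x = H x" using x
proof (induction rule: ext_induct)
  case (monom a i j)
  interpret E: cring E by (rule cring_ext)
  interpret T: cring T by (rule T)
  interpret G: ring_hom_cring E T G by (rule ring_hom_cringI[OF cring_ext T G(1)])
  interpret H: ring_hom_cring E T H by (rule ring_hom_cringI[OF cring_ext T G(2)])
  have "ext_const \<zeta> A \<tau> k d a \<in> carrier E" "ext_num \<zeta> A \<tau> k d (\<zeta> k) \<in> carrier E"
    using ring_hom_closed[OF ext_const_hom monom] ring_hom_closed[OF ext_num_hom] by auto
  then show ?case using monom assms ext_root_closed by simp
next
  case (add x y)
  then show ?case using ring_hom_add[OF G(1)] ring_hom_add[OF G(2)] by simp
qed

context
  fixes T :: "('b, 'n) ring_scheme" and h \<theta> y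
  assumes T: "cring T" and h: "h \<in> ring_hom A T" and \<theta>: "\<theta> \<in> ring_hom (rg (Zz \<zeta> k)) T"
    and y: "y \<in> carrier T" "y [^]\<^bsub>T\<^esub> d = h \<tau>"
begin

lemma ext_map:
  shows "ext_map \<zeta> A k T h (\<theta> (\<zeta> k)) y \<in> ring_hom E T"
    and "a \<in> carrier A ==> ext_map \<zeta> A k T h (\<theta> (\<zeta> k)) y (ext_const \<zeta> A \<tau> k d a) = h a"
    and "w \<in> Zz \<zeta> k ==> ext_map \<zeta> A k T h (\<theta> (\<zeta> k)) y (ext_num \<zeta> A \<tau> k d w) = \<theta> w"
    and "ext_map \<zeta> A k T h (\<theta> (\<zeta> k)) y (ext_root \<zeta> A \<tau> k d) = y"
proof -
  interpret T: cring T by (rule T)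
  note cm = cyc_map[OF T h \<theta>]
  let ?g = "cyc_map A T h (\<theta> (\<zeta> k))"
  let ?e = "UnivPoly.eval B T ?g y"
  note eh = eval_hom[OF cring_cyc T cm(1) y(1)]
  note em = eval_mon[OF cring_cyc T cm(1) y(1)]
  have ker: "?e F = \<zero>\<^bsub>T\<^esub>" if "F \<in> ext_ideal \<zeta> A \<tau> k d" for F
  proof -
    let ?F = "up_ring.monom (UP B) \<one>\<^bsub>B\<^esub> d" and ?G = "up_ring.monom (UP B) (cyc_const \<zeta> A k \<tau>) 0"
    have FG: "?F \<in> carrier (UP B)" "?G \<in> carrier (UP B)"
      by (intro UP_mon_closed[OF cring_cyc] B.R.one_closed tau_B)+
    have "F \<in> {x \<otimes>\<^bsub>UP B\<^esub> (?F \<ominus>\<^bsub>UP B\<^esub> ?G) | x. x \<in> carrier (UP B)}"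
      using that unfolding ext_ideal_def root_ideal_def cgenideal_def .
    then obtain H where H: "F = H \<otimes>\<^bsub>UP B\<^esub> (?F \<ominus>\<^bsub>UP B\<^esub> ?G)" "H \<in> carrier (UP B)"
      by (elim CollectE exE conjE) (rule that)
    have ht: "h \<tau> \<in> carrier T" using ring_hom_closed[OF h \<tau>] .
    have "?e F = ?e H \<otimes>\<^bsub>T\<^esub> (?e ?F \<ominus>\<^bsub>T\<^esub> ?e ?G)"
      using H FG ring_hom_mult[OF eh] ring_hom_minus[OF B.UP_cring T eh FG] by simp
    also have "?e ?F \<ominus>\<^bsub>T\<^esub> ?e ?G = \<zero>\<^bsub>T\<^esub>"
      using em[OF B.R.one_closed, of d] em[OF tau_B, of 0] cm(2)[OF \<tau>] y ring_hom_one[OF cm(1)] ht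
      by (simp add: T.r_neg a_minus_def)
    finally show ?thesis using ring_hom_closed[OF eh H(2)] by simp
  qed
  note ce = coset_eval_hom[OF cring_cyc T cm(1) y(1) ideal_ext ker]
  show "ext_map \<zeta> A k T h (\<theta> (\<zeta> k)) y \<in> ring_hom E T"
    using ce(1) by (simp add: ext_map_def ext_def)
  have c: "ext_map \<zeta> A k T h (\<theta> (\<zeta> k)) y (ext_of_cyc \<zeta> A \<tau> k d b) = ?g b" if "b \<in> carrier B" for b
    using that ring_hom_closed[OF cm(1) that]
    by (simp add: ext_map_def ext_of_cyc_def ce(2) UP_mon_closed[OF cring_cyc] em)
  show "ext_map \<zeta> A k T h (\<theta> (\<zeta> k)) y (ext_const \<zeta> A \<tau> k d a) = h a" if "a \<in> carrier A"
    using that c cm(2) ring_hom_closed[OF cyc_const_hom] by (simp add: ext_const_def)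
  show "ext_map \<zeta> A k T h (\<theta> (\<zeta> k)) y (ext_num \<zeta> A \<tau> k d w) = \<theta> w" if "w \<in> Zz \<zeta> k"
    using that c cm(3) ring_hom_closed[OF cyc_num_hom] by (simp add: ext_num_def)
  show "ext_map \<zeta> A k T h (\<theta> (\<zeta> k)) y (ext_root \<zeta> A \<tau> k d) = y"
    using y ring_hom_one[OF cm(1)] em[OF B.R.one_closed, of 1]
    by (simp add: ext_map_def ext_root_def ce(2) UP_mon_closed[OF cring_cyc])
qed

end

end

end

section \<open>Roots of unity\<close>

lemma ipoly_diff_root:
  assumes "ipoly P z = 0" "P ~= 0"
  shows "Polynomial.degree P > 0"
proof (rule ccontr)
  assume "\<not> Polynomial.degree P > 0"
  then obtain c where c: "P = [:c:]" using degree_eq_zeroE by blast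
  then show False using assms by simp
qed

lemma monic_division:
  fixes F G :: "int poly"
  assumes "Polynomial.lead_coeff G = 1"
  obtains Q S where "F = G * Q + S" "S = 0 \<or> Polynomial.degree S < Polynomial.degree G"
proof -
  have G: "G ~= 0" using assms by auto
  obtain Q S where "pseudo_divmod F G = (Q, S)" by (cases "pseudo_divmod F G")
  from pseudo_divmod[OF G this] assms that show thesis by simp
qed

text \<open>A nonzero integer polynomial G of least degree vanishing at z satisfies c M = G Q with a
  nonzero constant c. The prime M divides G, as dividing Q would make G constant. So M has least
  degree too, and division of P by the monic M leaves remainder 0.\<close>

lemma monic_prime_minimal:
  fixes M :: "int poly"
  assumes M: "prime_elem M" "Polynomial.lead_coeff M = 1" "ipoly M z = 0" and P: "ipoly P z = 0"
  shows "M dvd P"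
proof -
  have M0: "M ~= 0" using M(2) by auto
  define S where "S = {G :: int poly. G ~= 0 & ipoly G z = 0}"
  define G where "G = arg_min Polynomial.degree (%G. G \<in> S)"
  have "M \<in> S" using M0 M(3) by (simp add: S_def)
  then have G: "G \<in> S" "!!F. F \<in> S ==> Polynomial.degree G \<le> Polynomial.degree F"
    unfolding G_def by (auto intro: arg_min_natI arg_min_nat_le)
  have G0: "G ~= 0" "ipoly G z = 0" using G(1) by (auto simp: S_def)
  obtain Q T where QT: "pseudo_divmod M G = (Q, T)" by (cases "pseudo_divmod M G")
  define c where "c = Polynomial.lead_coeff G ^ (Suc (Polynomial.degree M) - Polynomial.degree G)"
  have eq: "smult c M = G * Q + T" and T: "T = 0 \<or> Polynomial.degree T < Polynomial.degree G"
    using pseudo_divmod[OF G0(1) QT] by (simp_all add: c_def)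
  have c0: "c ~= 0" using G0(1) by (simp add: c_def)
  have "smult c M = [:c:] * M" by simp
  then have "ipoly (smult c M) z = 0" using M(3) by (simp only: ipoly_simps) simp
  then have "ipoly T z = 0" using eq G0(2) by simp
  have T0: "T = 0"
  proof (rule ccontr)
    assume "T ~= 0"
    then have "T \<in> S" using \<open>ipoly T z = 0\<close> by (simp add: S_def)
    from G(2)[OF this] show False using T \<open>T ~= 0\<close> by simp
  qed
  have "M dvd smult c M" by (rule dvd_smult) simp
  then have "M dvd G * Q" using eq T0 by simp
  then have "M dvd G \<or> M dvd Q" using M(1) by (simp add: prime_elem_dvd_mult_iff)
  then have MG: "M dvd G"
  proof
    assume "M dvd Q"
    then obtain Q' where "Q = M * Q'" by (elim dvdE)
    then have "M * [:c:] = M * (G * Q')" using eq T0 by (simp add: algebra_simps)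
    then have "[:c:] = G * Q'" using M0 by (simp only: mult_cancel_left) simp
    then have "Polynomial.degree G = 0" using c0 G0(1)
      by (metis degree_mult_eq degree_pCons_0 add_is_0 mult_eq_0_iff pCons_eq_0_iff)
    then show ?thesis using ipoly_diff_root[OF G0(2,1)] by simp
  qed
  obtain Q' S' where Q': "P = M * Q' + S'" "S' = 0 \<or> Polynomial.degree S' < Polynomial.degree M"
    using monic_division[OF M(2)] by blast
  have "ipoly S' z = 0" using P M(3) Q' by simp
  moreover have "Polynomial.degree M \<le> Polynomial.degree G" using MG G0(1) by (rule dvd_imp_degree_le)
  moreover have "S' \<in> S" if "S' ~= 0" "ipoly S' z = 0" using that by (simp add: S_def)
  ultimately have "S' = 0" using Q'(2) G(2)[of S'] by fastforce
  then show ?thesis using Q' by simp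
qed

text \<open>In the factorial ring Z[X] a prime factor of a monic polynomial has leading coefficient
  1 or -1; the sign is corrected at the end.\<close>

lemma monic_prime_factor:
  fixes F :: "int poly"
  assumes F: "Polynomial.lead_coeff F = 1" "ipoly F z = 0"
  obtains M where "prime_elem M" "Polynomial.lead_coeff M = 1" "ipoly M z = 0" "M dvd F"
proof -
  have F0: "F ~= 0" using F by auto
  obtain A where A: "!!x. x \<in># A ==> prime_elem x" "normalize (prod_mset A) = normalize F"
    using prime_factorization_exists'[OF F0] by (metis prime_imp_prime_elem)
  have "F dvd prod_mset A" using A(2) by (metis associatedD1 dvd_refl normalize_dvd_iff)
  then have "ipoly (prod_mset A) z = 0" using F(2) by (auto elim!: dvdE)
  then obtain x where x: "x \<in># A" "ipoly x z = 0" by (induction A) auto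
  have "x dvd prod_mset A" using x(1) by (rule dvd_prod_mset)
  then have xF: "x dvd F" using A(2) by (metis dvd_normalize_iff normalize_dvd_iff)
  then obtain y where "F = x * y" by (elim dvdE)
  then have "Polynomial.lead_coeff x * Polynomial.lead_coeff y = 1" using F(1) by (simp add: lead_coeff_mult)
  then have "Polynomial.lead_coeff x = 1 \<or> Polynomial.lead_coeff x = -1" by (metis zmult_eq_1_iff)
  then show thesis
  proof
    assume "Polynomial.lead_coeff x = -1"
    then show thesis
      by (intro that[of "- x"]) (use A(1)[OF x(1)] x xF prime_elem_mult_unit_left[of "-1" x] in auto)
  qed (use that A(1) x xF in auto)
qed

text \<open>Otherwise M divides 1 - p S, where S is the remainder of P modulo M. By degree this
  difference is 0, which its constant term contradicts.\<close>

lemma monic_prime_not_one: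
  fixes M :: "int poly"
  assumes M: "prime_elem M" "Polynomial.lead_coeff M = 1" "ipoly M z = 0" and p: "p > (1::nat)"
  shows "of_nat p * ipoly P z ~= 1"
proof
  assume eq: "of_nat p * ipoly P z = 1"
  obtain Q S where Q: "P = M * Q + S" "S = 0 \<or> Polynomial.degree S < Polynomial.degree M"
    using monic_division[OF M(2)] by blast
  have "ipoly P z = ipoly S z" using Q M(3) by simp
  then have "ipoly (1 - [:int p:] * S) z = 0" using eq by (simp only: ipoly_simps) simp
  then have d: "M dvd 1 - [:int p:] * S" by (rule monic_prime_minimal[OF M])
  have M0: "Polynomial.degree M > 0" using ipoly_diff_root[OF M(3)] M(2) by force
  have "Polynomial.degree (1 - [:int p:] * S) < Polynomial.degree M"
    by (rule le_less_trans[OF degree_diff_le_max]) (use Q(2) M0 p in auto)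
  then have "1 - [:int p:] * S = 0" using d by (metis dvd_imp_degree_le not_less)
  then have "Polynomial.coeff (1 - [:int p:] * S) 0 = 0" by simp
  then have "int p * Polynomial.coeff S 0 = 1" by simp
  then have "int p dvd 1" by (metis dvd_triv_left)
  then show False using p by simp
qed

lemma freshman_subring:
  assumes S: "subring_set S" and ab: "a \<in> S" "b \<in> S" and p: "Factorial_Ring.prime p"
  obtains c where "c \<in> S" "(a + b) ^ p = a ^ p + b ^ p + of_nat p * c"
proof -
  interpret cring "rg S" by (rule cring_rg[OF S])
  have "(a \<oplus>\<^bsub>rg S\<^esub> b) [^]\<^bsub>rg S\<^esub> p \<ominus>\<^bsub>rg S\<^esub> (a [^]\<^bsub>rg S\<^esub> p \<oplus>\<^bsub>rg S\<^esub> b [^]\<^bsub>rg S\<^esub> p) \<in> PIdl\<^bsub>rg S\<^esub> (int_in (rg S) (int p))"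
    by (rule freshman) (use ab p in auto)
  then obtain c where "c \<in> S" "(a + b) ^ p - (a ^ p + b ^ p) = c * of_nat p"
    using ab subring_setD[OF S] by (auto simp: minus_rg[OF S] cgenideal_def int_in_rg[OF S])
  then show thesis by (intro that[of c]) (auto simp: algebra_simps)
qed

lemma freshman_iterate:
  fixes a b :: "'a::comm_ring_1"
  assumes S: "subring_set S" and ab: "a \<in> S" "b \<in> S" and p: "Factorial_Ring.prime p"
  shows "\<exists>c\<in>S. (a + b) ^ (p ^ e) = a ^ (p ^ e) + b ^ (p ^ e) + of_nat p * c"
proof (induction e)
  case (Suc e)
  then obtain c where c: "c \<in> S" "(a + b) ^ (p ^ e) = a ^ (p ^ e) + b ^ (p ^ e) + of_nat p * c" by blast
  note S' = subring_setD[OF S]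
  obtain c1 where c1: "c1 \<in> S"
    "(a ^ (p ^ e) + b ^ (p ^ e) + of_nat p * c) ^ p = (a ^ (p ^ e) + b ^ (p ^ e)) ^ p + (of_nat p * c) ^ p + of_nat p * c1"
    by (rule freshman_subring[OF S _ _ p, of "a ^ (p ^ e) + b ^ (p ^ e)" "of_nat p * c"]) (use ab c in \<open>auto intro: S'\<close>)
  obtain c2 where c2: "c2 \<in> S"
    "(a ^ (p ^ e) + b ^ (p ^ e)) ^ p = (a ^ (p ^ e)) ^ p + (b ^ (p ^ e)) ^ p + of_nat p * c2"
    by (rule freshman_subring[OF S _ _ p, of "a ^ (p ^ e)" "b ^ (p ^ e)"]) (use ab in \<open>auto intro: S'\<close>)
  obtain q where q: "p = Suc q" using prime_gt_0_nat[OF p] by (cases p) auto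
  have "(of_nat p * c) ^ p = of_nat p * (c * (of_nat p * c) ^ q)" by (subst (2) q) (simp add: algebra_simps)
  moreover have pw: "x ^ (p ^ Suc e) = (x ^ (p ^ e)) ^ p" for x :: 'a by (metis mult.commute power_Suc power_mult)
  ultimately have "(a + b) ^ (p ^ Suc e)
      = a ^ (p ^ Suc e) + b ^ (p ^ Suc e) + of_nat p * (c2 + c * (of_nat p * c) ^ q + c1)"
    unfolding pw c(2) c1(2) c2(2) by (simp add: distrib_left add.assoc)
  moreover have "c2 + c * (of_nat p * c) ^ q + c1 \<in> S"
    using c1 c2 c S'(8)[of "int p"] by (intro S') (auto intro: S')
  ultimately show ?case by blast
qed (use subring_setD(1)[OF S] in \<open>auto intro: bexI[of _ 0]\<close>)

section \<open>Systems of roots of unity and cyclotomic polynomials\<close>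

locale unity_roots =
  fixes \<zeta> :: "nat => complex"
  assumes roots: "root_of_unity_system \<zeta>"
begin

lemma zeta_pow_iff: "m \<ge> 1 ==> \<zeta> m ^ k = 1 \<longleftrightarrow> m dvd k"
  using roots by (auto simp: root_of_unity_system_def)

lemma zeta_coprime: "m \<ge> 1 ==> n \<ge> 1 ==> coprime m n ==> \<zeta> (m * n) = \<zeta> m * \<zeta> n"
  using roots by (auto simp: root_of_unity_system_def)

lemma zeta_pow_self [simp]: "m \<ge> 1 ==> \<zeta> m ^ m = 1" by (simp add: zeta_pow_iff)

lemma zeta_nz: "m \<ge> 1 ==> \<zeta> m ~= 0"
  using zeta_pow_self[of m] by (metis not_one_le_zero power_0_left zero_neq_one)

lemma zeta_1: "\<zeta> 1 = 1" using zeta_pow_self[of 1] by simp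

text \<open>The n distinct powers of \<open>\<zeta> n\<close> exhaust the n complex zeros of X^n -
  1.\<close>

lemma root_is_zeta_power:
  assumes n: "n \<ge> 1" and w: "w ^ n = 1"
  obtains a where "a < n" "w = \<zeta> n ^ a"
proof -
  have inj: "inj_on (%a. \<zeta> n ^ a) {..<n}"
  proof (rule inj_onI)
    have *: "a = b" if ab: "a \<le> b" "b < n" "\<zeta> n ^ a = \<zeta> n ^ b" for a b
    proof -
      have "\<zeta> n ^ a * \<zeta> n ^ (b - a) = \<zeta> n ^ a * 1"
        using ab by (metis le_add_diff_inverse mult.right_neutral power_add)
      then have "\<zeta> n ^ (b - a) = 1" using zeta_nz[OF n] by (simp only: mult_cancel_left) simp
      then have "n dvd b - a" using zeta_pow_iff[OF n] by simp
      then show ?thesis using ab by (meson dvd_imp_le less_imp_diff_less not_less zero_less_diff le_neq_implies_less)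
    qed
    fix a b assume "a \<in> {..<n}" "b \<in> {..<n}" "\<zeta> n ^ a = \<zeta> n ^ b"
    then show "a = b" using *[of a b] *[of b a] by (cases "a \<le> b") auto
  qed
  have sub: "(%a. \<zeta> n ^ a) ` {..<n} <= {z. z ^ n = 1}"
    using zeta_pow_self[OF n] by (auto simp: power_mult[symmetric] mult.commute[of _ n] power_mult)
  have "finite {z::complex. z ^ n = 1}" using card_roots_unity_eq[of n] n by (intro card_ge_0_finite) auto
  then have "(%a. \<zeta> n ^ a) ` {..<n} = {z. z ^ n = 1}"
    by (rule card_subset_eq[OF _ sub]) (use card_image[OF inj] card_roots_unity_eq[of n] n in auto)
  then show thesis using w that by blast
qed

lemma Zz_pow: "\<zeta> k ^ a \<in> Zz \<zeta> k" using subring_setD(7)[OF subring_Zz] by simp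

lemma zeta_mem:
  assumes "k \<ge> 1" "m dvd k" shows "\<zeta> m \<in> Zz \<zeta> k"
proof -
  have m: "m \<ge> 1" using assms by (metis One_nat_def Suc_leI dvd_0_left_iff gr0I not_one_le_zero)
  obtain c where c: "k = m * c" using assms(2) by (elim dvdE)
  have "\<zeta> m ^ k = 1" using zeta_pow_iff[OF m] assms(2) by simp
  then obtain a where "\<zeta> m = \<zeta> k ^ a" using root_is_zeta_power[OF assms(1)] by metis
  then show ?thesis using Zz_pow by simp
qed

lemma Zz_mono:
  assumes "k \<ge> 1" "m dvd k" shows "Zz \<zeta> m <= Zz \<zeta> k"
proof -
  note S = subring_setD[OF subring_Zz[of \<zeta> k]]
  have "ipoly P (\<zeta> m) \<in> Zz \<zeta> k" for P
    by (induction P) (use zeta_mem[OF assms] in \<open>auto intro: S\<close>)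
  then show ?thesis by (auto simp: Zz_def)
qed

text \<open>Write m = p^r n with n prime to p. The p^(r+1)-th power kills the p-parts of both roots
  of unity, so these powers coincide; and raising to a power of p is additive modulo p.\<close>

lemma zeta_diff_nilpotent:
  assumes m: "m \<ge> 1" and p: "Factorial_Ring.prime p"
  obtains e c where "e \<ge> 1" "c \<in> Zz \<zeta> (p * m)" "(\<zeta> (p * m) - \<zeta> m) ^ (p ^ e) = of_nat p * c"
proof -
  define r where "r = multiplicity p m"
  obtain n where n: "m = p ^ r * n" "\<not> p dvd n" using multiplicity_decompose'[of m p] m p unfolding r_def
    by (metis not_one_le_zero not_prime_unit)
  have n1: "n \<ge> 1" and p1: "p \<ge> 1" using n m prime_gt_0_nat[OF p] by (cases n; auto)+
  have cop: "coprime (p ^ j) n" for j using p n(2) by (simp add: prime_imp_coprime coprime_power_left_iff)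
  let ?q = "p ^ Suc r"
  have pj: "p ^ j \<ge> 1" for j using p1 by simp
  have z: "\<zeta> (p ^ j * n) ^ ?q = \<zeta> n ^ ?q" if j: "j \<le> Suc r" for j
  proof -
    have "\<zeta> (p ^ j) ^ ?q = 1" unfolding zeta_pow_iff[OF pj] by (rule le_imp_power_dvd[OF j])
    then show ?thesis by (simp add: zeta_coprime[OF pj n1 cop] power_mult_distrib)
  qed
  have pm: "p * m = p ^ Suc r * n" using n by simp
  have "\<zeta> (p * m) ^ ?q = \<zeta> n ^ ?q" unfolding pm by (rule z) simp
  moreover have "\<zeta> m ^ ?q = \<zeta> n ^ ?q" by (subst n(1), rule z) simp
  ultimately have eq: "\<zeta> (p * m) ^ ?q = \<zeta> m ^ ?q" by simp
  have k: "p * m \<ge> 1" using p1 m by simp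
  have mem: "\<zeta> m \<in> Zz \<zeta> (p * m)" by (rule zeta_mem[OF k]) simp
  obtain c where c: "c \<in> Zz \<zeta> (p * m)" "(\<zeta> m + (\<zeta> (p * m) - \<zeta> m)) ^ ?q
      = \<zeta> m ^ ?q + (\<zeta> (p * m) - \<zeta> m) ^ ?q + of_nat p * c"
    using freshman_iterate[OF subring_Zz mem subring_setD(6)[OF subring_Zz Zz_zeta mem] p] by blast
  have "(\<zeta> (p * m) - \<zeta> m) ^ ?q = of_nat p * (- c)" using c(2) eq by (simp add: eq_neg_iff_add_eq_0)
  then show thesis using that[of "Suc r" "- c"] subring_setD(5)[OF subring_Zz c(1)] by simp
qed

text \<open>The k-th cyclotomic polynomial; that all primitive k-th roots of unity are zeros of it
  is \<open>minpoly_conjugates\<close>.\<close>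

definition minpoly :: "nat => int poly" where
  "minpoly k = (SOME M. prime_elem M & Polynomial.lead_coeff M = 1 & ipoly M (\<zeta> k) = 0 & M dvd Polynomial.monom 1 k - 1)"

lemma degree_unity: "k \<ge> 1 ==> Polynomial.degree (Polynomial.monom 1 k - 1 :: int poly) = k"
  using degree_add_eq_left[of "-1 :: int poly" "Polynomial.monom 1 k"] by (simp add: degree_monom_eq)

lemma lead_coeff_unity: "k \<ge> 1 ==> Polynomial.lead_coeff (Polynomial.monom 1 k - 1 :: int poly) = 1"
  by (simp add: degree_unity)

lemma minpoly:
  assumes k: "k \<ge> 1"
  shows "prime_elem (minpoly k)" "Polynomial.lead_coeff (minpoly k) = 1" "ipoly (minpoly k) (\<zeta> k) = 0"
    "minpoly k dvd Polynomial.monom 1 k - 1"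
proof -
  have "ipoly (Polynomial.monom 1 k - 1) (\<zeta> k) = 0" using k by (simp only: ipoly_simps) simp
  then have "\<exists>M. prime_elem M & Polynomial.lead_coeff M = 1 & ipoly M (\<zeta> k) = 0 & M dvd Polynomial.monom 1 k - 1"
    using monic_prime_factor[OF lead_coeff_unity[OF k]] by metis
  from someI_ex[OF this] show "prime_elem (minpoly k)" "Polynomial.lead_coeff (minpoly k) = 1"
    "ipoly (minpoly k) (\<zeta> k) = 0" "minpoly k dvd Polynomial.monom 1 k - 1" unfolding minpoly_def by blast+
qed

text \<open>If \<open>x\<^sup>k - 1 = M N\<close> and \<open>N (z\<^sup>p) = 0\<close> for a root \<open>z\<close> of \<open>M\<close>, then \<open>p\<close> divides \<open>N(z)\<^sup>p\<close>, hence
  \<open>(k z\<^sup>k\<^sup>-\<^sup>1)\<^sup>p = M'(z)\<^sup>p N(z)\<^sup>p\<close>; since \<open>p\<close> does not divide \<open>k\<close>, it would be a unit of \<open>\<int>[z]\<close>.\<close>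

lemma minpoly_pow_prime:
  assumes k: "k \<ge> 1" and p: "Factorial_Ring.prime p" "\<not> p dvd k" and z: "ipoly (minpoly k) z = 0"
  shows "ipoly (minpoly k) (z ^ p) = 0"
proof (rule ccontr)
  assume nz: "ipoly (minpoly k) (z ^ p) ~= 0"
  let ?M = "minpoly k"
  obtain N where N: "Polynomial.monom 1 k - 1 = ?M * N" using minpoly(4)[OF k] by (elim dvdE)
  have "ipoly (Polynomial.monom 1 k - 1) z = 0" using z by (simp only: N ipoly_simps) simp
  then have zk: "z ^ k = 1" by (simp only: ipoly_simps) simp
  then have "(z ^ p) ^ k = 1" by (metis mult.commute power_mult power_one)
  then have "ipoly (Polynomial.monom 1 k - 1) (z ^ p) = 0" by (simp only: ipoly_simps) simp
  then have Nz: "ipoly N (z ^ p) = 0" using nz by (simp only: N ipoly_simps) simp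
  define S where "S = range (%P. ipoly P z)"
  have S: "subring_set S" using subring_Zz[of "%_. z" 0] by (simp add: S_def Zz_def)
  note S' = subring_setD[OF S]
  have Sm: "ipoly P z \<in> S" for P by (simp add: S_def)
  \<comment> \<open>Frobenius on Z[z] modulo p: raising P(z) to the p-th power amounts to replacing
    z by its p-th power.\<close>
  have frob: "\<exists>c\<in>S. ipoly P z ^ p = ipoly P (z ^ p) + of_nat p * c" for P
  proof (induction P)
    case 0
    then show ?case using p(1) prime_gt_0_nat by (intro bexI[of _ 0]) (auto intro: S' simp: power_0_left)
  next
    case (pCons a P)
    obtain c where c: "c \<in> S" "ipoly P z ^ p = ipoly P (z ^ p) + of_nat p * c" using pCons by blast
    have zS: "z \<in> S" using Sm[of "[:0, 1:]"] by simp
    obtain c1 where c1: "c1 \<in> S" "(of_int a + z * ipoly P z) ^ p = of_int a ^ p + (z * ipoly P z) ^ p + of_nat p * c1"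
      by (rule freshman_subring[OF S _ _ p(1), of "of_int a" "z * ipoly P z"]) (auto intro: S' zS Sm)
    \<comment> \<open>Fermat's congruence for natural numbers; it is applied to the residue of the
      integer coefficient a modulo p.\<close>
    have "\<exists>c. (of_nat n :: int) ^ p = of_nat n + int p * c" for n
    proof (induction n)
      case (Suc n)
      then obtain c where c: "int n ^ p = int n + int p * c" by auto
      obtain c' where "(int n + 1) ^ p = int n ^ p + 1 ^ p + of_nat p * c'"
        by (rule freshman_subring[OF subring_set_UNIV _ _ p(1), of "int n" 1]) auto
      then have "(int (Suc n)) ^ p = int (Suc n) + int p * (c + c')" using c by (simp add: algebra_simps)
      then show ?case by blast
    qed (use p(1) prime_gt_0_nat in \<open>auto simp: power_0_left\<close>)
    from this[of "nat (a mod int p)"] obtain d where d: "(a mod int p) ^ p = a mod int p + int p * d"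
      using p(1) prime_gt_0_nat[of p] by auto
    have "a ^ p mod int p = (a mod int p) ^ p mod int p" by (simp add: power_mod)
    also have "... = a mod int p" unfolding d by simp
    finally have "int p dvd a ^ p - a" by (simp add: mod_eq_dvd_iff)
    then obtain d where d: "a ^ p = a + int p * d" by (metis add.commute diff_add_cancel dvdE)
    have d': "(of_int a :: complex) ^ p = of_int a + of_nat p * of_int d"
      using arg_cong[OF d, of "of_int :: int => complex"] by simp
    show ?case by (rule bexI[of _ "of_int d + z ^ p * c + c1"])
        (use c c1 d' zS in \<open>auto simp: power_mult_distrib algebra_simps intro: S'\<close>)
  qed
  obtain c where c: "c \<in> S" "ipoly N z ^ p = of_nat p * c" using frob[of N] Nz by auto
  define M' where "M' = ipoly (pderiv ?M) z"
  \<comment> \<open>Differentiating X^k - 1 = M N at the zero z of M gives k z^(k-1) = M'(z)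
    N(z).\<close>
  have "pderiv (Polynomial.monom 1 k - 1) = pderiv ?M * N + ?M * pderiv N" unfolding N by (simp add: pderiv_mult)
  then have "ipoly (Polynomial.monom (int k) (k - 1)) z = M' * ipoly N z + ipoly ?M z * ipoly (pderiv N) z"
    unfolding M'_def by (simp add: pderiv_diff pderiv_monom)
  then have "of_nat k * z ^ (k - 1) = M' * ipoly N z" using z by simp
  moreover have "z ^ (k - 1) * z = 1" using zk k by (metis Suc_diff_1 Suc_le_eq One_nat_def power_Suc2)
  ultimately have "of_nat k = M' * ipoly N z * z" by (metis mult.assoc mult.right_neutral)
  then have "of_nat k ^ p = M' ^ p * z ^ p * (of_nat p * c)" unfolding c(2)[symmetric] by (simp add: power_mult_distrib)
  moreover have "M' ^ p * z ^ p * c \<in> S" using c Sm[of "[:0, 1:]"] by (auto simp: M'_def intro: S' Sm)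
  ultimately obtain d where d: "d \<in> S" "of_nat (k ^ p) = of_nat p * d"
    by (intro that[of "M' ^ p * z ^ p * c"]) auto
  have "coprime p k" using p by (rule prime_imp_coprime)
  then have "coprime (int (k ^ p)) (int p)" by (simp add: coprime_commute)
  then obtain u v where "u * int (k ^ p) + v * int p = 1" using bezout_int[of "int (k ^ p)" "int p"] by auto
  then have "(of_int (u * int (k ^ p) + v * int p) :: complex) = 1" by simp
  then have "of_int u * (of_nat p * d) + of_int v * of_nat p = 1" using d(2) by simp
  then have "of_nat p * (of_int u * d + of_int v) = 1" by (simp add: algebra_simps)
  moreover have "of_int u * d + of_int v \<in> S" using d by (auto intro: S')
  ultimately show False
    using monic_prime_not_one[OF minpoly(1,2)[OF k] z prime_gt_1_nat[OF p(1)]] by (auto simp: S_def)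
qed

text \<open>Induction over the prime factors of j, none of which divides k.\<close>

lemma minpoly_conjugates:
  assumes k: "k \<ge> 1" and j: "coprime j k"
  shows "ipoly (minpoly k) (\<zeta> k ^ j) = 0"
proof -
  have "ipoly (minpoly k) z = 0 ==> ipoly (minpoly k) (z ^ j) = 0" if "j ~= 0" "coprime j k" for j z using that
  proof (induction j arbitrary: z rule: prime_divisors_induct)
    case (factor p j)
    have pp: "Factorial_Ring.prime p" and cp: "coprime (p * j) k" using factor by auto
    have "\<not> p dvd k"
    proof
      assume "p dvd k"
      then have "is_unit p" by (rule coprime_common_divisor[OF cp dvd_triv_left])
      then show False using pp by (simp add: prime_nat_iff)
    qed
    then have "ipoly (minpoly k) (z ^ p) = 0" using minpoly_pow_prime[OF k pp] factor by blast
    then have "ipoly (minpoly k) ((z ^ p) ^ j) = 0" using factor by (auto simp: coprime_mult_left_iff)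
    then show ?case by (simp add: power_mult)
  qed auto
  moreover have "j ~= 0 \<or> k = 1" using j by (cases "j = 0") auto
  moreover have "\<zeta> 1 = 1" by (rule zeta_1)
  ultimately show ?thesis using minpoly(3)[OF k] j by (cases "j = 0") auto
qed

text \<open>Every l-th root of unity is a power \<open>\<zeta> d ^ j\<close> with d dividing l and j
  prime to d, hence a zero of \<open>minpoly d\<close>, which divides g. The remainder of g modulo
  X^l - 1 then has l distinct zeros and degree below l.\<close>

lemma unity_poly_dvd:
  assumes l: "l \<ge> 1" and g: "!!d. d dvd l ==> ipoly g (\<zeta> d) = 0"
  shows "Polynomial.monom 1 l - 1 dvd g"
proof -
  have gz: "ipoly g w = 0" if w: "w ^ l = 1" for w
  proof -
    obtain a where a: "a < l" "w = \<zeta> l ^ a" by (rule root_is_zeta_power[OF l w])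
    \<comment> \<open>The order of the root of unity w.\<close>
    define d where "d = l div gcd a l"
    have g0: "gcd a l > 0" using l by simp
    have d: "l = d * gcd a l" by (simp add: d_def)
    have d1: "d \<ge> 1" using d l by (cases d) auto
    have "l dvd a * d"
    proof -
      have "a * d = (a div gcd a l) * (gcd a l * d)" by (metis dvd_div_mult_self gcd_dvd1 mult.assoc)
      then show ?thesis by (metis d dvd_triv_right mult.commute)
    qed
    then have "w ^ d = 1" unfolding a(2) power_mult[symmetric] using zeta_pow_iff[OF l] by simp
    then obtain j where j: "w = \<zeta> d ^ j" using root_is_zeta_power[OF d1] by metis
    have "coprime j d"
    proof (rule coprimeI)
      fix c assume c: "c dvd j" "c dvd d"
      then obtain j' d' where jd: "j = c * j'" "d = c * d'" by (elim dvdE)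
      then have "d dvd j * d'" by simp
      then have "w ^ d' = 1" unfolding j power_mult[symmetric] using zeta_pow_iff[OF d1] by simp
      then have "l dvd a * d'" unfolding a(2) power_mult[symmetric] using zeta_pow_iff[OF l] by simp
      then have "(d * gcd a l) dvd (a div gcd a l * d') * gcd a l" using d by (simp add: mult_ac)
      then have "d dvd (a div gcd a l) * d'" using g0 l by auto
      moreover have "coprime d (a div gcd a l)"
        unfolding d_def using g0 by (subst coprime_commute) (simp add: div_gcd_coprime)
      ultimately have "d dvd d'" by (simp add: coprime_dvd_mult_right_iff)
      then have "c * d' dvd 1 * d'" using jd by simp
      moreover have "d' > 0" using d1 jd by (cases d') auto
      ultimately show "is_unit c" by simp
    qed
    then have "ipoly (minpoly d) w = 0" unfolding j by (rule minpoly_conjugates[OF d1])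
    moreover have "minpoly d dvd g"
      by (rule monic_prime_minimal[OF minpoly(1-3)[OF d1]], rule g) (metis d dvd_triv_left)
    ultimately show ?thesis by (auto elim!: dvdE)
  qed
  let ?U = "Polynomial.monom 1 l - 1 :: int poly"
  obtain Q S where Q: "g = ?U * Q + S" "S = 0 \<or> Polynomial.degree S < l"
    using monic_division[OF lead_coeff_unity[OF l]] degree_unity[OF l] by metis
  have "ipoly S w = 0" if "w ^ l = 1" for w using gz[OF that] that unfolding Q(1) by (simp only: ipoly_simps) simp
  then have sub: "{w::complex. w ^ l = 1} <= {w. poly (map_poly of_int S) w = 0}" by (auto simp: ipoly_def)
  have "S = 0"
  proof (rule ccontr)
    assume S: "S ~= 0"
    then have nz: "map_poly (of_int :: int => complex) S ~= 0" by (simp add: map_poly_eq_0_iff)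
    have "l = card {w::complex. w ^ l = 1}" using card_roots_unity_eq[of l] l by simp
    also have "... \<le> card {w. poly (map_poly (of_int :: int => complex) S) w = 0}"
      by (rule card_mono[OF poly_roots_finite[OF nz] sub])
    also have "... \<le> Polynomial.degree (map_poly (of_int :: int => complex) S)"
      by (rule card_poly_roots_bound[OF nz])
    also have "... \<le> Polynomial.degree S" by (subst degree_map_poly) auto
    finally show False using Q(2) S by simp
  qed
  then show ?thesis using Q by simp
qed

text \<open>A linear relation is an integer polynomial of degree below that of
  \<open>minpoly k\<close> vanishing at \<open>\<zeta> k\<close>, and it is divisible by
  \<open>minpoly k\<close>.\<close>

lemma minpoly_independent:
  assumes k: "k \<ge> 1" and z: "(\<Sum>i<Polynomial.degree (minpoly k). of_int (c i) * \<zeta> k ^ i) = 0"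
    and i: "i < Polynomial.degree (minpoly k)"
  shows "c i = 0"
proof -
  let ?d = "Polynomial.degree (minpoly k)"
  define P where "P = (\<Sum>i<?d. Polynomial.monom (c i) i)"
  have "ipoly (\<Sum>i\<in>A. Polynomial.monom (c i) i) (\<zeta> k) = (\<Sum>i\<in>A. of_int (c i) * \<zeta> k ^ i)" for A
    by (induction A rule: infinite_finite_induct) auto
  then have "ipoly P (\<zeta> k) = 0" using z by (simp add: P_def)
  then have "minpoly k dvd P" by (rule monic_prime_minimal[OF minpoly(1-3)[OF k]])
  moreover have "Polynomial.degree P < ?d"
  proof -
    have "Polynomial.degree P \<le> ?d - 1" unfolding P_def
      by (rule degree_sum_le) (auto intro: order.trans[OF degree_monom_le])
    then show ?thesis using i by linarith
  qed
  ultimately have P0: "P = 0" by (metis dvd_imp_degree_le not_less)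
  have "Polynomial.coeff P i = (\<Sum>j<?d. if j = i then c j else 0)" by (simp add: P_def coeff_sum coeff_monom)
  then show ?thesis using P0 i by simp
qed

end

section \<open>Re-expansion of power series\<close>

lemma fps_binomial_nth:
  fixes c :: "'a::comm_ring_1"
  shows "((fps_X + fps_const c) ^ k) $ j = of_nat (k choose j) * c ^ (k - j)"
proof (induction k arbitrary: j)
  case (Suc k)
  show ?case
  proof (cases j)
    case 0
    then show ?thesis using Suc[of 0] by (simp add: algebra_simps)
  next
    case (Suc i)
    have "((fps_X + fps_const c) ^ Suc k) $ Suc i
        = of_nat (k choose i) * c ^ (k - i) + c * (of_nat (k choose Suc i) * c ^ (k - Suc i))"
      using \<open>!!j. ((fps_X + fps_const c) ^ k) $ j = of_nat (k choose j) * c ^ (k - j)\<close>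
      by (simp add: distrib_right)
    also have "c * (of_nat (k choose Suc i) * c ^ (k - Suc i)) = of_nat (k choose Suc i) * c ^ (k - i)"
    proof (cases "i < k")
      case True
      then have "k - i = Suc (k - Suc i)" by simp
      then show ?thesis by (simp add: algebra_simps)
    qed (simp add: binomial_eq_0)
    finally show ?thesis using Suc by (simp add: algebra_simps)
  qed
qed (simp add: fps_one_nth, metis binomial_eq_0 gr0I of_nat_0)

context unity_roots
begin

text \<open>Z[zeta_k][[q - zeta_k]], with \<open>fps_X\<close> in the role of q - zeta_k.\<close>

definition W :: "nat => complex fps set" where
  "W k = {F. \<forall>j. F $ j \<in> Zz \<zeta> k}"

definition pZ :: "nat => nat => nat => complex set" where
  "pZ p k n = (%c. of_nat p ^ n * c) ` Zz \<zeta> k"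

text \<open>The \<open>t\<close>-th power of the ideal generated by \<open>p\<close> and \<open>q - \<zeta>\<^sub>k\<close>\<close>

definition NN :: "nat => nat => nat => complex fps set" where
  "NN p k t = {F. \<forall>j. F $ j \<in> pZ p k (t - j)}"

text \<open>The Taylor expansion of q at zeta_k.\<close>

definition Q :: "nat => complex fps" where
  "Q k = fps_X + fps_const (\<zeta> k)"

lemmas Zz_closed = subring_setD[OF subring_Zz[of \<zeta>]]

lemma subring_W: "subring_set (W k)"
  unfolding subring_set_def W_def by (auto simp: fps_mult_nth fps_one_nth intro!: Zz_closed)

lemmas W_closed = subring_setD[OF subring_W]

lemma W_nth: "F \<in> W k ==> F $ j \<in> Zz \<zeta> k" by (simp add: W_def)

lemma W_const [simp]: "c \<in> Zz \<zeta> k ==> fps_const c \<in> W k" by (auto simp: W_def intro: Zz_closed)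

lemma W_X [simp]: "fps_X \<in> W k" by (auto simp: W_def fps_X_def intro: Zz_closed)

lemma W_Q [simp]: "Q k \<in> W k" unfolding Q_def by (intro W_closed) auto

lemma pZ_0: "pZ p k 0 = Zz \<zeta> k" by (simp add: pZ_def)

lemma pZ_closed:
  "0 \<in> pZ p k n" "x \<in> pZ p k n ==> y \<in> pZ p k n ==> x + y \<in> pZ p k n"
  "x \<in> pZ p k n ==> - x \<in> pZ p k n" "x \<in> pZ p k n ==> y \<in> pZ p k n ==> x - y \<in> pZ p k n"
  "(!!i. i \<in> A ==> f i \<in> pZ p k n) ==> sum f A \<in> pZ p k n"
proof -
  show 0: "0 \<in> pZ p k n" by (auto simp: pZ_def intro!: image_eqI[of _ _ 0] Zz_closed)
  show a: "x \<in> pZ p k n ==> y \<in> pZ p k n ==> x + y \<in> pZ p k n" for x y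
    by (auto simp: pZ_def simp flip: distrib_left intro!: imageI Zz_closed)
  show m: "x \<in> pZ p k n ==> - x \<in> pZ p k n" for x
    by (auto simp: pZ_def simp flip: mult_minus_right intro!: imageI Zz_closed)
  show "x \<in> pZ p k n ==> y \<in> pZ p k n ==> x - y \<in> pZ p k n" using a[of x "- y"] m[of y] by simp
  show "(!!i. i \<in> A ==> f i \<in> pZ p k n) ==> sum f A \<in> pZ p k n"
    by (induction A rule: infinite_finite_induct) (auto intro: 0 a)
qed

lemma pZ_mult: "x \<in> pZ p k m ==> y \<in> pZ p k n ==> x * y \<in> pZ p k (m + n)"
proof -
  assume "x \<in> pZ p k m" "y \<in> pZ p k n"
  then obtain a b where "a \<in> Zz \<zeta> k" "b \<in> Zz \<zeta> k" "x = of_nat p ^ m * a" "y = of_nat p ^ n * b"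
    by (auto simp: pZ_def)
  then show ?thesis by (auto simp: pZ_def power_add mult_ac intro!: image_eqI[of _ _ "a * b"] Zz_closed)
qed

lemma pZ_antimono:
  assumes "m \<le> n" shows "pZ p k n <= pZ p k m"
proof
  fix x assume "x \<in> pZ p k n"
  then obtain a where a: "a \<in> Zz \<zeta> k" "x = of_nat p ^ n * a" by (auto simp: pZ_def)
  have "of_nat p ^ (n - m) \<in> Zz \<zeta> k" by (intro Zz_closed)
  moreover have "x = of_nat p ^ m * (of_nat p ^ (n - m) * a)"
    using assms a(2) by (metis le_add_diff_inverse mult.assoc power_add)
  ultimately show "x \<in> pZ p k m" using a(1) unfolding pZ_def by (intro image_eqI[of _ _ "of_nat p ^ (n - m) * a"] Zz_closed)
qed

lemma pZ_mult_Zz: "x \<in> pZ p k n ==> y \<in> Zz \<zeta> k ==> x * y \<in> pZ p k n"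
  using pZ_mult[of x p k n y 0] by (simp add: pZ_0)

lemma NN_antimono: "s \<le> t ==> NN p k t <= NN p k s"
  using pZ_antimono[of "s - j" "t - j" for j] by (fastforce simp: NN_def)

lemma NN_0: "NN p k 0 = W k" by (simp add: NN_def W_def pZ_0)

lemma NN_W: "F \<in> NN p k t ==> F \<in> W k" using NN_antimono[of 0 t p k] by (auto simp: NN_0)

lemma NN_closed:
  "0 \<in> NN p k t" "F \<in> NN p k t ==> G \<in> NN p k t ==> F + G \<in> NN p k t"
  "F \<in> NN p k t ==> - F \<in> NN p k t" "F \<in> NN p k t ==> G \<in> NN p k t ==> F - G \<in> NN p k t"
  "(!!i. i \<in> A ==> f i \<in> NN p k t) ==> sum f A \<in> NN p k t"
  by (auto simp: NN_def fps_sum_nth intro!: pZ_closed)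

lemma NN_mult:
  assumes "F \<in> NN p k s" "G \<in> NN p k t" shows "F * G \<in> NN p k (s + t)" unfolding NN_def
proof (intro CollectI allI)
  fix j
  show "(F * G) $ j \<in> pZ p k (s + t - j)" unfolding fps_mult_nth
  proof (rule pZ_closed)
    fix i assume i: "i \<in> {0..j}"
    have "F $ i * G $ (j - i) \<in> pZ p k ((s - i) + (t - (j - i)))"
      by (rule pZ_mult) (use assms in \<open>auto simp: NN_def\<close>)
    moreover have "s + t - j \<le> (s - i) + (t - (j - i))" using i by auto
    ultimately show "F $ i * G $ (j - i) \<in> pZ p k (s + t - j)" using pZ_antimono by blast
  qed
qed

lemma NN_mult_W: "F \<in> NN p k t ==> G \<in> W k ==> F * G \<in> NN p k t"
  and NN_W_mult: "F \<in> NN p k t ==> G \<in> W k ==> G * F \<in> NN p k t"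
  using NN_mult[of F p k t G 0] NN_mult[of G p k 0 F t] by (auto simp: NN_0)

lemma NN_power: "F \<in> NN p k 1 ==> F ^ n \<in> NN p k n"
  by (induction n) (use NN_mult[of F p k 1] W_closed(2) in \<open>auto simp: NN_0\<close>)

lemma NN_p: "of_nat p \<in> NN p k 1" unfolding NN_def
proof (intro CollectI allI)
  fix j show "(of_nat p :: complex fps) $ j \<in> pZ p k (1 - j)"
  proof (cases j)
    case 0
    have "of_nat p = of_nat p ^ 1 * (1::complex)" by simp
    then show ?thesis unfolding pZ_def using 0 by (intro image_eqI[of _ _ 1] Zz_closed) (simp add: fps_of_nat[symmetric])
  qed (simp add: fps_of_nat[symmetric] pZ_closed(1))
qed

lemma NN_X: "fps_X \<in> NN p k 1" unfolding NN_def
proof (intro CollectI allI)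
  fix j show "(fps_X :: complex fps) $ j \<in> pZ p k (1 - j)"
    by (cases j) (auto simp: fps_X_def pZ_def intro!: image_eqI[of _ _ 1] image_eqI[of _ _ 0] Zz_closed)
qed

lemma ideal_NN: "ideal (NN p k t) (rg (W k))"
proof (rule idealI)
  interpret cring "rg (W k)" by (rule cring_rg[OF subring_W])
  show "ring (rg (W k))" by (rule ring_axioms)
  show "subgroup (NN p k t) (add_monoid (rg (W k)))"
  proof (rule add.subgroupI)
    show "NN p k t ~= {}" using NN_closed(1) by blast
    fix a assume "a \<in> NN p k t"
    then show "\<ominus>\<^bsub>rg (W k)\<^esub> a \<in> NN p k t"
      using NN_closed(3) NN_W by (simp add: a_inv_rg[OF subring_W])
  qed (auto intro: NN_W NN_closed)
qed (auto intro: NN_mult_W NN_W_mult)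

lemma cring_NN_Quot: "cring (rg (W k) Quot NN p k t)"
  by (rule ideal.quotient_is_cring[OF ideal_NN cring_rg[OF subring_W]])

lemma NN_coset_eq: "F \<in> W k ==> G \<in> W k ==>
    NN p k t +>\<^bsub>rg (W k)\<^esub> F = NN p k t +>\<^bsub>rg (W k)\<^esub> G \<longleftrightarrow> F - G \<in> NN p k t"
  using ideal.coset_eq_iff[OF ideal_NN, of F k G p t] by (simp add: minus_rg[OF subring_W])

lemma NN_cong_mult:
  assumes "F - F' \<in> NN p k t" "G - G' \<in> NN p k t" "F' \<in> W k" "G \<in> W k"
  shows "F * G - F' * G' \<in> NN p k t"
proof -
  have "F * G - F' * G' = (F - F') * G + F' * (G - G')" by (simp add: algebra_simps)
  then show ?thesis using assms by (simp add: NN_closed NN_mult_W NN_W_mult)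
qed

definition \<delta> :: "nat => nat => complex" where
  "\<delta> p m = \<zeta> (p * m) - \<zeta> m"

text \<open>The element q - zeta_m in the variable q - zeta_pm.\<close>

definition DD :: "nat => nat => complex fps" where
  "DD p m = fps_X + fps_const (\<delta> p m)"

text \<open>An exponent for which the power of q - zeta_m lies in (p, q - zeta_pm). It tells how
  many coefficients of a series at zeta_m matter modulo a given power of this ideal.\<close>

definition qq :: "nat => nat => nat" where
  "qq p m = (SOME q. DD p m ^ q \<in> NN p (p * m) 1)"

text \<open>Re-expansion at zeta_pm, cut off where the powers of q - zeta_m fall into the t-th power
  of (p, q - zeta_pm). As a finite sum it stays over Z[zeta_pm].\<close>

definition rho :: "nat => nat => nat => complex fps => complex fps" where
  "rho p m t A = (\<Sum>j<qq p m * t. fps_const (A $ j) * DD p m ^ j)"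

text \<open>Equality of the re-expansion of A with B, tested modulo every power of (p, q - zeta_pm).
  It takes the place of \<open>reexpands\<close> by \<open>compat_iff_coeffs\<close>.\<close>

definition compat :: "nat => nat => complex fps => complex fps => bool" where
  "compat p m A B \<longleftrightarrow> (\<forall>t. rho p m t A - B \<in> NN p (p * m) t)"

context
  fixes p m :: nat
  assumes m: "m \<ge> 1" and p: "Factorial_Ring.prime p"
begin

lemma pm: "p * m \<ge> 1" using m prime_gt_0_nat[OF p] by simp

lemma Zz_pm: "Zz \<zeta> m <= Zz \<zeta> (p * m)" by (rule Zz_mono[OF pm]) simp

lemma delta_mem: "\<delta> p m \<in> Zz \<zeta> (p * m)"
  unfolding \<delta>_def using Zz_pm Zz_zeta by (intro Zz_closed) auto

lemma DD_W: "DD p m \<in> W (p * m)" unfolding DD_def by (intro W_closed W_X W_const delta_mem)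

text \<open>Modulo p the p^e-th power of q - zeta_m is the sum of those of q - zeta_pm and of
  zeta_pm - zeta_m, and for suitable e the latter is divisible by p.\<close>

lemma DD_qq: "DD p m ^ qq p m \<in> NN p (p * m) 1"
proof -
  obtain e c where e: "e \<ge> 1" "c \<in> Zz \<zeta> (p * m)" "\<delta> p m ^ (p ^ e) = of_nat p * c"
    unfolding \<delta>_def by (rule zeta_diff_nilpotent[OF m p])
  obtain C where C: "C \<in> W (p * m)" "DD p m ^ (p ^ e) = fps_X ^ (p ^ e) + fps_const (\<delta> p m) ^ (p ^ e) + of_nat p * C"
    unfolding DD_def using freshman_iterate[OF subring_W W_X W_const[OF delta_mem] p] by blast
  have "fps_const (\<delta> p m) ^ (p ^ e) = of_nat p * fps_const c"
    by (simp add: fps_const_power e(3) fps_of_nat[symmetric])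
  moreover have "fps_X ^ (p ^ e) \<in> NN p (p * m) 1"
    using NN_power[OF NN_X[of p "p * m"], of "p ^ e"] NN_antimono[of 1 "p ^ e" p "p * m"] prime_gt_0_nat[OF p] by auto
  ultimately have "DD p m ^ (p ^ e) \<in> NN p (p * m) 1"
    unfolding C(2) by (simp only:) (intro NN_closed(2) NN_mult_W NN_p W_const C(1) e(2))
  then show ?thesis unfolding qq_def by (rule someI)
qed

lemma DD_power_NN:
  assumes "j \<ge> qq p m * t" shows "DD p m ^ j \<in> NN p (p * m) t"
proof -
  have "DD p m ^ j = (DD p m ^ qq p m) ^ t * DD p m ^ (j - qq p m * t)"
    using assms by (simp flip: power_mult power_add)
  then show ?thesis using NN_power[OF DD_qq, of t] W_closed(7)[OF DD_W] by (simp add: NN_mult_W)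
qed

lemma rho_term: "A \<in> W m ==> fps_const (A $ j) * DD p m ^ i \<in> W (p * m)"
  using W_nth[of A m j] Zz_pm by (intro W_closed W_const DD_W) auto

lemma rho_W: "A \<in> W m ==> rho p m t A \<in> W (p * m)" unfolding rho_def by (intro W_closed(10) rho_term)

lemma rho_extend:
  assumes A: "A \<in> W m" and K: "K \<ge> qq p m * t"
  shows "(\<Sum>j<K. fps_const (A $ j) * DD p m ^ j) - rho p m t A \<in> NN p (p * m) t"
proof -
  have "(\<Sum>j<K. fps_const (A $ j) * DD p m ^ j) - rho p m t A = (\<Sum>j\<in>{qq p m * t..<K}. fps_const (A $ j) * DD p m ^ j)"
    unfolding rho_def using K by (simp add: sum_diff_nat_ivl flip: atLeast0LessThan)
  also have "... \<in> NN p (p * m) t"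
    using A W_nth[OF A] Zz_pm by (intro NN_closed NN_W_mult DD_power_NN W_const) auto
  finally show ?thesis .
qed

lemma rho_mono:
  assumes A: "A \<in> W m" and "t \<le> s"
  shows "rho p m s A - rho p m t A \<in> NN p (p * m) t"
  unfolding rho_def[of _ _ s] by (rule rho_extend[OF A]) (use assms in simp)

lemma rho_add: "rho p m t (A + B) = rho p m t A + rho p m t B"
  by (simp add: rho_def distrib_right sum.distrib flip: fps_const_add)

lemma rho_diff: "rho p m t (A - B) = rho p m t A - rho p m t B"
  by (simp add: rho_def left_diff_distrib sum_subtractf flip: fps_const_sub)

text \<open>What the product of the truncations has in excess are terms of total degree at least the
  cut-off, and these lie in the ideal.\<close>

lemma rho_mult:
  assumes A: "A \<in> W m" and B: "B \<in> W m"
  shows "rho p m t (A * B) - rho p m t A * rho p m t B \<in> NN p (p * m) t"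
proof -
  let ?K = "qq p m * t" and ?D = "DD p m"
  define f where "f = (%i j. fps_const (A $ i * B $ j) * ?D ^ (i + j))"
  have c: "fps_const (A $ i * B $ j) \<in> W (p * m)" for i j
    using W_nth[OF A] W_nth[OF B] Zz_pm by (intro W_const Zz_closed) auto
  have "rho p m t (A * B) = (\<Sum>k<?K. \<Sum>i\<le>k. f i (k - i))" unfolding rho_def
  proof (rule sum.cong[OF refl])
    fix k
    have "fps_const ((A * B) $ k) = (\<Sum>i\<le>k. fps_const (A $ i * B $ (k - i)))"
      by (rule fps_ext) (auto simp: fps_sum_nth fps_mult_nth atMost_atLeast0)
    then show "fps_const ((A * B) $ k) * ?D ^ k = (\<Sum>i\<le>k. f i (k - i))"
      by (simp add: f_def sum_distrib_right)
  qed
  also have "... = (\<Sum>(i, j)\<in>{(i, j). i + j < ?K}. f i j)" by (rule sum.triangle_reindex[symmetric])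
  finally have 1: "rho p m t (A * B) = (\<Sum>(i, j)\<in>{(i, j). i + j < ?K}. f i j)" .
  have 2: "rho p m t A * rho p m t B = (\<Sum>(i, j)\<in>{..<?K} \<times> {..<?K}. f i j)"
    by (simp add: rho_def sum_product sum.cartesian_product f_def power_add mult_ac flip: fps_const_mult)
  have sub: "{(i, j). i + j < ?K} <= {..<?K} \<times> {..<?K}" by auto
  have "rho p m t A * rho p m t B - rho p m t (A * B)
      = (\<Sum>(i, j)\<in>{..<?K} \<times> {..<?K} - {(i, j). i + j < ?K}. f i j)"
    unfolding 1 2 by (subst sum_diff[OF _ sub]) auto
  also have "... \<in> NN p (p * m) t" by (rule NN_closed(5)) (auto simp: f_def intro!: NN_W_mult c DD_power_NN)
  finally show ?thesis using NN_closed(3) by force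
qed

lemma rho_const:
  assumes c: "c \<in> Zz \<zeta> m" shows "rho p m t (fps_const c) - fps_const c \<in> NN p (p * m) t"
proof -
  have cW: "fps_const c \<in> W m" using c by simp
  have "(\<Sum>j<Suc (qq p m * t). fps_const (fps_const c $ j) * DD p m ^ j) = fps_const c"
    by (simp add: sum.lessThan_Suc_shift del: sum.lessThan_Suc)
  then show ?thesis using rho_extend[OF cW, of t "Suc (qq p m * t)"] NN_closed(3) by fastforce
qed

lemma rho_X: "rho p m t fps_X - DD p m \<in> NN p (p * m) t"
proof -
  have "(\<Sum>j<Suc (Suc (qq p m * t)). fps_const (fps_X $ j) * DD p m ^ j) = DD p m"
    by (simp add: sum.lessThan_Suc_shift fps_X_def del: sum.lessThan_Suc)
  then show ?thesis using rho_extend[OF W_X, of t "Suc (Suc (qq p m * t))"] NN_closed(3) by fastforce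
qed

lemma rho_hom: "(%A. NN p (p * m) t +>\<^bsub>rg (W (p * m))\<^esub> rho p m t A) \<in> ring_hom (rg (W m)) (rg (W (p * m)) Quot NN p (p * m) t)"
proof (rule ring_hom_memI)
  note h = ideal.rcos_ring_hom[OF ideal_NN[of p "p * m" t]]
  fix A B assume AB: "A \<in> carrier (rg (W m))" "B \<in> carrier (rg (W m))"
  then have r: "rho p m t A \<in> W (p * m)" "rho p m t B \<in> W (p * m)" "rho p m t (A * B) \<in> W (p * m)"
    by (auto intro!: rho_W W_closed)
  show "NN p (p * m) t +>\<^bsub>rg (W (p * m))\<^esub> rho p m t A \<in> carrier (rg (W (p * m)) Quot NN p (p * m) t)"
    using r ring_hom_closed[OF h] by simp
  show "NN p (p * m) t +>\<^bsub>rg (W (p * m))\<^esub> rho p m t (A \<oplus>\<^bsub>rg (W m)\<^esub> B) =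
      (NN p (p * m) t +>\<^bsub>rg (W (p * m))\<^esub> rho p m t A) \<oplus>\<^bsub>rg (W (p * m)) Quot NN p (p * m) t\<^esub>
      (NN p (p * m) t +>\<^bsub>rg (W (p * m))\<^esub> rho p m t B)"
    using r ring_hom_add[OF h, of "rho p m t A" "rho p m t B"] by (simp add: rho_add)
  have "NN p (p * m) t +>\<^bsub>rg (W (p * m))\<^esub> rho p m t (A * B) = NN p (p * m) t +>\<^bsub>rg (W (p * m))\<^esub> (rho p m t A * rho p m t B)"
    using r AB rho_mult by (subst NN_coset_eq) (auto intro: W_closed)
  then show "NN p (p * m) t +>\<^bsub>rg (W (p * m))\<^esub> rho p m t (A \<otimes>\<^bsub>rg (W m)\<^esub> B) =
      (NN p (p * m) t +>\<^bsub>rg (W (p * m))\<^esub> rho p m t A) \<otimes>\<^bsub>rg (W (p * m)) Quot NN p (p * m) t\<^esub>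
      (NN p (p * m) t +>\<^bsub>rg (W (p * m))\<^esub> rho p m t B)"
    using r ring_hom_mult[OF h, of "rho p m t A" "rho p m t B"] by simp
next
  note h = ideal.rcos_ring_hom[OF ideal_NN[of p "p * m" t]]
  have "NN p (p * m) t +>\<^bsub>rg (W (p * m))\<^esub> rho p m t 1 = NN p (p * m) t +>\<^bsub>rg (W (p * m))\<^esub> 1"
    using rho_const[of 1 t] by (subst NN_coset_eq) (auto intro: rho_W W_closed Zz_closed)
  then show "NN p (p * m) t +>\<^bsub>rg (W (p * m))\<^esub> rho p m t \<one>\<^bsub>rg (W m)\<^esub> = \<one>\<^bsub>rg (W (p * m)) Quot NN p (p * m) t\<^esub>"
    using ring_hom_one[OF h] by simp
qed

lemma compat_add: "compat p m A B ==> compat p m A' B' ==> compat p m (A + A') (B + B')"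
  unfolding compat_def rho_add add_diff_add by (blast intro: NN_closed(2))

lemma compat_diff: "compat p m A B ==> compat p m A' B' ==> compat p m (A - A') (B - B')"
proof -
  have eq: "a - a' - (b - b') = (a - b) - (a' - b')" for a a' b b' :: "complex fps" by simp
  assume "compat p m A B" "compat p m A' B'"
  then show ?thesis unfolding compat_def rho_diff eq by (blast intro: NN_closed(4))
qed

lemma compat_const: "c \<in> Zz \<zeta> m ==> compat p m (fps_const c) (fps_const c)"
  unfolding compat_def using rho_const by blast

lemma compat_of_int: "compat p m (of_int c) (of_int c)"
  using compat_const[of "of_int c"] by (simp add: Zz_closed fps_of_int)

lemma compat_mult:
  assumes "compat p m A B" "compat p m A' B'" "A \<in> W m" "A' \<in> W m" "B \<in> W (p * m)"
  shows "compat p m (A * A') (B * B')" unfolding compat_def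
proof
  fix t
  have "rho p m t A * rho p m t A' - B * B' \<in> NN p (p * m) t"
    using assms by (intro NN_cong_mult rho_W) (auto simp: compat_def)
  from NN_closed(2)[OF rho_mult[OF assms(3,4), of t] this]
  show "rho p m t (A * A') - B * B' \<in> NN p (p * m) t" by simp
qed

lemma compat_Q: "compat p m (Q m) (Q (p * m))" unfolding compat_def
proof
  fix t
  have "rho p m t fps_X - DD p m + (rho p m t (fps_const (\<zeta> m)) - fps_const (\<zeta> m)) \<in> NN p (p * m) t"
    by (intro NN_closed rho_X rho_const Zz_zeta)
  moreover have "DD p m + fps_const (\<zeta> m) = Q (p * m)" by (simp add: DD_def Q_def \<delta>_def)
  ultimately show "rho p m t (Q m) - Q (p * m) \<in> NN p (p * m) t"
    unfolding Q_def[of m] rho_add by (simp add: algebra_simps)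
qed

text \<open>Membership in the t-th power of the ideal controls coefficient j modulo p^(t-j), hence
  only finitely many coefficients. So p-adic convergence of every coefficient is congruence modulo
  all powers of the ideal.\<close>

lemma compat_iff_coeffs:
  assumes A: "A \<in> W m" and B: "B \<in> W (p * m)"
  shows "compat p m A B \<longleftrightarrow> (\<forall>j n. \<exists>K0. \<forall>K\<ge>K0.
    (\<Sum>k\<le>K. of_nat (k choose j) * (A $ k * \<delta> p m ^ (k - j))) - B $ j \<in> pZ p (p * m) n)"
proof -
  define S where "S = (%K. \<Sum>k<Suc K. fps_const (A $ k) * DD p m ^ k)"
  have S: "S K $ j = (\<Sum>k\<le>K. of_nat (k choose j) * (A $ k * \<delta> p m ^ (k - j)))" for K j
    by (simp add: S_def fps_sum_nth DD_def fps_binomial_nth lessThan_Suc_atMost mult_ac del: sum.lessThan_Suc)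
  have SR: "S K - rho p m t A \<in> NN p (p * m) t" if "K \<ge> qq p m * t" for K t
    unfolding S_def by (rule rho_extend[OF A]) (use that in simp)
  show ?thesis
  proof
    assume c: "compat p m A B"
    show "\<forall>j n. \<exists>K0. \<forall>K\<ge>K0. (\<Sum>k\<le>K. of_nat (k choose j) * (A $ k * \<delta> p m ^ (k - j))) - B $ j \<in> pZ p (p * m) n"
    \<comment> \<open>Precision n in coefficient j needs the power n + j of the ideal.\<close>
    proof (intro allI exI[of _ "qq p m * (n + j)" for n j] impI)
      fix j n K assume K: "qq p m * (n + j) \<le> K"
      have "S K - rho p m (n + j) A + (rho p m (n + j) A - B) \<in> NN p (p * m) (n + j)"
        by (rule NN_closed(2)[OF SR[OF K] c[unfolded compat_def, rule_format]])
      then have "S K - B \<in> NN p (p * m) (n + j)" by simp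
      then have "(S K - B) $ j \<in> pZ p (p * m) (n + j - j)" unfolding NN_def by blast
      then show "(\<Sum>k\<le>K. of_nat (k choose j) * (A $ k * \<delta> p m ^ (k - j))) - B $ j \<in> pZ p (p * m) n"
        by (simp add: S)
    qed
  next
    assume *: "\<forall>j n. \<exists>K0. \<forall>K\<ge>K0. (\<Sum>k\<le>K. of_nat (k choose j) * (A $ k * \<delta> p m ^ (k - j))) - B $ j \<in> pZ p (p * m) n"
    show "compat p m A B" unfolding compat_def
    proof
      fix t
      from * have "\<forall>j. \<exists>K0. \<forall>K\<ge>K0. S K $ j - B $ j \<in> pZ p (p * m) t" unfolding S[symmetric] by blast
      then obtain K0 where K0: "!!j K. K \<ge> K0 j ==> S K $ j - B $ j \<in> pZ p (p * m) t"
        unfolding choice_iff by blast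
      \<comment> \<open>One bound for the cut-off and for the finitely many coefficients below
        t.\<close>
      define K where "K = Max (insert (qq p m * t) (K0 ` {..<t}))"
      have K: "K \<ge> qq p m * t" "!!j. j < t ==> K \<ge> K0 j" by (auto simp: K_def)
      have "S K \<in> W (p * m)" unfolding S_def by (intro W_closed(10) rho_term A)
      have "S K - B \<in> NN p (p * m) t" unfolding NN_def
      proof (intro CollectI allI)
        fix j
        show "(S K - B) $ j \<in> pZ p (p * m) (t - j)"
        proof (cases "j < t")
          case True
          then show ?thesis using K0[OF K(2)[OF True]] pZ_antimono[of "t - j" t p "p * m"] by auto
        next
          case False
          then show ?thesis using W_nth[OF \<open>S K \<in> W (p * m)\<close>] W_nth[OF B] by (auto simp: pZ_0 intro: Zz_closed)
        qed
      qed
      from NN_closed(4)[OF this SR[OF K(1)]]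
      show "rho p m t A - B \<in> NN p (p * m) t" by simp
    qed
  qed
qed

end

end

section \<open>Cancelling q^i - q^j from congruences\<close>

context unity_roots
begin

text \<open>Multiplication by c' turns c into the integer N. The prime-to-p part of N is inverted by
  Bezout, so division by c loses only as many powers of p as divide N.\<close>

lemma pZ_cancel:
  assumes p: "Factorial_Ring.prime p" and c: "c' \<in> Zz \<zeta> k" "c * c' = of_nat N" "N > 0"
  obtains v where "!!n x. x \<in> Zz \<zeta> k ==> x * c \<in> pZ p k n ==> x \<in> pZ p k (n - v)"
proof -
  obtain M where M: "N = p ^ multiplicity p N * M" "\<not> p dvd M"
    using multiplicity_decompose'[of N p] c(3) p by (metis not_prime_unit less_irrefl)
  define v where "v = multiplicity p N"
  show thesis
  proof (rule that[of v])
    fix n x assume x: "x \<in> Zz \<zeta> k" "x * c \<in> pZ p k n"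
    show "x \<in> pZ p k (n - v)"
    proof (cases "v \<le> n")
      case True
      obtain y where y: "y \<in> Zz \<zeta> k" "x * c = of_nat p ^ n * y" using x(2) by (auto simp: pZ_def)
      have "of_nat p ^ v * (of_nat M * x) = x * of_nat N" by (subst M(1)) (simp add: v_def mult_ac)
      also have "... = x * c * c'" using c(2) by (simp add: mult.assoc)
      also have "... = of_nat p ^ v * (of_nat p ^ (n - v) * (y * c'))"
        unfolding y(2) using True by (metis le_add_diff_inverse mult.assoc power_add)
      finally have eq: "of_nat M * x = of_nat p ^ (n - v) * (y * c')" using p prime_gt_0_nat[OF p] by simp
      have "coprime p M" using p M(2) by (rule prime_imp_coprime)
      then have "coprime (int M) (int (p ^ (n - v)))" by (simp add: coprime_commute)
      then obtain a b where "a * int M + b * int (p ^ (n - v)) = 1"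
        using bezout_int[of "int M" "int (p ^ (n - v))"] by auto
      then have "(of_int (a * int M + b * int (p ^ (n - v))) :: complex) = 1" by simp
      then have one: "of_int a * of_nat M + of_int b * of_nat p ^ (n - v) = (1 :: complex)" by simp
      have "x = (of_int a * of_nat M + of_int b * of_nat p ^ (n - v)) * x" by (simp only: one mult_1_left)
      also have "... = of_int a * (of_nat M * x) + of_int b * of_nat p ^ (n - v) * x" by (simp add: algebra_simps)
      also have "... = of_nat p ^ (n - v) * (of_int a * (y * c') + of_int b * x)"
        unfolding eq by (simp add: algebra_simps)
      finally show ?thesis unfolding pZ_def using x(1) y(1) c(1)
        by (intro image_eqI[of _ _ "of_int a * (y * c') + of_int b * x"] Zz_closed)
    next
      case False
      then show ?thesis using x by (simp add: pZ_0)
    qed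
  qed
qed

text \<open>A quantitative form of being a non-zero-divisor: if F D is small in the (p, q -
  zeta_k)-adic filtration, then so is F, with a loss of precision that does not depend on F.\<close>

definition good :: "nat => nat => complex fps => bool" where
  "good p k D \<longleftrightarrow> D \<in> W k & (\<forall>t. \<exists>s. \<forall>F\<in>W k. F * D \<in> NN p k s --> F \<in> NN p k t)"

lemma good_1: "good p k 1" by (auto simp: good_def intro: W_closed)

lemma good_mult:
  assumes "good p k C" "good p k D" shows "good p k (C * D)" unfolding good_def
proof (intro conjI allI)
  show "C * D \<in> W k" using assms by (auto simp: good_def intro: W_closed)
  fix t
  obtain s where s: "!!F. F \<in> W k ==> F * C \<in> NN p k s ==> F \<in> NN p k t"
    using assms(1) unfolding good_def by blast
  obtain s' where s': "!!F. F \<in> W k ==> F * D \<in> NN p k s' ==> F \<in> NN p k s"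
    using assms(2) unfolding good_def by blast
  show "\<exists>s. \<forall>F\<in>W k. F * (C * D) \<in> NN p k s --> F \<in> NN p k t"
  proof (intro exI[of _ s'] ballI impI)
    fix F assume F: "F \<in> W k" "F * (C * D) \<in> NN p k s'"
    have C: "F * C \<in> W k" using F assms(1) by (auto simp: good_def intro: W_closed)
    show "F \<in> NN p k t" using s[OF F(1)] s'[OF C] F(2) by (simp add: mult.assoc)
  qed
qed

lemma good_prod: "(!!i. i \<in> A ==> good p k (f i)) ==> good p k (prod f A)"
  by (induction A rule: infinite_finite_induct) (auto intro: good_mult good_1)

lemma good_unit:
  assumes "D \<in> W k" "E \<in> W k" "D * E = 1" shows "good p k D" unfolding good_def
proof (intro conjI allI)
  fix t
  show "\<exists>s. \<forall>F\<in>W k. F * D \<in> NN p k s --> F \<in> NN p k t"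
  proof (intro exI[of _ t] ballI impI)
    fix F assume "F \<in> W k" "F * D \<in> NN p k t"
    then have "F * D * E \<in> NN p k t" using assms(2) by (blast intro: NN_mult_W)
    then show "F \<in> NN p k t" using assms(3) by (simp add: mult.assoc)
  qed
qed fact

text \<open>Solve for the coefficients of \<open>F\<close> one after the other; each step loses \<open>v\<close> powers of \<open>p\<close>.\<close>

lemma good_leading:
  assumes p: "Factorial_Ring.prime p" and U: "U \<in> W k" and c: "c' \<in> Zz \<zeta> k" "U $ 0 * c' = of_nat N" "N > 0"
  shows "good p k (fps_X ^ a * U)" unfolding good_def
proof (intro conjI allI)
  show "fps_X ^ a * U \<in> W k" using U by (intro W_closed W_X)
  obtain v where v: "!!n x. x \<in> Zz \<zeta> k ==> x * U $ 0 \<in> pZ p k n ==> x \<in> pZ p k (n - v)"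
    using pZ_cancel[OF p c] by blast
  fix t
  show "\<exists>s. \<forall>F\<in>W k. F * (fps_X ^ a * U) \<in> NN p k s --> F \<in> NN p k t"
  \<comment> \<open>The factor X^a costs a steps, and each of the first t coefficients costs v
    powers of p.\<close>
  proof (intro exI[of _ "t + t * v + a"] ballI impI)
    fix F assume F: "F \<in> W k" "F * (fps_X ^ a * U) \<in> NN p k (t + t * v + a)"
    define s where "s = t + t * v"
    have FU: "(F * U) $ j \<in> pZ p k (s - j)" for j
    proof -
      have "F * (fps_X ^ a * U) = fps_X ^ a * (F * U)" by (simp add: mult_ac)
      then have "(F * (fps_X ^ a * U)) $ (j + a) = (F * U) $ j" by (simp only:) (simp add: fps_X_power_mult_nth)
      moreover have "(F * (fps_X ^ a * U)) $ (j + a) \<in> pZ p k (s + a - (j + a))"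
        using F(2) unfolding NN_def s_def by blast
      ultimately show ?thesis by simp
    qed
    have Fj: "F $ j \<in> pZ p k (s - j - Suc j * v)" for j
    proof (induction j rule: less_induct)
      case (less j)
      have "F $ j * U $ 0 = (F * U) $ j - (\<Sum>i<j. F $ i * U $ (j - i))"
        by (simp add: fps_mult_nth flip: lessThan_Suc_atMost atMost_atLeast0)
      also have "... \<in> pZ p k (s - j - j * v)"
      proof (intro pZ_closed)
        show "(F * U) $ j \<in> pZ p k (s - j - j * v)" by (rule subsetD[OF pZ_antimono FU]) simp
        fix i assume i: "i \<in> {..<j}"
        then have "Suc i * v \<le> j * v" by (intro mult_right_mono) auto
        then have "i + Suc i * v \<le> j + j * v" using i by (intro add_mono) auto
        then have "s - j - j * v \<le> s - i - Suc i * v" unfolding diff_diff_left by (rule diff_le_mono2)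
        then have "F $ i \<in> pZ p k (s - j - j * v)" using less[of i] i pZ_antimono by blast
        then show "F $ i * U $ (j - i) \<in> pZ p k (s - j - j * v)" by (rule pZ_mult_Zz) (rule W_nth[OF U])
      qed
      finally have "F $ j \<in> pZ p k (s - j - j * v - v)" by (rule v[OF W_nth[OF F(1)]])
      moreover have "s - j - j * v - v = s - j - Suc j * v" by simp
      ultimately show ?case by simp
    qed
    show "F \<in> NN p k t" unfolding NN_def
    proof (intro CollectI allI)
      fix j
      show "F $ j \<in> pZ p k (t - j)"
      proof (cases "j < t")
        case True
        then have "Suc j * v \<le> t * v" by (intro mult_right_mono) auto
        moreover have "t - j \<le> t + b - j - a" if "a \<le> b" for a b :: nat using that True by simp
        ultimately have "t - j \<le> s - j - Suc j * v" unfolding s_def by blast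
        then show ?thesis using Fj[of j] pZ_antimono by blast
      qed (use W_nth[OF F(1)] in \<open>simp add: pZ_0\<close>)
    qed
  qed
qed

lemma Q_nth: "Q k ^ l $ j = of_nat (l choose j) * \<zeta> k ^ (l - j)" unfolding Q_def by (rule fps_binomial_nth)

text \<open>If zeta_k^l = 1, the series has order one and its leading coefficient divides l in
  Z[zeta_k]; otherwise its constant term divides k.\<close>

lemma good_Q_pow:
  assumes k: "k \<ge> 1" and l: "l \<ge> 1" and p: "Factorial_Ring.prime p"
  shows "good p k (Q k ^ l - 1)"
proof (cases "\<zeta> k ^ l = 1")
  case True
  define U where "U = fps_shift 1 (Q k ^ l - 1)"
  have D: "Q k ^ l - 1 \<in> W k" by (intro W_closed W_Q)
  then have "U $ j \<in> Zz \<zeta> k" for j unfolding U_def fps_shift_nth by (rule W_nth)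
  then have U: "U \<in> W k" by (simp add: W_def)
  have "U $ 0 = of_nat l * \<zeta> k ^ (l - 1)" by (simp add: U_def Q_nth)
  then have "U $ 0 * \<zeta> k = of_nat l * (\<zeta> k ^ (l - 1) * \<zeta> k)" by simp
  also have "\<zeta> k ^ (l - 1) * \<zeta> k = 1" using l True by (metis Suc_diff_1 Suc_le_eq One_nat_def power_Suc2)
  finally have c: "U $ 0 * \<zeta> k = of_nat l" by simp
  have "Q k ^ l - 1 = fps_X ^ 1 * U" unfolding U_def by (rule fps_ext) (auto simp: Q_nth True)
  then show ?thesis using good_leading[OF p U Zz_zeta c, of 1] l by simp
next
  case False
  define w where "w = \<zeta> k ^ l"
  have wk: "w ^ k = 1" unfolding w_def using k by (metis mult.commute power_mult power_one zeta_pow_self)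
  have wZ: "w ^ i \<in> Zz \<zeta> k" for i unfolding w_def by (intro Zz_closed Zz_zeta)
  \<comment> \<open>As the sum of w^i over i < k vanishes, k is minus the sum of w^i - 1, a multiple
    of w - 1.\<close>
  define c' where "c' = - (\<Sum>i<k. \<Sum>j<i. w ^ j)"
  have "(w - 1) * (\<Sum>i<k. w ^ i) = 0" by (subst power_diff_1_eq[symmetric]) (simp add: wk)
  then have sum0: "(\<Sum>i<k. w ^ i) = 0" using False by (simp add: w_def)
  have "(w - 1) * c' = - (\<Sum>i<k. (w - 1) * (\<Sum>j<i. w ^ j))" by (simp add: c'_def sum_distrib_left)
  also have "... = - (\<Sum>i<k. w ^ i - 1)" by (simp add: power_diff_1_eq)
  also have "... = of_nat k" by (simp add: sum_subtractf sum0)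
  finally have c: "(Q k ^ l - 1) $ 0 * c' = of_nat k" by (simp add: Q_nth w_def)
  have "c' \<in> Zz \<zeta> k" unfolding c'_def by (intro Zz_closed wZ)
  then show ?thesis using good_leading[OF p _ _ c, of k 0] k by (simp add: W_closed W_Q)
qed

text \<open>The geometric series for the inverse of q at zeta_k, with the inverse of zeta_k written
  as its (k-1)-th power.\<close>

definition Qi :: "nat => complex fps" where
  "Qi k = Abs_fps (%j. (-1) ^ j * \<zeta> k ^ ((k - 1) * Suc j))"

lemma Qi_W: "Qi k \<in> W k" unfolding W_def Qi_def by (auto intro!: Zz_closed Zz_zeta)

lemma Q_Qi:
  assumes k: "k \<ge> 1" shows "Q k * Qi k = 1"
proof -
  define w where "w = \<zeta> k ^ (k - 1)"
  have w: "\<zeta> k * w = 1" using k unfolding w_def by (metis Suc_diff_1 Suc_le_eq One_nat_def power_Suc zeta_pow_self)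
  have V: "Qi k $ j = (-1) ^ j * w ^ Suc j" for j unfolding Qi_def w_def by (simp only: fps_nth_Abs_fps power_mult)
  show ?thesis
  proof (rule fps_ext)
    fix j
    show "(Q k * Qi k) $ j = 1 $ j"
    proof (cases j)
      case 0
      then show ?thesis using w by (simp add: Q_def distrib_right V)
    next
      case (Suc i)
      have "(Q k * Qi k) $ Suc i = Qi k $ i + \<zeta> k * Qi k $ Suc i" by (simp add: Q_def distrib_right)
      also have "\<zeta> k * Qi k $ Suc i = - (\<zeta> k * w) * Qi k $ i" by (simp add: V)
      finally show ?thesis using Suc w by simp
    qed
  qed
qed

lemma good_Q: "k \<ge> 1 ==> good p k (Q k)" by (rule good_unit[OF W_Q Qi_W Q_Qi])

lemma good_node:
  assumes "k \<ge> 1" "j < i" "Factorial_Ring.prime p"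
  shows "good p k (Q k ^ i - Q k ^ j)"
proof -
  have "Q k ^ i = Q k ^ j * Q k ^ (i - j)" using assms by (simp flip: power_add)
  then have "Q k ^ i - Q k ^ j = Q k ^ j * (Q k ^ (i - j) - 1)" by (simp add: algebra_simps)
  then show ?thesis using good_prod[of "{..<j}" p k "%_. Q k", OF good_Q[OF assms(1)]] assms
    by (simp add: good_mult good_Q_pow)
qed

lemma Q_node_nz: "j < i ==> Q k ^ i ~= Q k ^ j" using Q_nth[of k i i] Q_nth[of k j i] by (auto simp: binomial_eq_0)

text \<open>The re-expansion of A minus B, multiplied by D, lies in every power of the ideal, and
  goodness removes D at a bounded cost. The computation runs at a higher precision s' and returns to
  t by \<open>rho_mono\<close>.\<close>

lemma compat_cancel:
  assumes m: "m \<ge> 1" and p: "Factorial_Ring.prime p"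
    and c: "compat p m (A * C) (B * D)" "compat p m C D" and D: "good p (p * m) D"
    and W: "A \<in> W m" "C \<in> W m" "B \<in> W (p * m)"
  shows "compat p m A B" unfolding compat_def
proof
  fix t
  have DW: "D \<in> W (p * m)" using D by (simp add: good_def)
  obtain s where s: "!!F. F \<in> W (p * m) ==> F * D \<in> NN p (p * m) s ==> F \<in> NN p (p * m) t"
    using D unfolding good_def by blast
  define s' where "s' = max s t"
  have "rho p m s' (A * C) - rho p m s' A * rho p m s' C \<in> NN p (p * m) s'" by (rule rho_mult[OF m p W(1,2)])
  moreover have "rho p m s' (A * C) - B * D \<in> NN p (p * m) s'" using c(1) by (simp add: compat_def)
  moreover have "rho p m s' A * rho p m s' C - rho p m s' A * D \<in> NN p (p * m) s'"
    unfolding right_diff_distrib[symmetric]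
    by (rule NN_W_mult[OF c(2)[unfolded compat_def, rule_format] rho_W[OF m p W(1)]])
  ultimately have "(rho p m s' (A * C) - B * D) - (rho p m s' (A * C) - rho p m s' A * rho p m s' C)
      - (rho p m s' A * rho p m s' C - rho p m s' A * D) \<in> NN p (p * m) s'" by (meson NN_closed(4))
  then have "(rho p m s' A - B) * D \<in> NN p (p * m) s'" by (simp add: algebra_simps)
  then have "(rho p m s' A - B) * D \<in> NN p (p * m) s" using NN_antimono[of s s'] by (auto simp: s'_def)
  then have "rho p m s' A - B \<in> NN p (p * m) t" using W rho_W[OF m p] by (intro s W_closed)
  moreover have "rho p m s' A - rho p m t A \<in> NN p (p * m) t"
    by (rule rho_mono[OF m p W(1)]) (simp add: s'_def)
  ultimately have "rho p m s' A - B - (rho p m s' A - rho p m t A) \<in> NN p (p * m) t" by (rule NN_closed)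
  then show "rho p m t A - B \<in> NN p (p * m) t" by simp
qed

lemma compat_Qi: "m \<ge> 1 ==> Factorial_Ring.prime p ==> compat p m (Qi m) (Qi (p * m))"
  using compat_cancel[of m p "Qi m" "Q m" "Qi (p * m)" "Q (p * m)"] compat_Q[of m p] good_Q[of "p * m" p]
    Q_Qi[of m] Q_Qi[of "p * m"] pm[of m p] compat_of_int[of m p 1] by (simp add: mult.commute[of "Qi _"] W_Q Qi_W)

section \<open>The Habiro ring in coordinates\<close>

text \<open>The complex number that an element of Z[zeta_m] represents; inverse to
  \<open>cyc_num\<close>.\<close>

definition cval :: "nat => (nat => int) set => complex" where
  "cval m = cyc_map \<Z> (rg UNIV) of_int (\<zeta> m)"

lemma of_int_hom: "of_int \<in> ring_hom \<Z> (rg UNIV)" by (rule ring_hom_memI) auto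

lemma incl_hom: "S <= T ==> (%x. x) \<in> ring_hom (rg S) (rg T)" by (rule ring_hom_memI) auto

lemma cval_hom: "cval m \<in> ring_hom (cyc \<zeta> \<Z> m) (rg UNIV)"
  and cval_num: "w \<in> Zz \<zeta> m ==> cval m (cyc_num \<zeta> \<Z> m w) = w" unfolding cval_def
  using cyc_map(1,3)[OF cring_int cring_rg[OF subring_set_UNIV] of_int_hom incl_hom[of "Zz \<zeta> m" UNIV]] by auto

text \<open>An element of \<open>UP \<Z>\<close> is the coefficient sequence of an integer
  polynomial, so \<open>cyc_num\<close> is onto.\<close>

lemma cyc_Z_num:
  assumes "x \<in> carrier (cyc \<zeta> \<Z> m)"
  shows "cval m x \<in> Zz \<zeta> m" "cyc_num \<zeta> \<Z> m (cval m x) = x"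
proof -
  obtain F where F: "F \<in> carrier (UP \<Z>)" "x = cyc_ideal \<zeta> \<Z> m +>\<^bsub>UP \<Z>\<^esub> F"
    using assms ideal.Quot_carrierE[OF ideal_cyc[OF cring_int]] unfolding cyc_def by metis
  obtain n where n: "bound 0 n F" using F(1) by (auto simp: UP_def up_def)
  have "\<forall>i>n. F i = 0" using n by (auto simp: bound_def)
  then have "\<forall>\<^sub>\<infinity>i. F i = 0" unfolding MOST_nat by blast
  then have "Polynomial.coeff (Abs_poly F) = F" by (rule Abs_poly_inverse[OF CollectI])
  then have "F = poly_in \<Z> (Abs_poly F)" by (simp add: poly_in_def)
  then have "x = cyc_num \<zeta> \<Z> m (ipoly (Abs_poly F) (\<zeta> m))"
    using F(2) cyc_num_ipoly[OF cring_int, of \<zeta> m "Abs_poly F"] by simp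
  then show "cval m x \<in> Zz \<zeta> m" "cyc_num \<zeta> \<Z> m (cval m x) = x"
    using cval_num[OF Zz_ipoly] by simp_all
qed

lemma cyc_num_closed: "w \<in> Zz \<zeta> m ==> cyc_num \<zeta> \<Z> m w \<in> carrier (cyc \<zeta> \<Z> m)"
  using ring_hom_closed[OF cyc_num_hom[OF cring_int]] by simp

text \<open>\<open>EE\<close> and \<open>EI\<close> are mutually inverse isomorphisms between the
  record ring of power series over Z[zeta_m] and \<open>W m\<close>; through them computations take
  place in complex power series.\<close>

definition EE :: "nat => (nat => (nat => int) set) => complex fps" where
  "EE m f = Abs_fps (%j. cval m (f j))"

definition EI :: "nat => complex fps => nat => (nat => int) set" where
  "EI m F = (%j. cyc_num \<zeta> \<Z> m (F $ j))"

lemma pseries_simps: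
  "carrier (pseries A) = {f. \<forall>k. f k \<in> carrier A}"
  "f \<otimes>\<^bsub>pseries A\<^esub> g = (%k. finsum A (%i. f i \<otimes>\<^bsub>A\<^esub> g (k - i)) {..k})"
  "\<one>\<^bsub>pseries A\<^esub> = (%k. if k = 0 then \<one>\<^bsub>A\<^esub> else \<zero>\<^bsub>A\<^esub>)"
  "\<zero>\<^bsub>pseries A\<^esub> = (%k. \<zero>\<^bsub>A\<^esub>)"
  "f \<oplus>\<^bsub>pseries A\<^esub> g = (%k. f k \<oplus>\<^bsub>A\<^esub> g k)" by (simp_all add: pseries_def)

lemma EE_W: "f \<in> carrier (pseries (cyc \<zeta> \<Z> m)) ==> EE m f \<in> W m"
  by (auto simp: EE_def W_def pseries_simps cyc_Z_num)

lemma EI_closed: "F \<in> W m ==> EI m F \<in> carrier (pseries (cyc \<zeta> \<Z> m))"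
  by (auto simp: EI_def W_def pseries_simps cyc_num_closed)

lemma EE_EI: "F \<in> W m ==> EE m (EI m F) = F" by (rule fps_ext) (simp add: EE_def EI_def W_nth cval_num)

lemma EI_EE: "f \<in> carrier (pseries (cyc \<zeta> \<Z> m)) ==> EI m (EE m f) = f"
  by (auto simp: EE_def EI_def pseries_simps cyc_Z_num fun_eq_iff)

lemma EE_ops:
  assumes f: "f \<in> carrier (pseries (cyc \<zeta> \<Z> m))" and g: "g \<in> carrier (pseries (cyc \<zeta> \<Z> m))"
  shows "EE m (f \<otimes>\<^bsub>pseries (cyc \<zeta> \<Z> m)\<^esub> g) = EE m f * EE m g"
    "EE m (f \<oplus>\<^bsub>pseries (cyc \<zeta> \<Z> m)\<^esub> g) = EE m f + EE m g"
    "EE m \<one>\<^bsub>pseries (cyc \<zeta> \<Z> m)\<^esub> = 1" "EE m \<zero>\<^bsub>pseries (cyc \<zeta> \<Z> m)\<^esub> = 0"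
proof -
  let ?C = "cyc \<zeta> \<Z> m"
  interpret C: cring ?C by (rule cring_cyc[OF cring_int])
  note U = cring_rg[OF subring_set_UNIV]
  have c: "f i \<in> carrier ?C" "g i \<in> carrier ?C" for i using f g by (auto simp: pseries_simps)
  show "EE m (f \<otimes>\<^bsub>pseries ?C\<^esub> g) = EE m f * EE m g"
  proof (rule fps_ext)
    fix k
    have "cval m (finsum ?C (%i. f i \<otimes>\<^bsub>?C\<^esub> g (k - i)) {..k})
        = finsum (rg UNIV) (%i. cval m (f i \<otimes>\<^bsub>?C\<^esub> g (k - i))) {..k}"
      by (rule ring_hom_finsum[OF C.is_cring U cval_hom]) (auto simp: c)
    also have "... = (\<Sum>i\<le>k. cval m (f i) * cval m (g (k - i)))"
      using ring_hom_mult[OF cval_hom c(1) c(2)] by (simp add: finsum_rg[OF subring_set_UNIV])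
    finally show "EE m (f \<otimes>\<^bsub>pseries ?C\<^esub> g) $ k = (EE m f * EE m g) $ k"
      by (simp add: EE_def pseries_simps fps_mult_nth atMost_atLeast0)
  qed
  show "EE m (f \<oplus>\<^bsub>pseries ?C\<^esub> g) = EE m f + EE m g"
    using ring_hom_add[OF cval_hom c(1) c(2)] by (intro fps_ext) (simp add: EE_def pseries_simps)
  have one: "cval m \<one>\<^bsub>?C\<^esub> = 1" and zero: "cval m \<zero>\<^bsub>?C\<^esub> = 0"
    using ring_hom_one[OF cval_hom] ring_hom_0[OF C.is_cring U cval_hom] by auto
  show "EE m \<one>\<^bsub>pseries ?C\<^esub> = 1" "EE m \<zero>\<^bsub>pseries ?C\<^esub> = 0"
    by (rule fps_ext; simp add: EE_def pseries_simps one zero fps_one_nth)+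
qed

lemma EE_inj: "f \<in> carrier (pseries (cyc \<zeta> \<Z> m)) ==> g \<in> carrier (pseries (cyc \<zeta> \<Z> m)) ==> EE m f = EE m g ==> f = g"
  by (metis EI_EE)

lemma cring_pseries_cyc: "cring (pseries (cyc \<zeta> \<Z> m))"
proof (rule cring_transfer[where I = "{()}" and h = "%_. EE m"])
  let ?P = "pseries (cyc \<zeta> \<Z> m)"
  interpret C: cring "cyc \<zeta> \<Z> m" by (rule cring_cyc[OF cring_int])
  show "x = y" if "x \<in> carrier ?P" "y \<in> carrier ?P" "!!i. i \<in> {()} ==> EE m x = EE m y" for x y
    using that by (intro EE_inj) auto
  show "\<exists>y\<in>carrier ?P. \<forall>i\<in>{()}. EE m y = - EE m x" if x: "x \<in> carrier ?P" for x
    using EE_EI[OF W_closed(5)[OF EE_W[OF x]]] EI_closed[OF W_closed(5)[OF EE_W[OF x]]]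
    by (intro bexI[of _ "EI m (- EE m x)"]) auto
  show z: "\<zero>\<^bsub>?P\<^esub> \<in> carrier ?P" "\<one>\<^bsub>?P\<^esub> \<in> carrier ?P" by (auto simp: pseries_simps)
  show "x \<oplus>\<^bsub>?P\<^esub> y \<in> carrier ?P" "x \<otimes>\<^bsub>?P\<^esub> y \<in> carrier ?P" if "x \<in> carrier ?P" "y \<in> carrier ?P" for x y
    using that by (auto simp: pseries_simps intro!: C.finsum_closed)
  show "EE m \<zero>\<^bsub>?P\<^esub> = 0" "EE m \<one>\<^bsub>?P\<^esub> = 1" using EE_ops[OF z(1) z(1)] by auto
qed (auto simp: EE_ops)

lemma EE_hom: "EE m \<in> ring_hom (pseries (cyc \<zeta> \<Z> m)) (rg (W m))"
  using EE_ops[OF cring.cring_simprules(2)[OF cring_pseries_cyc] cring.cring_simprules(2)[OF cring_pseries_cyc]]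
  by (intro ring_hom_memI) (auto simp: EE_W EE_ops)

lemma EI_hom: "EI m \<in> ring_hom (rg (W m)) (pseries (cyc \<zeta> \<Z> m))"
proof (rule ring_hom_memI)
  let ?P = "pseries (cyc \<zeta> \<Z> m)"
  interpret P: cring ?P by (rule cring_pseries_cyc)
  fix F G assume FG: "F \<in> carrier (rg (W m))" "G \<in> carrier (rg (W m))"
  then show "EI m F \<in> carrier ?P" by (simp add: EI_closed)
  show "EI m (F \<otimes>\<^bsub>rg (W m)\<^esub> G) = EI m F \<otimes>\<^bsub>?P\<^esub> EI m G" "EI m (F \<oplus>\<^bsub>rg (W m)\<^esub> G) = EI m F \<oplus>\<^bsub>?P\<^esub> EI m G"
    using FG by (auto intro!: EE_inj P.m_closed P.a_closed EI_closed simp: EE_ops EI_closed EE_EI W_closed)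
next
  let ?P = "pseries (cyc \<zeta> \<Z> m)"
  interpret P: cring ?P by (rule cring_pseries_cyc)
  show "EI m \<one>\<^bsub>rg (W m)\<^esub> = \<one>\<^bsub>?P\<^esub>"
    using EE_ops(3)[OF P.one_closed P.one_closed] by (intro EE_inj) (auto intro!: EI_closed simp: EE_EI W_closed)
qed

lemma EE_q_at: "EE m (q_at \<zeta> m) = Q m" and q_at_closed: "q_at \<zeta> m \<in> carrier (pseries (cyc \<zeta> \<Z> m))"
proof -
  interpret C: cring "cyc \<zeta> \<Z> m" by (rule cring_cyc[OF cring_int])
  have one: "cval m \<one>\<^bsub>cyc \<zeta> \<Z> m\<^esub> = 1" and zero: "cval m \<zero>\<^bsub>cyc \<zeta> \<Z> m\<^esub> = 0"
    using ring_hom_one[OF cval_hom] ring_hom_0[OF C.is_cring cring_rg[OF subring_set_UNIV] cval_hom] by auto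
  show "EE m (q_at \<zeta> m) = Q m"
    by (rule fps_ext) (simp add: EE_def q_at_def Q_def one zero cval_num fps_X_def)
  show "q_at \<zeta> m \<in> carrier (pseries (cyc \<zeta> \<Z> m))"
    by (auto simp: q_at_def pseries_simps cyc_num_closed)
qed

end

section \<open>Compatibility over Z_p as compatibility of complex power series\<close>

context unity_roots
begin

lemma ideal_pZ: "ideal (pZ p k n) (rg (Zz \<zeta> k))"
proof (rule idealI)
  interpret cring "rg (Zz \<zeta> k)" by (rule cring_rg[OF subring_Zz])
  show "ring (rg (Zz \<zeta> k))" by (rule ring_axioms)
  have sub: "x \<in> pZ p k n ==> x \<in> Zz \<zeta> k" for x using pZ_antimono[of 0 n p k] by (auto simp: pZ_0)
  show "subgroup (pZ p k n) (add_monoid (rg (Zz \<zeta> k)))"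
  proof (rule add.subgroupI)
    show "pZ p k n ~= {}" using pZ_closed(1) by blast
    fix a assume "a \<in> pZ p k n"
    then show "\<ominus>\<^bsub>rg (Zz \<zeta> k)\<^esub> a \<in> pZ p k n"
      using pZ_closed(3) sub by (simp add: a_inv_rg[OF subring_Zz])
  qed (auto intro: sub pZ_closed)
  fix a x assume "a \<in> pZ p k n" "x \<in> carrier (rg (Zz \<zeta> k))"
  then show "x \<otimes>\<^bsub>rg (Zz \<zeta> k)\<^esub> a \<in> pZ p k n" "a \<otimes>\<^bsub>rg (Zz \<zeta> k)\<^esub> x \<in> pZ p k n"
    using pZ_mult_Zz[of a p k n x] by (simp_all add: mult.commute)
qed

lemma pZ_prime_power: "of_nat p ^ n \<in> pZ p k n"
  unfolding pZ_def by (rule image_eqI[of _ _ 1]) (auto intro: Zz_closed)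

text \<open>Z_p[zeta_k] maps to Z[zeta_k] modulo p^n, since the latter is killed by p^n. So passing
  to Z_p[zeta_k] creates no new divisibility by p^n among elements of Z[zeta_k].\<close>

lemma theta_padic_iff:
  assumes w: "w \<in> Zz \<zeta> k"
  shows "cyc_num \<zeta> (completion \<Z> p) k w \<in> padic_ideal (cyc \<zeta> (completion \<Z> p) k) p n \<longleftrightarrow> w \<in> pZ p k n"
proof -
  let ?A = "completion \<Z> p"
  let ?S = "cyc \<zeta> ?A k" and ?\<theta> = "cyc_num \<zeta> ?A k"
  have A: "cring ?A" by (rule cring.cring_completion[OF cring_int])
  interpret S: cring ?S by (rule cring_cyc[OF A])
  note Zr = cring_rg[OF subring_Zz[of \<zeta> k]]
  note th = cyc_num_hom[OF A, of \<zeta> k]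
  show ?thesis
  proof
    assume "w \<in> pZ p k n"
    then obtain c where c: "c \<in> Zz \<zeta> k" "w = of_nat p ^ n * c" by (auto simp: pZ_def)
    have "?\<theta> (c * of_int (int p ^ n)) = ?\<theta> c \<otimes>\<^bsub>?S\<^esub> ?\<theta> (of_int (int p ^ n))"
      using ring_hom_mult[OF th, of c "of_int (int p ^ n)"] c by (simp del: of_int_power add: Zz_closed)
    also have "?\<theta> (of_int (int p ^ n)) = int_in ?S (int p ^ n)"
      using ring_hom_int_in[OF Zr S.is_cring th, of "int p ^ n"] by (simp only: int_in_rg[OF subring_Zz])
    finally have "?\<theta> w = ?\<theta> c \<otimes>\<^bsub>?S\<^esub> int_in ?S (int p ^ n)" using c by (simp add: mult.commute)
    moreover have "?\<theta> c \<in> carrier ?S" using ring_hom_closed[OF th] c by simp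
    ultimately show "?\<theta> w \<in> padic_ideal ?S p n" unfolding S.padic_ideal_iff by (intro bexI)
  next
    assume mem: "?\<theta> w \<in> padic_ideal ?S p n"
    let ?U = "rg (Zz \<zeta> k) Quot pZ p k n"
    have U: "cring ?U" by (rule ideal.quotient_is_cring[OF ideal_pZ Zr])
    interpret U: cring ?U by (rule U)
    note q = ideal.rcos_ring_hom[OF ideal_pZ[of p k n]]
    have 0: "int_in ?U (int p ^ n) = \<zero>\<^bsub>?U\<^esub>"
      using ring_hom_int_in[OF Zr U q, of "int p ^ n"] ideal.coset_zero_iff[OF ideal_pZ, of "of_nat p ^ n" k p n]
        pZ_prime_power[of p n k] by (simp add: int_in_rg[OF subring_Zz] Zz_closed)
    note g = completion_hom(1)[OF cring_int U U.int_in_hom 0]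
    note cm = cyc_map[OF A U g q]
    have "cyc_map ?A ?U (%x. int_in ?U (SOME a. a \<in> x n)) (pZ p k n +>\<^bsub>rg (Zz \<zeta> k)\<^esub> \<zeta> k) (?\<theta> w) = \<zero>\<^bsub>?U\<^esub>"
      by (rule padic_hom_zero[OF S.is_cring U cm(1) 0 mem])
    then have "pZ p k n +>\<^bsub>rg (Zz \<zeta> k)\<^esub> w = \<zero>\<^bsub>?U\<^esub>" using cm(3)[OF w] by simp
    then show "w \<in> pZ p k n" using ideal.coset_zero_iff[OF ideal_pZ] w by simp
  qed
qed

text \<open>When all data come from Z[zeta_k], the partial sums can be formed there before \<theta>
  is applied.\<close>

lemma reexpands_theta:
  fixes S :: "('c, 'k) ring_scheme"
  assumes S: "cring S" and th: "\<theta> \<in> ring_hom (rg (Zz \<zeta> k)) S"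
    and a: "!!i. a i \<in> Zz \<zeta> k" "!!i. b i \<in> Zz \<zeta> k" "d \<in> Zz \<zeta> k"
  shows "reexpands S p (\<theta> d) (%i. \<theta> (a i)) (%i. \<theta> (b i)) \<longleftrightarrow>
    (\<forall>j n. \<exists>K0. \<forall>K\<ge>K0. \<theta> ((\<Sum>i\<le>K. of_nat (i choose j) * (a i * d ^ (i - j))) - b j) \<in> padic_ideal S p n)"
proof -
  interpret S: cring S by (rule S)
  note Zr = cring_rg[OF subring_Zz[of \<zeta> k]]
  have t: "int_in S (int (i choose j)) \<otimes>\<^bsub>S\<^esub> (\<theta> (a i) \<otimes>\<^bsub>S\<^esub> \<theta> d [^]\<^bsub>S\<^esub> (i - j))
      = \<theta> (of_nat (i choose j) * (a i * d ^ (i - j)))" for i j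
  proof -
    have "\<theta> (of_int (int (i choose j))) = int_in S (int (i choose j))"
      using ring_hom_int_in[OF Zr S th, of "int (i choose j)"] by (simp only: int_in_rg[OF subring_Zz])
    moreover have "\<theta> (d ^ (i - j)) = \<theta> d [^]\<^bsub>S\<^esub> (i - j)"
      using ring_hom_nat_pow[OF Zr S th, of d "i - j"] a by simp
    moreover have "d ^ (i - j) \<in> Zz \<zeta> k" "(of_nat (i choose j) :: complex) \<in> Zz \<zeta> k" using a by (auto intro: Zz_closed)
    ultimately show ?thesis using ring_hom_mult[OF th, of "a i" "d ^ (i - j)"] a
        ring_hom_mult[OF th, of "of_nat (i choose j)" "a i * d ^ (i - j)"] by (simp add: Zz_closed)
  qed
  have tm: "of_nat (i choose j) * (a i * d ^ (i - j)) \<in> Zz \<zeta> k" for i j using a by (intro Zz_closed)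
  have "finsum S (%i. \<theta> (of_nat (i choose j) * (a i * d ^ (i - j)))) {..K} \<ominus>\<^bsub>S\<^esub> \<theta> (b j)
      = \<theta> ((\<Sum>i\<le>K. of_nat (i choose j) * (a i * d ^ (i - j))) - b j)" for j K
  proof -
    have "finsum S (%i. \<theta> (of_nat (i choose j) * (a i * d ^ (i - j)))) {..K}
        = \<theta> (\<Sum>i\<le>K. of_nat (i choose j) * (a i * d ^ (i - j)))"
      using ring_hom_finsum[OF Zr S th, of "%i. of_nat (i choose j) * (a i * d ^ (i - j))" "{..K}"] tm
        finsum_rg[OF subring_Zz, of "{..K}" "%i. of_nat (i choose j) * (a i * d ^ (i - j))" \<zeta> k] by simp
    moreover have "(\<Sum>i\<le>K. of_nat (i choose j) * (a i * d ^ (i - j))) \<in> Zz \<zeta> k"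
      by (rule Zz_closed(10)) (rule tm)
    ultimately show ?thesis
      using ring_hom_minus[OF Zr S th, of "\<Sum>i\<le>K. of_nat (i choose j) * (a i * d ^ (i - j))" "b j"] a
      by (simp add: minus_rg[OF subring_Zz])
  qed
  then show ?thesis unfolding reexpands_def padic_sums_def t by simp
qed

lemma habiro_Z_compatible_iff:
  assumes m: "m \<ge> 1" and p: "Factorial_Ring.prime p"
    and f: "f \<in> carrier (pseries (cyc \<zeta> \<Z> m))" and g: "g \<in> carrier (pseries (cyc \<zeta> \<Z> (p * m)))"
  shows "habiro_Z_compatible \<zeta> p m f g \<longleftrightarrow> compat p m (EE m f) (EE (p * m) g)"
proof -
  let ?A = "completion \<Z> p" and ?k = "p * m"
  let ?S = "cyc \<zeta> ?A ?k" and ?\<theta> = "cyc_num \<zeta> ?A ?k"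
  let ?h = "%r. cyc_const \<zeta> ?A ?k (to_completion \<Z> p r)"
  have A: "cring ?A" by (rule cring.cring_completion[OF cring_int])
  have S: "cring ?S" by (rule cring_cyc[OF A])
  note th = cyc_num_hom[OF A, of \<zeta> ?k]
  have h: "?h \<in> ring_hom \<Z> ?S"
    using ring_hom_trans[OF cring.to_completion_hom[OF cring_int] cyc_const_hom[OF A]] by (simp add: o_def)
  have th': "?\<theta> \<in> ring_hom (rg (Zz \<zeta> m)) ?S"
    using ring_hom_trans[OF incl_hom[OF Zz_pm[OF m p]] th] by (simp add: o_def)
  have 1: "cyc_map \<Z> ?S ?h (?\<theta> (\<zeta> m)) (f i) = ?\<theta> (EE m f $ i)" for i
    using cyc_map(3)[OF cring_int S h th', of "cval m (f i)"] cyc_Z_num[of "f i" m] f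
    by (simp add: EE_def pseries_simps)
  have 2: "cyc_map \<Z> ?S ?h (?\<theta> (\<zeta> ?k)) (g i) = ?\<theta> (EE ?k g $ i)" for i
    using cyc_map(3)[OF cring_int S h th, of "cval ?k (g i)"] cyc_Z_num[of "g i" ?k] g
    by (simp add: EE_def pseries_simps)
  have zm: "\<zeta> m \<in> Zz \<zeta> ?k" using Zz_pm[OF m p] Zz_zeta by blast
  have d: "?\<theta> (\<zeta> ?k) \<ominus>\<^bsub>?S\<^esub> ?\<theta> (\<zeta> m) = ?\<theta> (\<delta> p m)"
    using ring_hom_minus[OF cring_rg[OF subring_Zz] S th, of "\<zeta> ?k" "\<zeta> m"] zm
    by (simp add: minus_rg[OF subring_Zz] \<delta>_def)
  have a: "EE m f $ i \<in> Zz \<zeta> ?k" "EE ?k g $ i \<in> Zz \<zeta> ?k" for i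
    using W_nth[OF EE_W[OF f]] W_nth[OF EE_W[OF g]] Zz_pm[OF m p] by auto
  have mem: "(\<Sum>i\<le>K. of_nat (i choose j) * (EE m f $ i * \<delta> p m ^ (i - j))) - EE ?k g $ j \<in> Zz \<zeta> ?k" for j K
    using a delta_mem[OF m p] by (intro Zz_closed)
  show ?thesis unfolding habiro_Z_compatible_def Let_def 1 2 d
    unfolding reexpands_theta[OF S th a(1) a(2) delta_mem[OF m p]] theta_padic_iff[OF mem]
    by (rule compat_iff_coeffs[OF m p EE_W[OF f] EE_W[OF g], symmetric])
qed

definition HE :: "nat => (nat => nat => (nat => int) set) => complex fps" where
  "HE m f = EE m (f m)"

definition HI :: "(nat => complex fps) => nat => nat => (nat => int) set" where
  "HI F = (\<lambda>m\<in>{1..}. EI m (F m))"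

abbreviation "HZ \<equiv> habiro_Z \<zeta>"

lemma carrier_update_simps:
  "carrier (A\<lparr>carrier := C\<rparr>) = C" "\<one>\<^bsub>A\<lparr>carrier := C\<rparr>\<^esub> = \<one>\<^bsub>A\<^esub>" "\<zero>\<^bsub>A\<lparr>carrier := C\<rparr>\<^esub> = \<zero>\<^bsub>A\<^esub>"
  "f \<otimes>\<^bsub>A\<lparr>carrier := C\<rparr>\<^esub> g = f \<otimes>\<^bsub>A\<^esub> g" "f \<oplus>\<^bsub>A\<lparr>carrier := C\<rparr>\<^esub> g = f \<oplus>\<^bsub>A\<^esub> g"
  for A :: "('a, 'm) ring_scheme" by simp_all

lemma prod_ring_simps:
  "carrier (prod_ring I G) = (\<Pi>\<^sub>E i\<in>I. carrier (G i))"
  "\<one>\<^bsub>prod_ring I G\<^esub> = (\<lambda>i\<in>I. \<one>\<^bsub>G i\<^esub>)" "\<zero>\<^bsub>prod_ring I G\<^esub> = (\<lambda>i\<in>I. \<zero>\<^bsub>G i\<^esub>)"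
  "f \<otimes>\<^bsub>prod_ring I G\<^esub> g = (\<lambda>i\<in>I. f i \<otimes>\<^bsub>G i\<^esub> g i)" "f \<oplus>\<^bsub>prod_ring I G\<^esub> g = (\<lambda>i\<in>I. f i \<oplus>\<^bsub>G i\<^esub> g i)"
  by (simp_all add: prod_ring_def)

lemma HZ_simps:
  "\<one>\<^bsub>HZ\<^esub> = (\<lambda>m\<in>{1..}. \<one>\<^bsub>pseries (cyc \<zeta> \<Z> m)\<^esub>)" "\<zero>\<^bsub>HZ\<^esub> = (\<lambda>m\<in>{1..}. \<zero>\<^bsub>pseries (cyc \<zeta> \<Z> m)\<^esub>)"
  "f \<otimes>\<^bsub>HZ\<^esub> g = (\<lambda>m\<in>{1..}. f m \<otimes>\<^bsub>pseries (cyc \<zeta> \<Z> m)\<^esub> g m)"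
  "f \<oplus>\<^bsub>HZ\<^esub> g = (\<lambda>m\<in>{1..}. f m \<oplus>\<^bsub>pseries (cyc \<zeta> \<Z> m)\<^esub> g m)"
  unfolding habiro_Z_def Let_def carrier_update_simps prod_ring_simps by (rule refl)+

lemma HZ_carrier_iff:
  "f \<in> carrier HZ \<longleftrightarrow> f \<in> extensional {1..} & (\<forall>m\<ge>1. f m \<in> carrier (pseries (cyc \<zeta> \<Z> m)))
    & (\<forall>m\<ge>1. \<forall>p. Factorial_Ring.prime p --> compat p m (HE m f) (HE (p * m) f))"
proof -
  have "f \<in> carrier HZ \<longleftrightarrow> f \<in> (\<Pi>\<^sub>E m\<in>{1..}. carrier (pseries (cyc \<zeta> \<Z> m)))
    & (\<forall>m\<ge>1. \<forall>p. Factorial_Ring.prime p --> habiro_Z_compatible \<zeta> p m (f m) (f (p * m)))"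
    unfolding habiro_Z_def Let_def carrier_update_simps prod_ring_simps by (rule mem_Collect_eq)
  also have "f \<in> (\<Pi>\<^sub>E m\<in>{1..}. carrier (pseries (cyc \<zeta> \<Z> m)))
      \<longleftrightarrow> f \<in> extensional {1..} & (\<forall>m\<ge>1. f m \<in> carrier (pseries (cyc \<zeta> \<Z> m)))"
    by (auto simp: PiE_iff)
  finally have 1: "f \<in> carrier HZ \<longleftrightarrow> (f \<in> extensional {1..} & (\<forall>m\<ge>1. f m \<in> carrier (pseries (cyc \<zeta> \<Z> m))))
    & (\<forall>m\<ge>1. \<forall>p. Factorial_Ring.prime p --> habiro_Z_compatible \<zeta> p m (f m) (f (p * m)))" .
  have 2: "habiro_Z_compatible \<zeta> p m (f m) (f (p * m)) \<longleftrightarrow> compat p m (HE m f) (HE (p * m) f)"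
    if c: "\<forall>m\<ge>1. f m \<in> carrier (pseries (cyc \<zeta> \<Z> m))" and m: "m \<ge> 1" "Factorial_Ring.prime p" for m p
    unfolding HE_def by (rule habiro_Z_compatible_iff[OF m]) (use c m pm[OF m] in auto)
  show ?thesis unfolding 1 conj_assoc using 2 by (intro conj_cong refl all_cong1 imp_cong) simp_all
qed

lemma HZ_component: "f \<in> carrier HZ ==> m \<ge> 1 ==> f m \<in> carrier (pseries (cyc \<zeta> \<Z> m))"
  by (simp add: HZ_carrier_iff)

lemma HE_W: "f \<in> carrier HZ ==> m \<ge> 1 ==> HE m f \<in> W m" unfolding HE_def by (intro EE_W HZ_component)

lemma HE_compat: "f \<in> carrier HZ ==> m \<ge> 1 ==> Factorial_Ring.prime p ==> compat p m (HE m f) (HE (p * m) f)"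
  by (simp add: HZ_carrier_iff)

lemma HE_HI: "m \<ge> 1 ==> F m \<in> W m ==> HE m (HI F) = F m" by (simp add: HE_def HI_def EE_EI)

lemma HI_closed:
  assumes F: "!!m. m \<ge> 1 ==> F m \<in> W m"
    and c: "!!m p. m \<ge> 1 ==> Factorial_Ring.prime p ==> compat p m (F m) (F (p * m))"
  shows "HI F \<in> carrier HZ" unfolding HZ_carrier_iff
proof (intro conjI allI impI)
  show "HI F \<in> extensional {1..}" by (simp add: HI_def)
  show "HI F m \<in> carrier (pseries (cyc \<zeta> \<Z> m))" if "1 \<le> m" for m
    using that F by (simp add: HI_def EI_closed)
  show "compat p m (HE m (HI F)) (HE (p * m) (HI F))" if "1 \<le> m" "Factorial_Ring.prime p" for m p
  proof -
    have "HE m (HI F) = F m" "HE (p * m) (HI F) = F (p * m)"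
      using HE_HI[of m F] HE_HI[of "p * m" F] F[of m] F[of "p * m"] pm[OF that] that by auto
    then show ?thesis using c[OF that] by simp
  qed
qed

lemma HE_inj:
  assumes f: "f \<in> carrier HZ" and g: "g \<in> carrier HZ" and eq: "!!m. m \<ge> 1 ==> HE m f = HE m g"
  shows "f = g"
proof (rule extensionalityI)
  show "f \<in> extensional {1..}" "g \<in> extensional {1..}" using f g by (auto simp: HZ_carrier_iff)
  fix m :: nat assume "m \<in> {1..}"
  then show "f m = g m"
    using eq[of m] HZ_component[OF f, of m] HZ_component[OF g, of m] by (auto simp: HE_def intro: EE_inj)
qed

lemma HE_ops:
  assumes "m \<ge> 1"
  shows "f \<in> carrier HZ ==> g \<in> carrier HZ ==> HE m (f \<otimes>\<^bsub>HZ\<^esub> g) = HE m f * HE m g"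
    "f \<in> carrier HZ ==> g \<in> carrier HZ ==> HE m (f \<oplus>\<^bsub>HZ\<^esub> g) = HE m f + HE m g"
    "HE m \<one>\<^bsub>HZ\<^esub> = 1" "HE m \<zero>\<^bsub>HZ\<^esub> = 0"
proof -
  interpret P: cring "pseries (cyc \<zeta> \<Z> m)" by (rule cring_pseries_cyc)
  show "f \<in> carrier HZ ==> g \<in> carrier HZ ==> HE m (f \<otimes>\<^bsub>HZ\<^esub> g) = HE m f * HE m g"
    "f \<in> carrier HZ ==> g \<in> carrier HZ ==> HE m (f \<oplus>\<^bsub>HZ\<^esub> g) = HE m f + HE m g"
    using assms EE_ops[of "f m" m "g m"] HZ_component[of _ m] by (auto simp: HE_def HZ_simps)
  show "HE m \<one>\<^bsub>HZ\<^esub> = 1" "HE m \<zero>\<^bsub>HZ\<^esub> = 0"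
    using assms EE_ops(3,4)[OF P.zero_closed P.zero_closed] by (simp_all add: HE_def HZ_simps)
qed

lemma HZ_memI:
  assumes x: "x \<in> extensional {1..}" "!!m. m \<ge> 1 ==> x m \<in> carrier (pseries (cyc \<zeta> \<Z> m))"
    and F: "!!m. m \<ge> 1 ==> HE m x = F m"
    and c: "!!m p. m \<ge> 1 ==> Factorial_Ring.prime p ==> compat p m (F m) (F (p * m))"
  shows "x \<in> carrier HZ" unfolding HZ_carrier_iff using assms pm by (metis)

lemma cring_HZ: "cring HZ"
proof (rule cring_transfer[where I = "{1..}" and h = HE])
  interpret P: cring "pseries (cyc \<zeta> \<Z> m)" for m by (rule cring_pseries_cyc)
  have c: "!!m p. m \<ge> 1 ==> Factorial_Ring.prime p ==> compat p m (of_int a) (of_int a)" for a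
    by (rule compat_of_int)
  show "\<zero>\<^bsub>HZ\<^esub> \<in> carrier HZ"
    by (rule HZ_memI[of _ "%_. of_int 0"]) (use HE_ops(4) compat_of_int[of _ _ 0] in \<open>simp_all, auto simp: HZ_simps\<close>)
  show "\<one>\<^bsub>HZ\<^esub> \<in> carrier HZ"
    by (rule HZ_memI[of _ "%_. of_int 1"]) (use HE_ops(3) compat_of_int[of _ _ 1] in \<open>simp_all, auto simp: HZ_simps\<close>)
  show "x \<oplus>\<^bsub>HZ\<^esub> y \<in> carrier HZ" if xy: "x \<in> carrier HZ" "y \<in> carrier HZ" for x y
  proof (rule HZ_memI[of _ "%m. HE m x + HE m y"])
    show "x \<oplus>\<^bsub>HZ\<^esub> y \<in> extensional {1..}"
      "!!m. m \<ge> 1 ==> (x \<oplus>\<^bsub>HZ\<^esub> y) m \<in> carrier (pseries (cyc \<zeta> \<Z> m))"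
      using xy HZ_component by (auto simp: HZ_simps(4))
    show "HE m (x \<oplus>\<^bsub>HZ\<^esub> y) = HE m x + HE m y" if "m \<ge> 1" for m using HE_ops(2)[OF that xy] .
    show "compat p m (HE m x + HE m y) (HE (p * m) x + HE (p * m) y)"
      if "m \<ge> 1" "Factorial_Ring.prime p" for m p by (intro compat_add HE_compat HE_W that xy pm)
  qed
  show "x \<otimes>\<^bsub>HZ\<^esub> y \<in> carrier HZ" if xy: "x \<in> carrier HZ" "y \<in> carrier HZ" for x y
  proof (rule HZ_memI[of _ "%m. HE m x * HE m y"])
    show "x \<otimes>\<^bsub>HZ\<^esub> y \<in> extensional {1..}"
      "!!m. m \<ge> 1 ==> (x \<otimes>\<^bsub>HZ\<^esub> y) m \<in> carrier (pseries (cyc \<zeta> \<Z> m))"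
      using xy HZ_component by (auto simp: HZ_simps(3))
    show "HE m (x \<otimes>\<^bsub>HZ\<^esub> y) = HE m x * HE m y" if "m \<ge> 1" for m using HE_ops(1)[OF that xy] .
    show "compat p m (HE m x * HE m y) (HE (p * m) x * HE (p * m) y)"
      if "m \<ge> 1" "Factorial_Ring.prime p" for m p by (intro compat_mult HE_compat HE_W that xy pm)
  qed
  show "\<exists>y\<in>carrier HZ. \<forall>m\<in>{1..}. HE m y = - HE m x" if x: "x \<in> carrier HZ" for x
  proof (rule bexI[of _ "HI (%m. - HE m x)"])
    have W: "- HE m x \<in> W m" if "m \<ge> 1" for m using HE_W[OF x that] by (rule W_closed)
    show "\<forall>m\<in>{1..}. HE m (HI (%m. - HE m x)) = - HE m x" using W by (auto intro: HE_HI)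
    show "HI (%m. - HE m x) \<in> carrier HZ"
    proof (rule HI_closed[OF W])
      fix m p :: nat assume m: "m \<ge> 1" "Factorial_Ring.prime p"
      have "compat p m (of_int 0 - HE m x) (of_int 0 - HE (p * m) x)"
        by (intro compat_diff compat_of_int HE_compat m x)
      then show "compat p m (- HE m x) (- HE (p * m) x)" by simp
    qed
  qed
  show "x = y" if "x \<in> carrier HZ" "y \<in> carrier HZ" "!!i. i \<in> {1..} ==> HE i x = HE i y" for x y
    using that by (intro HE_inj) auto
qed (use HE_ops in auto)

lemma HE_hom: "m \<ge> 1 ==> HE m \<in> ring_hom HZ (rg (W m))" by (rule ring_hom_memI) (auto simp: HE_ops HE_W)

abbreviation "hq \<equiv> habiro_q \<zeta>"

lemma HE_q: "m \<ge> 1 ==> HE m hq = Q m" by (simp add: HE_def habiro_q_def EE_q_at)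

lemma hq_closed: "hq \<in> carrier HZ"
proof (rule HZ_memI[of _ Q])
  show "hq \<in> extensional {1..}" "!!m. m \<ge> 1 ==> hq m \<in> carrier (pseries (cyc \<zeta> \<Z> m))"
    by (auto simp: habiro_q_def q_at_closed)
qed (auto intro: HE_q compat_Q)

lemma hq_Units: "hq \<in> Units HZ"
proof -
  interpret H: cring HZ by (rule cring_HZ)
  have i: "HI Qi \<in> carrier HZ" by (rule HI_closed) (auto intro: Qi_W compat_Qi)
  have "hq \<otimes>\<^bsub>HZ\<^esub> HI Qi = \<one>\<^bsub>HZ\<^esub>"
    by (rule HE_inj) (use i hq_closed in \<open>auto simp: HE_ops HE_q HE_HI Qi_W Q_Qi\<close>)
  then show ?thesis using i hq_closed H.m_comm[OF i hq_closed] unfolding Units_def by auto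
qed

lemma HE_pow: "m \<ge> 1 ==> f \<in> carrier HZ ==> HE m (f [^]\<^bsub>HZ\<^esub> (n::nat)) = HE m f ^ n"
  using ring_hom_nat_pow[OF cring_HZ cring_rg[OF subring_W] HE_hom, of m f n] by simp

lemma HE_minus: "m \<ge> 1 ==> f \<in> carrier HZ ==> g \<in> carrier HZ ==> HE m (f \<ominus>\<^bsub>HZ\<^esub> g) = HE m f - HE m g"
  using ring_hom_minus[OF cring_HZ cring_rg[OF subring_W] HE_hom, of m f g] by (simp add: minus_rg[OF subring_W] HE_W)

lemma HE_int_in: "m \<ge> 1 ==> HE m (int_in HZ c) = of_int c"
  using ring_hom_int_in[OF cring_HZ cring_rg[OF subring_W] HE_hom, of m c] by (simp add: int_in_rg[OF subring_W])

end

section \<open>Specialization in coordinates\<close>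

context unity_roots
begin

lemma countable_Zz: "countable (Zz \<zeta> k)"
proof -
  have "Zz \<zeta> k = (%xs. ipoly (Poly xs) (\<zeta> k)) ` UNIV"
    unfolding Zz_def by (auto simp: image_iff) (metis Poly_coeffs)
  then show ?thesis by simp
qed

end

locale habiro_etale = etale_over_laurent R \<eta> + unity_roots \<zeta>
  for R :: "'a ring" and \<eta> :: "(int => int) => 'a" and \<zeta> :: "nat => complex" +
  fixes ev :: "'a => int"
  assumes ev_hom: "ev \<in> ring_hom R \<Z>"
    and ev_eta: "\<forall>P \<in> carrier (laurent \<Z>). ev (\<eta> P) = laurent_eval \<Z> \<Z> id 1 P"
begin

lemma tau_closed: "\<tau> \<in> carrier R" using tau_Units by (rule R.Units_closed)

lemma ev_tau: "ev \<tau> = 1"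
proof -
  have "id \<in> ring_hom \<Z> \<Z>" by (rule ring_hom_memI) auto
  moreover have "1 \<in> Units \<Z>" by (auto simp: Units_def)
  ultimately have "laurent_eval \<Z> \<Z> id 1 (monomial \<Z> 1 1) = 1"
    using laurent_eval_monomial[OF cring_int cring_int, of id 1 1 1]
      monoid.Units_int_pow(3)[OF ring.is_monoid[OF cring.axioms(1)[OF cring_int]], of 1] by simp
  then show ?thesis using ev_eta int.monomial_closed[of 1 "1::int"] by simp
qed

section \<open>Lifts of the evaluation at t = 1\<close>

definition ordK :: "nat => 'b::comm_ring_1 fps set => 'b fps set" where
  "ordK n S = {F \<in> S. \<forall>k\<le>n. F $ k = 0}"

lemma ideal_ordK:
  assumes S: "subring_set S" shows "ideal (ordK n S) (rg S)"
proof (rule idealI)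
  interpret cring "rg S" by (rule cring_rg[OF S])
  note S' = subring_setD[OF S]
  show "ring (rg S)" by (rule ring_axioms)
  show "subgroup (ordK n S) (add_monoid (rg S))"
  proof (rule add.subgroupI)
    show "ordK n S ~= {}" using S'(1) by (auto simp: ordK_def)
    fix a assume "a \<in> ordK n S"
    then show "\<ominus>\<^bsub>rg S\<^esub> a \<in> ordK n S" by (auto simp: a_inv_rg[OF S] ordK_def intro: S')
  qed (auto simp: ordK_def intro: S')
  fix a x assume "a \<in> ordK n S" "x \<in> carrier (rg S)"
  then show "x \<otimes>\<^bsub>rg S\<^esub> a \<in> ordK n S" "a \<otimes>\<^bsub>rg S\<^esub> x \<in> ordK n S"
    by (auto simp: ordK_def fps_mult_nth intro!: S' sum.neutral)
qed

lemma ordK_square: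
  assumes S: "subring_set S" and "F \<in> ordK n S" "G \<in> ordK n S"
  shows "F \<otimes>\<^bsub>rg S\<^esub> G \<in> ordK (Suc n) S"
proof -
  have "(F * G) $ k = 0" if "k \<le> Suc n" for k unfolding fps_mult_nth
  proof (rule sum.neutral, rule ballI)
    fix i assume "i \<in> {0..k}"
    then show "F $ i * G $ (k - i) = 0" using assms(2,3) that by (cases "i \<le> n") (auto simp: ordK_def)
  qed
  then show ?thesis using assms subring_setD[OF S] by (auto simp: ordK_def)
qed

text \<open>As \<open>R\<close> is etale, \<open>ev\<close> lifts along the powers of t - 1; the
  compatible lifts glue to a homomorphism to Z[[t - 1]].\<close>

lemma psi_exists: "\<exists>\<psi>. \<psi> \<in> ring_hom R (rg (UNIV :: int fps set)) & \<psi> \<tau> = 1 + fps_X & (\<forall>r\<in>carrier R. \<psi> r $ 0 = ev r)"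
proof -
  let ?T = "rg (UNIV :: int fps set)"
  define K where "K = (%n. ordK n (UNIV :: int fps set))"
  have T: "cring ?T" by (rule cring_rg[OF subring_set_UNIV])
  have idK: "ideal (K n) ?T" for n unfolding K_def by (rule ideal_ordK[OF subring_set_UNIV])
  \<comment> \<open>Integer power series embed into the first summand of the type for which lifting
    is assumed.\<close>
  have e: "inj_on (%F. Inl (%k. F $ nat k) :: (int => int) + 'a + nat) (carrier ?T)"
  proof (rule inj_onI, rule fps_ext)
    fix F G :: "int fps" and n
    assume "(Inl (%k. F $ nat k) :: (int => int) + 'a + nat) = Inl (%k. G $ nat k)"
    then have "(%k. F $ nat k) (int n) = (%k. G $ nat k) (int n)" by (metis Inl_inject)
    then show "F $ n = G $ n" by simp
  qed
  have chain: "ideal_chain ?T K"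
    unfolding ideal_chain_def ideal_chain_axioms_def using T idK by (auto simp: K_def ordK_def)
  have sq: "F \<otimes>\<^bsub>?T\<^esub> G \<in> K (Suc n)" if "F \<in> K n" "G \<in> K n" for n F G
    using ordK_square[OF subring_set_UNIV, of F n G] that by (simp add: K_def)
  have u: "1 + fps_X \<in> Units ?T"
  proof -
    have "(1 + fps_X) * Abs_fps (%n. (-1) ^ n) = (1 :: int fps)"
    proof (rule fps_ext)
      fix j show "((1 + fps_X) * Abs_fps (%n. (-1) ^ n)) $ j = (1 :: int fps) $ j"
        by (cases j) (simp_all add: distrib_right)
    qed
    then show ?thesis
      unfolding Units_def by (simp, intro exI[of _ "Abs_fps (%n. (-1) ^ n)"]) (simp add: mult.commute)
  qed
  have c: "(%r. of_int (ev r)) \<in> ring_hom R ?T"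
    using ring_hom_closed[OF ev_hom] ring_hom_mult[OF ev_hom] ring_hom_add[OF ev_hom] ring_hom_one[OF ev_hom]
    by (intro ring_hom_memI) auto
  define b where "b = (%r. K 0 +>\<^bsub>?T\<^esub> of_int (ev r))"
  have b: "b \<in> ring_hom R (?T Quot K 0)"
    using ring_hom_trans[OF c ideal.rcos_ring_hom[OF idK]] by (simp add: b_def o_def)
  have cong: "K n +>\<^bsub>?T\<^esub> F = K n +>\<^bsub>?T\<^esub> G \<longleftrightarrow> (\<forall>k\<le>n. F $ k = G $ k)" for n F G
    using ideal.coset_eq_iff[OF idK, of F G n] by (simp add: minus_rg K_def ordK_def)
  have bt: "b \<tau> = K 0 +>\<^bsub>?T\<^esub> (1 + fps_X)" unfolding b_def cong by (simp add: ev_tau)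
  obtain g where g: "!!n. g n \<in> ring_hom R (?T Quot K n)" "!!n. g n \<tau> = K n +>\<^bsub>?T\<^esub> (1 + fps_X)"
    "!!n r. r \<in> carrier R ==> g (Suc n) r <= g n r" "g 0 = b"
    by (rule lift_limit[OF T e chain sq u b bt], assumption+) (rule that)
  have gn: "g n r <= g k r" if "k \<le> n" "r \<in> carrier R" for k n r
    using that(1) by (induction n rule: dec_induct) (use g(3)[OF that(2)] in auto)
  \<comment> \<open>Level n is the first one that determines coefficient n.\<close>
  define \<psi> where "\<psi> = (%r. Abs_fps (%n. (SOME F. F \<in> g n r) $ n))"
  have gc: "g n r \<in> carrier (?T Quot K n)" if "r \<in> carrier R" for n r using ring_hom_closed[OF g(1) that] .
  have mem: "F $ k = \<psi> r $ k" if F: "F \<in> g n r" and r: "r \<in> carrier R" and k: "k \<le> n" for F n r k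
  proof -
    have "F \<in> g k r" using gn[OF k r] F by blast
    then have "g k r = K k +>\<^bsub>?T\<^esub> F" by (rule ideal.coset_memE(2)[OF idK gc[OF r]])
    moreover have "g k r = K k +>\<^bsub>?T\<^esub> (SOME F. F \<in> g k r)" by (rule ideal.coset_some(3)[OF idK gc[OF r]])
    ultimately show ?thesis using cong[of k F "SOME F. F \<in> g k r"] by (simp add: \<psi>_def)
  qed
  have mem': "\<psi> r $ k = F $ k" if "r \<in> carrier R" "g n r = K n +>\<^bsub>?T\<^esub> F" "k \<le> n" for F n r k
    using mem[OF _ that(1,3), of F] ideal.mem_coset_iff[OF idK, of F F n] that(2)
    by (simp add: minus_rg K_def ordK_def)
  have eq: "g n r = K n +>\<^bsub>?T\<^esub> \<psi> r" if r: "r \<in> carrier R" for n r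
  proof -
    obtain F where F: "F \<in> g n r" using ideal.coset_nonempty[OF idK gc[OF r]] by blast
    then have "g n r = K n +>\<^bsub>?T\<^esub> F" by (rule ideal.coset_memE(2)[OF idK gc[OF r]])
    also have "... = K n +>\<^bsub>?T\<^esub> \<psi> r" unfolding cong using mem[OF F r] by blast
    finally show ?thesis .
  qed
  have eqI: "\<psi> r = F" if "r \<in> carrier R" "!!n. g n r = K n +>\<^bsub>?T\<^esub> F" for r F
    by (rule fps_ext) (rule mem'[OF that order.refl])
  have "\<psi> \<in> ring_hom R ?T"
  proof (rule ring_hom_memI)
    fix x y assume x: "x \<in> carrier R" and y: "y \<in> carrier R"
    note h = ideal.rcos_ring_hom[OF idK]
    have "g n (x \<otimes>\<^bsub>R\<^esub> y) = K n +>\<^bsub>?T\<^esub> (\<psi> x * \<psi> y)" for n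
      using ring_hom_mult[OF g(1) x y, of n] ring_hom_mult[OF h, of "\<psi> x" "\<psi> y" n] by (simp add: eq x y)
    then show "\<psi> (x \<otimes>\<^bsub>R\<^esub> y) = \<psi> x \<otimes>\<^bsub>?T\<^esub> \<psi> y"
      using x y by (auto intro: eqI)
    have "g n (x \<oplus>\<^bsub>R\<^esub> y) = K n +>\<^bsub>?T\<^esub> (\<psi> x + \<psi> y)" for n
      using ring_hom_add[OF g(1) x y, of n] ring_hom_add[OF h, of "\<psi> x" "\<psi> y" n] by (simp add: eq x y)
    then show "\<psi> (x \<oplus>\<^bsub>R\<^esub> y) = \<psi> x \<oplus>\<^bsub>?T\<^esub> \<psi> y"
      using x y by (auto intro: eqI)
  next
    have "g n \<one>\<^bsub>R\<^esub> = K n +>\<^bsub>?T\<^esub> 1" for n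
      using ring_hom_one[OF g(1)] ring_hom_one[OF ideal.rcos_ring_hom[OF idK]] by simp
    then show "\<psi> \<one>\<^bsub>R\<^esub> = \<one>\<^bsub>?T\<^esub>" by (auto intro: eqI)
  qed simp
  moreover have "\<psi> \<tau> = 1 + fps_X" by (rule eqI[OF tau_closed g(2)])
  moreover have "\<psi> r $ 0 = ev r" if "r \<in> carrier R" for r
    using mem'[OF that, of 0 "of_int (ev r)" 0] g(4) by (simp add: b_def)
  ultimately show ?thesis by blast
qed

definition psi :: "'a => int fps" where
  "psi = (SOME \<psi>. \<psi> \<in> ring_hom R (rg (UNIV :: int fps set)) & \<psi> \<tau> = 1 + fps_X & (\<forall>r\<in>carrier R. \<psi> r $ 0 = ev r))"

lemma psi_hom: "psi \<in> ring_hom R (rg UNIV)" and psi_tau: "psi \<tau> = 1 + fps_X"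
  and psi_0: "r \<in> carrier R ==> psi r $ 0 = ev r" using someI_ex[OF psi_exists] unfolding psi_def by blast+

definition psiC :: "'a => complex fps" where
  "psiC r = Abs_fps (%k. of_int (psi r $ k))"

lemma psiC_ops:
  assumes "r \<in> carrier R" "s \<in> carrier R"
  shows "psiC (r \<otimes>\<^bsub>R\<^esub> s) = psiC r * psiC s" "psiC (r \<oplus>\<^bsub>R\<^esub> s) = psiC r + psiC s" "psiC \<one>\<^bsub>R\<^esub> = 1"
  using ring_hom_mult[OF psi_hom assms] ring_hom_add[OF psi_hom assms] ring_hom_one[OF psi_hom]
  by (auto simp: psiC_def fps_eq_iff fps_mult_nth fps_one_nth)

lemma psiC_tau: "psiC \<tau> = 1 + fps_X" by (rule fps_ext) (simp add: psiC_def psi_tau fps_X_def fps_one_nth)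

text \<open>The lift of \<open>ev\<close> with t sent to q^(mi): in Z[[t - 1]] the variable is
  replaced by q^(mi) - 1, which vanishes at q = zeta_m.\<close>

definition LL :: "nat => nat => 'a => complex fps" where
  "LL m i r = psiC r oo (Q m ^ (m * i) - 1)"

lemma Qm_0: "m \<ge> 1 ==> (Q m ^ (m * i) - 1) $ 0 = 0" using zeta_pow_iff[of m "m * i"] by (simp add: Q_nth)

lemma LL_W: "LL m i r \<in> W m"
proof -
  have "LL m i r $ j \<in> Zz \<zeta> m" for j unfolding LL_def fps_compose_nth psiC_def fps_nth_Abs_fps
    by (rule Zz_closed(10), rule Zz_closed(4), rule Zz_closed(8), rule W_nth) (intro W_closed W_Q)
  then show ?thesis by (simp add: W_def)
qed

lemma LL_hom: "m \<ge> 1 ==> LL m i \<in> ring_hom R (rg (W m))" by (rule ring_hom_memI)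
    (simp_all add: LL_W, simp_all add: LL_def psiC_ops(1,2) psiC_ops(3)[OF R.one_closed R.one_closed]
      fps_compose_mult_distrib[OF Qm_0] fps_compose_add_distrib)

lemma LL_tau: "m \<ge> 1 ==> LL m i \<tau> = Q m ^ (m * i)"
  by (simp add: LL_def psiC_tau fps_compose_add_distrib fps_X_fps_compose_startby0[OF Qm_0])

lemma LL_0: "r \<in> carrier R ==> LL m i r $ 0 = of_int (ev r)" by (simp add: LL_def psiC_def psi_0)

text \<open>The countability of Z[zeta_m] lets its power series be coded by functions on the
  integers, so uniqueness of lifts applies to \<open>W m\<close>.\<close>

lemma W_countable_inj: "\<exists>e :: complex fps => (int => int) + 'a + nat. inj_on e (W m)"
proof
  let ?e = "%F. Inl (%k. int (to_nat_on (Zz \<zeta> m) (F $ nat k))) :: (int => int) + 'a + nat"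
  show "inj_on ?e (W m)"
  proof (rule inj_onI, rule fps_ext)
    fix F G n assume FG: "F \<in> W m" "G \<in> W m" "?e F = ?e G"
    then have "to_nat_on (Zz \<zeta> m) (F $ nat (int n)) = to_nat_on (Zz \<zeta> m) (G $ nat (int n))"
      by (metis (no_types, lifting) Inl_inject of_nat_eq_iff)
    then show "F $ n = G $ n"
      using inj_on_to_nat_on[OF countable_Zz, of m] W_nth[OF FG(1)] W_nth[OF FG(2)] by (auto dest: inj_onD)
  qed
qed

text \<open>Agreement up to order n improves to order n + 1, because the square of
  \<open>ordK n\<close> is contained in the next ideal.\<close>

lemma W_lift_unique:
  assumes g: "g \<in> ring_hom R (rg (W m))" "g' \<in> ring_hom R (rg (W m))" "g \<tau> = g' \<tau>"
    and c0: "!!r. r \<in> carrier R ==> g r $ 0 = g' r $ 0" and r: "r \<in> carrier R"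
  shows "g r = g' r"
proof -
  obtain e :: "complex fps => (int => int) + 'a + nat" where e: "inj_on e (carrier (rg (W m)))"
    using W_countable_inj[of m] by auto
  have gc: "g r \<in> W m" "g' r \<in> W m" if "r \<in> carrier R" for r
    using ring_hom_closed[OF g(1) that] ring_hom_closed[OF g(2) that] by auto
  have "\<forall>r\<in>carrier R. g r \<ominus>\<^bsub>rg (W m)\<^esub> g' r \<in> ordK n (W m)" for n
  proof (induction n)
    case 0
    then show ?case using c0 gc by (auto simp: minus_rg[OF subring_W] ordK_def intro: W_closed)
  next
    case (Suc n)
    show ?case
    proof
      fix r assume r: "r \<in> carrier R"
      show "g r \<ominus>\<^bsub>rg (W m)\<^esub> g' r \<in> ordK (Suc n) (W m)"
        by (rule unique_step[OF cring_rg[OF subring_W] e ideal_ordK[OF subring_W] ideal_ordK[OF subring_W] _ g _ r])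
          (use ordK_square[OF subring_W] Suc in auto)
    qed
  qed
  then have "g r - g' r \<in> ordK n (W m)" for n using r gc by (auto simp: minus_rg[OF subring_W])
  then show ?thesis by (auto simp: ordK_def fps_eq_iff)
qed

lemma q_at_pow: "EE m (q_at \<zeta> m [^]\<^bsub>pseries (cyc \<zeta> \<Z> m)\<^esub> (i::nat)) = Q m ^ i"
  using ring_hom_nat_pow[OF cring_pseries_cyc cring_rg[OF subring_W] EE_hom q_at_closed, of m i] by (simp add: EE_q_at)

lemma q_at_pow_closed: "q_at \<zeta> m [^]\<^bsub>pseries (cyc \<zeta> \<Z> m)\<^esub> (i::nat) \<in> carrier (pseries (cyc \<zeta> \<Z> m))"
  by (rule monoid.nat_pow_closed[OF ring.is_monoid[OF cring.axioms(1)[OF cring_pseries_cyc]] q_at_closed])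

text \<open>\<open>LL\<close> shows that the set from which \<open>ev_lift\<close> chooses is
  nonempty, and uniqueness of lifts identifies the chosen map with \<open>LL\<close>.\<close>

lemma ev_lift:
  assumes m: "m \<ge> 1"
  shows "ev_lift \<zeta> R \<eta> ev m (int i) \<in> ring_hom R (pseries (cyc \<zeta> \<Z> m))"
    and "r \<in> carrier R ==> EE m (ev_lift \<zeta> R \<eta> ev m (int i) r) = LL m i r"
proof -
  let ?C = "cyc \<zeta> \<Z> m" and ?P = "pseries (cyc \<zeta> \<Z> m)"
  let ?L = "%l. l \<in> ring_hom R ?P & l \<tau> = q_at \<zeta> m [^]\<^bsub>?P\<^esub> (int m * int i)
           & (\<forall>r\<in>carrier R. l r 0 = int_in ?C (ev r))"
  have C: "cring ?C" by (rule cring_cyc[OF cring_int])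
  have pw: "q_at \<zeta> m [^]\<^bsub>?P\<^esub> (int m * int i) = q_at \<zeta> m [^]\<^bsub>?P\<^esub> (m * i)"
    by (metis int_pow_int of_nat_mult)
  have ii: "int_in ?C c = cyc_num \<zeta> \<Z> m (of_int c)" for c
    using ring_hom_int_in[OF cring_rg[OF subring_Zz] C cyc_num_hom[OF cring_int, of \<zeta> m], of c] by (simp add: int_in_rg[OF subring_Zz])
  have "?L (%r. EI m (LL m i r))"
  proof (intro conjI ballI)
    show "(%r. EI m (LL m i r)) \<in> ring_hom R ?P"
      using ring_hom_trans[OF LL_hom[OF m] EI_hom] by (simp add: o_def)
    show "EI m (LL m i \<tau>) = q_at \<zeta> m [^]\<^bsub>?P\<^esub> (int m * int i)"
      unfolding pw LL_tau[OF m] by (rule EE_inj[of _ m]) (auto simp: EI_closed q_at_pow_closed EE_EI q_at_pow W_closed)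
    show "EI m (LL m i r) 0 = int_in ?C (ev r)" if "r \<in> carrier R" for r
      using LL_0[OF that] by (simp add: EI_def ii)
  qed
  then have *: "?L (ev_lift \<zeta> R \<eta> ev m (int i))" unfolding ev_lift_def by (rule someI[of ?L])
  note l1 = conjunct1[OF *] and l2 = conjunct1[OF conjunct2[OF *]] and l3 = conjunct2[OF conjunct2[OF *]]
  show h: "ev_lift \<zeta> R \<eta> ev m (int i) \<in> ring_hom R ?P" by (rule l1)
  show "EE m (ev_lift \<zeta> R \<eta> ev m (int i) r) = LL m i r" if r: "r \<in> carrier R"
  proof (rule W_lift_unique[OF _ LL_hom[OF m] _ _ r, where g = "%r. EE m (ev_lift \<zeta> R \<eta> ev m (int i) r)"])
    show "(%r. EE m (ev_lift \<zeta> R \<eta> ev m (int i) r)) \<in> ring_hom R (rg (W m))"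
      using ring_hom_trans[OF h EE_hom] by (simp add: o_def)
    show "EE m (ev_lift \<zeta> R \<eta> ev m (int i) \<tau>) = LL m i \<tau>"
      by (simp only: l2 pw q_at_pow LL_tau[OF m])
    show "EE m (ev_lift \<zeta> R \<eta> ev m (int i) s) $ 0 = LL m i s $ 0" if "s \<in> carrier R" for s
      by (simp add: EE_def bspec[OF l3 that] ii cval_num Zz_closed LL_0[OF that])
  qed
qed

abbreviation XT :: "nat => _" where "XT m \<equiv> ext \<zeta> R \<tau> m m"

text \<open>The substitution \<sigma> of \<open>specialize\<close> on R[zeta_m, t^(1/m)], with
  t^(1/m) going to q^i, read as a complex power series.\<close>

definition sg :: "nat => nat => _ => complex fps" where
  "sg m i x = EE m (ext_map \<zeta> R m (pseries (cyc \<zeta> \<Z> m)) (ev_lift \<zeta> R \<eta> ev m (int i))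
      (%k. if k = 0 then cyc_num \<zeta> \<Z> m (\<zeta> m) else \<zero>\<^bsub>cyc \<zeta> \<Z> m\<^esub>)
      (q_at \<zeta> m [^]\<^bsub>pseries (cyc \<zeta> \<Z> m)\<^esub> (int i)) x)"

lemma cring_XT: "cring (XT m)" by (rule cring_ext[OF cring_R tau_closed])

context
  fixes m i :: nat
  assumes m: "m \<ge> 1"
begin

lemma sg_map:
  shows "ext_map \<zeta> R m (pseries (cyc \<zeta> \<Z> m)) (ev_lift \<zeta> R \<eta> ev m (int i))
      (%k. if k = 0 then cyc_num \<zeta> \<Z> m (\<zeta> m) else \<zero>\<^bsub>cyc \<zeta> \<Z> m\<^esub>)
      (q_at \<zeta> m [^]\<^bsub>pseries (cyc \<zeta> \<Z> m)\<^esub> (int i)) \<in> ring_hom (XT m) (pseries (cyc \<zeta> \<Z> m))"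
    and "sg m i \<in> ring_hom (XT m) (rg (W m))"
    and "r \<in> carrier R ==> sg m i (ext_const \<zeta> R \<tau> m m r) = LL m i r"
    and "w \<in> Zz \<zeta> m ==> sg m i (ext_num \<zeta> R \<tau> m m w) = fps_const w"
    and "sg m i (ext_root \<zeta> R \<tau> m m) = Q m ^ i"
proof -
  let ?C = "cyc \<zeta> \<Z> m" and ?P = "pseries (cyc \<zeta> \<Z> m)"
  let ?l = "ev_lift \<zeta> R \<eta> ev m (int i)"
  let ?y = "q_at \<zeta> m [^]\<^bsub>pseries (cyc \<zeta> \<Z> m)\<^esub> i"
  interpret P: cring ?P by (rule cring_pseries_cyc)
  have z0: "cyc_num \<zeta> \<Z> m 0 = \<zero>\<^bsub>?C\<^esub>"
    using ring_hom_0[OF cring_rg[OF subring_Zz] cring_cyc[OF cring_int] cyc_num_hom[OF cring_int, of \<zeta> m]] by simp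
  define \<theta> where "\<theta> = (%w. EI m (fps_const w))"
  have th: "\<theta> \<in> ring_hom (rg (Zz \<zeta> m)) ?P"
  proof -
    have "(%w. fps_const w) \<in> ring_hom (rg (Zz \<zeta> m)) (rg (W m))" by (rule ring_hom_memI) auto
    from ring_hom_trans[OF this EI_hom] show ?thesis by (simp add: o_def \<theta>_def)
  qed
  have tz: "(%k. if k = 0 then cyc_num \<zeta> \<Z> m (\<zeta> m) else \<zero>\<^bsub>?C\<^esub>) = \<theta> (\<zeta> m)"
    by (auto simp: \<theta>_def EI_def z0 fun_eq_iff)
  note l = ev_lift(1)[OF m, of i] ev_lift(2)[OF m, where i = i]
  have y: "?y \<in> carrier ?P" by (rule q_at_pow_closed)
  have yp: "?y [^]\<^bsub>?P\<^esub> m = ?l \<tau>"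
  proof (rule EE_inj)
    show "EE m (?y [^]\<^bsub>?P\<^esub> m) = EE m (?l \<tau>)"
      using q_at_closed by (simp add: P.nat_pow_pow q_at_pow l(2)[OF tau_closed] LL_tau[OF m] mult.commute)
  qed (use y l(1) tau_closed in \<open>auto simp: ring_hom_closed\<close>)
  note em = ext_map[OF cring_R tau_closed P.is_cring l(1) th y yp]
  note sgd = sg_def[of m i, unfolded int_pow_int tz, abs_def]
  show 1: "ext_map \<zeta> R m ?P ?l (%k. if k = 0 then cyc_num \<zeta> \<Z> m (\<zeta> m) else \<zero>\<^bsub>?C\<^esub>)
      (q_at \<zeta> m [^]\<^bsub>?P\<^esub> (int i)) \<in> ring_hom (XT m) ?P"
    unfolding int_pow_int tz by (rule em(1))
  show "sg m i \<in> ring_hom (XT m) (rg (W m))"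
    unfolding sgd using ring_hom_trans[OF em(1) EE_hom] by (simp add: o_def)
  show "r \<in> carrier R ==> sg m i (ext_const \<zeta> R \<tau> m m r) = LL m i r" by (simp add: sgd em(2) l(2))
  show "w \<in> Zz \<zeta> m ==> sg m i (ext_num \<zeta> R \<tau> m m w) = fps_const w"
    by (simp only: sgd em(3)) (simp add: \<theta>_def EE_EI)
  show "sg m i (ext_root \<zeta> R \<tau> m m) = Q m ^ i" by (simp add: sgd em(4) q_at_pow)
qed

end

text \<open>The m-th component of f(q^i, q) when \<open>a\<close> is the coefficient sequence of
  f_m; see \<open>specialize_coords\<close>.\<close>

definition Spec :: "nat => nat => (nat => _) => complex fps" where
  "Spec m i a = Abs_fps (%j. \<Sum>k\<le>j. sg m i (a k) $ (j - k))"

lemma specialize_coords: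
  assumes m: "m \<ge> 1" and f: "!!k. f m k \<in> carrier (XT m)"
  shows "specialize \<zeta> R \<eta> ev (int i) f m \<in> carrier (pseries (cyc \<zeta> \<Z> m))"
    and "HE m (specialize \<zeta> R \<eta> ev (int i) f) = Spec m i (f m)"
proof -
  let ?C = "cyc \<zeta> \<Z> m" and ?P = "pseries (cyc \<zeta> \<Z> m)"
  interpret C: cring ?C by (rule cring_cyc[OF cring_int])
  define s where "s = ext_map \<zeta> R m ?P (ev_lift \<zeta> R \<eta> ev m (int i))
      (%k. if k = 0 then cyc_num \<zeta> \<Z> m (\<zeta> m) else \<zero>\<^bsub>?C\<^esub>) (q_at \<zeta> m [^]\<^bsub>?P\<^esub> (int i))"
  have s: "s \<in> ring_hom (XT m) ?P" unfolding s_def by (rule sg_map(1)[OF m])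
  have sc: "s (f m k) j \<in> carrier ?C" for k j using ring_hom_closed[OF s f, of k] by (simp add: pseries_simps)
  have eq: "specialize \<zeta> R \<eta> ev (int i) f m = (%j. finsum ?C (%k. s (f m k) (j - k)) {..j})"
    using m by (simp add: specialize_def Let_def s_def)
  show "specialize \<zeta> R \<eta> ev (int i) f m \<in> carrier ?P"
    unfolding eq pseries_simps by (auto intro!: C.finsum_closed sc)
  have "sg m i x = EE m (s x)" for x by (simp add: sg_def s_def)
  then have "cval m (finsum ?C (%k. s (f m k) (j - k)) {..j}) = Spec m i (f m) $ j" for j
    using ring_hom_finsum[OF C.is_cring cring_rg[OF subring_set_UNIV] cval_hom, of "%k. s (f m k) (j - k)" "{..j}"] sc
    by (simp add: Spec_def finsum_rg[OF subring_set_UNIV] EE_def)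
  then show "HE m (specialize \<zeta> R \<eta> ev (int i) f) = Spec m i (f m)"
    by (intro fps_ext) (simp add: HE_def EE_def eq)
qed

lemma Spec_W:
  assumes m: "m \<ge> 1" and a: "!!k. a k \<in> carrier (XT m)" shows "Spec m i a \<in> W m"
proof -
  have "sg m i (a k) \<in> W m" for k using ring_hom_closed[OF sg_map(2)[OF m] a] by simp
  then have "Spec m i a $ j \<in> Zz \<zeta> m" for j
    unfolding Spec_def fps_nth_Abs_fps by (intro Zz_closed(10) W_nth)
  then show ?thesis by (simp add: W_def)
qed

end

section \<open>Specializations lie in the Habiro ring\<close>

lemma fermat_dvd:
  fixes a :: int
  assumes p: "Factorial_Ring.prime p"
  shows "int p dvd a ^ p - a"
proof (induction a rule: int_induct[where k = 0])
  case base
  then show ?case using prime_gt_0_nat[OF p] by (simp add: power_0_left)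
next
  case (step1 a)
  obtain c where "(a + 1) ^ p = a ^ p + 1 ^ p + of_nat p * c"
    by (rule freshman_subring[OF subring_set_UNIV _ _ p, of a 1]) auto
  then have eq: "(a + 1) ^ p - (a + 1) = (a ^ p - a) + int p * c" by simp
  show ?case unfolding eq by (rule dvd_add[OF step1(2)]) simp
next
  case (step2 a)
  obtain c where "(a - 1 + 1) ^ p = (a - 1) ^ p + 1 ^ p + of_nat p * c"
    by (rule freshman_subring[OF subring_set_UNIV _ _ p, of "a - 1" 1]) auto
  then have eq: "(a - 1) ^ p - (a - 1) = (a ^ p - a) - int p * c" by simp
  show ?case unfolding eq by (rule dvd_diff[OF step2(2)]) simp
qed

lemma (in etale_over_laurent) unique_filtered:
  fixes T :: "('c, 'k) ring_scheme" and e :: "'c => (int => int) + 'a + nat"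
  assumes T: "cring T" and e: "inj_on e (carrier T)" and K: "!!n. ideal (K n) T"
    and sq: "!!n x y. x \<in> K n ==> y \<in> K n ==> x \<otimes>\<^bsub>T\<^esub> y \<in> K (Suc n)"
    and g: "g \<in> ring_hom R T" "g' \<in> ring_hom R T" "g \<tau> = g' \<tau>"
    and K0: "!!r. r \<in> carrier R ==> g r \<ominus>\<^bsub>T\<^esub> g' r \<in> K 0" and r: "r \<in> carrier R"
  shows "g r \<ominus>\<^bsub>T\<^esub> g' r \<in> K n" using r
proof (induction n arbitrary: r)
  case (Suc n)
  show ?case by (rule unique_step[OF T e K[of n] K[of "Suc n"] sq g _ Suc(2)]) (use Suc(1) in auto)
qed (use K0 in auto)

context habiro_etale
begin

lemma Spec_Suc: "Spec m i a = sg m i (a 0) + fps_X * Spec m i (%k. a (Suc k))"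
proof (rule fps_ext)
  fix j
  show "Spec m i a $ j = (sg m i (a 0) + fps_X * Spec m i (%k. a (Suc k))) $ j"
    by (cases j) (simp_all add: Spec_def sum.atMost_Suc_shift del: sum.atMost_Suc)
qed

lemma Spec_split: "Spec m i a = (\<Sum>k<K. fps_X ^ k * sg m i (a k)) + fps_X ^ K * Spec m i (%k. a (k + K))"
proof (induction K arbitrary: a)
  case (Suc K)
  show ?case
    by (subst Spec_Suc, subst Suc) (simp add: sum.lessThan_Suc_shift algebra_simps sum_distrib_left del: sum.lessThan_Suc)
qed simp

context
  fixes p m t i :: nat
  assumes m: "m \<ge> 1" and p: "Factorial_Ring.prime p"
begin

private abbreviation "N \<equiv> NN p (p * m) t"
private abbreviation "T \<equiv> rg (W (p * m)) Quot N"
private abbreviation "cl \<equiv> %F. N +>\<^bsub>rg (W (p * m))\<^esub> F"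

private lemma T: "cring T" by (rule cring_NN_Quot)

private lemma cl: "cl \<in> ring_hom (rg (W (p * m))) T" by (rule ideal.rcos_ring_hom[OF ideal_NN])

private lemma cl_T: "F \<in> W (p * m) ==> cl F \<in> carrier T" using ring_hom_closed[OF cl, of F] by simp

private lemma cl_surj: "cl ` carrier (rg (W (p * m))) = carrier T" by (rule surj_image_carrier[OF ideal_NN])

private lemma cl_ops:
  assumes "F \<in> W (p * m)" "G \<in> W (p * m)"
  shows "cl F \<otimes>\<^bsub>T\<^esub> cl G = cl (F * G)" "cl F \<oplus>\<^bsub>T\<^esub> cl G = cl (F + G)" "cl F \<ominus>\<^bsub>T\<^esub> cl G = cl (F - G)"
    "cl F [^]\<^bsub>T\<^esub> (n::nat) = cl (F ^ n)" "int_in T c = cl (of_int c)"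
  using ring_hom_mult[OF cl, of F G] ring_hom_add[OF cl, of F G]
    ring_hom_minus[OF cring_rg[OF subring_W] T cl, of F G] ring_hom_nat_pow[OF cring_rg[OF subring_W] T cl, of F n]
    ring_hom_int_in[OF cring_rg[OF subring_W] T cl, of c] assms
  by (simp_all add: minus_rg[OF subring_W] int_in_rg[OF subring_W])

private lemma cl_eq: "F \<in> W (p * m) ==> G \<in> W (p * m) ==> cl F = cl G \<longleftrightarrow> F - G \<in> N"
  by (rule NN_coset_eq)

text \<open>That p^t vanishes in \<open>T\<close> is what makes \<open>completion_hom\<close> and
  \<open>padic_hom_zero\<close> applicable.\<close>

private lemma T_p: "int_in T (int p ^ t) = \<zero>\<^bsub>T\<^esub>"
proof -
  have "of_nat p ^ t \<in> N" using NN_power[OF NN_p] by blast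
  then have "cl (of_int (int p ^ t)) = cl 0"
    using NN_W[OF \<open>of_nat p ^ t \<in> N\<close>] by (subst cl_eq) (auto intro: W_closed)
  then show ?thesis
    using cl_ops(5)[of 0 0 "int p ^ t"] ring_hom_0[OF cring_rg[OF subring_W] T cl] W_closed(1) by simp
qed

private lemma T_inj: "\<exists>e :: complex fps set => (int => int) + 'a + nat. inj_on e (carrier T)"
  using W_countable_inj[of "p * m"] inj_Quot_some[OF ideal_NN[of p "p * m" t]] by (metis rg_simps(1))

text \<open>The ideal generated by p, q - zeta_pm and the s-th power of zeta_pm - zeta_m: only the
  constant coefficient is restricted.\<close>

definition II :: "nat => complex fps set" where
  "II s = {F \<in> W (p * m). \<exists>a\<in>Zz \<zeta> (p * m). \<exists>b\<in>Zz \<zeta> (p * m). F $ 0 = of_nat p * a + \<delta> p m ^ s * b}"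

private lemma ideal_II: "ideal (II s) (rg (W (p * m)))"
proof (rule idealI)
  interpret cring "rg (W (p * m))" by (rule cring_rg[OF subring_W])
  show "ring (rg (W (p * m)))" by (rule ring_axioms)
  have add: "F + G \<in> II s" if "F \<in> II s" "G \<in> II s" for F G
  proof -
    from that obtain a b a' b' where "a \<in> Zz \<zeta> (p * m)" "b \<in> Zz \<zeta> (p * m)" "F $ 0 = of_nat p * a + \<delta> p m ^ s * b"
      "a' \<in> Zz \<zeta> (p * m)" "b' \<in> Zz \<zeta> (p * m)" "G $ 0 = of_nat p * a' + \<delta> p m ^ s * b'" "F \<in> W (p * m)" "G \<in> W (p * m)"
      by (auto simp: II_def)
    then show ?thesis unfolding II_def
      by (intro CollectI conjI bexI[of _ "a + a'"] bexI[of _ "b + b'"] Zz_closed(3) W_closed(3)) (simp_all add: algebra_simps)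
  qed
  have mult: "G * F \<in> II s" if F: "F \<in> II s" and G: "G \<in> W (p * m)" for F G
  proof -
    from F obtain a b where "a \<in> Zz \<zeta> (p * m)" "b \<in> Zz \<zeta> (p * m)" "F $ 0 = of_nat p * a + \<delta> p m ^ s * b" "F \<in> W (p * m)"
      by (auto simp: II_def)
    then show ?thesis using W_nth[OF G, of 0] G unfolding II_def
      by (intro CollectI conjI bexI[of _ "G $ 0 * a"] bexI[of _ "G $ 0 * b"] Zz_closed(4) W_closed(4)) (simp_all add: algebra_simps)
  qed
  have z: "0 \<in> II s" unfolding II_def by (intro CollectI conjI bexI[of _ 0] Zz_closed(1) W_closed(1)) simp
  show "subgroup (II s) (add_monoid (rg (W (p * m))))"
  proof (rule add.subgroupI)
    show "II s <= carrier (rg (W (p * m)))" by (auto simp: II_def)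
    show "II s ~= {}" using z by blast
    fix a b assume a: "a \<in> II s" and b: "b \<in> II s"
    have "a \<in> W (p * m)" using a by (simp add: II_def)
    then show "\<ominus>\<^bsub>rg (W (p * m))\<^esub> a \<in> II s"
      using mult[OF a, of "-1"] W_closed(5)[OF W_closed(2)] by (simp add: a_inv_rg[OF subring_W])
    show "a \<oplus>\<^bsub>rg (W (p * m))\<^esub> b \<in> II s" using add[OF a b] by simp
  qed
  fix a x assume "a \<in> II s" "x \<in> carrier (rg (W (p * m)))"
  then show "x \<otimes>\<^bsub>rg (W (p * m))\<^esub> a \<in> II s" "a \<otimes>\<^bsub>rg (W (p * m))\<^esub> x \<in> II s"
    using mult[of a x] by (simp_all add: mult.commute)
qed

private lemma II_mult:
  assumes F: "F \<in> II s" and G: "G \<in> II s" shows "F * G \<in> II (2 * s)"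
proof -
  from F obtain a b where 1: "a \<in> Zz \<zeta> (p * m)" "b \<in> Zz \<zeta> (p * m)" "F $ 0 = of_nat p * a + \<delta> p m ^ s * b" "F \<in> W (p * m)"
    by (auto simp: II_def)
  from G obtain a' b' where 2: "a' \<in> Zz \<zeta> (p * m)" "b' \<in> Zz \<zeta> (p * m)" "G $ 0 = of_nat p * a' + \<delta> p m ^ s * b'" "G \<in> W (p * m)"
    by (auto simp: II_def)
  have "(F * G) $ 0 = of_nat p * (a * (of_nat p * a' + \<delta> p m ^ s * b') + \<delta> p m ^ s * b * a') + \<delta> p m ^ (2 * s) * (b * b')"
    unfolding mult_2 power_add by (simp add: 1 2 algebra_simps)
  moreover have "a * (of_nat p * a' + \<delta> p m ^ s * b') + \<delta> p m ^ s * b * a' \<in> Zz \<zeta> (p * m)" "b * b' \<in> Zz \<zeta> (p * m)"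
    using 1 2 delta_mem[OF m p] by (auto intro!: Zz_closed)
  ultimately show ?thesis using W_closed(4)[OF 1(4) 2(4)] unfolding II_def by blast
qed

text \<open>A high power of zeta_pm - zeta_m is divisible by p. The exponent is a power of 2 because
  s doubles in \<open>II_mult\<close>.\<close>

private lemma II_NN: "\<exists>n. II (2 ^ n) <= NN p (p * m) 1"
proof -
  obtain e c where e: "e \<ge> 1" "c \<in> Zz \<zeta> (p * m)" "\<delta> p m ^ (p ^ e) = of_nat p * c"
    unfolding \<delta>_def by (rule zeta_diff_nilpotent[OF m p])
  have "F \<in> NN p (p * m) 1" if F: "F \<in> II (2 ^ (p ^ e))" for F
  proof -
    from F obtain a b where 1: "a \<in> Zz \<zeta> (p * m)" "b \<in> Zz \<zeta> (p * m)" "F $ 0 = of_nat p * a + \<delta> p m ^ 2 ^ (p ^ e) * b" "F \<in> W (p * m)"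
      by (auto simp: II_def)
    have le: "p ^ e \<le> 2 ^ (p ^ e)" using less_exp[of "p ^ e"] by simp
    have "\<delta> p m ^ 2 ^ (p ^ e) = of_nat p * c * \<delta> p m ^ (2 ^ (p ^ e) - p ^ e)"
      unfolding e(3)[symmetric] using le by (simp flip: power_add)
    then have F0: "F $ 0 = of_nat p ^ 1 * (a + c * \<delta> p m ^ (2 ^ (p ^ e) - p ^ e) * b)"
      by (simp add: 1 algebra_simps)
    have "a + c * \<delta> p m ^ (2 ^ (p ^ e) - p ^ e) * b \<in> Zz \<zeta> (p * m)"
      by (intro Zz_closed(3,4,7) 1 e delta_mem[OF m p])
    then have "F $ 0 \<in> pZ p (p * m) 1" unfolding F0 pZ_def by blast
    moreover have "F $ j \<in> pZ p (p * m) (1 - j)" if "j > 0" for j using that W_nth[OF 1(4)] by (simp add: pZ_0)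
    ultimately have "F $ j \<in> pZ p (p * m) (1 - j)" for j by (cases "j = 0") simp_all
    then show ?thesis by (simp add: NN_def)
  qed
  then show ?thesis by blast
qed

text \<open>Unique lifting along two filtrations: first the exponent s doubles until
  \<open>II s\<close> lies in (p, q - zeta_pm), then the powers of this ideal double until they lie
  in \<open>N\<close>.\<close>

private lemma hom_agree:
  assumes g: "g \<in> ring_hom R T" "g' \<in> ring_hom R T" "g \<tau> = g' \<tau>"
    and c: "!!r. r \<in> carrier R ==> g r \<ominus>\<^bsub>T\<^esub> g' r \<in> cl ` II 1" and r: "r \<in> carrier R"
  shows "g r = g' r"
proof -
  interpret T: cring T by (rule T)
  obtain e :: "complex fps set => (int => int) + 'a + nat" where e: "inj_on e (carrier T)" using T_inj by blast
  note im = surj_image_ideal[OF cring_rg[OF subring_W] T cl cl_surj]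
  obtain n where n: "II (2 ^ n) <= NN p (p * m) 1" using II_NN by blast
  have 1: "g r \<ominus>\<^bsub>T\<^esub> g' r \<in> cl ` NN p (p * m) (2 ^ 0)" if r: "r \<in> carrier R" for r
  proof -
    have "g r \<ominus>\<^bsub>T\<^esub> g' r \<in> cl ` II (2 ^ n)"
    proof (rule unique_filtered[where K = "%n. cl ` II (2 ^ n)", OF T e im[OF ideal_II] _ g _ r])
      fix n x y assume "x \<in> cl ` II (2 ^ n)" "y \<in> cl ` II (2 ^ n)"
      then obtain F G where FG: "F \<in> II (2 ^ n)" "G \<in> II (2 ^ n)" "x = cl F" "y = cl G" by blast
      then have "x \<otimes>\<^bsub>T\<^esub> y = cl (F * G)" using cl_ops(1)[of F G] by (simp add: II_def)
      then show "x \<otimes>\<^bsub>T\<^esub> y \<in> cl ` II (2 ^ Suc n)" using II_mult[OF FG(1,2)] by simp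
    qed (use c in simp)
    then show ?thesis using n by auto
  qed
  have "g r \<ominus>\<^bsub>T\<^esub> g' r \<in> cl ` NN p (p * m) (2 ^ t)"
  proof (rule unique_filtered[where K = "%n. cl ` NN p (p * m) (2 ^ n)", OF T e im[OF ideal_NN] _ g 1 r])
    fix n x y assume "x \<in> cl ` NN p (p * m) (2 ^ n)" "y \<in> cl ` NN p (p * m) (2 ^ n)"
    then obtain F G where FG: "F \<in> NN p (p * m) (2 ^ n)" "G \<in> NN p (p * m) (2 ^ n)" "x = cl F" "y = cl G" by blast
    then have "x \<otimes>\<^bsub>T\<^esub> y = cl (F * G)" using cl_ops(1)[OF NN_W NN_W] by simp
    then show "x \<otimes>\<^bsub>T\<^esub> y \<in> cl ` NN p (p * m) (2 ^ Suc n)" using NN_mult[OF FG(1,2)] by (simp add: mult_2)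
  qed
  then obtain F where F: "F \<in> NN p (p * m) (2 ^ t)" "g r \<ominus>\<^bsub>T\<^esub> g' r = cl F" by blast
  have "F \<in> N" using F(1) NN_antimono[of t "2 ^ t" p "p * m"] less_exp[of t] by auto
  then have "g r \<ominus>\<^bsub>T\<^esub> g' r = \<zero>\<^bsub>T\<^esub>" unfolding F(2) using ideal.coset_zero_iff[OF ideal_NN, of F] NN_W by simp
  then show ?thesis using ring_hom_closed[OF g(1) r] ring_hom_closed[OF g(2) r] by simp
qed

text \<open>\<open>gg\<close> is the substitution at zeta_m followed by re-expansion, with values
  modulo \<open>N\<close>; \<open>gh\<close> extends it to R_p through level t of the
  completion.\<close>

private definition "gg = (%r. cl (rho p m t (LL m i r)))"
private definition "gh = (%x. gg (SOME a. a \<in> x t))"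

private lemma gg: "gg \<in> ring_hom R T"
  using ring_hom_trans[OF LL_hom[OF m] rho_hom[OF m p]] by (simp add: gg_def o_def)

private lemma gh: "gh \<in> ring_hom (completion R p) T"
    "a \<in> carrier R ==> gh (to_completion R p a) = gg a"
  using completion_hom[OF cring_R T gg T_p] by (simp_all add: gh_def)

private lemma rho_Q: "cl (rho p m t (Q m ^ n)) = cl (Q (p * m) ^ n)"
proof -
  have "compat p m (Q m ^ n) (Q (p * m) ^ n)"
  proof (induction n)
    case 0
    show ?case using compat_of_int[OF m p, of 1] by simp
  next
    case (Suc n)
    show ?case unfolding power_Suc by (rule compat_mult[OF m p compat_Q[OF m p] Suc]) (intro W_closed(7) W_Q)+
  qed
  then show ?thesis
    using rho_W[OF m p W_closed(7)[OF W_Q, of m n], of t] W_closed(7)[OF W_Q, of "p * m" n] by (subst cl_eq) (auto simp: compat_def)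
qed

private lemma gg_tau: "gg \<tau> = cl (Q (p * m) ^ (m * i))" by (simp add: gg_def LL_tau[OF m] rho_Q)

text \<open>Both maps send t to q^(pmi). Modulo p, q - zeta_pm and zeta_pm - zeta_m they become the
  p-th power of \<open>ev\<close> and \<open>ev\<close> itself, which agree by Fermat's little
  theorem. So \<open>hom_agree\<close> applies.\<close>

private lemma frob_agree:
  assumes r: "r \<in> carrier R"
  shows "gh (frob R \<tau> p (to_completion R p r)) = cl (LL (p * m) i r)"
proof (rule hom_agree[where g = "%r. gh (frob R \<tau> p (to_completion R p r))" and g' = "%r. cl (LL (p * m) i r)", OF _ _ _ _ r])
  note fr = frob[OF p, unfolded frobenius_lift_def]
  note f1 = conjunct1[OF fr] and f2 = conjunct1[OF conjunct2[OF fr]] and f3 = conjunct2[OF conjunct2[OF fr]]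
  interpret C: cring "completion R p" by (rule R.cring_completion)
  interpret T: cring T by (rule T)
  show "(%r. gh (frob R \<tau> p (to_completion R p r))) \<in> ring_hom R T"
    using ring_hom_trans[OF ring_hom_trans[OF R.to_completion_hom f1] gh(1)] by (simp add: o_def)
  show "(%r. cl (LL (p * m) i r)) \<in> ring_hom R T"
    using ring_hom_trans[OF LL_hom[OF pm[OF m p]] cl] by (simp add: o_def)
  have tc: "to_completion R p s \<in> carrier (completion R p)" if "s \<in> carrier R" for s
    using ring_hom_closed[OF R.to_completion_hom that] .
  show "gh (frob R \<tau> p (to_completion R p \<tau>)) = cl (LL (p * m) i \<tau>)"
    using ring_hom_nat_pow[OF C.is_cring T gh(1) tc[OF tau_closed], of p]
    by (simp add: f3 gh(2)[OF tau_closed] gg_tau LL_tau[OF pm[OF m p]] cl_ops(4)[OF W_closed(7)[OF W_Q] W_closed(1)]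
        mult.commute[of "m * i" p] mult.assoc[of p m i] flip: power_mult)
  fix s assume s: "s \<in> carrier R"
  let ?x = "to_completion R p s"
  have fx: "frob R \<tau> p ?x \<in> carrier (completion R p)" using ring_hom_closed[OF f1 tc[OF s]] .
  obtain a where a: "a \<in> carrier (completion R p)"
    "frob R \<tau> p ?x \<ominus>\<^bsub>completion R p\<^esub> ?x [^]\<^bsub>completion R p\<^esub> p = a \<otimes>\<^bsub>completion R p\<^esub> int_in (completion R p) (int p ^ 1)"
    using bspec[OF f2 tc[OF s]] unfolding C.padic_ideal_iff by blast
  obtain G where G: "G \<in> W (p * m)" "gh a = cl G"
    using ring_hom_closed[OF gh(1) a(1)] ideal.Quot_carrierE[OF ideal_NN] by (metis rg_simps(1))
  \<comment> \<open>One term beyond the cut-off of \<open>rho\<close>, so that the term with index 0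
    can always be split off.\<close>
  define K where "K = Suc (qq p m * t)"
  define S where "S = (\<Sum>j<K. fps_const (LL m i s $ j) * DD p m ^ j)"
  have SW: "S \<in> W (p * m)" unfolding S_def by (intro W_closed(10) rho_term[OF m p] LL_W)
  have gS: "gg s = cl S"
    using rho_extend[OF m p LL_W, of t K i s] SW rho_W[OF m p LL_W, of t i s] unfolding gg_def S_def[symmetric]
    by (subst eq_commute, subst cl_eq) (simp_all add: K_def)
  show "gh (frob R \<tau> p ?x) \<ominus>\<^bsub>T\<^esub> cl (LL (p * m) i s) \<in> cl ` II 1"
  proof -
    \<comment> \<open>The constant coefficient of S is \<open>ev s\<close> plus (zeta_pm - zeta_m)
      times b, since the powers of q - zeta_m with positive exponent contribute multiples of that
      difference.\<close>
    define b where "b = (\<Sum>j<qq p m * t. LL m i s $ Suc j * \<delta> p m ^ j)"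
    have LZ: "LL m i s $ j \<in> Zz \<zeta> (p * m)" for j using W_nth[OF LL_W] Zz_pm[OF m p] by blast
    have b: "b \<in> Zz \<zeta> (p * m)" unfolding b_def by (intro Zz_closed(4,7,10) LZ delta_mem[OF m p])
    have S0: "S $ 0 = of_int (ev s) + \<delta> p m * b"
      unfolding S_def K_def sum.lessThan_Suc_shift fps_add_nth fps_sum_nth
      by (simp add: LL_0[OF s] b_def sum_distrib_left DD_def fps_nth_power_0 mult_ac)
    define y where "y = (\<Sum>i<p. of_int (ev s) ^ (p - Suc i) * (S $ 0) ^ i)"
    have y: "y \<in> Zz \<zeta> (p * m)" unfolding y_def by (intro Zz_closed(4,7,8,10) W_nth[OF SW])
    have d: "(S $ 0) ^ p - of_int (ev s) ^ p = \<delta> p m * (b * y)"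
      unfolding y_def power_diff_sumr2 by (simp add: S0)
    obtain c where "ev s ^ p - ev s = int p * c" using fermat_dvd[OF p, of "ev s"] by (elim dvdE)
    from arg_cong[OF this, of "of_int :: int => complex"]
    have c: "of_int (ev s) ^ p - of_int (ev s) = (of_nat p * of_int c :: complex)" by simp
    \<comment> \<open>A representative of the difference of the two maps at s; its constant
      coefficient is a multiple of p plus a multiple of zeta_pm - zeta_m.\<close>
    let ?F = "S ^ p + G * of_nat p - LL (p * m) i s"
    have "?F $ 0 = of_nat p * (of_int c + G $ 0) + \<delta> p m ^ 1 * (b * y)"
      using c d by (simp add: LL_0[OF s] fps_nth_power_0 algebra_simps flip: fps_of_nat)
    moreover have "of_int c + G $ 0 \<in> Zz \<zeta> (p * m)" "b * y \<in> Zz \<zeta> (p * m)"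
      using b y W_nth[OF G(1)] by (auto intro: Zz_closed(3,4,8))
    moreover have FW: "S ^ p \<in> W (p * m)" "G * of_nat p \<in> W (p * m)" "LL (p * m) i s \<in> W (p * m)"
      by (intro W_closed(4,7,9) SW G LL_W)+
    moreover have "?F \<in> W (p * m)" by (intro W_closed(3,6) FW)
    ultimately have F: "?F \<in> II 1" unfolding II_def by blast
    have "frob R \<tau> p ?x = ?x [^]\<^bsub>completion R p\<^esub> p \<oplus>\<^bsub>completion R p\<^esub> a \<otimes>\<^bsub>completion R p\<^esub> int_in (completion R p) (int p)"
    proof -
      have xp: "?x [^]\<^bsub>completion R p\<^esub> p \<in> carrier (completion R p)" by (rule C.nat_pow_closed[OF tc[OF s]])
      have "frob R \<tau> p ?x = ?x [^]\<^bsub>completion R p\<^esub> p \<oplus>\<^bsub>completion R p\<^esub> (frob R \<tau> p ?x \<ominus>\<^bsub>completion R p\<^esub> ?x [^]\<^bsub>completion R p\<^esub> p)"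
        using C.r_neg1[OF xp fx] by (simp only: C.minus_eq C.a_comm[OF fx C.a_inv_closed[OF xp]]) (simp add: C.r_neg2[OF xp fx])
      then show ?thesis by (simp only: a(2) power_one_right)
    qed
    then have "gh (frob R \<tau> p ?x) = gh (?x [^]\<^bsub>completion R p\<^esub> p) \<oplus>\<^bsub>T\<^esub> gh a \<otimes>\<^bsub>T\<^esub> gh (int_in (completion R p) (int p))"
      using ring_hom_add[OF gh(1)] ring_hom_mult[OF gh(1)] a(1) C.nat_pow_closed[OF tc[OF s], of p] C.int_in_closed[of "int p"] by simp
    also have "gh (?x [^]\<^bsub>completion R p\<^esub> p) = cl (S ^ p)"
      using ring_hom_nat_pow[OF C.is_cring T gh(1) tc[OF s], of p] cl_ops(4)[OF SW SW] by (simp add: gh(2)[OF s] gS)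
    also have "gh (int_in (completion R p) (int p)) = cl (of_nat p)"
      using ring_hom_int_in[OF C.is_cring T gh(1), of "int p"] cl_ops(5)[OF SW SW, of "int p"] by simp
    finally have "gh (frob R \<tau> p ?x) \<ominus>\<^bsub>T\<^esub> cl (LL (p * m) i s) = cl ?F"
      using FW G SW by (simp add: cl_ops W_closed)
    then show ?thesis using F by blast
  qed
qed

private abbreviation "Rp \<equiv> completion R p"
private abbreviation "\<iota> \<equiv> to_completion R p"
private abbreviation "SS \<equiv> ext \<zeta> Rp (\<iota> \<tau>) (p * m) m"
private abbreviation "cc \<equiv> ext_const \<zeta> Rp (\<iota> \<tau>) (p * m) m"
private abbreviation "zz \<equiv> ext_num \<zeta> Rp (\<iota> \<tau>) (p * m) m"
private abbreviation "yy \<equiv> ext_root \<zeta> Rp (\<iota> \<tau>) (p * m) m"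
private abbreviation "uu \<equiv> ext_map \<zeta> R m SS (%r. cc (\<iota> r)) (zz (\<zeta> m)) yy"
private abbreviation "vv \<equiv> ext_map \<zeta> R (p * m) SS (%r. cc (frob R \<tau> p (\<iota> r))) (zz (\<zeta> (p * m))) yy"

private lemma Rp: "cring Rp" by (rule R.cring_completion)

private lemma tRp: "\<iota> \<tau> \<in> carrier Rp" using ring_hom_closed[OF R.to_completion_hom tau_closed] .

private lemma SS: "cring SS" by (rule cring_ext[OF Rp tRp])

private lemma fro: "frob R \<tau> p \<in> ring_hom Rp Rp" "frob R \<tau> p (\<iota> \<tau>) = \<iota> \<tau> [^]\<^bsub>Rp\<^esub> p"
  using frob[OF p] by (simp_all add: frobenius_lift_def)

private lemma zz: "zz \<in> ring_hom (rg (Zz \<zeta> (p * m))) SS" "zz \<in> ring_hom (rg (Zz \<zeta> m)) SS"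
proof -
  show 1: "zz \<in> ring_hom (rg (Zz \<zeta> (p * m))) SS" by (rule ext_num_hom[OF Rp tRp])
  show "zz \<in> ring_hom (rg (Zz \<zeta> m)) SS"
    using subsetD[OF Zz_pm[OF m p]] ring_hom_closed[OF 1] ring_hom_mult[OF 1] ring_hom_add[OF 1] ring_hom_one[OF 1]
    by (intro ring_hom_memI) (simp_all only: rg_simps)
qed

private lemma cc: "cc \<in> ring_hom Rp SS" by (rule ext_const_hom[OF Rp tRp])

private lemma yy: "yy \<in> carrier SS" "yy [^]\<^bsub>SS\<^esub> m = cc (\<iota> \<tau>)"
  by (rule ext_root_closed[OF Rp tRp], rule ext_root_pow[OF Rp tRp])

private lemma yy_pm: "yy [^]\<^bsub>SS\<^esub> (p * m) = cc (frob R \<tau> p (\<iota> \<tau>))"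
proof -
  interpret cring SS by (rule SS)
  show ?thesis
    unfolding fro(2) ring_hom_nat_pow[OF Rp SS cc tRp, of p] yy(2)[symmetric] nat_pow_pow[OF yy(1), of m p]
    by (simp only: mult.commute)
qed

private lemma h1: "(%r. cc (\<iota> r)) \<in> ring_hom R SS"
  using ring_hom_trans[OF R.to_completion_hom cc] by (simp add: o_def)

private lemma h2: "(%r. cc (frob R \<tau> p (\<iota> r))) \<in> ring_hom R SS"
  using ring_hom_trans[OF ring_hom_trans[OF R.to_completion_hom fro(1)] cc] by (simp add: o_def)

private lemmas uu = ext_map[where h = "%r. cc (\<iota> r)" and \<theta> = zz and y = yy and T = SS, OF cring_R tau_closed SS h1 zz(2) yy]
private lemmas vv = ext_map[where h = "%r. cc (frob R \<tau> p (\<iota> r))" and \<theta> = zz and y = yy and T = SS, OF cring_R tau_closed SS h2 zz(1) yy(1) yy_pm]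

private definition "th = (%w. cl (fps_const w))"

private lemma th: "th \<in> ring_hom (rg (Zz \<zeta> (p * m))) T"
proof -
  have "(%w. fps_const w) \<in> ring_hom (rg (Zz \<zeta> (p * m))) (rg (W (p * m)))" by (rule ring_hom_memI) auto
  from ring_hom_trans[OF this cl] show ?thesis by (simp add: o_def th_def)
qed

text \<open>The test map from R_p[zeta_pm, t^(1/m)] to \<open>T\<close> with t^(1/m) going to q^i.
  It turns the p-adic compatibility condition on f into congruences modulo \<open>N\<close>.\<close>

private definition "Psi = ext_map \<zeta> Rp (p * m) T gh (th (\<zeta> (p * m))) (cl (Q (p * m) ^ i))"

private lemma Psi:
  shows "Psi \<in> ring_hom SS T" and "a \<in> carrier Rp ==> Psi (cc a) = gh a"
    and "w \<in> Zz \<zeta> (p * m) ==> Psi (zz w) = th w" and "Psi yy = cl (Q (p * m) ^ i)"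
proof -
  have 1: "cl (Q (p * m) ^ i) \<in> carrier T" by (intro cl_T W_closed(7) W_Q)
  have 2: "cl (Q (p * m) ^ i) [^]\<^bsub>T\<^esub> m = gh (\<iota> \<tau>)"
    by (simp add: gh(2)[OF tau_closed] gg_tau cl_ops(4)[OF W_closed(7)[OF W_Q] W_closed(1)] mult.commute[of i m] flip: power_mult)
  note em = ext_map[where h = gh and \<theta> = th and T = T, OF Rp tRp T gh(1) th 1 2]
  show "Psi \<in> ring_hom SS T" "a \<in> carrier Rp ==> Psi (cc a) = gh a"
    "w \<in> Zz \<zeta> (p * m) ==> Psi (zz w) = th w" "Psi yy = cl (Q (p * m) ^ i)"
    unfolding Psi_def by (rule em(1), rule em(2), assumption, rule em(3), assumption, rule em(4))
qed

private lemma Psi_uu: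
  assumes x: "x \<in> carrier (XT m)" shows "Psi (uu x) = cl (rho p m t (sg m i x))"
proof (rule ext_hom_unique[OF cring_R tau_closed T _ _ _ _ _ x, where G = "%x. Psi (uu x)" and H = "%x. cl (rho p m t (sg m i x))"])
  show "(%x. Psi (uu x)) \<in> ring_hom (XT m) T" using ring_hom_trans[OF uu(1) Psi(1)] by (simp add: o_def)
  show "(%x. cl (rho p m t (sg m i x))) \<in> ring_hom (XT m) T"
    using ring_hom_trans[OF sg_map(2)[OF m] rho_hom[OF m p]] by (simp add: o_def)
  show "Psi (uu (ext_const \<zeta> R \<tau> m m a)) = cl (rho p m t (sg m i (ext_const \<zeta> R \<tau> m m a)))" if a: "a \<in> carrier R" for a
    using ring_hom_closed[OF R.to_completion_hom a] by (simp add: uu(2)[OF a] Psi(2) gh(2)[OF a] sg_map(3)[OF m a] gg_def)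
  have "cl (rho p m t (fps_const (\<zeta> m))) = cl (fps_const (\<zeta> m))"
    using rho_const[OF m p Zz_zeta] rho_W[OF m p W_const[OF Zz_zeta]] W_const[OF subsetD[OF Zz_pm[OF m p] Zz_zeta]]
    by (subst cl_eq) auto
  then show "Psi (uu (ext_num \<zeta> R \<tau> m m (\<zeta> m))) = cl (rho p m t (sg m i (ext_num \<zeta> R \<tau> m m (\<zeta> m))))"
    using subsetD[OF Zz_pm[OF m p] Zz_zeta] by (simp only: uu(3)[OF Zz_zeta] Psi(3) sg_map(4)[OF m Zz_zeta] th_def)
  show "Psi (uu (ext_root \<zeta> R \<tau> m m)) = cl (rho p m t (sg m i (ext_root \<zeta> R \<tau> m m)))"
    by (simp only: uu(4) Psi(4) sg_map(5)[OF m] rho_Q)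
qed

text \<open>Two homomorphisms are compared on generators; on constants this is
  \<open>frob_agree\<close>.\<close>

private lemma Psi_vv:
  assumes x: "x \<in> carrier (XT (p * m))" shows "Psi (vv x) = cl (sg (p * m) i x)"
proof (rule ext_hom_unique[OF cring_R tau_closed T _ _ _ _ _ x, where G = "%x. Psi (vv x)" and H = "%x. cl (sg (p * m) i x)"])
  note pm1 = pm[OF m p]
  show "(%x. Psi (vv x)) \<in> ring_hom (XT (p * m)) T" using ring_hom_trans[OF vv(1) Psi(1)] by (simp add: o_def)
  show "(%x. cl (sg (p * m) i x)) \<in> ring_hom (XT (p * m)) T"
    using ring_hom_trans[OF sg_map(2)[OF pm1] cl] by (simp add: o_def)
  show "Psi (vv (ext_const \<zeta> R \<tau> (p * m) (p * m) a)) = cl (sg (p * m) i (ext_const \<zeta> R \<tau> (p * m) (p * m) a))" if a: "a \<in> carrier R" for a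
    using ring_hom_closed[OF fro(1) ring_hom_closed[OF R.to_completion_hom a]]
    by (simp only: vv(2)[OF a] Psi(2) frob_agree[OF a] sg_map(3)[OF pm1 a])
  show "Psi (vv (ext_num \<zeta> R \<tau> (p * m) (p * m) (\<zeta> (p * m)))) = cl (sg (p * m) i (ext_num \<zeta> R \<tau> (p * m) (p * m) (\<zeta> (p * m))))"
    by (simp only: vv(3)[OF Zz_zeta] Psi(3)[OF Zz_zeta] sg_map(4)[OF pm1 Zz_zeta] th_def)
  show "Psi (vv (ext_root \<zeta> R \<tau> (p * m) (p * m))) = cl (sg (p * m) i (ext_root \<zeta> R \<tau> (p * m) (p * m)))"
    by (simp only: vv(4) Psi(4) sg_map(5)[OF pm1])
qed

text \<open>\<open>Psi\<close> kills p^t, so the convergence of coefficient j in the compatibility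
  condition becomes a congruence modulo \<open>N\<close> for all large K.\<close>

private lemma reexpands_coeff:
  assumes a: "!!k. a k \<in> carrier (XT m)" and b: "!!k. b k \<in> carrier (XT (p * m))"
    and c: "habiro_compatible \<zeta> R \<tau> p m a b"
  shows "\<exists>K0. \<forall>K\<ge>K0. (\<Sum>k\<le>K. of_nat (k choose j) * (rho p m t (sg m i (a k)) * fps_const (\<delta> p m) ^ (k - j))) - sg (p * m) i (b j) \<in> N"
proof -
  interpret S: cring SS by (rule SS)
  interpret T: cring T by (rule T)
  let ?d = "zz (\<zeta> (p * m)) \<ominus>\<^bsub>SS\<^esub> zz (\<zeta> m)"
  let ?f = "%k. int_in SS (int (k choose j)) \<otimes>\<^bsub>SS\<^esub> (uu (a k) \<otimes>\<^bsub>SS\<^esub> ?d [^]\<^bsub>SS\<^esub> (k - j))"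
  let ?F = "%k. of_nat (k choose j) * (rho p m t (sg m i (a k)) * fps_const (\<delta> p m) ^ (k - j))"
  have "reexpands SS p ?d (%k. uu (a k)) (%k. vv (b k))" using c unfolding habiro_compatible_def Let_def .
  then have "padic_sums SS p ?f (vv (b j))" unfolding reexpands_def by (rule spec)
  then have "\<exists>K0. \<forall>K\<ge>K0. finsum SS ?f {..K} \<ominus>\<^bsub>SS\<^esub> vv (b j) \<in> padic_ideal SS p t"
    unfolding padic_sums_def by (rule spec)
  then obtain K0 where K0': "\<forall>K\<ge>K0. finsum SS ?f {..K} \<ominus>\<^bsub>SS\<^esub> vv (b j) \<in> padic_ideal SS p t"
    by (rule exE)
  note K0 = K0'[rule_format]
  have zc: "zz (\<zeta> (p * m)) \<in> carrier SS" "zz (\<zeta> m) \<in> carrier SS"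
    using ring_hom_closed[OF zz(1)] subsetD[OF Zz_pm[OF m p] Zz_zeta] Zz_zeta by simp_all
  have dc: "?d \<in> carrier SS" using zc by simp
  have uc: "uu (a k) \<in> carrier SS" for k by (rule ring_hom_closed[OF uu(1) a])
  have vc: "vv (b k) \<in> carrier SS" for k by (rule ring_hom_closed[OF vv(1) b])
  have dW: "fps_const (\<delta> p m) \<in> W (p * m)" by (rule W_const[OF delta_mem[OF m p]])
  have rW: "rho p m t (sg m i (a k)) \<in> W (p * m)" for k
    using ring_hom_closed[OF sg_map(2)[OF m] a] by (intro rho_W[OF m p]) simp
  have sW: "sg (p * m) i (b k) \<in> W (p * m)" for k using ring_hom_closed[OF sg_map(2)[OF pm[OF m p]] b] by simp
  have fc: "?f k \<in> carrier SS" for k by (intro S.m_closed S.int_in_closed S.nat_pow_closed uc dc)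
  have FW: "?F k \<in> W (p * m)" for k by (intro W_closed(4,7,9) rW dW)
  have Pd: "Psi ?d = cl (fps_const (\<delta> p m))"
    using ring_hom_minus[OF SS T Psi(1) zc] subsetD[OF Zz_pm[OF m p] Zz_zeta] Zz_zeta
    by (simp add: Psi(3) th_def cl_ops W_const \<delta>_def)
  have Pf: "Psi (?f k) = cl (?F k)" for k
  proof -
    have "Psi (?f k) = int_in T (int (k choose j)) \<otimes>\<^bsub>T\<^esub> (cl (rho p m t (sg m i (a k))) \<otimes>\<^bsub>T\<^esub> cl (fps_const (\<delta> p m)) [^]\<^bsub>T\<^esub> (k - j))"
      by (simp only: ring_hom_mult[OF Psi(1) S.int_in_closed S.m_closed[OF uc S.nat_pow_closed[OF dc]]]
        ring_hom_mult[OF Psi(1) uc S.nat_pow_closed[OF dc]] ring_hom_nat_pow[OF SS T Psi(1) dc]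
        ring_hom_int_in[OF SS T Psi(1)] Pd Psi_uu[OF a])
    also have "... = cl (?F k)" by (simp only: cl_ops(4,5)[OF dW dW] cl_ops(1)[OF rW W_closed(7)[OF dW]]
        cl_ops(1)[OF W_closed(9) W_closed(4)[OF rW W_closed(7)[OF dW]]] of_int_of_nat_eq)
    finally show ?thesis .
  qed
  have Psum: "Psi (finsum SS ?f {..K}) = cl (\<Sum>k\<le>K. ?F k)" for K
    using ring_hom_finsum[OF SS T Psi(1), of ?f "{..K}"] fc
      ring_hom_finsum[OF cring_rg[OF subring_W] T cl, of ?F "{..K}"] FW finsum_rg[OF subring_W, of "{..K}" ?F "p * m"]
    by (simp add: Pf)
  have "(\<Sum>k\<le>K. ?F k) - sg (p * m) i (b j) \<in> N" if "K \<ge> K0" for K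
  proof -
    have "Psi (finsum SS ?f {..K} \<ominus>\<^bsub>SS\<^esub> vv (b j)) = \<zero>\<^bsub>T\<^esub>"
      by (rule padic_hom_zero[OF SS T Psi(1) T_p K0[OF that]])
    then have z: "Psi (finsum SS ?f {..K}) \<ominus>\<^bsub>T\<^esub> Psi (vv (b j)) = \<zero>\<^bsub>T\<^esub>"
      using ring_hom_minus[OF SS T Psi(1) S.finsum_closed vc, of ?f "{..K}" j] fc by simp
    have "cl (\<Sum>k\<le>K. ?F k) \<ominus>\<^bsub>T\<^esub> cl (sg (p * m) i (b j)) = \<zero>\<^bsub>T\<^esub>"
      using z unfolding Psum Psi_vv[OF b] .
    moreover have "(\<Sum>k\<le>K. ?F k) \<in> W (p * m)" by (rule W_closed(10)) (rule FW)
    ultimately show ?thesis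
      using ideal.coset_zero_iff[OF ideal_NN, of "(\<Sum>k\<le>K. ?F k) - sg (p * m) i (b j)"] sW W_closed(6)
      by (simp add: cl_ops)
  qed
  then show ?thesis by blast
qed

text \<open>Expand (q - zeta_m)^k binomially in q - zeta_pm and interchange the two sums: the inner
  sums are those compared in \<open>reexpands_coeff\<close>. Modulo \<open>N\<close> all sums can be
  truncated.\<close>

lemma Spec_compat_t:
  assumes a: "!!k. a k \<in> carrier (XT m)" and b: "!!k. b k \<in> carrier (XT (p * m))"
    and c: "habiro_compatible \<zeta> R \<tau> p m a b"
  shows "rho p m t (Spec m i a) - Spec (p * m) i b \<in> N"
proof -
  let ?s = "%k. sg m i (a k)" and ?s' = "%k. sg (p * m) i (b k)"
  let ?r = "%k. rho p m t (?s k)" and ?D = "DD p m" and ?e = "fps_const (\<delta> p m)"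
  have sW: "?s k \<in> W m" for k using ring_hom_closed[OF sg_map(2)[OF m] a] by simp
  have s'W: "?s' k \<in> W (p * m)" for k using ring_hom_closed[OF sg_map(2)[OF pm[OF m p]] b] by simp
  have rW: "?r k \<in> W (p * m)" for k by (rule rho_W[OF m p sW])
  have eW: "?e \<in> W (p * m)" by (rule W_const[OF delta_mem[OF m p]])
  have DW: "?D \<in> W (p * m)" by (rule DD_W[OF m p])
  have "\<forall>j. \<exists>K0. \<forall>K\<ge>K0. (\<Sum>k\<le>K. of_nat (k choose j) * (?r k * ?e ^ (k - j))) - ?s' j \<in> N"
    using reexpands_coeff[OF a b c] by (rule allI)
  from choice[OF this] obtain K0
    where K0': "\<forall>j. \<forall>K\<ge>K0 j. (\<Sum>k\<le>K. of_nat (k choose j) * (?r k * ?e ^ (k - j))) - ?s' j \<in> N"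
    by (rule exE)
  note K0 = K0'[rule_format]
  \<comment> \<open>Beyond the cut-off of \<open>rho\<close> and beyond the bounds for the finitely
    many coefficients below t.\<close>
  define K where "K = Max (insert (qq p m * t) (K0 ` {..<t}))"
  have K: "K \<ge> qq p m * t" "!!j. j < t ==> K \<ge> K0 j" by (auto simp: K_def)
  let ?A = "\<Sum>k\<le>K. ?r k * ?D ^ k"
  have Xt: "fps_X ^ n \<in> N" if "n \<ge> t" for n by (rule subsetD[OF NN_antimono[OF that] NN_power[OF NN_X]])
  \<comment> \<open>The terms past K contain (q - zeta_m)^(K+1), whose re-expansion lies in
    \<open>N\<close>.\<close>
  have 1: "rho p m t (Spec m i a) - ?A \<in> N"
  proof -
    define h where "h = (%F. cl (rho p m t F))"
    have h: "h \<in> ring_hom (rg (W m)) T" unfolding h_def by (rule rho_hom[OF m p])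
    interpret T: cring T by (rule T)
    let ?G = "Spec m i (%k. a (k + Suc K))"
    have GW: "?G \<in> W m" by (rule Spec_W[OF m a])
    have hX: "h fps_X = cl ?D" unfolding h_def using rho_X[OF m p] rho_W[OF m p W_X] DW by (subst cl_eq) auto
    have hXk: "h (fps_X ^ k) = cl (?D ^ k)" for k
      using ring_hom_nat_pow[OF cring_rg[OF subring_W] T h, of fps_X k] W_X by (simp add: hX cl_ops(4)[OF DW DW])
    have hs: "h (fps_X ^ k * ?s k) = cl (?r k * ?D ^ k)" for k
    proof -
      have "h (fps_X ^ k * ?s k) = cl (?D ^ k) \<otimes>\<^bsub>T\<^esub> cl (?r k)"
        using ring_hom_mult[OF h, of "fps_X ^ k" "?s k"] sW[of k] W_closed(7)[OF W_X, of k m] unfolding hXk[symmetric] h_def by simp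
      also have "... = cl (?D ^ k * ?r k)" by (rule cl_ops(1)[OF W_closed(7)[OF DW] rW])
      finally show ?thesis by (simp only: mult.commute[of "?D ^ k"])
    qed
    have rDW: "?r k * ?D ^ k \<in> W (p * m)" for k by (intro W_closed(4,7) rW DW)
    have sXW: "fps_X ^ k * ?s k \<in> W m" for k by (intro W_closed(4,7) sW W_X)
    have sumW: "(\<Sum>k<Suc K. fps_X ^ k * ?s k) \<in> W m" by (rule W_closed(10)) (rule sXW)
    have XG: "fps_X ^ Suc K * ?G \<in> W m" by (intro W_closed(4,7) W_X GW)
    have "h (fps_X ^ Suc K * ?G) = cl (?D ^ Suc K) \<otimes>\<^bsub>T\<^esub> h ?G"
      using ring_hom_mult[OF h, of "fps_X ^ Suc K" ?G] GW W_closed(7)[OF W_X, of "Suc K" m] unfolding hXk[symmetric] by (simp del: power_Suc)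
    also have "cl (?D ^ Suc K) = \<zero>\<^bsub>T\<^esub>"
      by (rule ideal.coset_zero_iff[OF ideal_NN, THEN iffD2, rotated])
        (use DD_power_NN[OF m p, of t "Suc K"] K(1) W_closed(7)[OF DW, of "Suc K"] in simp_all)
    finally have z: "h (fps_X ^ Suc K * ?G) = \<zero>\<^bsub>T\<^esub>" using ring_hom_closed[OF h, of ?G] GW by simp
    have "h (\<Sum>k<Suc K. fps_X ^ k * ?s k) = cl (\<Sum>k<Suc K. ?r k * ?D ^ k)"
      using ring_hom_finsum[OF cring_rg[OF subring_W] T h, of "%k. fps_X ^ k * ?s k" "{..<Suc K}"] sXW
        finsum_rg[OF subring_W, of "{..<Suc K}" "%k. fps_X ^ k * ?s k" m]
        ring_hom_finsum[OF cring_rg[OF subring_W] T cl, of "%k. ?r k * ?D ^ k" "{..<Suc K}"] rDW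
        finsum_rg[OF subring_W, of "{..<Suc K}" "%k. ?r k * ?D ^ k" "p * m"]
      by (simp add: hs del: sum.lessThan_Suc)
    then have "h (Spec m i a) = cl ?A"
      using ring_hom_add[OF h, of "\<Sum>k<Suc K. fps_X ^ k * ?s k" "fps_X ^ Suc K * ?G"] sumW XG z
        cl_T[OF W_closed(10)[of "{..<Suc K}" "%k. ?r k * ?D ^ k"]] rDW
      by (subst Spec_split[of m i a "Suc K"]) (simp add: lessThan_Suc_atMost del: sum.lessThan_Suc power_Suc)
    moreover have "?A \<in> W (p * m)" by (rule W_closed(10)) (rule rDW)
    ultimately show ?thesis unfolding h_def using rho_W[OF m p Spec_W[OF m a]] by (subst (asm) cl_eq) auto
  qed
  let ?B = "\<Sum>j<t. fps_X ^ j * (\<Sum>k\<le>K. of_nat (k choose j) * (?r k * ?e ^ (k - j)))"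
  \<comment> \<open>The binomial terms with (q - zeta_pm)^j lie in \<open>N\<close> for j at least
    t.\<close>
  have 2: "?A - ?B \<in> N"
  proof -
    have B: "?B = (\<Sum>k\<le>K. ?r k * (\<Sum>j<t. of_nat (k choose j) * fps_X ^ j * ?e ^ (k - j)))"
      unfolding sum_distrib_left by (subst sum.swap) (simp add: mult_ac)
    have D: "?D ^ k - (\<Sum>j<t. of_nat (k choose j) * fps_X ^ j * ?e ^ (k - j)) \<in> N" (is "_ - ?S k \<in> _") for k
    proof -
      let ?f = "%j. of_nat (k choose j) * fps_X ^ j * ?e ^ (k - j)"
      have "?D ^ k = sum ?f {..k}" unfolding DD_def by (rule binomial_ring)
      also have "... = sum ?f {..<t + Suc k}" by (rule sum.mono_neutral_left) (auto simp: binomial_eq_0)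
      also have "... = ?S k + sum ?f {t..<t + Suc k}"
        by (simp only: lessThan_atLeast0 sum.atLeastLessThan_concat le_add1 zero_le)
      finally have "?D ^ k - ?S k = sum ?f {t..<t + Suc k}" by simp
      also have "... \<in> N" by (rule NN_closed(5)) (intro NN_mult_W NN_W_mult Xt W_closed(7,9) eW, simp)
      finally show ?thesis .
    qed
    have "?A - ?B = (\<Sum>k\<le>K. ?r k * (?D ^ k - (\<Sum>j<t. of_nat (k choose j) * fps_X ^ j * ?e ^ (k - j))))"
      unfolding B by (simp add: right_diff_distrib sum_subtractf)
    also have "... \<in> N" by (rule NN_closed(5)) (intro NN_W_mult D rW)
    finally show ?thesis .
  qed
  let ?C = "\<Sum>j<t. fps_X ^ j * ?s' j"
  have 3: "?B - ?C \<in> N" unfolding sum_subtractf[symmetric] right_diff_distrib[symmetric]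
    by (rule NN_closed(5)) (intro NN_W_mult K0 K(2) W_closed(7) W_X, simp)
  have 4: "?C - Spec (p * m) i b \<in> N"
  proof -
    have "?C - Spec (p * m) i b = - (fps_X ^ t * Spec (p * m) i (%k. b (k + t)))"
      by (subst Spec_split[of "p * m" i b t]) simp
    also have "... \<in> N" by (intro NN_closed(3) NN_mult_W Xt Spec_W[OF pm[OF m p]] b order.refl)
    finally show ?thesis .
  qed
  show ?thesis using NN_closed(2)[OF NN_closed(2)[OF 1 2] NN_closed(2)[OF 3 4]] by simp
qed

end

lemma Spec_compat:
  assumes "m \<ge> 1" "Factorial_Ring.prime p" "!!k. a k \<in> carrier (XT m)" "!!k. b k \<in> carrier (XT (p * m))"
    and "habiro_compatible \<zeta> R \<tau> p m a b"
  shows "compat p m (Spec m i a) (Spec (p * m) i b)" unfolding compat_def using Spec_compat_t[OF assms] by blast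

abbreviation "XX \<equiv> habiro_ext \<zeta> R \<eta>"

lemma XX_component:
  assumes "f \<in> carrier XX" "m \<ge> 1"
  shows "f m k \<in> carrier (XT m)"
  using assms by (auto simp: habiro_ext_def Let_def carrier_update_simps prod_ring_simps pseries_simps PiE_iff)

lemma XX_extensional: "f \<in> carrier XX ==> f \<in> extensional {1..}"
  by (auto simp: habiro_ext_def Let_def carrier_update_simps prod_ring_simps PiE_iff)

lemma XX_compatible:
  assumes "f \<in> carrier XX" "m \<ge> 1" "Factorial_Ring.prime p"
  shows "habiro_compatible \<zeta> R \<tau> p m (f m) (f (p * m))"
  using assms by (auto simp: habiro_ext_def Let_def carrier_update_simps)

lemma specialize_HZ:
  assumes f: "f \<in> carrier XX"
  shows "specialize \<zeta> R \<eta> ev (int i) f \<in> carrier HZ"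
    and "m \<ge> 1 ==> HE m (specialize \<zeta> R \<eta> ev (int i) f) = Spec m i (f m)"
proof -
  show H: "HE m (specialize \<zeta> R \<eta> ev (int i) f) = Spec m i (f m)" if "m \<ge> 1" for m
    by (rule specialize_coords(2)[where f = f, OF that XX_component[OF f that]])
  show "specialize \<zeta> R \<eta> ev (int i) f \<in> carrier HZ"
  proof (rule HZ_memI[where F = "%m. Spec m i (f m)", OF _ _ H])
    show "specialize \<zeta> R \<eta> ev (int i) f \<in> extensional {1..}" by (simp add: specialize_def)
    show "specialize \<zeta> R \<eta> ev (int i) f m \<in> carrier (pseries (cyc \<zeta> \<Z> m))" if "m \<ge> 1" for m
      by (rule specialize_coords(1)[where f = f, OF that XX_component[OF f that]])
    show "compat p m (Spec m i (f m)) (Spec (p * m) i (f (p * m)))"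
      if "m \<ge> 1" "Factorial_Ring.prime p" for m p
      by (rule Spec_compat[OF that XX_component[OF f that(1)] XX_component[OF f pm[OF that]] XX_compatible[OF f that]])
  qed
qed

end

section \<open>Newton expansions\<close>

lemma fps_X_power_dvd_iff: "fps_X ^ n dvd F \<longleftrightarrow> (\<forall>j<n. F $ j = 0)"
  for F :: "'a::comm_ring_1 fps"
proof
  assume *: "\<forall>j<n. F $ j = 0"
  have "F = fps_X ^ n * fps_shift n F" by (rule fps_ext) (use * in \<open>auto simp: fps_X_power_mult_nth\<close>)
  then show "fps_X ^ n dvd F" by (rule dvdI)
qed (auto elim!: dvdE simp: fps_X_power_mult_nth)

context habiro_etale
begin

text \<open>The Newton polynomial of degree l for the nodes 1, q, q^2, ..., evaluated at t = q^i. It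
  vanishes for l > i, which makes Newton sums finite.\<close>

definition nb :: "nat => nat => nat => complex fps" where
  "nb m i l = (\<Prod>j<l. Q m ^ i - Q m ^ j)"

definition nev :: "nat => (nat => complex fps) => nat => complex fps" where
  "nev m c i = (\<Sum>l\<le>i. c l * nb m i l)"

text \<open>Coefficient sequences \<open>c\<close> with \<open>c l = O((q - \<zeta>\<^sub>m)\<^bsup>w-l\<^esup>)\<close>. Multiplying the sequence \<open>\<Sum>\<^sub>l c\<^sub>l \<Prod>\<^sub>j\<^sub><\<^sub>l (q\<^sup>i - q\<^sup>j)\<close>
  by \<open>q\<^sup>m\<^sup>i - 1\<close> raises the weight \<open>w\<close>, which makes the expansions of specializations converge.\<close>

definition NC :: "nat => nat => (nat => complex fps) set" where
  "NC m w = {c. \<forall>l. c l \<in> W m & fps_X ^ (w - l) dvd c l}"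

definition NW :: "nat => nat => (nat => complex fps) set" where
  "NW m w = nev m ` NC m w"

text \<open>Multiplication by q^i on Newton coefficients, from q^i = q^l + (q^i - q^l): the second
  summand turns the l-th basis element into the next one.\<close>

definition mulQ :: "nat => (nat => complex fps) => nat => complex fps" where
  "mulQ m c l = Q m ^ l * c l + (case l of 0 => 0 | Suc k => c k)"

lemma nb_W: "nb m i l \<in> W m" unfolding nb_def by (intro W_closed(11) W_closed(6,7) W_Q)

lemma nev_mulQ: "nev m (mulQ m c) i = Q m ^ i * nev m c i"
proof -
  \<comment> \<open>The partial sums telescope up to one boundary term. At n = i it vanishes, its
    basis element containing the factor q^i - q^i.\<close>
  have "(\<Sum>l\<le>n. mulQ m c l * nb m i l) = Q m ^ i * (\<Sum>l\<le>n. c l * nb m i l) - c n * nb m i (Suc n)" for n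
    by (induction n) (simp_all add: mulQ_def nb_def algebra_simps)
  then show ?thesis by (simp add: nev_def nb_def)
qed

lemma NC_add: "c \<in> NC m w ==> d \<in> NC m w ==> (%l. c l + d l) \<in> NC m w"
  by (auto simp: NC_def intro: W_closed)

lemma NC_mult: "c \<in> NC m w ==> F \<in> W m ==> (%l. F * c l) \<in> NC m w"
  by (auto simp: NC_def intro: W_closed)

lemma NC_mulQ:
  assumes c: "c \<in> NC m w" shows "mulQ m c \<in> NC m w" unfolding NC_def
proof (intro CollectI allI conjI)
  fix l
  have cW: "c k \<in> W m" "fps_X ^ (w - k) dvd c k" for k using c by (auto simp: NC_def)
  show "mulQ m c l \<in> W m" unfolding mulQ_def by (cases l) (auto intro!: W_closed cW)
  show "fps_X ^ (w - l) dvd mulQ m c l"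
  proof (cases l)
    case 0
    then show ?thesis using cW(2)[of 0] by (simp add: mulQ_def)
  next
    case (Suc k)
    have "fps_X ^ (w - l) dvd c k" by (rule dvd_trans[OF le_imp_power_dvd cW(2)]) (use Suc in simp)
    moreover have "mulQ m c l = Q m ^ l * c l + c k" using Suc by (simp add: mulQ_def)
    ultimately show ?thesis using cW(2)[of l] by simp
  qed
qed

text \<open>An index shift by one raises the weight by one, so modulo weight w + 1 each application
  of \<open>mulQ\<close> is multiplication by q^l.\<close>

lemma NC_mulQ_pow:
  assumes c: "c \<in> NC m w"
  shows "(%l. (mulQ m ^^ n) c l - Q m ^ (l * n) * c l) \<in> NC m (Suc w)"
proof (induction n)
  case 0
  then show ?case by (simp add: NC_def W_closed)
next
  case (Suc n)
  let ?d = "%l. (mulQ m ^^ n) c l - Q m ^ (l * n) * c l"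
  have M: "(mulQ m ^^ n) c \<in> NC m w" by (induction n) (simp_all add: c NC_mulQ)
  define e where "e = (%l. case l of 0 => 0 | Suc k => (mulQ m ^^ n) c k)"
  have e: "e \<in> NC m (Suc w)" using M by (auto simp: NC_def e_def W_closed split: nat.split)
  have "(%l. Q m ^ l * ?d l) \<in> NC m (Suc w)" using Suc W_closed(4,7) W_Q by (auto simp: NC_def)
  from NC_add[OF this e]
  moreover have "(mulQ m ^^ Suc n) c l - Q m ^ (l * Suc n) * c l = Q m ^ l * ?d l + e l" for l
    by (cases l) (simp_all add: mulQ_def[of m "(mulQ m ^^ n) c"] e_def algebra_simps power_add)
  ultimately show ?case by (simp only:)
qed

lemma NW_add:
  assumes "u \<in> NW m w" "v \<in> NW m w" shows "(%i. u i + v i) \<in> NW m w"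
proof -
  obtain c d where "c \<in> NC m w" "d \<in> NC m w" "u = nev m c" "v = nev m d" using assms by (auto simp: NW_def)
  then show ?thesis
    unfolding NW_def by (intro image_eqI[OF _ NC_add[of c _ _ d]]) (simp_all add: nev_def distrib_right sum.distrib fun_eq_iff)
qed

lemma NW_mult:
  assumes "v \<in> NW m w" "F \<in> W m" shows "(%i. F * v i) \<in> NW m w"
proof -
  obtain c where "c \<in> NC m w" "v = nev m c" using assms by (auto simp: NW_def)
  then show ?thesis
    unfolding NW_def using assms(2) by (intro image_eqI[OF _ NC_mult]) (simp_all add: nev_def sum_distrib_left mult_ac fun_eq_iff)
qed

lemma NW_X:
  assumes "v \<in> NW m w" shows "(%i. fps_X ^ k * v i) \<in> NW m (w + k)"
proof -
  obtain c where c: "c \<in> NC m w" "v = nev m c" using assms by (auto simp: NW_def)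
  have "(%l. fps_X ^ k * c l) \<in> NC m (w + k)" unfolding NC_def
  proof (intro CollectI allI conjI)
    fix l
    have "fps_X ^ (w + k - l) dvd (fps_X ^ (k + (w - l)) :: complex fps)" by (rule le_imp_power_dvd) simp
    also have "... dvd fps_X ^ k * c l" using c(1) by (simp add: power_add NC_def)
    finally show "fps_X ^ (w + k - l) dvd fps_X ^ k * c l" .
    show "fps_X ^ k * c l \<in> W m" using c(1) by (intro W_closed(4,7) W_X) (simp add: NC_def)
  qed
  then show ?thesis
    unfolding NW_def c(2) by (rule image_eqI[rotated]) (simp add: nev_def sum_distrib_left mult_ac fun_eq_iff)
qed

lemma NW_Q:
  assumes "v \<in> NW m w" shows "(%i. Q m ^ i * v i) \<in> NW m w"
  using assms unfolding NW_def by (auto intro!: image_eqI[OF _ NC_mulQ] simp: nev_mulQ fun_eq_iff)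

lemma NW_Q_pow: "v \<in> NW m w ==> (%i. Q m ^ (i * j) * v i) \<in> NW m w"
proof (induction j)
  case (Suc j)
  then show ?case using NW_Q[of "%i. Q m ^ (i * j) * v i" m w] by (simp add: power_add mult.assoc)
qed simp

text \<open>For n = m the factor q^(lm) in \<open>NC_mulQ_pow\<close> is 1 modulo q - zeta_m, so
  multiplication by q^(mi) - 1 gains one unit of weight.\<close>

lemma NW_Q_m:
  assumes m: "m \<ge> 1" and v: "v \<in> NW m w" shows "(%i. (Q m ^ (m * i) - 1) * v i) \<in> NW m (Suc w)"
proof -
  obtain c where c: "c \<in> NC m w" "v = nev m c" using v by (auto simp: NW_def)
  have cW: "c k \<in> W m" "fps_X ^ (w - k) dvd c k" for k using c by (auto simp: NC_def)
  have "(%l. (Q m ^ (l * m) - 1) * c l) \<in> NC m (Suc w)" unfolding NC_def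
  proof (intro CollectI allI conjI)
    fix l
    have "fps_X ^ 1 dvd Q m ^ (l * m) - 1"
      unfolding fps_X_power_dvd_iff using Qm_0[OF m, of l] by (simp add: mult.commute)
    from mult_dvd_mono[OF this cW(2)[of l]]
    have "fps_X ^ Suc (w - l) dvd (Q m ^ (l * m) - 1) * c l" by simp
    moreover have "Suc w - l \<le> Suc (w - l)" by simp
    ultimately show "fps_X ^ (Suc w - l) dvd (Q m ^ (l * m) - 1) * c l" by (meson le_imp_power_dvd dvd_trans)
    show "(Q m ^ (l * m) - 1) * c l \<in> W m" by (intro W_closed(2,4,6,7) W_Q cW)
  qed
  from NC_add[OF NC_mulQ_pow[OF c(1), of m] this]
  have *: "(%l. (mulQ m ^^ m) c l - c l) \<in> NC m (Suc w)" by (simp add: algebra_simps)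
  have M: "nev m ((mulQ m ^^ n) c) i = Q m ^ (n * i) * nev m c i" for n i
    by (induction n) (simp_all add: nev_mulQ power_add mult.assoc)
  have "nev m (%l. (mulQ m ^^ m) c l - c l) = (%i. (Q m ^ (m * i) - 1) * v i)"
    using M[of m] by (simp add: fun_eq_iff nev_def c(2) left_diff_distrib sum_subtractf)
  then show ?thesis using * unfolding NW_def by (metis image_eqI)
qed

lemma NW_Q_m_pow:
  assumes m: "m \<ge> 1" and v: "v \<in> NW m 0" shows "(%i. (Q m ^ (m * i) - 1) ^ k * v i) \<in> NW m k"
proof (induction k)
  case (Suc k)
  show ?case using NW_Q_m[OF m Suc] by (simp add: mult.assoc)
qed (use v in simp)

lemma NW_const: "F \<in> W m ==> (%i. F) \<in> NW m 0" unfolding NW_def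
  by (rule image_eqI[of _ _ "%l. if l = 0 then F else 0"])
    (auto simp: NC_def nev_def nb_def fun_eq_iff if_distrib[of "%x. x * _"] W_closed cong: if_cong)

text \<open>Weight k makes coefficient j of the i-th value vanish once k exceeds i + j, so the sum
  up to i + j is the whole infinite sum. The Newton coefficients converge in the same way, with l in
  place of i.\<close>

lemma NW_infinite_sum:
  assumes v: "!!k. v k \<in> NW m k"
  shows "(%i. Abs_fps (%j. \<Sum>k\<le>i+j. v k i $ j)) \<in> NW m 0"
proof -
  have "\<forall>k. \<exists>c. c \<in> NC m k & v k = nev m c" using v by (auto simp: NW_def)
  from choice[OF this] obtain c where c: "!!k. c k \<in> NC m k" "!!k. v k = nev m (c k)" by blast
  have cW: "c k l \<in> W m" "j < k - l ==> c k l $ j = 0" for k l j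
    using c(1)[of k] by (auto simp: NC_def fps_X_power_dvd_iff)
  define C where "C = (%l. Abs_fps (%j. \<Sum>k\<le>l+j. c k l $ j))"
  have C: "C l $ j = (\<Sum>k\<le>K. c k l $ j)" if "l + j \<le> K" for l j K unfolding C_def fps_nth_Abs_fps
  proof (rule sum.mono_neutral_left)
    show "\<forall>k\<in>{..K} - {..l + j}. c k l $ j = 0" by (intro ballI cW(2)) auto
  qed (use that in auto)
  have "C \<in> NC m 0" by (auto simp: NC_def W_def C_def intro!: Zz_closed(10) W_nth cW)
  moreover have "nev m C i = Abs_fps (%j. \<Sum>k\<le>i+j. v k i $ j)" for i
  proof (rule fps_ext)
    fix j
    have "nev m C i $ j = (\<Sum>l\<le>i. \<Sum>r=0..j. C l $ r * nb m i l $ (j - r))"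
      by (simp add: nev_def fps_sum_nth fps_mult_nth)
    also have "... = (\<Sum>l\<le>i. \<Sum>r=0..j. (\<Sum>k\<le>i+j. c k l $ r) * nb m i l $ (j - r))"
      by (intro sum.cong refl arg_cong2[of _ _ _ _ "(*)"] C) auto
    also have "... = (\<Sum>l\<le>i. (\<Sum>k\<le>i+j. c k l * nb m i l) $ j)"
      by (simp add: fps_mult_nth fps_sum_nth flip: sum_distrib_right)
    also have "... = (\<Sum>k\<le>i+j. v k i $ j)" by (simp add: c(2) nev_def fps_sum_nth) (rule sum.swap)
    finally show "nev m C i $ j = Abs_fps (%j. \<Sum>k\<le>i+j. v k i $ j) $ j" by simp
  qed
  ultimately show ?thesis unfolding NW_def by (intro image_eqI[of _ _ C]) auto
qed

text \<open>\<open>LL\<close> is a series in q^(mi) - 1 with constant coefficients, and the k-th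
  power of q^(mi) - 1 has weight k.\<close>

lemma NW_LL:
  assumes m: "m \<ge> 1" shows "(%i. LL m i r) \<in> NW m 0"
proof -
  let ?v = "%k i. fps_const (psiC r $ k) * ((Q m ^ (m * i) - 1) ^ k * 1)"
  have "psiC r $ k \<in> Zz \<zeta> m" for k by (simp add: psiC_def Zz_closed(8))
  then have "?v k \<in> NW m k" for k by (intro NW_mult NW_Q_m_pow[OF m] NW_const W_closed(2) W_const)
  note * = NW_infinite_sum[of ?v, OF this]
  have "LL m i r $ j = (\<Sum>k\<le>i+j. ?v k i $ j)" for i j
  proof -
    have "LL m i r $ j = (\<Sum>k\<le>j. ?v k i $ j)" by (simp add: LL_def fps_compose_nth atMost_atLeast0)
    also have "... = (\<Sum>k\<le>i+j. ?v k i $ j)"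
    proof (rule sum.mono_neutral_left)
      show "\<forall>k\<in>{..i + j} - {..j}. ?v k i $ j = 0"
        using startsby_zero_power_prefix[OF Qm_0[OF m, of i]] by auto
    qed auto
    finally show ?thesis .
  qed
  then have "(%i. LL m i r) = (%i. Abs_fps (%j. \<Sum>k\<le>i+j. ?v k i $ j))" by (simp add: fun_eq_iff fps_eq_iff)
  then show ?thesis using * by simp
qed

lemma NW_sg:
  assumes m: "m \<ge> 1" and x: "x \<in> carrier (XT m)"
  shows "(%i. sg m i x) \<in> NW m 0" using x
proof (induction rule: ext_induct[OF cring_R tau_closed, consumes 1, case_names monom add])
  case (monom a k j)
  interpret E: cring "XT m" by (rule cring_XT)
  have c: "ext_const \<zeta> R \<tau> m m a \<in> carrier (XT m)" "ext_num \<zeta> R \<tau> m m (\<zeta> m) \<in> carrier (XT m)" "ext_root \<zeta> R \<tau> m m \<in> carrier (XT m)"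
    using ring_hom_closed[OF ext_const_hom[OF cring_R tau_closed] monom] ring_hom_closed[OF ext_num_hom[OF cring_R tau_closed]]
      ext_root_closed[OF cring_R tau_closed] by simp_all
  have "sg m i (ext_const \<zeta> R \<tau> m m a \<otimes>\<^bsub>XT m\<^esub> ext_num \<zeta> R \<tau> m m (\<zeta> m) [^]\<^bsub>XT m\<^esub> k
        \<otimes>\<^bsub>XT m\<^esub> ext_root \<zeta> R \<tau> m m [^]\<^bsub>XT m\<^esub> j) = Q m ^ (i * j) * (fps_const (\<zeta> m) ^ k * LL m i a)" for i
  proof -
    interpret G: ring_hom_cring "XT m" "rg (W m)" "sg m i"
      by (rule ring_hom_cringI[OF cring_XT cring_rg[OF subring_W] sg_map(2)[OF m]])
    show ?thesis using c sg_map(3)[OF m monom, of i] sg_map(4)[OF m Zz_zeta, of i] sg_map(5)[OF m, of i]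
      by (simp add: nat_pow_rg power_mult)
  qed
  then show ?case
    using NW_Q_pow[OF NW_mult[OF NW_LL[OF m, of a]], of "fps_const (\<zeta> m) ^ k" j] by (simp add: W_const Zz_closed(7))
next
  case (add x y)
  have "sg m i (x \<oplus>\<^bsub>XT m\<^esub> y) = sg m i x + sg m i y" for i
    using ring_hom_add[OF sg_map(2)[OF m] add(1,2)] by simp
  then show ?case using NW_add[OF add(3,4)] by simp
qed

lemma NW_Spec:
  assumes m: "m \<ge> 1" and a: "!!k. a k \<in> carrier (XT m)"
  shows "(%i. Spec m i a) \<in> NW m 0"
proof -
  let ?v = "%k i. fps_X ^ k * sg m i (a k)"
  have "?v k \<in> NW m k" for k using NW_X[OF NW_sg[OF m a], of k k] by simp
  note * = NW_infinite_sum[of ?v, OF this]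
  have "Spec m i a $ j = (\<Sum>k\<le>i+j. ?v k i $ j)" for i j
  proof -
    have "Spec m i a $ j = (\<Sum>k\<le>j. ?v k i $ j)" by (simp add: Spec_def fps_X_power_mult_nth)
    also have "... = (\<Sum>k\<le>i+j. ?v k i $ j)"
      by (rule sum.mono_neutral_left) (auto simp: fps_X_power_mult_nth)
    finally show ?thesis .
  qed
  then have "(%i. Spec m i a) = (%i. Abs_fps (%j. \<Sum>k\<le>i+j. ?v k i $ j))"
    by (simp add: fun_eq_iff fps_eq_iff)
  then show ?thesis using * by simp
qed

lemma nb_diag_nz: "nb m l l ~= 0" unfolding nb_def using Q_node_nz[of _ l m] by (subst prod_zero_iff) auto

lemma compat_nb:
  assumes "m \<ge> 1" "Factorial_Ring.prime p" shows "compat p m (nb m i l) (nb (p * m) i l)"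
proof -
  have pw: "compat p m (Q m ^ n) (Q (p * m) ^ n)" for n
  proof (induction n)
    case 0
    show ?case using compat_of_int[OF assms, of 1] by simp
  next
    case (Suc n)
    show ?case unfolding power_Suc by (rule compat_mult[OF assms compat_Q[OF assms] Suc]) (intro W_closed(7) W_Q)+
  qed
  show ?thesis
  proof (induction l)
    case 0
    show ?case using compat_of_int[OF assms, of 1] by (simp add: nb_def)
  next
    case (Suc l)
    have *: "nb k i (Suc l) = nb k i l * (Q k ^ i - Q k ^ l)" for k by (simp add: nb_def)
    show ?case unfolding *
      by (rule compat_mult[OF assms Suc compat_diff[OF assms pw pw]]) (intro nb_W W_closed(6,7) W_Q)+
  qed
qed

text \<open>Newton coefficients exist for each m separately. They are compatible by induction on l:
  the l-th one times \<open>nb m l l\<close> is expressed by compatible data, and that factor, a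
  product of q^l - q^j, can be cancelled.\<close>

lemma Newton_HZ:
  assumes f: "f \<in> carrier XX"
  obtains C where "!!l. C l \<in> carrier HZ"
    "!!m i. m \<ge> 1 ==> HE m (specialize \<zeta> R \<eta> ev (int i) f) = (\<Sum>l\<le>i. HE m (C l) * nb m i l)"
proof -
  have "\<forall>m. \<exists>c. m \<ge> 1 --> c \<in> NC m 0 & (%i. Spec m i (f m)) = nev m c"
    using NW_Spec XX_component[OF f] by (auto simp: NW_def image_iff) blast
  from choice[OF this] obtain c where c': "!!m. m \<ge> 1 ==> c m \<in> NC m 0 & (%i. Spec m i (f m)) = nev m (c m)" by blast
  have cW: "c m l \<in> W m" if "m \<ge> 1" for m l using c'[OF that] by (auto simp: NC_def)
  have cS: "Spec m i (f m) = (\<Sum>l\<le>i. c m l * nb m i l)" if "m \<ge> 1" for m i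
    using c'[OF that] by (simp add: fun_eq_iff nev_def)
  have comp: "compat p m (c m l) (c (p * m) l)" if mp: "m \<ge> 1" "Factorial_Ring.prime p" for m p l
  proof (induction l rule: less_induct)
    case (less l)
    note pm1 = pm[OF mp]
    have eq: "c k l * nb k l l = Spec k l (f k) - (\<Sum>j<l. c k j * nb k l j)" if "k \<ge> 1" for k
      using cS[OF that, of l] by (simp add: lessThan_Suc_atMost[symmetric])
    have sum: "compat p m (\<Sum>j<n. c m j * nb m l j) (\<Sum>j<n. c (p * m) j * nb (p * m) l j)" if "n \<le> l" for n
      using that
    proof (induction n)
      case 0
      show ?case using compat_of_int[OF mp, of 0] by simp
    next
      case (Suc n)
      show ?case unfolding sum.lessThan_Suc
        using Suc less.IH[of n] by (intro compat_add[OF mp] compat_mult[OF mp] compat_nb[OF mp] cW nb_W mp pm1) auto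
    qed
    have "compat p m (c m l * nb m l l) (c (p * m) l * nb (p * m) l l)" unfolding eq[OF mp(1)] eq[OF pm1]
      by (intro compat_diff[OF mp] sum order.refl Spec_compat[OF mp] XX_component[OF f] XX_compatible[OF f] mp pm1)
    then show ?case
    proof (rule compat_cancel[OF mp])
      show "compat p m (nb m l l) (nb (p * m) l l)" by (rule compat_nb[OF mp])
      show "good p (p * m) (nb (p * m) l l)"
        unfolding nb_def using good_node[OF pm1 _ mp(2)] by (intro good_prod) auto
    qed (intro cW nb_W mp pm1)+
  qed
  show thesis
  proof (rule that[of "%l. HI (%m. c m l)"])
    show "HI (%m. c m l) \<in> carrier HZ" for l by (rule HI_closed[OF cW comp])
    show "HE m (specialize \<zeta> R \<eta> ev (int i) f) = (\<Sum>l\<le>i. HE m (HI (%m. c m l)) * nb m i l)" if "m \<ge> 1" for m i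
      unfolding specialize_HZ(2)[OF f that] cS[OF that]
      by (rule sum.cong[OF refl]) (simp only: HE_HI[where F = "%m. c m _", OF that cW[OF that]])
  qed
qed

end

section \<open>Interpolation at powers of \<open>q\<close>\<close>

text \<open>The properties shared by the Habiro ring and its subring of Laurent polynomials in q.
  Cancellation of q^i - q^j makes interpolation at powers of q unique modulo
  \<open>tq_ideal\<close>.\<close>

locale q_ring = cring H for H (structure) +
  fixes q
  assumes q: "q \<in> Units H"
    and cancel: "x \<in> carrier H ==> j < i ==> x \<otimes> (q [^] (i::nat) \<ominus> q [^] (j::nat)) = \<zero> ==> x = \<zero>"
begin

abbreviation "LH \<equiv> laurent H"
abbreviation "c0 a \<equiv> monomial H a (0::int)"

definition ev :: "'a => (int => 'a) => 'a" where
  "ev u = laurent_eval H H id u"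

lemma cring_LH: "cring LH" by (rule cring_laurent)

sublocale LH: cring LH by (rule cring_LH)

lemma id_hom: "id \<in> ring_hom H H" by (rule ring_hom_memI) auto

lemma ev_hom: "u \<in> Units H ==> ev u \<in> ring_hom LH H"
  unfolding ev_def by (rule laurent_eval_hom[OF is_cring is_cring id_hom])

lemma ev_monomial: "u \<in> Units H ==> a \<in> carrier H ==> ev u (monomial H a k) = a \<otimes> u [^] k"
  unfolding ev_def by (simp only: laurent_eval_monomial[OF is_cring is_cring id_hom] id_apply)

lemma c0_hom: "c0 \<in> ring_hom H LH"
  by (rule ring_hom_memI) (simp_all add: monomial_closed monomial_mult monomial_add, simp add: laurent_simps)

lemma q_closed: "q \<in> carrier H" using q by (rule Units_closed)

lemma q_pow: "q [^] (i::nat) \<in> Units H" using q by (rule Units_pow_closed)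

lemma ev_c0: "u \<in> Units H ==> a \<in> carrier H ==> ev u (c0 a) = a" by (simp add: ev_monomial)

text \<open>In the quotient by 1 - a t^(-1) the variable t becomes a, so P becomes the constant
  P(a). In the quotient, negative powers of t are treated like positive ones.\<close>

lemma factor_theorem:
  assumes a: "a \<in> Units H" and P: "P \<in> carrier LH" and z: "ev a P = \<zero>"
  shows "\<exists>G\<in>carrier LH. P = G \<otimes>\<^bsub>LH\<^esub> (\<one>\<^bsub>LH\<^esub> \<ominus>\<^bsub>LH\<^esub> monomial H \<one> (-1) \<otimes>\<^bsub>LH\<^esub> c0 a)"
proof -
  let ?f = "\<one>\<^bsub>LH\<^esub> \<ominus>\<^bsub>LH\<^esub> monomial H \<one> (-1) \<otimes>\<^bsub>LH\<^esub> c0 a"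
  let ?t = "monomial H \<one> (1::int)"
  define I where "I = PIdl\<^bsub>LH\<^esub> ?f"
  have ac: "a \<in> carrier H" using a by (rule Units_closed)
  have t: "?t \<in> carrier LH" "monomial H \<one> (-1) \<in> carrier LH" "c0 a \<in> carrier LH" by (intro monomial_closed one_closed ac)+
  have f: "?f \<in> carrier LH" using t by simp
  interpret I: ideal I LH unfolding I_def by (rule LH.cgenideal_ideal[OF f])
  define \<pi> where "\<pi> = (%P. I +>\<^bsub>LH\<^esub> P)"
  have \<pi>: "\<pi> \<in> ring_hom LH (LH Quot I)" unfolding \<pi>_def by (rule I.rcos_ring_hom)
  have Q: "cring (LH Quot I)" by (rule I.quotient_is_cring[OF cring_LH])
  \<comment> \<open>Multiplying the generator by t gives t - a.\<close>
  have "?t \<otimes>\<^bsub>LH\<^esub> ?f \<in> I" unfolding I_def by (rule ideal.I_l_closed[OF LH.cgenideal_ideal[OF f] LH.cgenideal_self[OF f] t(1)])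
  moreover have "?t \<otimes>\<^bsub>LH\<^esub> ?f = ?t \<ominus>\<^bsub>LH\<^esub> c0 a"
  proof -
    have "?t \<otimes>\<^bsub>LH\<^esub> ?f = ?t \<ominus>\<^bsub>LH\<^esub> ?t \<otimes>\<^bsub>LH\<^esub> monomial H \<one> (-1) \<otimes>\<^bsub>LH\<^esub> c0 a"
      using t by algebra
    also have "?t \<otimes>\<^bsub>LH\<^esub> monomial H \<one> (-1) = \<one>\<^bsub>LH\<^esub>" by (simp add: monomial_mult laurent_simps)
    finally show ?thesis using t by simp
  qed
  ultimately have \<pi>t: "\<pi> ?t = \<pi> (c0 a)" using I.coset_eq_iff[OF t(1,3)] by (simp add: \<pi>_def)
  have tU: "?t \<in> Units LH" by (rule monomial_Units[OF is_cring])
  have cU: "c0 a \<in> Units LH" by (rule ring_hom_Units[OF is_cring cring_LH c0_hom a])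
  note evh = ev_hom[OF a]
  have *: "\<pi> P = \<pi> (c0 (ev a P))" if "P \<in> carrier LH" for P using that
  proof (induction rule: laurent_induct)
    case zero
    have "c0 \<zero> = \<zero>\<^bsub>LH\<^esub>" by (rule ring_hom_0[OF is_cring cring_LH c0_hom])
    then show ?case by (simp only: ring_hom_0[OF cring_LH is_cring evh])
  next
    case (monomial b k)
    have b: "c0 b \<in> carrier LH" using monomial by (rule monomial_closed)
    have "monomial H b k = c0 b \<otimes>\<^bsub>LH\<^esub> ?t [^]\<^bsub>LH\<^esub> k"
      using monomial by (simp add: monomial_int_pow[OF is_cring] monomial_mult)
    then have "\<pi> (monomial H b k) = \<pi> (c0 b) \<otimes>\<^bsub>LH Quot I\<^esub> \<pi> ?t [^]\<^bsub>LH Quot I\<^esub> k"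
      using ring_hom_mult[OF \<pi> b, of "?t [^]\<^bsub>LH\<^esub> k"] LH.Units_closed[OF LH.Units_int_pow(1)[OF tU]]
      by (simp add: ring_hom_int_pow[OF cring_LH Q \<pi> tU])
    also have "... = \<pi> (c0 b \<otimes>\<^bsub>LH\<^esub> c0 a [^]\<^bsub>LH\<^esub> k)"
      unfolding \<pi>t using ring_hom_mult[OF \<pi> b, of "c0 a [^]\<^bsub>LH\<^esub> k"] LH.Units_closed[OF LH.Units_int_pow(1)[OF cU]]
      by (simp add: ring_hom_int_pow[OF cring_LH Q \<pi> cU])
    also have "c0 b \<otimes>\<^bsub>LH\<^esub> c0 a [^]\<^bsub>LH\<^esub> k = c0 (b \<otimes> a [^] k)"
      using ring_hom_int_pow[OF is_cring cring_LH c0_hom a, of k] ring_hom_mult[OF c0_hom monomial, of "a [^] k"]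
        Units_closed[OF Units_int_pow(1)[OF a]] by simp
    finally show ?case using monomial by (simp add: ev_monomial a)
  next
    case (add P P')
    have e: "ev a P \<in> carrier H" "ev a P' \<in> carrier H" using ring_hom_closed[OF evh] add by auto
    have "\<pi> (P \<oplus>\<^bsub>LH\<^esub> P') = \<pi> (c0 (ev a P)) \<oplus>\<^bsub>LH Quot I\<^esub> \<pi> (c0 (ev a P'))"
      using ring_hom_add[OF \<pi> add(1,2)] add by simp
    also have "... = \<pi> (c0 (ev a P \<oplus> ev a P'))"
      using ring_hom_add[OF \<pi>, of "c0 (ev a P)" "c0 (ev a P')"] ring_hom_add[OF c0_hom e] monomial_closed[OF e(1), of "0::int"] monomial_closed[OF e(2), of "0::int"] by simp
    finally show ?case using ring_hom_add[OF evh add(1,2)] by simp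
  qed
  have "c0 \<zero> = \<zero>\<^bsub>LH\<^esub>" by (rule ring_hom_0[OF is_cring cring_LH c0_hom])
  then have "\<pi> P = \<zero>\<^bsub>LH Quot I\<^esub>" using *[OF P] z ring_hom_0[OF cring_LH Q \<pi>] by simp
  then have "P \<in> I" using I.coset_zero_iff[OF P] by (simp add: \<pi>_def)
  then show ?thesis unfolding I_def cgenideal_def by blast
qed

definition fac :: "nat => int => 'a" where
  "fac i = \<one>\<^bsub>LH\<^esub> \<ominus>\<^bsub>LH\<^esub> monomial H \<one> (-1) \<otimes>\<^bsub>LH\<^esub> c0 q [^]\<^bsub>LH\<^esub> i"

lemma fac_alt: "fac i = \<one>\<^bsub>LH\<^esub> \<ominus>\<^bsub>LH\<^esub> monomial H \<one> (-1) \<otimes>\<^bsub>LH\<^esub> c0 (q [^] i)"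
  using ring_hom_nat_pow[OF is_cring cring_LH c0_hom q_closed, of i] by (simp add: fac_def)

lemma fac_closed: "fac i \<in> carrier LH"
  unfolding fac_def by (intro LH.minus_closed LH.m_closed LH.nat_pow_closed monomial_closed LH.one_closed one_closed q_closed)

lemma ev_fac:
  assumes u: "u \<in> Units H" shows "u \<otimes> ev u (fac i) = u \<ominus> q [^] i"
proof -
  have qi: "q [^] i \<in> carrier H" by (simp add: q_closed)
  have m: "monomial H \<one> (-1) \<in> carrier LH" "c0 (q [^] i) \<in> carrier LH" by (intro monomial_closed one_closed qi)+
  have ui: "u [^] (-1::int) \<in> carrier H" "u \<in> carrier H" using Units_closed[OF Units_int_pow(1)[OF u]] Units_closed[OF u] by auto
  have e: "ev u (fac i) = \<one> \<ominus> u [^] (-1::int) \<otimes> q [^] i" unfolding fac_alt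
    using ring_hom_minus[OF cring_LH is_cring ev_hom[OF u] LH.one_closed LH.m_closed[OF m]] ring_hom_mult[OF ev_hom[OF u] m]
      ring_hom_one[OF ev_hom[OF u]] ui qi by (simp add: ev_monomial[OF u])
  have "u \<otimes> u [^] (-1::int) = \<one>"
    using Units_int_pow(2)[OF u, of 1 "-1"] Units_int_pow(3)[OF u] by simp
  moreover have "u \<otimes> (\<one> \<ominus> u [^] (-1::int) \<otimes> q [^] i) = u \<ominus> (u \<otimes> u [^] (-1::int)) \<otimes> q [^] i"
    using ui qi by algebra
  ultimately show ?thesis using qi by (simp add: e)
qed

lemma tq_ideal_Suc: "qpoch LH (monomial H \<one> (-1)) (c0 q) (Suc n) = fac n \<otimes>\<^bsub>LH\<^esub> qpoch LH (monomial H \<one> (-1)) (c0 q) n"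
  unfolding qpoch_def lessThan_Suc fac_def[symmetric]
  using fac_closed by (subst LH.finprod_insert) (auto simp: fac_def[symmetric])

text \<open>Induction on n. If P = x g_n vanishes at q^n, then so does x, because g_n(q^n) is up to
  units a product of factors q^n - q^k. The factor theorem then splits off the next factor from
  x.\<close>

lemma tq_ideal_iff: "P \<in> tq_ideal H q n \<longleftrightarrow> P \<in> carrier LH & (\<forall>i<n. ev (q [^] i) P = \<zero>)"
proof (induction n arbitrary: P)
  case 0
  have "qpoch LH (monomial H \<one> (-1)) (c0 q) 0 = \<one>\<^bsub>LH\<^esub>" by (simp add: qpoch_def)
  then show ?case by (auto simp: tq_ideal_def cgenideal_def intro: exI[of _ P])
next
  case (Suc n)
  let ?g = "qpoch LH (monomial H \<one> (-1)) (c0 q)"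
  have g: "?g n \<in> carrier LH" for n
    unfolding qpoch_def fac_def[symmetric] by (rule LH.finprod_closed) (auto intro: fac_closed)
  have I: "P \<in> tq_ideal H q n \<longleftrightarrow> (\<exists>x\<in>carrier LH. P = x \<otimes>\<^bsub>LH\<^esub> ?g n)" for P n
    by (auto simp: tq_ideal_def cgenideal_def)
  have ec: "ev (q [^] i) P \<in> carrier H" if "P \<in> carrier LH" for i :: nat and P using ring_hom_closed[OF ev_hom[OF q_pow] that] .
  note em = ring_hom_mult[OF ev_hom[OF q_pow]]
  show ?case
  proof
    assume "P \<in> tq_ideal H q (Suc n)"
    then obtain x where x: "x \<in> carrier LH" "P = x \<otimes>\<^bsub>LH\<^esub> ?g (Suc n)" unfolding I by blast
    have P: "P = (x \<otimes>\<^bsub>LH\<^esub> fac n) \<otimes>\<^bsub>LH\<^esub> ?g n" unfolding x(2) tq_ideal_Suc using x g fac_closed by (simp add: LH.m_assoc)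
    then have "P \<in> tq_ideal H q n" unfolding I using x fac_closed by blast
    then have 1: "P \<in> carrier LH" "\<forall>i<n. ev (q [^] i) P = \<zero>" using Suc by blast+
    have "q [^] n \<otimes> ev (q [^] n) (fac n) = \<zero>"
      using ev_fac[OF q_pow, of n n] q_closed by (simp add: minus_eq r_neg)
    then have "ev (q [^] n) (fac n) = \<zero>"
      using Units_l_cancel[OF q_pow ec[OF fac_closed] zero_closed, of n n] q_closed by simp
    then have "ev (q [^] n) P = \<zero>" unfolding P using x g fac_closed ec by (simp add: em)
    then show "P \<in> carrier LH & (\<forall>i<Suc n. ev (q [^] i) P = \<zero>)" using 1 less_Suc_eq by auto
  next
    assume *: "P \<in> carrier LH & (\<forall>i<Suc n. ev (q [^] i) P = \<zero>)"
    then have "P \<in> tq_ideal H q n" using Suc by auto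
    then obtain x where x: "x \<in> carrier LH" "P = x \<otimes>\<^bsub>LH\<^esub> ?g n" unfolding I by blast
    have nz: "y = \<zero>" if "y \<in> carrier H" "y \<otimes> ev (q [^] n) (?g k) = \<zero>" "k \<le> n" for y k
      using that
    proof (induction k arbitrary: y)
      case 0
      then show ?case using ring_hom_one[OF ev_hom[OF q_pow]] by (simp add: qpoch_def)
    next
      case (Suc k)
      have c: "y \<in> carrier H" "ev (q [^] n) (fac k) \<in> carrier H" "ev (q [^] n) (?g k) \<in> carrier H" "q [^] n \<in> carrier H" "q [^] k \<in> carrier H"
        using Suc ec fac_closed g q_closed by auto
      have "y \<otimes> ev (q [^] n) (fac k) \<otimes> ev (q [^] n) (?g k) = \<zero>"
        using Suc.prems c by (simp add: tq_ideal_Suc em fac_closed g m_assoc)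
      from Suc.IH[OF m_closed[OF c(1,2)] this Suc_leD[OF Suc.prems(3)]]
      have "y \<otimes> ev (q [^] n) (fac k) = \<zero>" .
      then have "q [^] n \<otimes> (y \<otimes> ev (q [^] n) (fac k)) = \<zero>" using c by simp
      then have "y \<otimes> (q [^] n \<otimes> ev (q [^] n) (fac k)) = \<zero>" using c by (simp add: m_lcomm)
      then show ?case unfolding ev_fac[OF q_pow] using cancel[of y k n] Suc.prems by simp
    qed
    have "ev (q [^] n) x \<otimes> ev (q [^] n) (?g n) = \<zero>" using * x g by (simp add: em[symmetric])
    from nz[OF ec[OF x(1)] this order.refl] have "ev (q [^] n) x = \<zero>" .
    from factor_theorem[OF q_pow x(1) this] obtain G where G: "G \<in> carrier LH" "x = G \<otimes>\<^bsub>LH\<^esub> fac n"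
      unfolding fac_alt by blast
    have "P = G \<otimes>\<^bsub>LH\<^esub> ?g (Suc n)" unfolding x(2) G(2) tq_ideal_Suc using G g fac_closed by (simp add: LH.m_assoc)
    then show "P \<in> tq_ideal H q (Suc n)" unfolding I using G by blast
  qed
qed

text \<open>Taking all interpolants avoids a choice and makes the sets for successive N nested by
  definition.\<close>

definition Phi :: "(nat => 'a) => nat => (int => 'a) set" where
  "Phi s N = {P \<in> carrier LH. \<forall>i<N. ev (q [^] i) P = s i}"

lemma ideal_tq: "ideal (tq_ideal H q n) LH" unfolding tq_ideal_def qpoch_def fac_def[symmetric]
  by (rule LH.cgenideal_ideal, rule LH.finprod_closed) (auto intro: fac_closed)

lemma Phi_coset:
  assumes "P \<in> Phi s N" shows "Phi s N = tq_ideal H q N +>\<^bsub>LH\<^esub> P"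
proof -
  have P: "P \<in> carrier LH" using assms by (simp add: Phi_def)
  have "P' \<in> Phi s N \<longleftrightarrow> P' \<in> tq_ideal H q N +>\<^bsub>LH\<^esub> P" for P'
  proof (cases "P' \<in> carrier LH")
    case True
    have "ev (q [^] i) (P' \<ominus>\<^bsub>LH\<^esub> P) = \<zero> \<longleftrightarrow> ev (q [^] i) P' = ev (q [^] i) P" for i :: nat
      using ring_hom_minus[OF cring_LH is_cring ev_hom[OF q_pow] True P, of i]
        ring_hom_closed[OF ev_hom[OF q_pow] True, of i] ring_hom_closed[OF ev_hom[OF q_pow] P, of i] by simp
    then show ?thesis
      using ideal.mem_coset_iff[OF ideal_tq P True, of N] assms True P by (simp add: tq_ideal_iff) (auto simp: Phi_def)
  next
    case False
    then show ?thesis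
      using ideal.Quot_closed[OF ideal_tq P, of N] ideal.coset_memE(1)[OF ideal_tq, of _ N P'] by (auto simp: Phi_def)
  qed
  then show ?thesis by blast
qed

lemma Phi_lim:
  assumes "!!N. Phi s N ~= {}" shows "Phi s \<in> carrier (lim_quot LH (tq_ideal H q))"
proof -
  have "Phi s N \<in> carrier (LH Quot tq_ideal H q N)" for N
  proof -
    obtain P where P: "P \<in> Phi s N" using assms by blast
    then show ?thesis using Phi_coset[OF P] ideal.Quot_closed[OF ideal_tq, of P N] by (auto simp: Phi_def)
  qed
  then show ?thesis by (auto simp: lim_quot_simps Phi_def)
qed

definition node :: "nat => nat => 'a" where
  "node i l = finprod H (%j. q [^] i \<ominus> q [^] j) {..<l}"

lemma node_closed: "node i l \<in> carrier H" unfolding node_def by (rule finprod_closed) (auto simp: q_closed)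

lemma node_zero:
  assumes "i < l" shows "node i l = \<zero>"
proof -
  have "node i l = (q [^] i \<ominus> q [^] i) \<otimes> finprod H (%j. q [^] i \<ominus> q [^] j) ({..<l} - {i})"
    unfolding node_def using assms q_closed by (subst finprod_insert[symmetric]) (auto simp: insert_absorb)
  moreover have "finprod H (%j. q [^] i \<ominus> q [^] j) ({..<l} - {i}) \<in> carrier H"
    by (rule finprod_closed) (auto simp: q_closed)
  ultimately show ?thesis using q_closed by (simp add: r_neg a_minus_def)
qed

text \<open>The Newton polynomial truncated at l < N interpolates: at q^i the terms with l > i
  vanish.\<close>

lemma Phi_nonempty:
  assumes C: "!!l. C l \<in> carrier H" and s: "!!i. s i = finsum H (%l. C l \<otimes> node i l) {..i}"
  shows "Phi s N ~= {}"
proof -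
  let ?t = "monomial H \<one> (1::int)"
  define B where "B = (%l::nat. finprod LH (%j. ?t \<ominus>\<^bsub>LH\<^esub> c0 (q [^] j)) {..<l})"
  define P where "P = finsum LH (%l. c0 (C l) \<otimes>\<^bsub>LH\<^esub> B l) {..<N}"
  have t: "?t \<in> carrier LH" "c0 (q [^] j) \<in> carrier LH" "c0 (C l) \<in> carrier LH" for j :: nat and l
    by (intro monomial_closed one_closed nat_pow_closed q_closed C)+
  have Bc: "B l \<in> carrier LH" for l unfolding B_def by (rule LH.finprod_closed) (use t in auto)
  have "ev (q [^] i) P = s i" if "i < N" for i
  proof -
    note e = ev_hom[OF q_pow, of i]
    have et: "ev (q [^] i) (?t \<ominus>\<^bsub>LH\<^esub> c0 (q [^] j)) = q [^] i \<ominus> q [^] j" for j :: nat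
      using ring_hom_minus[OF cring_LH is_cring e t(1,2)] q_closed
      by (simp add: ev_monomial q_pow Units_int_pow(3))
    have eB: "ev (q [^] i) (B l) = node i l" for l
      unfolding B_def node_def using ring_hom_finprod[OF cring_LH is_cring e, of "%j. ?t \<ominus>\<^bsub>LH\<^esub> c0 (q [^] j)" "{..<l}"] t
      by (simp add: et)
    have "ev (q [^] i) P = finsum H (%l. C l \<otimes> node i l) {..<N}"
      unfolding P_def using ring_hom_finsum[OF cring_LH is_cring e, of "%l. c0 (C l) \<otimes>\<^bsub>LH\<^esub> B l" "{..<N}"] t Bc ring_hom_mult[OF e t(3) Bc]
      by (simp add: eB ev_c0 q_pow C)
    also have "... = s i" unfolding s
      by (rule finsum_neutral_left[symmetric]) (use that C node_closed node_zero in auto)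
    finally show ?thesis .
  qed
  moreover have "P \<in> carrier LH" unfolding P_def by (rule LH.finsum_closed) (use t Bc in auto)
  ultimately show ?thesis unfolding Phi_def by blast
qed

lemma Phi_ops:
  assumes N: "!!N. Phi s N ~= {}" "!!N. Phi s' N ~= {}"
  shows "Phi (%i. s i \<otimes> s' i) = Phi s \<otimes>\<^bsub>lim_quot LH (tq_ideal H q)\<^esub> Phi s'"
    and "Phi (%i. s i \<oplus> s' i) = Phi s \<oplus>\<^bsub>lim_quot LH (tq_ideal H q)\<^esub> Phi s'"
proof -
  note h = ideal.rcos_ring_hom[OF ideal_tq]
  have 1: "Phi (%i. s i \<otimes> s' i) N = Phi s N \<otimes>\<^bsub>LH Quot tq_ideal H q N\<^esub> Phi s' N &
    Phi (%i. s i \<oplus> s' i) N = Phi s N \<oplus>\<^bsub>LH Quot tq_ideal H q N\<^esub> Phi s' N" for N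
  proof -
    obtain P P' where P: "P \<in> Phi s N" "P' \<in> Phi s' N" using N by blast
    have c: "P \<in> carrier LH" "P' \<in> carrier LH" using P by (auto simp: Phi_def)
    have "P \<otimes>\<^bsub>LH\<^esub> P' \<in> Phi (%i. s i \<otimes> s' i) N" "P \<oplus>\<^bsub>LH\<^esub> P' \<in> Phi (%i. s i \<oplus> s' i) N"
      using P ring_hom_mult[OF ev_hom[OF q_pow] c] ring_hom_add[OF ev_hom[OF q_pow] c] by (auto simp: Phi_def)
    then show ?thesis unfolding Phi_coset[OF P(1)] Phi_coset[OF P(2)]
      using Phi_coset[of "P \<otimes>\<^bsub>LH\<^esub> P'"] Phi_coset[of "P \<oplus>\<^bsub>LH\<^esub> P'"]
      by (simp only: ring_hom_mult[OF h c, symmetric] ring_hom_add[OF h c, symmetric])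
  qed
  then show "Phi (%i. s i \<otimes> s' i) = Phi s \<otimes>\<^bsub>lim_quot LH (tq_ideal H q)\<^esub> Phi s'"
    "Phi (%i. s i \<oplus> s' i) = Phi s \<oplus>\<^bsub>lim_quot LH (tq_ideal H q)\<^esub> Phi s'"
    by (auto simp: lim_quot_simps fun_eq_iff)
qed

lemma Phi_one: "Phi (%i. \<one>) = \<one>\<^bsub>lim_quot LH (tq_ideal H q)\<^esub>"
proof -
  note h = ideal.rcos_ring_hom[OF ideal_tq]
  have "Phi (%i. \<one>) N = \<one>\<^bsub>LH Quot tq_ideal H q N\<^esub>" for N
  proof -
    have "\<one>\<^bsub>LH\<^esub> \<in> Phi (%i. \<one>) N" using ring_hom_one[OF ev_hom[OF q_pow]] by (simp add: Phi_def)
    then show ?thesis unfolding ring_hom_one[OF h, symmetric] by (rule Phi_coset)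
  qed
  then show "Phi (%i. \<one>) = \<one>\<^bsub>lim_quot LH (tq_ideal H q)\<^esub>" by (simp add: lim_quot_simps fun_eq_iff)
qed

lemma Phi_inj:
  assumes "!!N. Phi s N ~= {}" "Phi s = Phi s'" shows "s = s'"
proof
  fix i
  obtain P where "P \<in> Phi s (Suc i)" using assms(1) by blast
  moreover from this have "P \<in> Phi s' (Suc i)" using assms(2) by simp
  ultimately show "s i = s' i" by (simp add: Phi_def)
qed

end

locale q_subring = q_ring +
  fixes S
  assumes subring_S: "subring S H" and q_S: "q \<in> S" "inv q \<in> S"
begin

abbreviation "L \<equiv> H\<lparr>carrier := S\<rparr>"

lemma S_closed: "S <= carrier H" using subringE(1)[OF subring_S] .

lemma cring_L: "cring L" using subcring_iff[OF S_closed] subcringI'[OF subring_S] by blast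

lemma incl_L: "(%x. x) \<in> ring_hom L H" by (rule ring_hom_memI) (use S_closed in auto)

lemma q_L: "q \<in> Units L" unfolding Units_def using q_S Units_r_inv[OF q] Units_l_inv[OF q] by auto

lemma nat_pow_L: "a [^]\<^bsub>L\<^esub> (i::nat) = a [^] i" by (simp add: nat_pow_def)

lemma minus_L: "a \<in> S ==> b \<in> S ==> a \<ominus>\<^bsub>L\<^esub> b = a \<ominus> b"
  using ring_hom_minus[OF cring_L is_cring incl_L, of a b] by simp

lemma pow_S: "q [^] (i::nat) \<in> S"
  using monoid.nat_pow_closed[OF ring.is_monoid[OF cring.axioms(1)[OF cring_L]], of q i] q_S by (simp add: nat_pow_L)

lemma finsum_L: "(!!i. i \<in> A ==> f i \<in> S) ==> finsum L f A = finsum H f A"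
  using ring_hom_finsum[OF cring_L is_cring incl_L, of f A] by (simp add: Pi_def)

lemma finprod_L: "(!!i. i \<in> A ==> f i \<in> S) ==> finprod L f A = finprod H f A"
  using ring_hom_finprod[OF cring_L is_cring incl_L, of f A] by (simp add: Pi_def)

sublocale L: q_ring L q
proof (rule q_ring.intro[OF cring_L], rule q_ring_axioms.intro[OF q_L])
  fix x :: 'a and i j :: nat
  assume "x \<in> carrier L" "j < i" "x \<otimes>\<^bsub>L\<^esub> (q [^]\<^bsub>L\<^esub> i \<ominus>\<^bsub>L\<^esub> q [^]\<^bsub>L\<^esub> j) = \<zero>\<^bsub>L\<^esub>"
  then show "x = \<zero>\<^bsub>L\<^esub>" using cancel[of x j i] S_closed by (auto simp: nat_pow_L minus_L pow_S)
qed

lemma node_S: "q [^] (i::nat) \<ominus> q [^] (j::nat) \<in> S"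
  using L.minus_closed[of "q [^] i" "q [^] j"] pow_S minus_L[OF pow_S pow_S, of i j] by simp

lemma node_L: "L.node i l = node i l" unfolding L.node_def node_def nat_pow_L minus_L[OF pow_S pow_S]
  by (rule finprod_L) (rule node_S)

lemma laurent_L: "carrier (laurent L) <= carrier LH" using S_closed by (auto simp: laurent_simps)

lemma ev_L:
  assumes P: "P \<in> carrier (laurent L)" shows "L.ev (q [^] (i::nat)) P = ev (q [^] i) P"
proof -
  have Pk: "P k \<in> S" for k using P by (auto simp: laurent_simps)
  have qi: "q [^] i \<in> Units L" using L.q_pow[of i] by (simp add: nat_pow_L)
  have pw: "(q [^] i) [^]\<^bsub>L\<^esub> k = (q [^] i) [^] k" for k :: int
    using ring_hom_int_pow[OF cring_L is_cring incl_L qi, of k] .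
  have "(q [^] i) [^]\<^bsub>L\<^esub> k \<in> carrier L" for k :: int
    by (rule L.Units_closed[OF L.Units_int_pow(1)[OF qi]])
  then have "P k \<otimes> (q [^] i) [^] k \<in> S" for k
    using L.m_closed[of "P k" "(q [^] i) [^]\<^bsub>L\<^esub> k"] Pk by (simp add: pw)
  then show ?thesis unfolding L.ev_def ev_def laurent_eval_def by (simp add: pw finsum_L)
qed

text \<open>An interpolant over the subring is one over H, and adding the larger ideal to the
  smaller coset yields all of them; this is the natural map in \<open>q_laurent_lim\<close>.\<close>

lemma Phi_L:
  assumes "!!N. L.Phi s N ~= {}"
  shows "Phi s \<in> (%x n. tq_ideal H q n <+>\<^bsub>LH\<^esub> x n) ` carrier (lim_quot (laurent L) (tq_ideal L q))"
proof (rule image_eqI[OF _ L.Phi_lim[OF assms]], rule ext)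
  fix N
  obtain P where P: "P \<in> L.Phi s N" using assms by blast
  have sub: "L.Phi s N <= Phi s N" using laurent_L ev_L by (auto simp: L.Phi_def Phi_def nat_pow_L)
  have Pc: "P \<in> carrier LH" using P sub by (auto simp: Phi_def)
  have co: "Phi s N = tq_ideal H q N +>\<^bsub>LH\<^esub> P" using Phi_coset P sub by blast
  show "Phi s N = tq_ideal H q N <+>\<^bsub>LH\<^esub> L.Phi s N"
  proof
    show "Phi s N <= tq_ideal H q N <+>\<^bsub>LH\<^esub> L.Phi s N"
      unfolding co using P by (auto simp: a_r_coset_def' set_add_def')
    show "tq_ideal H q N <+>\<^bsub>LH\<^esub> L.Phi s N <= Phi s N"
    proof
      fix x assume "x \<in> tq_ideal H q N <+>\<^bsub>LH\<^esub> L.Phi s N"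
      then obtain a b where ab: "a \<in> tq_ideal H q N" "b \<in> L.Phi s N" "x = a \<oplus>\<^bsub>LH\<^esub> b"
        by (auto simp: set_add_def')
      have "b \<in> Phi s N" using ab sub by blast
      then have "Phi s N = tq_ideal H q N +>\<^bsub>LH\<^esub> b" by (rule Phi_coset)
      then show "x \<in> Phi s N" using ab by (auto simp: a_r_coset_def')
    qed
  qed
qed

end

section \<open>Laurent polynomials in q inside the Habiro ring\<close>

context unity_roots
begin

lemma HZ_cancel:
  assumes x: "x \<in> carrier HZ" and ji: "j < i" and z: "x \<otimes>\<^bsub>HZ\<^esub> (hq [^]\<^bsub>HZ\<^esub> (i::nat) \<ominus>\<^bsub>HZ\<^esub> hq [^]\<^bsub>HZ\<^esub> (j::nat)) = \<zero>\<^bsub>HZ\<^esub>"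
  shows "x = \<zero>\<^bsub>HZ\<^esub>"
proof (rule HE_inj[OF x])
  interpret cring HZ by (rule cring_HZ)
  show "\<zero>\<^bsub>HZ\<^esub> \<in> carrier HZ" by simp
  have c: "hq [^]\<^bsub>HZ\<^esub> i \<in> carrier HZ" "hq [^]\<^bsub>HZ\<^esub> j \<in> carrier HZ" by (intro nat_pow_closed hq_closed)+
  fix m :: nat assume m: "m \<ge> 1"
  have "HE m x * (Q m ^ i - Q m ^ j) = HE m \<zero>\<^bsub>HZ\<^esub>"
    unfolding z[symmetric] HE_ops(1)[OF m x minus_closed[OF c]] HE_minus[OF m c] HE_pow[OF m hq_closed] HE_q[OF m] ..
  then show "HE m x = HE m \<zero>\<^bsub>HZ\<^esub>" using Q_node_nz[OF ji, of m] by (simp add: HE_ops(4)[OF m])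
qed

sublocale HZ: q_ring HZ hq
  by (rule q_ring.intro[OF cring_HZ], rule q_ring_axioms.intro[OF hq_Units]) (rule HZ_cancel)

definition qev :: "(int => int) => nat => nat => (nat => int) set" where
  "qev = laurent_eval \<Z> HZ (int_in HZ) hq"

lemma qev_hom: "qev \<in> ring_hom (laurent \<Z>) HZ"
  unfolding qev_def by (rule laurent_eval_hom[OF cring_int cring_HZ HZ.int_in_hom hq_Units])

lemma qev_monomial: "qev (monomial \<Z> a k) = int_in HZ a \<otimes>\<^bsub>HZ\<^esub> hq [^]\<^bsub>HZ\<^esub> k"
  unfolding qev_def by (rule laurent_eval_monomial[OF cring_int cring_HZ HZ.int_in_hom hq_Units]) simp

lemma q_laurent_qev: "q_laurent \<zeta> = qev ` carrier (laurent \<Z>)" by (simp add: q_laurent_def qev_def)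

lemma monomial_Z: "monomial \<Z> a (k::int) \<in> carrier (laurent \<Z>)" using int.monomial_closed[of a k] by simp

lemma subring_q_laurent: "subring (q_laurent \<zeta>) HZ"
proof (rule HZ.subringI)
  interpret Z: cring "laurent \<Z>" by (rule int.cring_laurent)
  note h = qev_hom
  show "q_laurent \<zeta> <= carrier HZ" unfolding q_laurent_qev using ring_hom_closed[OF h] by auto
  show "\<one>\<^bsub>HZ\<^esub> \<in> q_laurent \<zeta>"
    unfolding q_laurent_qev ring_hom_one[OF h, symmetric] by (rule imageI) simp
  show "\<ominus>\<^bsub>HZ\<^esub> a \<in> q_laurent \<zeta>" if "a \<in> q_laurent \<zeta>" for a
  proof -
    from that obtain P where P: "P \<in> carrier (laurent \<Z>)" "a = qev P" unfolding q_laurent_qev by (elim imageE)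
    show ?thesis unfolding P(2) q_laurent_qev ring_hom_a_inv[OF Z.is_cring cring_HZ h P(1), symmetric] using P(1) by (intro imageI Z.a_inv_closed)
  qed
  fix a b assume "a \<in> q_laurent \<zeta>" "b \<in> q_laurent \<zeta>"
  then obtain P P' where P: "P \<in> carrier (laurent \<Z>)" "a = qev P" "P' \<in> carrier (laurent \<Z>)" "b = qev P'"
    unfolding q_laurent_qev by (elim imageE)
  show "a \<otimes>\<^bsub>HZ\<^esub> b \<in> q_laurent \<zeta>" "a \<oplus>\<^bsub>HZ\<^esub> b \<in> q_laurent \<zeta>"
    unfolding P q_laurent_qev ring_hom_mult[OF h P(1,3), symmetric] ring_hom_add[OF h P(1,3), symmetric]
    by (intro imageI Z.m_closed Z.a_closed P(1,3))+
qed

lemmas q_laurent_closed = subringE[OF subring_q_laurent]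

lemma int_in_q_laurent: "int_in HZ a \<in> q_laurent \<zeta>"
  unfolding q_laurent_qev by (rule image_eqI[of _ _ "monomial \<Z> a 0"]) (simp_all add: qev_monomial monomial_Z)

lemma hq_pow_q_laurent: "hq [^]\<^bsub>HZ\<^esub> (k::int) \<in> q_laurent \<zeta>"
proof -
  have "hq [^]\<^bsub>HZ\<^esub> k = qev (monomial \<Z> 1 k)"
    using HZ.Units_closed[OF HZ.Units_int_pow(1)[OF hq_Units, of k]] by (simp add: qev_monomial HZ.int_in_one)
  then show ?thesis unfolding q_laurent_qev using monomial_Z by blast
qed

sublocale QL: q_subring HZ hq "q_laurent \<zeta>"
proof (rule q_subring.intro[OF HZ.q_ring_axioms], rule q_subring_axioms.intro[OF subring_q_laurent])
  show "hq \<in> q_laurent \<zeta>" using hq_pow_q_laurent[of 1] HZ.Units_int_pow(3)[OF hq_Units] by simp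
  show "inv\<^bsub>HZ\<^esub> hq \<in> q_laurent \<zeta>"
    using hq_pow_q_laurent[of "-1"] HZ.Units_int_pow(4)[OF hq_Units, of 1] HZ.Units_int_pow(3)[OF hq_Units] by simp
qed

definition fpoly :: "int poly => complex fps => complex fps" where
  "fpoly g F = poly (map_poly of_int g) F"

lemma fpoly_0: "fpoly 0 F = 0" and fpoly_pCons: "fpoly (pCons a g) F = of_int a + F * fpoly g F"
  by (simp_all add: fpoly_def map_poly_pCons)

lemma fpoly_add: "fpoly (f + g) F = fpoly f F + fpoly g F"
  by (induction f g rule: poly_induct2) (simp_all add: fpoly_0 fpoly_pCons algebra_simps)

lemma fpoly_smult: "fpoly (smult c f) F = of_int c * fpoly f F"
  by (induction f) (simp_all add: fpoly_0 fpoly_pCons algebra_simps)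

lemma fpoly_diff: "fpoly (f - g) F = fpoly f F - fpoly g F"
  using fpoly_add[of f "smult (- 1) g" F] fpoly_smult[of "- 1" g F] by simp

lemma fpoly_1: "fpoly 1 F = 1" using fpoly_pCons[of 1 0 F] by (simp add: fpoly_0 one_pCons del: pCons_one)

lemma fpoly_mult: "fpoly (f * g) F = fpoly f F * fpoly g F"
  by (induction f) (simp_all add: fpoly_0 fpoly_pCons fpoly_add fpoly_smult algebra_simps)

lemma fpoly_monom: "fpoly (Polynomial.monom a n) F = of_int a * F ^ n"
  by (induction n) (simp_all add: fpoly_0 fpoly_pCons Polynomial.monom_Suc Polynomial.monom_0 algebra_simps)

lemma fpoly_nth_0: "fpoly g F $ 0 = ipoly g (F $ 0)"
  by (induction g) (simp_all add: fpoly_0 fpoly_pCons fps_of_int[symmetric])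

lemma fpoly_q_laurent: "\<exists>y\<in>q_laurent \<zeta>. \<forall>m\<ge>1. HE m y = fpoly g (Q m)"
proof (induction g)
  case 0
  show ?case
    using q_laurent_closed(2) HE_ops(4) by (intro bexI[of _ "\<zero>\<^bsub>HZ\<^esub>"]) (simp_all add: fpoly_0)
next
  case (pCons a g)
  then obtain y where y: "y \<in> q_laurent \<zeta>" "!!m. m \<ge> 1 ==> HE m y = fpoly g (Q m)" by blast
  have yc: "y \<in> carrier HZ" using y(1) q_laurent_closed(1) by blast
  show ?case
  proof (rule bexI[of _ "int_in HZ a \<oplus>\<^bsub>HZ\<^esub> hq \<otimes>\<^bsub>HZ\<^esub> y"], intro allI impI)
    show "int_in HZ a \<oplus>\<^bsub>HZ\<^esub> hq \<otimes>\<^bsub>HZ\<^esub> y \<in> q_laurent \<zeta>"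
      by (intro q_laurent_closed(7) q_laurent_closed(6) int_in_q_laurent QL.q_S y)
    fix m :: nat assume m: "m \<ge> 1"
    show "HE m (int_in HZ a \<oplus>\<^bsub>HZ\<^esub> hq \<otimes>\<^bsub>HZ\<^esub> y) = fpoly (pCons a g) (Q m)"
      using y(2)[OF m] yc hq_closed by (simp add: HE_ops[OF m] HE_int_in[OF m] HE_q[OF m] fpoly_pCons)
  qed
qed

lemma HE_int_pow:
  assumes m: "m \<ge> 1" and k: "k + int N \<ge> 0"
  shows "HE m (hq [^]\<^bsub>HZ\<^esub> k) * Q m ^ N = Q m ^ nat (k + int N)"
proof -
  have c: "hq [^]\<^bsub>HZ\<^esub> k \<in> carrier HZ" by (rule HZ.Units_closed[OF HZ.Units_int_pow(1)[OF hq_Units]])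
  have "hq [^]\<^bsub>HZ\<^esub> k \<otimes>\<^bsub>HZ\<^esub> hq [^]\<^bsub>HZ\<^esub> N = hq [^]\<^bsub>HZ\<^esub> nat (k + int N)"
    using HZ.Units_int_pow(2)[OF hq_Units, of k "int N"] k int_pow_int[of HZ hq "nat (k + int N)"] by (simp add: int_pow_int)
  from arg_cong[OF this, of "HE m"] show ?thesis
    by (simp add: HE_ops(1)[OF m c HZ.nat_pow_closed[OF hq_closed]] HE_pow[OF m hq_closed] HE_q[OF m])
qed

text \<open>N clears the negative powers of q; one pair N, g serves all m.\<close>

lemma q_laurent_fpoly:
  assumes "y \<in> q_laurent \<zeta>" shows "\<exists>N g. \<forall>m\<ge>1. HE m y * Q m ^ N = fpoly g (Q m)"
proof -
  obtain P where P: "P \<in> carrier (laurent \<Z>)" "y = qev P" using assms unfolding q_laurent_qev by (elim imageE)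
  show ?thesis unfolding P(2) using P(1)
  proof (induction rule: int.laurent_induct)
    case zero
    show ?case
      using HE_ops(4) by (intro exI[of _ 0]) (simp add: ring_hom_0[OF int.cring_laurent cring_HZ qev_hom] fpoly_0)
  next
    case (monomial a k)
    have c: "hq [^]\<^bsub>HZ\<^esub> k \<in> carrier HZ" by (rule HZ.Units_closed[OF HZ.Units_int_pow(1)[OF hq_Units]])
    have "HE m (qev (monomial \<Z> a k)) * Q m ^ nat (- k) = fpoly (Polynomial.monom a (nat (k + int (nat (- k))))) (Q m)" if m: "m \<ge> 1" for m
      using HE_int_pow[OF m, of k "nat (- k)"] by (simp add: qev_monomial HE_ops(1)[OF m _ c] HE_int_in[OF m] fpoly_monom mult.assoc)
    then show ?case by blast
  next
    case (add P P')
    obtain N g N' g' where *: "!!m. m \<ge> 1 ==> HE m (qev P) * Q m ^ N = fpoly g (Q m)"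
      "!!m. m \<ge> 1 ==> HE m (qev P') * Q m ^ N' = fpoly g' (Q m)" using add by blast
    have c: "qev P \<in> carrier HZ" "qev P' \<in> carrier HZ" using add(1,2) ring_hom_closed[OF qev_hom] by blast+
    have "HE m (qev (P \<oplus>\<^bsub>laurent \<Z>\<^esub> P')) * Q m ^ (N + N')
        = fpoly (g * Polynomial.monom 1 N' + g' * Polynomial.monom 1 N) (Q m)" if m: "m \<ge> 1" for m
      unfolding ring_hom_add[OF qev_hom add(1,2)]
      by (simp add: HE_ops(2)[OF m c] fpoly_add fpoly_mult fpoly_monom *[OF m, symmetric] algebra_simps power_add)
    then show ?case by blast
  qed
qed

text \<open>Once powers of q are cleared, x (q^l - 1) becomes an integer polynomial g in q. At q =
  zeta_d with d dividing l the factor q^l - 1 vanishes, hence so does g, and X^l - 1 divides g by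
  \<open>unity_poly_dvd\<close>.\<close>

lemma q_laurent_divide:
  assumes x: "x \<in> carrier HZ" and ji: "j < i"
    and xq: "x \<otimes>\<^bsub>HZ\<^esub> (hq [^]\<^bsub>HZ\<^esub> (i::nat) \<ominus>\<^bsub>HZ\<^esub> hq [^]\<^bsub>HZ\<^esub> (j::nat)) \<in> q_laurent \<zeta>"
  shows "x \<in> q_laurent \<zeta>"
proof -
  define l where "l = i - j"
  have l: "l \<ge> 1" "i = l + j" using ji by (auto simp: l_def)
  have c: "hq [^]\<^bsub>HZ\<^esub> i \<in> carrier HZ" "hq [^]\<^bsub>HZ\<^esub> j \<in> carrier HZ" by (intro HZ.nat_pow_closed hq_closed)+
  obtain N g where g: "!!m. m \<ge> 1 ==> HE m (x \<otimes>\<^bsub>HZ\<^esub> (hq [^]\<^bsub>HZ\<^esub> i \<ominus>\<^bsub>HZ\<^esub> hq [^]\<^bsub>HZ\<^esub> j)) * Q m ^ N = fpoly g (Q m)"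
    using q_laurent_fpoly[OF xq] by blast
  have g': "HE m x * (Q m ^ l - 1) * Q m ^ (j + N) = fpoly g (Q m)" if m: "m \<ge> 1" for m
    using g[OF m] unfolding HE_ops(1)[OF m x HZ.minus_closed[OF c]] HE_minus[OF m c] HE_pow[OF m hq_closed] HE_q[OF m]
    by (simp add: l(2) power_add algebra_simps)
  have "ipoly g (\<zeta> d) = 0" if d: "d dvd l" for d
  proof -
    have d1: "d \<ge> 1" using d l by (cases d) auto
    have "fpoly g (Q d) $ 0 = 0" using zeta_pow_iff[OF d1, of l] d by (simp add: g'[OF d1, symmetric] Q_nth)
    then show ?thesis by (simp add: fpoly_nth_0 Q_def)
  qed
  then have "Polynomial.monom 1 l - 1 dvd g" by (rule unity_poly_dvd[OF l(1)])
  then obtain h where h: "g = (Polynomial.monom 1 l - 1) * h" by (elim dvdE)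
  obtain y where y: "y \<in> q_laurent \<zeta>" "!!m. m \<ge> 1 ==> HE m y = fpoly h (Q m)" using fpoly_q_laurent[of h] by blast
  have yc: "y \<in> carrier HZ" using y(1) q_laurent_closed(1) by blast
  have fm1: "fpoly (Polynomial.monom 1 l - 1) F = F ^ l - 1" for F by (simp add: fpoly_diff fpoly_1 fpoly_monom)
  have "hq [^]\<^bsub>HZ\<^esub> (j + N) \<otimes>\<^bsub>HZ\<^esub> x = y"
  proof (rule HE_inj[OF _ yc])
    fix m :: nat assume m: "m \<ge> 1"
    have "(Q m ^ l - 1) * (HE m x * Q m ^ (j + N)) = (Q m ^ l - 1) * fpoly h (Q m)"
      using g'[OF m] by (simp add: h fpoly_mult fm1 mult_ac)
    moreover have "Q m ^ l - 1 ~= 0" using Q_node_nz[of 0 l m] l by simp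
    ultimately have "HE m x * Q m ^ (j + N) = fpoly h (Q m)" by (simp only: mult_cancel_left) simp
    then show "HE m (hq [^]\<^bsub>HZ\<^esub> (j + N) \<otimes>\<^bsub>HZ\<^esub> x) = HE m y"
      by (simp add: HE_ops(1)[OF m HZ.nat_pow_closed[OF hq_closed] x] HE_pow[OF m hq_closed] HE_q[OF m] y(2)[OF m] mult.commute)
  qed (intro HZ.m_closed HZ.nat_pow_closed hq_closed x)
  moreover have "hq [^]\<^bsub>HZ\<^esub> (- int (j + N)) \<otimes>\<^bsub>HZ\<^esub> hq [^]\<^bsub>HZ\<^esub> (j + N) = \<one>\<^bsub>HZ\<^esub>"
    using HZ.Units_int_pow(2)[OF hq_Units, of "- int (j + N)" "int (j + N)"] by (simp add: int_pow_int del: of_nat_add)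
  moreover have ic: "hq [^]\<^bsub>HZ\<^esub> (- int (j + N)) \<in> carrier HZ" by (rule HZ.Units_closed[OF HZ.Units_int_pow(1)[OF hq_Units]])
  ultimately have "x = hq [^]\<^bsub>HZ\<^esub> (- int (j + N)) \<otimes>\<^bsub>HZ\<^esub> y"
    using x HZ.m_assoc[OF ic HZ.nat_pow_closed[OF hq_closed, of "j + N"] x] by simp
  then show ?thesis using q_laurent_closed(6)[OF hq_pow_q_laurent y(1)] by simp
qed

text \<open>The triangular system is solved from the lowest coefficient on; the diagonal entry is
  removed one factor q^l - q^k at a time by \<open>q_laurent_divide\<close>.\<close>

lemma Newton_q_laurent:
  assumes C: "!!l. C l \<in> carrier HZ" and s: "!!i. s i = finsum HZ (%l. C l \<otimes>\<^bsub>HZ\<^esub> HZ.node i l) {..i}"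
    and sq: "!!i. s i \<in> q_laurent \<zeta>"
  shows "C l \<in> q_laurent \<zeta>"
proof (induction l rule: less_induct)
  case (less l)
  have nS: "HZ.node i k \<in> q_laurent \<zeta>" for i k using QL.L.node_closed[of i k] by (simp add: QL.node_L)
  let ?S = "finsum HZ (%k. C k \<otimes>\<^bsub>HZ\<^esub> HZ.node l k) {..<l}"
  have CN: "C k \<otimes>\<^bsub>HZ\<^esub> HZ.node i k \<in> carrier HZ" for i k using C HZ.node_closed by blast
  have t: "C k \<otimes>\<^bsub>HZ\<^esub> HZ.node l k \<in> q_laurent \<zeta>" if "k < l" for k
    by (rule q_laurent_closed(6)[OF less[OF that] nS])
  have "?S = finsum QL.L (%k. C k \<otimes>\<^bsub>HZ\<^esub> HZ.node l k) {..<l}"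
    by (rule QL.finsum_L[symmetric]) (use t in auto)
  also have "... \<in> carrier QL.L" by (rule QL.L.finsum_closed) (use t in auto)
  finally have S: "?S \<in> q_laurent \<zeta>" by simp
  have "s l = C l \<otimes>\<^bsub>HZ\<^esub> HZ.node l l \<oplus>\<^bsub>HZ\<^esub> ?S"
    unfolding s using CN by (subst lessThan_Suc_atMost[symmetric], unfold lessThan_Suc, subst HZ.finsum_insert) auto
  moreover have Sc: "?S \<in> carrier HZ" using S q_laurent_closed(1) by blast
  ultimately have "C l \<otimes>\<^bsub>HZ\<^esub> HZ.node l l = s l \<oplus>\<^bsub>HZ\<^esub> \<ominus>\<^bsub>HZ\<^esub> ?S"
    using CN[of l l] by (simp add: HZ.a_assoc HZ.r_neg)
  then have "C l \<otimes>\<^bsub>HZ\<^esub> HZ.node l l \<in> q_laurent \<zeta>" using q_laurent_closed(5,7) S sq by simp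
  moreover have "x \<in> q_laurent \<zeta>" if "x \<otimes>\<^bsub>HZ\<^esub> HZ.node l k \<in> q_laurent \<zeta>" "x \<in> carrier HZ" "k \<le> l" for x k
    using that
  proof (induction k arbitrary: x)
    case 0
    then show ?case by (simp add: HZ.node_def)
  next
    case (Suc k)
    let ?d = "hq [^]\<^bsub>HZ\<^esub> l \<ominus>\<^bsub>HZ\<^esub> hq [^]\<^bsub>HZ\<^esub> k"
    have d: "?d \<in> carrier HZ" by (intro HZ.minus_closed HZ.nat_pow_closed hq_closed)
    have "HZ.node l (Suc k) = ?d \<otimes>\<^bsub>HZ\<^esub> HZ.node l k"
      unfolding HZ.node_def lessThan_Suc by (subst HZ.finprod_insert) (auto simp: hq_closed)
    then have "(x \<otimes>\<^bsub>HZ\<^esub> ?d) \<otimes>\<^bsub>HZ\<^esub> HZ.node l k \<in> q_laurent \<zeta>"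
      using Suc.prems(1) HZ.m_assoc[OF Suc.prems(2) d HZ.node_closed] by simp
    from Suc.IH[OF this HZ.m_closed[OF Suc.prems(2) d] Suc_leD[OF Suc.prems(3)]]
    show ?case by (rule q_laurent_divide[OF Suc.prems(2), rotated]) (use Suc.prems(3) in simp)
  qed
  ultimately show ?case using C by blast
qed

end

section \<open>The interpolation homomorphism\<close>

context habiro_etale
begin

abbreviation "spec i f \<equiv> specialize \<zeta> R \<eta> ev (int i) f"

lemma Spec_trunc:
  assumes m: "m \<ge> 1"
  shows "fps_X ^ N dvd Spec m i a - (\<Sum>k<N. fps_X ^ k * sg m i (a k))" using Spec_split[of m i a N] by simp

lemma Spec_add:
  assumes m: "m \<ge> 1" and a: "!!k. a k \<in> carrier (XT m)" "!!k. b k \<in> carrier (XT m)"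
  shows "Spec m i (%k. a k \<oplus>\<^bsub>XT m\<^esub> b k) = Spec m i a + Spec m i b"
  using ring_hom_add[OF sg_map(2)[OF m, of i] a] by (simp add: Spec_def fps_eq_iff sum.distrib)

text \<open>Modulo X^N all series may be truncated, and the product of the truncations exceeds the
  truncated Cauchy product by terms divisible by X^N.\<close>

lemma Spec_mult:
  assumes m: "m \<ge> 1" and a: "!!k. a k \<in> carrier (XT m)" and b: "!!k. b k \<in> carrier (XT m)"
  shows "Spec m i (%k. finsum (XT m) (%j. a j \<otimes>\<^bsub>XT m\<^esub> b (k - j)) {..k}) = Spec m i a * Spec m i b"
    (is "Spec m i ?c = _")
proof (rule fps_ext)
  fix n
  define N where "N = Suc n"
  interpret E: cring "XT m" by (rule cring_XT)
  let ?s = "%x. sg m i x"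
  let ?f = "%k j. fps_X ^ (k + j) * (?s (a k) * ?s (b j))"
  have c: "?s (?c k) = (\<Sum>j\<le>k. ?s (a j) * ?s (b (k - j)))" for k
    using ring_hom_finsum[OF cring_XT cring_rg[OF subring_W] sg_map(2)[OF m], of "%j. a j \<otimes>\<^bsub>XT m\<^esub> b (k - j)" "{..k}" i]
      ring_hom_mult[OF sg_map(2)[OF m, of i] a b] ring_hom_closed[OF sg_map(2)[OF m, of i] a] ring_hom_closed[OF sg_map(2)[OF m, of i] b] a b
    by (simp add: finsum_rg[OF subring_W] W_closed(4))
  have "(\<Sum>k<N. fps_X ^ k * ?s (?c k)) = (\<Sum>k<N. \<Sum>j\<le>k. ?f j (k - j))"
    by (simp add: c sum_distrib_left)
  also have "... = (\<Sum>(k, j)\<in>{(k, j). k + j < N}. ?f k j)" by (rule sum.triangle_reindex[symmetric])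
  finally have 1: "(\<Sum>k<N. fps_X ^ k * ?s (?c k)) = (\<Sum>(k, j)\<in>{(k, j). k + j < N}. ?f k j)" .
  have 2: "(\<Sum>k<N. fps_X ^ k * ?s (a k)) * (\<Sum>k<N. fps_X ^ k * ?s (b k)) = (\<Sum>(k, j)\<in>{..<N} \<times> {..<N}. ?f k j)"
    by (simp add: sum_product sum.cartesian_product power_add mult_ac)
  have sub: "{(k, j). k + j < N} <= {..<N} \<times> {..<N}" by auto
  have "(\<Sum>k<N. fps_X ^ k * ?s (a k)) * (\<Sum>k<N. fps_X ^ k * ?s (b k)) - (\<Sum>k<N. fps_X ^ k * ?s (?c k))
      = (\<Sum>(k, j)\<in>{..<N} \<times> {..<N} - {(k, j). k + j < N}. ?f k j)"
    unfolding 1 2 by (subst sum_diff[OF _ sub]) auto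
  also have "fps_X ^ N dvd ..." by (rule dvd_sum) (auto intro!: dvd_mult2 le_imp_power_dvd)
  finally have 3: "fps_X ^ N dvd (\<Sum>k<N. fps_X ^ k * ?s (a k)) * (\<Sum>k<N. fps_X ^ k * ?s (b k)) - (\<Sum>k<N. fps_X ^ k * ?s (?c k))" .
  let ?A = "\<Sum>k<N. fps_X ^ k * ?s (a k)" and ?B = "\<Sum>k<N. fps_X ^ k * ?s (b k)" and ?C = "\<Sum>k<N. fps_X ^ k * ?s (?c k)"
  \<comment> \<open>Arranged so that each summand has a factor divisible by X^N.\<close>
  have eq: "Spec m i ?c - Spec m i a * Spec m i b = (Spec m i ?c - ?C) - (?A * ?B - ?C)
      - (Spec m i a - ?A) * Spec m i b - ?A * (Spec m i b - ?B)" by (simp add: algebra_simps)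
  have "fps_X ^ N dvd Spec m i ?c - Spec m i a * Spec m i b"
    unfolding eq by (intro dvd_diff dvd_mult2 dvd_mult Spec_trunc[OF m] 3)
  then show "Spec m i ?c $ n = (Spec m i a * Spec m i b) $ n" unfolding fps_X_power_dvd_iff by (simp add: N_def)
qed

lemma Spec_one: "m \<ge> 1 ==> Spec m i (%k. if k = 0 then \<one>\<^bsub>XT m\<^esub> else \<zero>\<^bsub>XT m\<^esub>) = 1"
  using ring_hom_one[OF sg_map(2), of m i] ring_hom_0[OF cring_XT cring_rg[OF subring_W] sg_map(2), of m i]
  by (subst Spec_Suc) (simp add: Spec_def fps_zero_def[symmetric])

text \<open>Membership of f is required componentwise, so that sums, products and the unit of
  \<open>XX\<close> can be treated before they are known to be compatible.\<close>

lemma spec_eqI: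
  assumes f: "!!m k. m \<ge> 1 ==> f m k \<in> carrier (XT m)" and z: "z \<in> carrier HZ"
    and eq: "!!m. m \<ge> 1 ==> Spec m i (f m) = HE m z"
  shows "spec i f = z"
proof -
  have H: "HE m (spec i f) = HE m z" if "m \<ge> 1" for m
    using specialize_coords(2)[where f = f, OF that f[OF that]] eq[OF that] by simp
  show ?thesis
  proof (rule HE_inj[OF _ z H])
    show "spec i f \<in> carrier HZ"
    proof (rule HZ_memI[where F = "%m. HE m z", OF _ _ H])
      show "spec i f \<in> extensional {1..}" by (simp add: specialize_def)
      show "spec i f m \<in> carrier (pseries (cyc \<zeta> \<Z> m))" if "m \<ge> 1" for m
        by (rule specialize_coords(1)[where f = f, OF that f[OF that]])
    qed (use HE_compat[OF z] in auto)
  qed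
qed

lemma spec_ops:
  assumes f: "f \<in> carrier XX" and g: "g \<in> carrier XX"
  shows "spec i (f \<otimes>\<^bsub>XX\<^esub> g) = spec i f \<otimes>\<^bsub>HZ\<^esub> spec i g"
    and "spec i (f \<oplus>\<^bsub>XX\<^esub> g) = spec i f \<oplus>\<^bsub>HZ\<^esub> spec i g"
proof -
  note s = specialize_HZ(1)[OF f, of i] specialize_HZ(2)[OF f, of _ i] specialize_HZ(1)[OF g, of i] specialize_HZ(2)[OF g, of _ i]
  note fc = XX_component[OF f] and gc = XX_component[OF g]
  have E: "cring (XT m)" for m by (rule cring_XT)
  have fg: "(f \<otimes>\<^bsub>XX\<^esub> g) m = (%k. finsum (XT m) (%j. f m j \<otimes>\<^bsub>XT m\<^esub> g m (k - j)) {..k})"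
      "(f \<oplus>\<^bsub>XX\<^esub> g) m = (%k. f m k \<oplus>\<^bsub>XT m\<^esub> g m k)"
 if "m \<ge> 1" for m
    using that by (simp_all add: habiro_ext_def Let_def carrier_update_simps prod_ring_simps pseries_simps)
  show "spec i (f \<otimes>\<^bsub>XX\<^esub> g) = spec i f \<otimes>\<^bsub>HZ\<^esub> spec i g"
  proof (rule spec_eqI)
    fix m :: nat assume m: "m \<ge> 1"
    interpret E: cring "XT m" by (rule E)
    show "(f \<otimes>\<^bsub>XX\<^esub> g) m k \<in> carrier (XT m)" for k
      unfolding fg[OF m] by (rule E.finsum_closed) (use fc[OF m] gc[OF m] in blast)
    show "Spec m i ((f \<otimes>\<^bsub>XX\<^esub> g) m) = HE m (spec i f \<otimes>\<^bsub>HZ\<^esub> spec i g)"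
      unfolding fg[OF m] using Spec_mult[OF m fc[OF m] gc[OF m]] s m by (simp add: HE_ops(1)[OF m])
  qed (intro HZ.m_closed s)
  show "spec i (f \<oplus>\<^bsub>XX\<^esub> g) = spec i f \<oplus>\<^bsub>HZ\<^esub> spec i g"
  proof (rule spec_eqI)
    fix m :: nat assume m: "m \<ge> 1"
    interpret E: cring "XT m" by (rule E)
    show "(f \<oplus>\<^bsub>XX\<^esub> g) m k \<in> carrier (XT m)" for k
      unfolding fg[OF m] by (rule E.a_closed[OF fc[OF m] gc[OF m]])
    show "Spec m i ((f \<oplus>\<^bsub>XX\<^esub> g) m) = HE m (spec i f \<oplus>\<^bsub>HZ\<^esub> spec i g)"
      unfolding fg[OF m] using Spec_add[OF m fc[OF m] gc[OF m]] s m by (simp add: HE_ops(2)[OF m])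
  qed (intro HZ.a_closed s)
qed

lemma spec_one: "spec i \<one>\<^bsub>XX\<^esub> = \<one>\<^bsub>HZ\<^esub>"
proof (rule spec_eqI)
  fix m :: nat assume m: "m \<ge> 1"
  interpret E: cring "XT m" by (rule cring_XT)
  have o: "\<one>\<^bsub>XX\<^esub> m = (%k. if k = 0 then \<one>\<^bsub>XT m\<^esub> else \<zero>\<^bsub>XT m\<^esub>)"
    using m by (simp add: habiro_ext_def Let_def carrier_update_simps prod_ring_simps pseries_simps)
  show "\<one>\<^bsub>XX\<^esub> m k \<in> carrier (XT m)" for k unfolding o by simp
  show "Spec m i (\<one>\<^bsub>XX\<^esub> m) = HE m \<one>\<^bsub>HZ\<^esub>"
    unfolding o Spec_one[OF m] by (simp add: HE_ops(3)[OF m])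
qed simp

lemma HE_node: "m \<ge> 1 ==> HE m (HZ.node i l) = nb m i l"
proof -
  assume m: "m \<ge> 1"
  have c: "hq [^]\<^bsub>HZ\<^esub> (n::nat) \<in> carrier HZ" for n by (intro HZ.nat_pow_closed hq_closed)
  have "HE m (hq [^]\<^bsub>HZ\<^esub> i \<ominus>\<^bsub>HZ\<^esub> hq [^]\<^bsub>HZ\<^esub> j) = Q m ^ i - Q m ^ j" for j
    by (simp add: HE_minus[OF m c c] HE_pow[OF m hq_closed] HE_q[OF m])
  moreover have "(%j. Q m ^ i - Q m ^ j) \<in> A \<rightarrow> W m" for A by (intro Pi_I W_closed(6,7) W_Q)
  ultimately show ?thesis unfolding HZ.node_def nb_def
    using ring_hom_finprod[OF cring_HZ cring_rg[OF subring_W] HE_hom[OF m], of "%j. hq [^]\<^bsub>HZ\<^esub> i \<ominus>\<^bsub>HZ\<^esub> hq [^]\<^bsub>HZ\<^esub> j" "{..<l}"]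
      finprod_rg[OF subring_W, of "{..<l}" "%j. Q m ^ i - Q m ^ j" m] c by (simp add: Pi_def)
qed

lemma HE_Newton:
  assumes m: "m \<ge> 1" and C: "!!l. C l \<in> carrier HZ"
  shows "HE m (finsum HZ (%l. C l \<otimes>\<^bsub>HZ\<^esub> HZ.node i l) {..i}) = (\<Sum>l\<le>i. HE m (C l) * nb m i l)"
proof -
  have c: "C l \<otimes>\<^bsub>HZ\<^esub> HZ.node i l \<in> carrier HZ" for l using C HZ.node_closed by blast
  have "HE m (C l \<otimes>\<^bsub>HZ\<^esub> HZ.node i l) = HE m (C l) * nb m i l" for l
    by (simp add: HE_ops(1)[OF m C HZ.node_closed] HE_node[OF m])
  then show ?thesis
    using ring_hom_finsum[OF cring_HZ cring_rg[OF subring_W] HE_hom[OF m], of "%l. C l \<otimes>\<^bsub>HZ\<^esub> HZ.node i l" "{..i}"] c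
      finsum_rg[OF subring_W, of "{..i}" "%l. HE m (C l) * nb m i l" m] HE_W[OF C m] nb_W W_closed(4) by (simp add: Pi_def)
qed

lemma Newton_spec:
  assumes f: "f \<in> carrier XX"
  obtains C where "!!l. C l \<in> carrier HZ" "!!i. spec i f = finsum HZ (%l. C l \<otimes>\<^bsub>HZ\<^esub> HZ.node i l) {..i}"
proof -
  obtain C where C: "!!l. C l \<in> carrier HZ"
    "!!m i. m \<ge> 1 ==> HE m (spec i f) = (\<Sum>l\<le>i. HE m (C l) * nb m i l)"
    by (rule Newton_HZ[OF f]) (assumption | rule that)+
  show thesis by (rule that[OF C(1)], rule HE_inj[OF specialize_HZ(1)[OF f] HZ.finsum_closed])
      (use C HZ.node_closed in \<open>auto simp: HE_Newton\<close>)
qed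

definition interp where "interp f = HZ.Phi (%i. spec i f)"

lemma interp_nonempty: "f \<in> carrier XX ==> HZ.Phi (%i. spec i f) N ~= {}"
  by (rule Newton_spec, assumption) (rule HZ.Phi_nonempty)

lemma interp_hom: "interp \<in> ring_hom XX (habiro_lim \<zeta>)"
proof (rule ring_hom_memI)
  fix f g assume f: "f \<in> carrier XX" and g: "g \<in> carrier XX"
  show "interp f \<in> carrier (habiro_lim \<zeta>)"
    unfolding interp_def habiro_lim_def by (rule HZ.Phi_lim[OF interp_nonempty[OF f]])
  show "interp (f \<otimes>\<^bsub>XX\<^esub> g) = interp f \<otimes>\<^bsub>habiro_lim \<zeta>\<^esub> interp g"
    unfolding interp_def habiro_lim_def spec_ops(1)[OF f g] by (rule HZ.Phi_ops(1)[OF interp_nonempty[OF f] interp_nonempty[OF g]])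
  show "interp (f \<oplus>\<^bsub>XX\<^esub> g) = interp f \<oplus>\<^bsub>habiro_lim \<zeta>\<^esub> interp g"
    unfolding interp_def habiro_lim_def spec_ops(2)[OF f g] by (rule HZ.Phi_ops(2)[OF interp_nonempty[OF f] interp_nonempty[OF g]])
next
  show "interp \<one>\<^bsub>XX\<^esub> = \<one>\<^bsub>habiro_lim \<zeta>\<^esub>"
    unfolding interp_def habiro_lim_def spec_one by (rule HZ.Phi_one)
qed

lemma interp_interpolates: "interpolates \<zeta> R \<eta> ev f (interp f)"
  by (simp add: interpolates_def interp_def HZ.Phi_def HZ.ev_def)

lemma interp_q_laurent:
  assumes f: "f \<in> carrier XX" and s: "\<forall>n::int. n > 0 --> specialize \<zeta> R \<eta> ev (n - 1) f \<in> q_laurent \<zeta>"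
  shows "interp f \<in> q_laurent_lim \<zeta>"
proof -
  \<comment> \<open>The hypothesis speaks of n - 1 for positive n, so the exponent i belongs to n =
    i + 1.\<close>
  have sq: "spec i f \<in> q_laurent \<zeta>" for i using s[rule_format, of "int (Suc i)"] by simp
  obtain C where C: "!!l. C l \<in> carrier HZ" "!!i. spec i f = finsum HZ (%l. C l \<otimes>\<^bsub>HZ\<^esub> HZ.node i l) {..i}"
    using Newton_spec[OF f] by blast
  have Cq: "C l \<in> q_laurent \<zeta>" for l by (rule Newton_q_laurent[OF C sq])
  have "QL.L.Phi (%i. spec i f) N ~= {}" for N
  proof (rule QL.L.Phi_nonempty)
    show "C l \<in> carrier QL.L" for l using Cq by simp
    have nS: "HZ.node i k \<in> q_laurent \<zeta>" for i k using QL.L.node_closed[of i k] by (simp add: QL.node_L)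
    show "spec i f = finsum QL.L (%l. C l \<otimes>\<^bsub>QL.L\<^esub> QL.L.node i l) {..i}" for i
      unfolding C(2) QL.node_L using q_laurent_closed(6)[OF Cq nS] by (simp add: QL.finsum_L)
  qed
  from QL.Phi_L[OF this] show ?thesis unfolding q_laurent_lim_def interp_def Let_def .
qed

end

section \<open>Finitely generated rings\<close>

context cring
begin

text \<open>Finite sums of products from S and G. The coefficient set S will be a subring, the whole
  ring or an ideal; the last case expresses an ideal times a module.\<close>

inductive_set span for S G where
  zero: "\<zero> \<in> span S G"
| add: "b \<in> S ==> g \<in> G ==> v \<in> span S G ==> b \<otimes> g \<oplus> v \<in> span S G"

lemma span_mono: "v \<in> span S G ==> G <= H ==> v \<in> span S H"
  by (induction rule: span.induct) (auto intro: span.intros)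

lemma countable_span:
  assumes "countable S" "countable G" shows "countable (span S G)"
proof -
  have *: "v \<in> (%xs. foldr (%(b, g) v. b \<otimes> g \<oplus> v) xs \<zero>) ` lists (S \<times> G)" if "v \<in> span S G" for v
    using that
  proof induction
    case (add b g v)
    then obtain xs where "xs \<in> lists (S \<times> G)" "v = foldr (%(b, g) v. b \<otimes> g \<oplus> v) xs \<zero>" by blast
    then show ?case using add by (intro image_eqI[of _ _ "(b, g) # xs"]) auto
  qed (intro image_eqI[of _ _ "[]"], auto)
  have "countable ((%xs. foldr (%(b, g) v. b \<otimes> g \<oplus> v) xs \<zero>) ` lists (S \<times> G))" using assms by simp
  then show ?thesis by (rule countable_subset[rotated]) (rule subsetI, rule *)
qed

context
  fixes S G
  assumes S: "S <= carrier R" and G: "G <= carrier R"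
begin

lemma span_closed: "v \<in> span S G ==> v \<in> carrier R" by (induction rule: span.induct) (use S G in auto)

private lemma span_step:
  assumes "b \<in> S" "g \<in> G" "v \<in> span S G" shows "b \<in> carrier R" "g \<in> carrier R" "v \<in> carrier R"
  using assms S G span_closed by auto

lemma span_add: "u \<in> span S G ==> v \<in> span S G ==> u \<oplus> v \<in> span S G"
proof (induction rule: span.induct)
  case (add b g w)
  have "b \<otimes> g \<oplus> w \<oplus> v = b \<otimes> g \<oplus> (w \<oplus> v)" using span_step[OF add.hyps] span_closed[OF add.prems] by algebra
  then show ?case using span.add[OF add.hyps(1,2) add.IH[OF add.prems]] by (simp only:)
qed (use span_closed in simp)

lemma span_image:
  assumes y: "y \<in> carrier R" and H: "!!b g. b \<in> S ==> g \<in> G ==> \<exists>b'\<in>S'. \<exists>h\<in>H. y \<otimes> (b \<otimes> g) = b' \<otimes> h"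
  shows "v \<in> span S G ==> y \<otimes> v \<in> span S' H"
proof (induction rule: span.induct)
  case (add b g w)
  obtain b' h where b': "b' \<in> S'" "h \<in> H" "y \<otimes> (b \<otimes> g) = b' \<otimes> h" using H[OF add.hyps(1,2)] by blast
  have "y \<otimes> (b \<otimes> g \<oplus> w) = y \<otimes> (b \<otimes> g) \<oplus> y \<otimes> w" using y span_step[OF add.hyps] by algebra
  then show ?case using span.add[OF b'(1,2) add.IH] by (simp only: b'(3))
qed (use y span.zero[of S' H] in simp)

lemma span_smult:
  assumes s: "s \<in> carrier R" "!!b. b \<in> S ==> s \<otimes> b \<in> S"
  shows "v \<in> span S G ==> s \<otimes> v \<in> span S G"
proof (rule span_image[OF s(1)])
  fix b g assume "b \<in> S" "g \<in> G"
  then show "\<exists>b'\<in>S. \<exists>h\<in>G. s \<otimes> (b \<otimes> g) = b' \<otimes> h"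
    using s S G by (intro bexI[of _ "s \<otimes> b" S] bexI[of _ g G]) (simp_all add: m_assoc subset_iff)
qed

lemma span_ideal:
  assumes Y: "ideal Y R" and w: "w \<in> carrier R" "!!g. g \<in> G ==> w \<otimes> g \<in> Y"
  shows "v \<in> span S G ==> w \<otimes> v \<in> Y"
proof (induction rule: span.induct)
  interpret Y: ideal Y R by (rule Y)
  case (add b g z)
  have "w \<otimes> (b \<otimes> g \<oplus> z) = b \<otimes> (w \<otimes> g) \<oplus> w \<otimes> z" using span_step[OF add.hyps] w(1) by algebra
  also have "... \<in> Y" by (rule Y.a_closed[OF Y.I_l_closed[OF w(2)[OF add.hyps(2)] span_step(1)[OF add.hyps]] add.IH])
  finally show ?case .
qed (use w additive_subgroup.zero_closed[OF ideal.axioms(1)[OF Y]] in simp)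

end

lemma span_insert:
  assumes "v \<in> span S (insert x G)" and S: "S <= carrier R" "!!a b. a \<in> S ==> b \<in> S ==> a \<oplus> b \<in> S" "\<zero> \<in> S"
    and G: "insert x G <= carrier R"
  shows "\<exists>k\<in>S. \<exists>w\<in>span S G. v = k \<otimes> x \<oplus> w" using assms(1)
proof induction
  case zero
  show ?case using S(3) span.zero[of S G] G by (intro bexI[of _ \<zero>]) auto
next
  case (add b g v)
  then obtain k w where kw: "k \<in> S" "w \<in> span S G" "v = k \<otimes> x \<oplus> w" by blast
  have c: "b \<in> carrier R" "k \<in> carrier R" "w \<in> carrier R" "g \<in> carrier R" "x \<in> carrier R"
    using add.hyps(1,2) kw(1) S(1) G span_closed[OF S(1) _ kw(2)] by auto
  show ?case
  proof (cases "g = x")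
    case True
    have "b \<otimes> g \<oplus> v = (b \<oplus> k) \<otimes> x \<oplus> w" unfolding True kw(3) using c by algebra
    then show ?thesis using S(2)[OF add.hyps(1) kw(1)] kw(2) by blast
  next
    case False
    then have "b \<otimes> g \<oplus> w \<in> span S G" using span.add[OF add.hyps(1) _ kw(2)] add.hyps(2) by blast
    moreover have "b \<otimes> g \<oplus> v = k \<otimes> x \<oplus> (b \<otimes> g \<oplus> w)" unfolding kw(3) using c by algebra
    ultimately show ?thesis using kw(1) by blast
  qed
qed

text \<open>Values at x of polynomials over S of degree below n; for n = 0 only zero.\<close>

definition polys :: "'a set => 'a => nat => 'a set" where
  "polys S x n = span S ((%i. x [^] i) ` {..<n})"

text \<open>The ring S[x] when S is a subring.\<close>

definition adj :: "'a set => 'a => 'a set" where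
  "adj S x = span S (range (%i::nat. x [^] i))"

lemma countable_adj: "countable S ==> countable (adj S x)" unfolding adj_def by (rule countable_span) auto

text \<open>Hilbert's basis theorem for subrings: an ideal that is not finitely generated contains a sequence
  of elements of minimal degree outside the ideal generated by their predecessors.\<close>

definition noeth :: "'a set => bool" where
  "noeth S \<longleftrightarrow> (\<forall>I\<subseteq>S. \<zero> \<in> I & (\<forall>u\<in>I. \<forall>v\<in>I. u \<oplus> v \<in> I) & (\<forall>s\<in>S. \<forall>u\<in>I. s \<otimes> u \<in> I) -->
    (\<exists>G\<subseteq>I. finite G & I <= span S G))"

lemma span_subset:
  assumes "G <= I" "\<zero> \<in> I" "!!u v. u \<in> I ==> v \<in> I ==> u \<oplus> v \<in> I" "!!s u. s \<in> S ==> u \<in> I ==> s \<otimes> u \<in> I"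
  shows "v \<in> span S G ==> v \<in> I"
  by (induction rule: span.induct) (blast intro: assms(2-4) subsetD[OF assms(1)])+

context
  fixes S x
  assumes S: "subring S R" and x: "x \<in> carrier R"
begin

private lemma S': "S <= carrier R" "\<zero> \<in> S" "\<one> \<in> S" "a \<in> S ==> \<ominus> a \<in> S" "a \<in> S ==> b \<in> S ==> a \<otimes> b \<in> S"
  "a \<in> S ==> b \<in> S ==> a \<oplus> b \<in> S" by (rule subringE[OF S]; assumption?)+

private lemma X: "(%i::nat. x [^] i) ` A <= carrier R" using x by auto

lemma polys_add: "u \<in> polys S x n ==> v \<in> polys S x n ==> u \<oplus> v \<in> polys S x n"
  unfolding polys_def by (rule span_add[OF S'(1) X])

lemma polys_smult: "s \<in> S ==> v \<in> polys S x n ==> s \<otimes> v \<in> polys S x n"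
  unfolding polys_def by (rule span_smult[OF S'(1) X]) (use S' in auto)

lemma polys_adj: "polys S x n <= adj S x" unfolding polys_def adj_def by (rule subsetI, erule span_mono) auto

lemma adj_closed: "adj S x <= carrier R" unfolding adj_def by (rule subsetI, rule span_closed[OF S'(1) X])

lemma polys_x_pow: "v \<in> polys S x n ==> x [^] k \<otimes> v \<in> polys S x (n + k)" unfolding polys_def
proof (erule span_image[OF S'(1) X, rotated 2])
  fix b g assume b: "b \<in> S" and "g \<in> (%i. x [^] i) ` {..<n}"
  then obtain i where i: "g = x [^] i" "i < n" by blast
  have "x [^] k \<otimes> (b \<otimes> g) = b \<otimes> x [^] (i + k)"
    using b S'(1) x by (auto simp: i nat_pow_mult[symmetric] m_ac)
  then show "\<exists>b'\<in>S. \<exists>h\<in>(%i. x [^] i) ` {..<n + k}. x [^] k \<otimes> (b \<otimes> g) = b' \<otimes> h" using b i by (intro bexI[of _ b] bexI[of _ "x [^] (i + k)"]) auto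
qed (use x in simp)

lemma adj_polys: "v \<in> adj S x ==> \<exists>n. v \<in> polys S x n" unfolding adj_def
proof (induction rule: span.induct)
  case (add b g v)
  then obtain n i where n: "v \<in> polys S x n" "g = x [^] (i::nat)" by blast
  have "v \<in> polys S x (n + Suc i)" using n(1) unfolding polys_def by (rule span_mono) auto
  then have "b \<otimes> g \<oplus> v \<in> polys S x (n + Suc i)"
    unfolding polys_def n(2) by (intro span.add add.hyps) auto
  then show ?case by blast
qed (auto simp: polys_def intro: span.zero)

lemma adj_S: "S <= adj S x"
proof
  fix s assume s: "s \<in> S"
  have "s \<otimes> x [^] (0::nat) \<oplus> \<zero> \<in> adj S x" unfolding adj_def by (intro span.intros s rangeI)
  then show "s \<in> adj S x" using s S'(1) by auto
qed

lemma adj_x: "x \<in> adj S x"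
proof -
  have "\<one> \<otimes> x [^] (1::nat) \<oplus> \<zero> \<in> adj S x" unfolding adj_def by (intro span.intros S' rangeI)
  then show ?thesis using x by simp
qed

lemma subring_adj: "subring (adj S x) R"
proof (rule subringI)
  have sm: "s \<otimes> v \<in> adj S x" if s: "s \<in> S" and v: "v \<in> adj S x" for s v
    unfolding adj_def by (rule span_smult[OF S'(1) X _ _ v[unfolded adj_def]]) (use s S' in auto)
  show add: "u \<oplus> v \<in> adj S x" if "u \<in> adj S x" "v \<in> adj S x" for u v
    using that unfolding adj_def by (rule span_add[OF S'(1) X])
  show "\<ominus> u \<in> adj S x" if "u \<in> adj S x" for u
    using sm[OF S'(4)[OF S'(3)] that] that adj_closed by (auto simp: l_minus)
  fix u v assume u: "u \<in> adj S x" and v: "v \<in> adj S x"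
  have vc: "v \<in> carrier R" using v adj_closed by blast
  obtain n where n: "v \<in> polys S x n" using adj_polys[OF v] by blast
  show "u \<otimes> v \<in> adj S x" using u unfolding adj_def
  proof (induction rule: span.induct)
    case (add b g w)
    then obtain i where i: "g = x [^] (i::nat)" by blast
    have c: "b \<in> carrier R" "g \<in> carrier R" "w \<in> carrier R" using add.hyps i x S'(1) span_closed[OF S'(1) X add.hyps(3)] by auto
    have "(b \<otimes> g \<oplus> w) \<otimes> v = b \<otimes> (g \<otimes> v) \<oplus> w \<otimes> v" using c vc by algebra
    moreover have "b \<otimes> (g \<otimes> v) \<in> adj S x"
      unfolding i using polys_x_pow[OF n, of i] polys_adj sm add.hyps(1) by blast
    ultimately show ?case using add.IH \<open>!!u v. u \<in> adj S x ==> v \<in> adj S x ==> u \<oplus> v \<in> adj S x\<close> unfolding adj_def by simp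
  qed (use vc span.zero[of S] in simp)
qed (use adj_closed adj_S S'(3) in auto)

lemma noeth_adj:
  assumes n: "noeth S" shows "noeth (adj S x)" unfolding noeth_def
proof (intro allI impI, rule ccontr)
  fix I
  assume I: "I <= adj S x" "\<zero> \<in> I & (\<forall>u\<in>I. \<forall>v\<in>I. u \<oplus> v \<in> I) & (\<forall>s\<in>adj S x. \<forall>u\<in>I. s \<otimes> u \<in> I)"
    and nfg: "\<not> (\<exists>G\<subseteq>I. finite G & I <= span (adj S x) G)"
  note A = subringE[OF subring_adj]
  have xA: "x [^] k \<in> adj S x" for k :: nat by (induction k) (simp_all add: A(3) A(6) adj_x)
  have Ic: "I <= carrier R" using I(1) adj_closed by blast
  have I2: "\<zero> \<in> I" "!!u v. u \<in> I ==> v \<in> I ==> u \<oplus> v \<in> I" "!!s u. s \<in> adj S x ==> u \<in> I ==> s \<otimes> u \<in> I"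
    using I(2) by simp_all
  \<comment> \<open>\<open>P G n\<close> says that some element of I outside the ideal generated by
    G has degree below n. Below, \<open>d G\<close> is the least such n and \<open>f G\<close> an
    element attaining it.\<close>
  define P where "P = (%G n. \<exists>u\<in>I - span (adj S x) G. u \<in> polys S x n)"
  define d where "d = (%G. LEAST n. P G n)"
  have d: "P G (d G)" if "finite G" "G <= I" for G
  proof -
    have "\<not> I <= span (adj S x) G"
    proof
      assume "I <= span (adj S x) G"
      then have "\<exists>G\<subseteq>I. finite G & I <= span (adj S x) G" by (intro exI[of _ G] conjI that)
      then show False using nfg by (rule notE[rotated])
    qed
    then obtain u where u: "u \<in> I" "u \<notin> span (adj S x) G" unfolding subset_iff by auto
    obtain n where "u \<in> polys S x n" using adj_polys[OF subsetD[OF I(1) u(1)]] by (rule exE)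
    then have "P G n" unfolding P_def using u by (intro bexI[of _ u] DiffI)
    then show ?thesis unfolding d_def by (rule LeastI)
  qed
  have dle: "d G \<le> n" if "P G n" for G n unfolding d_def using that by (rule Least_le)
  define f where "f = (%G. SOME u. u \<in> I - span (adj S x) G & u \<in> polys S x (d G))"
  have f: "f G \<in> I - span (adj S x) G & f G \<in> polys S x (d G)" if "finite G" "G <= I" for G
    unfolding f_def by (rule someI_ex) (use d[OF that] in \<open>auto simp: P_def\<close>)
  define F where "F = rec_nat {} (%_ G. insert (f G) G)"
  define D where "D = (%i. d (F i) - 1)"
  have FI: "finite (F i) & F i <= I" for i by (induction i) (auto simp: F_def dest: f)
  have Fm: "i \<le> j ==> F i <= F j" for i j by (rule lift_Suc_mono_le[of F]) (auto simp: F_def)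
  note fF = f[OF conjunct1[OF FI] conjunct2[OF FI]]
  \<comment> \<open>Zero lies in every span, so an element outside it has positive length;
    \<open>D i\<close> is its degree.\<close>
  have Df: "d (F i) = Suc (D i)" for i
    using fF[of i] span.zero by (cases "d (F i)") (auto simp: D_def polys_def elim: span.cases)
  have Dm: "D i \<le> D j" if "i \<le> j" for i j unfolding D_def
    by (intro diff_le_mono dle) (use fF[of j] span_mono[OF _ Fm[OF that]] in \<open>auto simp: P_def\<close>)
  have "\<exists>a\<in>S. \<exists>w\<in>polys S x (D i). f (F i) = a \<otimes> x [^] D i \<oplus> w" for i
    unfolding polys_def by (rule span_insert) (use fF[of i] x S' in \<open>auto simp: Df polys_def lessThan_Suc\<close>)
  then obtain a w where aw: "!!i. a i \<in> S" "!!i. w i \<in> polys S x (D i)" "!!i. f (F i) = a i \<otimes> x [^] D i \<oplus> w i" by metis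
  have ac: "a ` J <= carrier R" for J using aw(1) S'(1) by blast
  \<comment> \<open>The ideal of leading coefficients is finitely generated, so for a suitable N the
    coefficient a_N lies in the ideal generated by the earlier ones.\<close>
  define L where "L = span S (range a)"
  have sS: "u \<in> span S (a ` J) ==> s \<in> S ==> s \<otimes> u \<in> span S (a ` J)" for s u J
    by (rule span_smult[OF S'(1) ac]) (use S' in auto)
  have "L <= S" unfolding L_def by (rule subsetI, rule span_subset[OF _ S'(2,6,5)]) (use aw(1) in auto)
  then have "\<exists>G\<subseteq>L. finite G & L <= span S G" using n unfolding noeth_def
    by (elim allE[of _ L] impE) (auto simp: L_def intro: span.zero span_add[OF S'(1) ac] sS)
  then obtain G where G: "G <= L" "finite G" "L <= span S G" by blast
  have "\<exists>N. v \<in> span S (a ` {..<N})" if "v \<in> L" for v using that unfolding L_def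
  proof (induction rule: span.induct)
    case (add b g v)
    then obtain N i where N: "v \<in> span S (a ` {..<N})" "g = a i" by blast
    have "v \<in> span S (a ` {..<N + Suc i})" using N(1) by (rule span_mono) auto
    then show ?case unfolding N(2) by (intro exI[of _ "N + Suc i"] span.add add.hyps) auto
  qed (auto intro: span.zero)
  then obtain N' where N': "!!v. v \<in> L ==> v \<in> span S (a ` {..<N' v})" by metis
  define N where "N = Max (N' ` G)"
  have GN: "G <= span S (a ` {..<N})"
  proof
    fix g assume g: "g \<in> G"
    then have "N' g \<le> N" using G(2) by (simp add: N_def)
    then show "g \<in> span S (a ` {..<N})" using G(1) g by (intro span_mono[OF N']) auto
  qed
  have aG: "a N \<in> span S G" using G(3) span.add[OF S'(3), of "a N" "range a" \<zero>] span.zero subsetD[OF S'(1) aw(1)[of N]] by (auto simp: L_def)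
  have aN: "a N \<in> span S (a ` {..<N})"
    by (rule span_subset[OF GN _ _ _ aG]) (auto intro: span.zero span_add[OF S'(1) ac] sS)
  \<comment> \<open>Powers of x raise the leading terms of the earlier elements to degree
    \<open>D N\<close>, so every combination of their leading coefficients is the leading
    coefficient of an element generated by \<open>F N\<close>.\<close>
  have "\<exists>h\<in>span (adj S x) (F N). \<exists>v\<in>polys S x (D N). h = z \<otimes> x [^] D N \<oplus> v" if "z \<in> span S (a ` {..<N})" for z
    using that
  proof induction
    case zero
    show ?case using x by (intro bexI[of _ \<zero>]) (auto simp: polys_def span.zero)
  next
    case (add b g z)
    then obtain h v i where h: "h \<in> span (adj S x) (F N)" "v \<in> polys S x (D N)" "h = z \<otimes> x [^] D N \<oplus> v" and i: "g = a i" "i < N"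
      by blast
    have v': "x [^] (D N - D i) \<otimes> w i \<in> polys S x (D N)" using polys_x_pow[OF aw(2), of "D N - D i" i] Dm[of i N] i by simp
    have c: "b \<in> carrier R" "z \<in> carrier R" "a i \<in> carrier R" "w i \<in> carrier R" "v \<in> carrier R"
      using add.hyps(1) aw(1)[of i] S'(1) span_closed[OF S'(1) ac add.hyps(3)] aw(2)[of i] h(2) polys_adj adj_closed by auto
    have "x [^] D N = x [^] (D N - D i) \<otimes> x [^] D i" using x Dm[of i N] i by (simp add: nat_pow_mult)
    then have "(b \<otimes> x [^] (D N - D i)) \<otimes> f (F i) \<oplus> h = (b \<otimes> g \<oplus> z) \<otimes> x [^] D N \<oplus> (b \<otimes> (x [^] (D N - D i) \<otimes> w i) \<oplus> v)"
      unfolding aw(3) h(3) i(1) using c nat_pow_closed[OF x, of "D N - D i"] nat_pow_closed[OF x, of "D i"] by (simp only:) algebra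
    moreover have "b \<otimes> (x [^] (D N - D i) \<otimes> w i) \<oplus> v \<in> polys S x (D N)"
      by (intro polys_add polys_smult add.hyps(1) v' h(2))
    moreover have "b \<otimes> x [^] (D N - D i) \<in> adj S x" by (intro A(6) subsetD[OF adj_S] add.hyps(1) xA)
    moreover have "f (F i) \<in> F N" using Fm[of "Suc i" N] i by (auto simp: F_def)
    ultimately show ?case using span.add[OF _ _ h(1)] by (intro bexI[of _ "(b \<otimes> x [^] (D N - D i)) \<otimes> f (F i) \<oplus> h"] bexI[of _ "b \<otimes> (x [^] (D N - D i) \<otimes> w i) \<oplus> v"])
  qed
  from this[OF aN] obtain h v where h: "h \<in> span (adj S x) (F N)" "v \<in> polys S x (D N)" "h = a N \<otimes> x [^] D N \<oplus> v" by blast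
  have Fc: "F N <= carrier R" using FI[of N] Ic by blast
  have hI: "h \<in> I" by (rule span_subset[OF conjunct2[OF FI] I2 h(1)])
  have c: "h \<in> carrier R" "a N \<in> carrier R" "w N \<in> carrier R" "v \<in> carrier R" "x [^] D N \<in> carrier R"
    using span_closed[OF A(1) Fc h(1)] ac subsetD[OF adj_closed subsetD[OF polys_adj aw(2)]] subsetD[OF adj_closed subsetD[OF polys_adj h(2)]] x by auto
  \<comment> \<open>Subtracting h removes the leading term of the N-th element and leaves it outside
    the span, against the minimality of its degree.\<close>
  define u where "u = f (F N) \<oplus> \<ominus> \<one> \<otimes> h"
  have u: "u = w N \<oplus> \<ominus> \<one> \<otimes> v" "u \<oplus> h = f (F N)" unfolding u_def aw(3) h(3) using c by algebra+
  have "u \<in> I" unfolding u_def using fF[of N] by (intro I2 A hI) simp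
  moreover have "u \<notin> span (adj S x) (F N)" using span_add[OF A(1) Fc _ h(1), of u] fF[of N] by (auto simp: u(2))
  moreover have "u \<in> polys S x (D N)" unfolding u(1) by (intro polys_add polys_smult S' aw(2) h(2))
  ultimately have "d (F N) \<le> D N" by (intro dle) (auto simp: P_def)
  then show False by (simp add: Df)
qed

end

lemma subring_int: "subring (range (int_in R)) R"
proof (rule subringI)
  have "int_in R 1 \<in> range (int_in R)" by (rule rangeI)
  then show "\<one> \<in> range (int_in R)" by (simp add: int_in_one)
  show "\<ominus> u \<in> range (int_in R)" if u: "u \<in> range (int_in R)" for u
  proof -
    obtain c where c: "u = int_in R c" using u by blast
    have "int_in R (- c) \<oplus> u = \<zero>" unfolding c by (simp flip: int_in_add)
    then have "\<ominus> u = int_in R (- c)" using c by (intro minus_equality) auto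
    then show ?thesis by simp
  qed
qed (auto simp flip: int_in_add int_in_mult)

lemma noeth_int: "noeth (range (int_in R))" unfolding noeth_def
proof (intro allI impI)
  fix I
  assume sub: "I <= range (int_in R)"
    and "\<zero> \<in> I & (\<forall>u\<in>I. \<forall>v\<in>I. u \<oplus> v \<in> I) & (\<forall>s\<in>range (int_in R). \<forall>u\<in>I. s \<otimes> u \<in> I)"
  then have I: "int_in R a \<in> I ==> int_in R b \<in> I ==> int_in R (a + b) \<in> I" "int_in R b \<in> I ==> int_in R (a * b) \<in> I" for a b
    by (simp_all add: int_in_add int_in_mult)
  define P where "P = (%c. int_in R c \<in> I & c ~= 0)"
  \<comment> \<open>A nonzero element of least absolute value, or 0 if I is zero; in that case the
    second property is vacuous.\<close>
  obtain c where c: "int_in R c \<in> I" "!!b. int_in R b \<in> I ==> b ~= 0 ==> c ~= 0 & \<bar>c\<bar> \<le> \<bar>b\<bar>"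
  proof (cases "\<exists>c. P c")
    case True
    then obtain c where c: "P c" "!!b. P b ==> nat \<bar>c\<bar> \<le> nat \<bar>b\<bar>" using ex_has_least_nat[of P _ "%c. nat \<bar>c\<bar>"] by blast
    have "\<bar>c\<bar> \<le> \<bar>b\<bar>" if "P b" for b using c(2)[OF that] by simp
    then show ?thesis using c(1) by (intro that[of c]) (auto simp: P_def)
  qed (use \<open>\<zero> \<in> I & _\<close> that[of 0] in \<open>auto simp: P_def\<close>)
  have "I <= span (range (int_in R)) {int_in R c}"
  proof
    fix u assume u: "u \<in> I"
    then obtain b where b: "u = int_in R b" using sub by blast
    have "int_in R (b + (- (b div c)) * c) \<in> I" by (intro I c u[unfolded b])
    then have "int_in R (b mod c) \<in> I" by (simp add: minus_div_mult_eq_mod)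
    then have "b mod c = 0" using c(2)[of "b mod c"] abs_mod_less[of c b] by fastforce
    then have "u = int_in R (b div c) \<otimes> int_in R c \<oplus> \<zero>"
      unfolding b by (simp flip: int_in_mult add: minus_mod_eq_div_mult[symmetric])
    then show "u \<in> span (range (int_in R)) {int_in R c}" by (simp only: span.add[OF rangeI insertI1 span.zero])
  qed
  then show "\<exists>G\<subseteq>I. finite G & I <= span (range (int_in R)) G" using c(1) by (intro exI[of _ "{int_in R c}"]) simp
qed

text \<open>Gaussian elimination in place of the determinant trick behind Nakayama's lemma\<close>

lemma eliminate:
  assumes K: "ideal K R" and Y: "ideal Y R" and U: "U <= carrier R"
    "!!u v. u \<in> U ==> v \<in> U ==> u \<otimes> v \<in> U" "!!u k. u \<in> U ==> k \<in> K ==> u \<ominus> k \<in> U"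
    and G: "finite G" "G <= carrier R"
    and u: "u \<in> U" "!!g. g \<in> G ==> \<exists>v\<in>span K G. u \<otimes> g \<ominus> v \<in> Y"
  shows "\<exists>w\<in>U. \<forall>g\<in>G. w \<otimes> g \<in> Y" using G u
proof (induction arbitrary: u rule: finite_induct)
  case (insert x G)
  interpret K: ideal K R by (rule K)
  interpret Y: ideal Y R by (rule Y)
  have Kc: "K <= carrier R" using K.Icarr by blast
  have G: "G <= carrier R" and x: "x \<in> carrier R" using insert.prems(1) by auto
  have uc: "u \<in> carrier R" using insert.prems(2) U(1) by blast
  note sp = span_add[OF Kc G] and sc = span_closed[OF Kc G]
  have sm: "s \<otimes> v \<in> span K G" if "s \<in> carrier R" "v \<in> span K G" for s v
    by (rule span_smult[OF Kc G that(1) _ that(2)]) (rule K.I_l_closed[OF _ that(1)])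
  have dec: "\<exists>k\<in>K. \<exists>v\<in>span K G. u \<otimes> g \<ominus> (k \<otimes> x \<oplus> v) \<in> Y" if g: "g \<in> insert x G" for g
  proof -
    obtain v where v: "v \<in> span K (insert x G)" "u \<otimes> g \<ominus> v \<in> Y" using insert.prems(3)[OF g] by blast
    have "\<exists>k\<in>K. \<exists>w\<in>span K G. v = k \<otimes> x \<oplus> w"
      by (rule span_insert[OF v(1) Kc K.a_closed _ insert.prems(1)]) auto
    then show ?thesis using v(2) by blast
  qed
  obtain k0 v0 where 0: "k0 \<in> K" "v0 \<in> span K G" "u \<otimes> x \<ominus> (k0 \<otimes> x \<oplus> v0) \<in> Y" using dec[of x] by blast
  \<comment> \<open>Modulo Y, v takes x into the span of the remaining generators; it stays in U
    because k0 is in K.\<close>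
  define v where "v = u \<ominus> k0"
  have c0: "k0 \<in> carrier R" "v0 \<in> carrier R" using 0 K.Icarr sc by auto
  have vU: "v \<in> U" unfolding v_def by (rule U(3)[OF insert.prems(2) 0(1)])
  have vc: "v \<in> carrier R" using vU U(1) by blast
  have "v \<otimes> x \<ominus> v0 = u \<otimes> x \<ominus> (k0 \<otimes> x \<oplus> v0)" unfolding v_def using uc c0 x by algebra
  then have vx: "v \<otimes> x \<ominus> v0 \<in> Y" using 0(3) by (simp only:)
  have "\<exists>z\<in>span K G. (v \<otimes> u) \<otimes> g \<ominus> z \<in> Y" if g: "g \<in> G" for g
  proof -
    have gc: "g \<in> carrier R" using g G by blast
    obtain k w where kw: "k \<in> K" "w \<in> span K G" "u \<otimes> g \<ominus> (k \<otimes> x \<oplus> w) \<in> Y" using dec[of g] g by blast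
    have c: "k \<in> carrier R" "w \<in> carrier R" using kw K.Icarr sc by auto
    \<comment> \<open>The relation for g is multiplied by v, and then v x is replaced by v0, which
      eliminates x.\<close>
    have "(v \<otimes> u) \<otimes> g \<ominus> (v \<otimes> w \<oplus> k \<otimes> v0) = v \<otimes> (u \<otimes> g \<ominus> (k \<otimes> x \<oplus> w)) \<oplus> k \<otimes> (v \<otimes> x \<ominus> v0)"
      using c c0 vc uc gc x by algebra
    also have "... \<in> Y" by (rule Y.a_closed[OF Y.I_l_closed[OF kw(3) vc] Y.I_l_closed[OF vx c(1)]])
    finally show ?thesis using sp[OF sm[OF vc kw(2)] sm[OF c(1) 0(2)]] by blast
  qed
  from insert.IH[OF G U(2)[OF vU insert.prems(2)] this]
  obtain w where w: "w \<in> U" "!!g. g \<in> G ==> w \<otimes> g \<in> Y" by blast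
  have wc: "w \<in> carrier R" using w(1) U(1) by blast
  note ws = span_ideal[OF Kc G Y wc w(2)]
  have "(w \<otimes> v) \<otimes> g \<in> Y" if "g \<in> insert x G" for g
  proof (cases "g = x")
    case True
    have "(w \<otimes> v) \<otimes> x = w \<otimes> (v \<otimes> x \<ominus> v0) \<oplus> w \<otimes> v0" using wc vc x c0 by algebra
    also have "... \<in> Y" by (rule Y.a_closed[OF Y.I_l_closed[OF vx wc] ws[OF _ 0(2)]])
    finally show ?thesis using True by simp
  next
    case False
    then have g: "g \<in> G" "g \<in> carrier R" using that G by auto
    have "(w \<otimes> v) \<otimes> g = v \<otimes> (w \<otimes> g)" using wc vc g(2) by algebra
    then show ?thesis using Y.I_l_closed[OF w(2)[OF g(1)] vc] by simp
  qed
  then show ?case using U(2)[OF w(1) vU] by blast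
qed auto

end

section \<open>Finite generation of R over the integers\<close>

context etale_over_laurent
begin

text \<open>By finite presentation over Z[t, 1/t], R is generated as a ring by finitely many
  elements. So a property that holds for the image of Z and passes from S to S[x] reaches R.\<close>

lemma fg_induct:
  assumes int: "P (range (int_in R))"
    and adj: "!!S x. subring S R ==> x \<in> carrier R ==> P S ==> P (R.adj S x)"
  shows "P (carrier R)"
proof -
  let ?A = "laurent \<Z>"
  interpret A: cring ?A by (rule int.cring_laurent)
  obtain N h where h: "h \<in> ring_hom (mpoly_ring N ?A) R" "h ` carrier (mpoly_ring N ?A) = carrier R"
    "!!a. a \<in> carrier ?A ==> h (monomial ?A a 0) = \<eta> a"
    using etale unfolding etale_algebra_def finitely_presented_def by blast
  have mp: "carrier (mpoly_ring N ?A) = {f \<in> carrier (monoid_algebra ?A). \<forall>k. f k ~= \<zero>\<^bsub>?A\<^esub> --> Poly_Mapping.keys k <= {..<N}}"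
    "f \<oplus>\<^bsub>mpoly_ring N ?A\<^esub> g = f \<oplus>\<^bsub>monoid_algebra ?A\<^esub> g" "f \<otimes>\<^bsub>mpoly_ring N ?A\<^esub> g = f \<otimes>\<^bsub>monoid_algebra ?A\<^esub> g" for f g
    by (simp_all add: mpoly_ring_def)
  have mon: "monomial ?A a k \<in> carrier (mpoly_ring N ?A)" if "a \<in> carrier ?A" "Poly_Mapping.keys k <= {..<N}" for a k
    using that A.monomial_closed[OF that(1), of k] unfolding mp by (auto simp: monomial_def)
  let ?x = "%k. h (monomial ?A \<one>\<^bsub>?A\<^esub> k)"
  have xc: "?x (Poly_Mapping.single i 1) \<in> carrier R" if "i < N" for i
    by (rule ring_hom_closed[OF h(1) mon]) (use that in auto)
  \<comment> \<open>The generators: t, its inverse and the images of the polynomial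
    variables.\<close>
  define Gs where "Gs = (%e::int. \<tau> [^]\<^bsub>R\<^esub> e) ` {1, - 1} \<union> (%i. ?x (Poly_Mapping.single i 1)) ` {..<N}"
  have Gs: "finite Gs" "Gs <= carrier R" unfolding Gs_def using xc R.Units_int_pow(5)[OF tau_Units] by auto
  then have "\<exists>T. subring T R & P T & range (int_in R) <= T & Gs <= T"
  proof (induction rule: finite_induct)
    case empty
    show ?case using R.subring_int int by blast
  next
    case (insert x Gs)
    then obtain T where T: "subring T R" "P T" "range (int_in R) <= T" "Gs <= T" by auto
    have x: "x \<in> carrier R" using insert by simp
    show ?case using R.subring_adj[OF T(1) x] adj[OF T(1) x T(2)] R.adj_x[OF T(1) x] R.adj_S[OF T(1) x] T(3,4)
      by (intro exI[of _ "R.adj T x"]) auto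
  qed
  then obtain T where T: "subring T R" "P T" "range (int_in R) <= T" "Gs <= T" by blast
  note T' = subringE[OF T(1)]
  have tau: "\<tau> [^]\<^bsub>R\<^esub> (e * int n) \<in> T" if "e = 1 \<or> e = - 1" for e n
  proof (induction n)
    case (Suc n)
    have "\<tau> [^]\<^bsub>R\<^esub> e \<in> T" using that T(4) by (auto simp: Gs_def)
    moreover have "\<tau> [^]\<^bsub>R\<^esub> (e * int (Suc n)) = \<tau> [^]\<^bsub>R\<^esub> e \<otimes>\<^bsub>R\<^esub> \<tau> [^]\<^bsub>R\<^esub> (e * int n)"
      unfolding R.Units_int_pow(2)[OF tau_Units, symmetric] by (simp add: distrib_left)
    ultimately show ?case using T'(6) Suc by simp
  qed (simp add: T'(3))
  have etaT: "\<eta> a \<in> T" if a: "a \<in> carrier ?A" for a using a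
  proof (induction rule: int.laurent_induct)
    case (monomial c k)
    have "\<eta> (monomial \<Z> c k) = int_in R c \<otimes>\<^bsub>R\<^esub> \<tau> [^]\<^bsub>R\<^esub> k"
      using laurent_Z_hom_unique(2)[OF cring_R eta_hom refl int.monomial_closed[of c k]]
        laurent_eval_monomial[OF cring_int cring_R R.int_in_hom tau_Units, of c k] by simp
    moreover have "\<tau> [^]\<^bsub>R\<^esub> k \<in> T" using tau[of 1 "nat k"] tau[of "- 1" "nat (- k)"] by (cases "k \<ge> 0") simp_all
    ultimately show ?case using T'(6)[OF subsetD[OF T(3) rangeI[of _ c]]] by simp
  qed (use ring_hom_0[OF A.is_cring cring_R eta_hom] T'(2) ring_hom_add[OF eta_hom] T'(7) in simp_all)
  define M where "M = {k. Poly_Mapping.keys k <= {..<N} & ?x k \<in> T}"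
  have M0: "0 \<in> M" using h(3)[OF A.one_closed] etaT[OF A.one_closed] by (simp add: M_def)
  have Madd: "j + k \<in> M" if "j \<in> M" "k \<in> M" for j k
  proof -
    have "?x (j + k) = ?x j \<otimes>\<^bsub>R\<^esub> ?x k"
      using that ring_hom_mult[OF h(1) mon mon, of "\<one>\<^bsub>?A\<^esub>" j "\<one>\<^bsub>?A\<^esub>" k] by (simp add: M_def mp(3) A.monomial_mult)
    then show ?thesis using that T'(6) Poly_Mapping.keys_add[of j k] by (auto simp: M_def)
  qed
  have sM: "Poly_Mapping.single i e \<in> M" if "i < N" for i e
  proof (induction e)
    case (Suc e)
    have "Poly_Mapping.single i 1 \<in> M" using that T(4) by (auto simp: M_def Gs_def)
    from Madd[OF this Suc] show ?case by (simp flip: single_add)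
  qed (simp add: M0)
  have "(\<Sum>i\<in>F. Poly_Mapping.single i (e i)) \<in> M" if "finite F" "F <= {..<N}" for F e
    using that by (induction F rule: finite_induct) (auto simp: M0 intro: Madd sM)
  moreover have "k = (\<Sum>i\<in>Poly_Mapping.keys k. Poly_Mapping.single i (Poly_Mapping.lookup k i))" for k :: "nat \<Rightarrow>\<^sub>0 nat"
    by (rule poly_mapping_eqI) (simp add: lookup_sum lookup_single when_def in_keys_iff)
  ultimately have M: "k \<in> M" if "Poly_Mapping.keys k <= {..<N}" for k using that by (metis finite_keys)
  have "h f \<in> T" if f: "f \<in> carrier (mpoly_ring N ?A)" for f
  proof -
    have f': "f \<in> carrier (monoid_algebra ?A)" "!!k. f k ~= \<zero>\<^bsub>?A\<^esub> ==> Poly_Mapping.keys k <= {..<N}" using f by (auto simp: mp)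
    \<comment> \<open>Membership in \<open>mpoly_ring\<close> is carried along because additivity of
      h is known only there.\<close>
    have "h f \<in> T & f \<in> carrier (mpoly_ring N ?A)" using f'(1)
    proof (induction rule: A.monoid_algebra_induct)
      case zero
      show ?case using h(3)[OF A.zero_closed] etaT[OF A.zero_closed] mon[OF A.zero_closed, of 0] by (simp add: monomial_def)
    next
      case (add g k)
      have c: "f k \<in> carrier ?A" using f'(1) by (simp add: laurent_simps(1)[of "laurent \<Z>"])
      have kN: "Poly_Mapping.keys k <= {..<N}" using f'(2) add by blast
      have "monomial ?A (f k) k = monomial ?A (f k) 0 \<otimes>\<^bsub>mpoly_ring N ?A\<^esub> monomial ?A \<one>\<^bsub>?A\<^esub> k"
        using c by (simp add: mp(3) A.monomial_mult)
      then have "h (monomial ?A (f k) k) = \<eta> (f k) \<otimes>\<^bsub>R\<^esub> ?x k"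
        using ring_hom_mult[OF h(1) mon[OF c, of 0] mon[OF A.one_closed kN]] h(3)[OF c] by simp
      moreover have "?x k \<in> T" using M[OF kN] by (simp add: M_def)
      ultimately have "h (monomial ?A (f k) k) \<in> T" using T'(6)[OF etaT[OF c]] by simp
      moreover have "Poly_Mapping.keys j <= {..<N}" if "(monomial ?A (f k) k \<oplus>\<^bsub>monoid_algebra ?A\<^esub> g) j ~= \<zero>\<^bsub>?A\<^esub>" for j
        using that kN f'(2)[of j] add(2)[of j]
        by (cases "g j = \<zero>\<^bsub>?A\<^esub>") (auto simp: laurent_simps(4)[of "laurent \<Z>"] monomial_def split: if_splits)
      then have "monomial ?A (f k) k \<oplus>\<^bsub>mpoly_ring N ?A\<^esub> g \<in> carrier (mpoly_ring N ?A)"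
        using A.monoid_algebra_add_closed[OF A.monomial_closed[OF c] add(1)] by (simp add: mp)
      ultimately show ?case using ring_hom_add[OF h(1) mon[OF c kN], of g] add T'(7) by (simp add: mp(2))
    qed
    then show ?thesis by blast
  qed
  then have "carrier R = T" using T'(1) unfolding h(2)[symmetric] by blast
  then show ?thesis using T(2) by simp
qed

lemma countable_R: "countable (carrier R)" by (rule fg_induct) (simp_all add: R.countable_adj)

lemma noeth_R: "R.noeth (carrier R)" by (rule fg_induct) (rule R.noeth_int, rule R.noeth_adj)

end

section \<open>Krull's intersection theorem at t = 1\<close>

context habiro_etale
begin

definition "ker_ev = a_kernel R \<Z> ev"

lemma ker_ev_iff: "r \<in> ker_ev \<longleftrightarrow> r \<in> carrier R & ev r = 0"
  by (simp add: ker_ev_def a_kernel_def')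

lemma ideal_ker_ev: "ideal ker_ev R" unfolding ker_ev_def
  by (rule ring_hom_ring.kernel_is_ideal) (simp add: ring_hom_ringI2 R.ring_axioms cring.axioms(1)[OF cring_int] ev_hom)

lemma ev_minus: "r \<in> carrier R ==> s \<in> carrier R ==> ev (r \<ominus>\<^bsub>R\<^esub> s) = ev r - ev s"
  using ring_hom_minus[OF cring_R cring_int ev_hom, of r s] by (simp add: int_ring_eq minus_rg del: rg_simps)

text \<open>The multiplicative set 1 + \<open>ker_ev\<close>, which supplies the multipliers in
  eliminations.\<close>

definition "ev1 = {u \<in> carrier R. ev u = 1}"

lemma ev1: "ev1 <= carrier R" "u \<in> ev1 ==> v \<in> ev1 ==> u \<otimes>\<^bsub>R\<^esub> v \<in> ev1" "u \<in> ev1 ==> k \<in> ker_ev ==> u \<ominus>\<^bsub>R\<^esub> k \<in> ev1" "\<one>\<^bsub>R\<^esub> \<in> ev1"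
  using ring_hom_mult[OF ev_hom] ring_hom_one[OF ev_hom] by (auto simp: ev1_def ker_ev_iff ev_minus)

lemma noeth_ideal:
  assumes I: "ideal I R" obtains G where "finite G" "G <= I" "I <= R.span (carrier R) G" "G <= carrier R"
proof -
  interpret I: ideal I R by (rule I)
  have "I <= carrier R" using I.Icarr by blast
  then show thesis using noeth_R that I.I_l_closed unfolding R.noeth_def by (metis I.a_closed I.zero_closed order.trans)
qed

text \<open>\<open>ker_ev\<close> is generated by \<open>t - 1\<close> modulo its square: by uniqueness of infinitesimal lifts, the projection
  and \<open>ev\<close> agree modulo \<open>t - 1\<close> and this square.\<close>

lemma ker_ev_local:
  obtains s where "s \<in> ev1" "!!r. r \<in> ker_ev ==> \<exists>r'\<in>carrier R. s \<otimes>\<^bsub>R\<^esub> r = (\<tau> \<ominus>\<^bsub>R\<^esub> \<one>\<^bsub>R\<^esub>) \<otimes>\<^bsub>R\<^esub> r'"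
proof -
  let ?y = "\<tau> \<ominus>\<^bsub>R\<^esub> \<one>\<^bsub>R\<^esub>" and ?J = "ker_ev"
  have y: "?y \<in> carrier R" using tau_closed by simp
  define Y where "Y = PIdl\<^bsub>R\<^esub> ?y"
  interpret Y: ideal Y R unfolding Y_def by (rule R.cgenideal_ideal[OF y])
  interpret J: ideal ker_ev R by (rule ideal_ker_ev)
  have Jc: "ker_ev <= carrier R" using J.Icarr by blast
  obtain G where G: "finite G" "G <= ker_ev" "ker_ev <= R.span (carrier R) G" "G <= carrier R" by (rule noeth_ideal[OF ideal_ker_ev])
  \<comment> \<open>With J = \<open>ker_ev\<close> generated by G, the product of J with itself is
    spanned by G with coefficients in J.\<close>
  have JG: "v \<in> R.span ?J G" if "v \<in> ?J \<cdot>\<^bsub>R\<^esub> ?J" for v using that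
  proof induction
    case (prod a b)
    have "\<exists>b'\<in>?J. \<exists>h\<in>G. a \<otimes>\<^bsub>R\<^esub> (c \<otimes>\<^bsub>R\<^esub> g) = b' \<otimes>\<^bsub>R\<^esub> h" if "c \<in> carrier R" "g \<in> G" for c g
      using that G(4) J.I_r_closed[OF prod(1) that(1)] J.Icarr[OF prod(1)]
      by (intro bexI[of _ "a \<otimes>\<^bsub>R\<^esub> c"] bexI[of _ g]) (auto simp: R.m_assoc)
    then show ?case using G(3) prod by (intro R.span_image[OF order.refl G(4) J.Icarr[OF prod(1)]]) auto
  next
    case (sum u v)
    then show ?case by (intro R.span_add[OF Jc G(4)])
  qed
  \<comment> \<open>The square of J together with t - 1; the point is that J lies in it.\<close>
  define Z where "Z = ?J \<cdot>\<^bsub>R\<^esub> ?J <+>\<^bsub>R\<^esub> Y"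
  have Z: "ideal Z R" unfolding Z_def by (intro R.add_ideals R.ideal_prod_is_ideal ideal_ker_ev Y.ideal_axioms)
  interpret Z: ideal Z R by (rule Z)
  have ZG: "\<exists>v\<in>R.span ?J G. z \<ominus>\<^bsub>R\<^esub> v \<in> Y" if z: "z \<in> Z" for z
  proof -
    obtain u w where u: "u \<in> ?J \<cdot>\<^bsub>R\<^esub> ?J" "w \<in> Y" "z = u \<oplus>\<^bsub>R\<^esub> w" using z by (auto simp: Z_def set_add_def')
    have "u \<in> carrier R" using R.span_closed[OF Jc G(4) JG[OF u(1)]] .
    then have "z \<ominus>\<^bsub>R\<^esub> u = w" using Y.Icarr[OF u(2)] unfolding u(3) by algebra
    then show ?thesis using JG u by blast
  qed
  have ZI: "u \<oplus>\<^bsub>R\<^esub> w \<in> Z" if "u \<in> ?J \<cdot>\<^bsub>R\<^esub> ?J" "w \<in> Y" for u w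
    unfolding Z_def set_add_def' using that by blast
  have JJ: "a \<otimes>\<^bsub>R\<^esub> b \<in> Z" if "a \<in> ?J" "b \<in> ?J" for a b
    using ZI[OF ideal_prod.prod[OF that] Y.zero_closed] J.Icarr that by simp
  have yZ: "?y \<in> Z"
    using ZI[OF ideal_prod.prod[OF J.zero_closed J.zero_closed] R.cgenideal_self[OF y, folded Y_def]] y by simp
  define \<pi> where "\<pi> = (%r. Z +>\<^bsub>R\<^esub> r)"
  have T: "cring (R Quot Z)" by (rule Z.quotient_is_cring[OF cring_R])
  interpret T: cring "R Quot Z" by (rule T)
  have \<pi>: "\<pi> \<in> ring_hom R (R Quot Z)" unfolding \<pi>_def by (rule Z.rcos_ring_hom)
  have \<pi>s: "\<pi> ` carrier R = carrier (R Quot Z)" unfolding \<pi>_def by (rule surj_image_carrier[OF Z])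
  have inj: "inj_on (%C. Inr (Inl (SOME a. a \<in> C)) :: (int => int) + 'a + nat) (carrier (R Quot Z))"
    by (rule inj_Quot_some[OF Z]) (simp add: inj_on_def)
  have JZ: "r \<in> Z" if r: "r \<in> ?J" for r
  proof -
    have "\<pi> r \<ominus>\<^bsub>R Quot Z\<^esub> \<pi> (int_in R (ev r)) \<in> {\<zero>\<^bsub>R Quot Z\<^esub>}"
    proof (rule unique_step[OF T inj surj_image_ideal[OF cring_R T \<pi> \<pi>s ideal_ker_ev] T.zeroideal _ \<pi> _ _ _ J.Icarr[OF r]])
      show "u \<otimes>\<^bsub>R Quot Z\<^esub> v \<in> {\<zero>\<^bsub>R Quot Z\<^esub>}" if uv: "u \<in> \<pi> ` ?J" "v \<in> \<pi> ` ?J" for u v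
      proof -
        obtain a b where ab: "a \<in> ?J" "b \<in> ?J" "u = \<pi> a" "v = \<pi> b" using uv by blast
        show ?thesis
          using ring_hom_mult[OF \<pi> J.Icarr[OF ab(1)] J.Icarr[OF ab(2)]] JJ[OF ab(1,2)] J.Icarr[OF ab(1)] J.Icarr[OF ab(2)] ab(3,4)
            Z.coset_zero_iff[of "a \<otimes>\<^bsub>R\<^esub> b"] by (simp add: \<pi>_def)
      qed
      show "(%r. \<pi> (int_in R (ev r))) \<in> ring_hom R (R Quot Z)"
        using ring_hom_trans[OF ring_hom_trans[OF ev_hom R.int_in_hom] \<pi>] by (simp add: o_def)
      show "\<pi> \<tau> = \<pi> (int_in R (ev \<tau>))"
        using Z.coset_eq_iff[OF tau_closed R.one_closed] yZ by (simp add: \<pi>_def ev_tau R.int_in_one)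
      show "\<pi> s \<ominus>\<^bsub>R Quot Z\<^esub> \<pi> (int_in R (ev s)) \<in> \<pi> ` ?J" if s: "s \<in> carrier R" for s
        unfolding ring_hom_minus[OF cring_R T \<pi> s R.int_in_closed, symmetric]
        using s ring_hom_int_in[OF cring_R cring_int ev_hom] by (intro imageI) (simp add: ker_ev_iff ev_minus)
    qed
    then show ?thesis using r ring_hom_closed[OF \<pi>, of r] ring_hom_0[OF cring_R T \<pi>] Z.coset_zero_iff[of r]
      by (simp add: ker_ev_iff a_minus_def) (simp add: \<pi>_def)
  qed
  \<comment> \<open>Modulo t - 1 each generator of J lies in the square of J, so elimination yields
    a multiplier in 1 + J that takes all of G into the ideal of t - 1.\<close>
  have "\<exists>w\<in>ev1. \<forall>g\<in>G. w \<otimes>\<^bsub>R\<^esub> g \<in> Y"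
    by (rule R.eliminate[OF ideal_ker_ev Y.ideal_axioms ev1(1-3) G(1,4) ev1(4)]) (use ZG JZ G in auto)
  then obtain s where s: "s \<in> ev1" "!!g. g \<in> G ==> s \<otimes>\<^bsub>R\<^esub> g \<in> Y" by blast
  have "s \<in> carrier R" using s ev1 by blast
  then have "s \<otimes>\<^bsub>R\<^esub> r \<in> Y" if "r \<in> ?J" for r
    using R.span_ideal[OF order.refl G(4) Y.ideal_axioms _ s(2)] that G(3) by blast
  then have "\<exists>r'\<in>carrier R. s \<otimes>\<^bsub>R\<^esub> r = ?y \<otimes>\<^bsub>R\<^esub> r'" if "r \<in> ?J" for r
    using that y unfolding Y_def cgenideal_def by (auto simp: R.m_comm)
  then show thesis by (rule that[OF s(1)])
qed

text \<open>Let A be the kernel of \<open>psi\<close>. For g in A, \<open>ker_ev_local\<close> gives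
  s g = (t - 1) r'; as \<open>psi\<close> sends t - 1 to the variable, r' is again in A. So
  elimination applies to generators of A with coefficients in \<open>ker_ev\<close> and gives w with
  \<open>ev w\<close> = 1 annihilating A.\<close>

lemma psi_inj:
  assumes dom: "domain R" and r: "r \<in> carrier R" "psi r = 0"
  shows "r = \<zero>\<^bsub>R\<^esub>"
proof -
  let ?y = "\<tau> \<ominus>\<^bsub>R\<^esub> \<one>\<^bsub>R\<^esub>"
  interpret D: domain R by (rule dom)
  have U: "cring (rg (UNIV :: int fps set))" by (rule cring_rg) simp
  have y: "?y \<in> carrier R" using tau_closed by simp
  have py: "psi ?y = fps_X"
    using ring_hom_minus[OF cring_R U psi_hom tau_closed R.one_closed] ring_hom_one[OF psi_hom]
    by (simp add: minus_rg psi_tau)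
  have yJ: "?y \<in> ker_ev" using y psi_0[OF y] by (simp add: ker_ev_iff py)
  obtain s where s: "s \<in> ev1" "!!r. r \<in> ker_ev ==> \<exists>r'\<in>carrier R. s \<otimes>\<^bsub>R\<^esub> r = ?y \<otimes>\<^bsub>R\<^esub> r'"
    by (rule ker_ev_local) blast
  have sc: "s \<in> carrier R" using s ev1 by blast
  define A where "A = a_kernel R (rg UNIV) psi"
  have A: "ideal A R"
    unfolding A_def by (rule ring_hom_ring.kernel_is_ideal) (simp add: ring_hom_ringI2 R.ring_axioms cring.axioms(1)[OF U] psi_hom)
  have A_iff: "r \<in> A \<longleftrightarrow> r \<in> carrier R & psi r = 0" for r by (simp add: A_def a_kernel_def')
  obtain G where G: "finite G" "G <= A" "A <= R.span (carrier R) G" "G <= carrier R" by (rule noeth_ideal[OF A])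
  have "\<exists>w\<in>ev1. \<forall>g\<in>G. w \<otimes>\<^bsub>R\<^esub> g \<in> {\<zero>\<^bsub>R\<^esub>}"
  proof (rule R.eliminate[OF ideal_ker_ev R.zeroideal ev1(1-3) G(1,4) s(1)])
    fix g assume "g \<in> G"
    then have g: "g \<in> carrier R" "psi g = 0" using G(2) by (auto simp: A_iff)
    have "g \<in> ker_ev" using g psi_0[OF g(1)] by (simp add: ker_ev_iff)
    then obtain r' where r': "r' \<in> carrier R" "s \<otimes>\<^bsub>R\<^esub> g = ?y \<otimes>\<^bsub>R\<^esub> r'" using s(2) by blast
    have "fps_X * psi r' = 0"
      using arg_cong[OF r'(2), of psi] ring_hom_mult[OF psi_hom sc g(1)] ring_hom_mult[OF psi_hom y r'(1)] by (simp add: py g)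
    then have "r' \<in> R.span (carrier R) G" using G(3) r'(1) by (auto simp: A_iff)
    then have "?y \<otimes>\<^bsub>R\<^esub> r' \<in> R.span ker_ev G"
    proof (rule R.span_image[OF order.refl G(4) y, rotated])
      show "\<exists>b'\<in>ker_ev. \<exists>h\<in>G. ?y \<otimes>\<^bsub>R\<^esub> (c \<otimes>\<^bsub>R\<^esub> g) = b' \<otimes>\<^bsub>R\<^esub> h" if "c \<in> carrier R" "g \<in> G" for c g
        using that G(4) ideal.I_r_closed[OF ideal_ker_ev yJ that(1)] R.m_assoc[OF y that(1), of g] by (metis subsetD)
    qed
    moreover have "s \<otimes>\<^bsub>R\<^esub> g \<ominus>\<^bsub>R\<^esub> ?y \<otimes>\<^bsub>R\<^esub> r' \<in> {\<zero>\<^bsub>R\<^esub>}"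
      unfolding r'(2) using R.m_closed[OF y r'(1)] by (simp add: a_minus_def R.r_neg)
    ultimately show "\<exists>v\<in>R.span ker_ev G. s \<otimes>\<^bsub>R\<^esub> g \<ominus>\<^bsub>R\<^esub> v \<in> {\<zero>\<^bsub>R\<^esub>}" by blast
  qed
  then obtain w where w: "w \<in> carrier R" "ev w = 1" "!!g. g \<in> G ==> w \<otimes>\<^bsub>R\<^esub> g \<in> {\<zero>\<^bsub>R\<^esub>}" by (auto simp: ev1_def)
  have "w ~= \<zero>\<^bsub>R\<^esub>" using w(2) ring_hom_0[OF cring_R cring_int ev_hom] by auto
  moreover have "w \<otimes>\<^bsub>R\<^esub> r \<in> {\<zero>\<^bsub>R\<^esub>}"
    using R.span_ideal[OF order.refl G(4) R.zeroideal w(1,3)] r G(3) by (auto simp: A_iff)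
  ultimately show ?thesis using D.integral[of w r] w(1) r(1) by simp
qed

end

section \<open>Counting\<close>

lemma countable_UP:
  assumes A: "countable (carrier A)" shows "countable (carrier (UP A))"
proof -
  let ?F = "%xs n. if n < length xs then xs ! n else \<zero>\<^bsub>A\<^esub>"
  have "carrier (UP A) <= ?F ` lists (carrier A)"
  proof
    fix f assume "f \<in> carrier (UP A)"
    then obtain N where f: "!!n. f n \<in> carrier A" "!!n. n > N ==> f n = \<zero>\<^bsub>A\<^esub>"
      by (auto simp: UP_def up_def bound_def Pi_def)
    have "f = ?F (map f [0..<Suc N])"
    proof
      fix n show "f n = ?F (map f [0..<Suc N]) n" using f(2)[of n] by (cases "n < Suc N") (simp_all del: upt_Suc)
    qed
    then show "f \<in> ?F ` lists (carrier A)" by (rule image_eqI) (use f(1) in \<open>auto simp del: upt_Suc\<close>)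
  qed
  then show ?thesis by (rule countable_subset) (simp add: A)
qed

lemma countable_Quot:
  assumes "countable (carrier A)" shows "countable (carrier (A Quot I))"
proof -
  have "carrier (A Quot I) = (%a. I +>\<^bsub>A\<^esub> a) ` carrier A"
    by (auto simp: FactRing_def A_RCOSETS_def' )
  then show ?thesis using assms by simp
qed

context habiro_etale
begin

lemma countable_XT: "countable (carrier (XT m))"
  unfolding ext_def cyc_def by (intro countable_Quot countable_UP countable_R)

text \<open>The values at powers of q of the Newton series with integer coefficients a; they are
  polynomials in q.\<close>

definition seq_elem :: "(nat => nat) => nat => _" where
  "seq_elem a i = finsum HZ (%l. int_in HZ (int (a l)) \<otimes>\<^bsub>HZ\<^esub> HZ.node i l) {..i}"

lemma seq_term: "int_in HZ c \<otimes>\<^bsub>HZ\<^esub> HZ.node i l \<in> q_laurent \<zeta>"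
proof -
  have "HZ.node i l \<in> q_laurent \<zeta>" using QL.L.node_closed[of i l] by (simp add: QL.node_L)
  then show ?thesis by (rule q_laurent_closed(6)[OF int_in_q_laurent])
qed

lemma seq_elem_nonempty:
  "HZ.Phi (seq_elem a) N ~= {}" "QL.L.Phi (seq_elem a) N ~= {}"
proof -
  show "HZ.Phi (seq_elem a) N ~= {}"
    by (rule HZ.Phi_nonempty[where C = "%l. int_in HZ (int (a l))"]) (simp_all add: seq_elem_def)
  show "QL.L.Phi (seq_elem a) N ~= {}"
  proof (rule QL.L.Phi_nonempty[where C = "%l. int_in HZ (int (a l))"])
    show "int_in HZ (int (a l)) \<in> carrier QL.L" for l using int_in_q_laurent by simp
    show "seq_elem a i = finsum QL.L (%l. int_in HZ (int (a l)) \<otimes>\<^bsub>QL.L\<^esub> QL.L.node i l) {..i}" for i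
      unfolding seq_elem_def QL.node_L using seq_term by (simp add: QL.finsum_L)
  qed
qed

text \<open>At the first index l where the coefficients differ, the values at q^l differ by a
  nonzero integer times the nonzero diagonal basis element.\<close>

lemma seq_elem_inj: "seq_elem a = seq_elem b ==> a = b"
proof (rule ccontr)
  assume eq: "seq_elem a = seq_elem b" and ne: "a ~= b"
  define l where "l = (LEAST l. a l ~= b l)"
  have l: "a l ~= b l" unfolding l_def by (rule LeastI_ex) (use ne in auto)
  have lt: "a k = b k" if "k < l" for k using not_less_Least[OF that[unfolded l_def]] by simp
  have "(\<Sum>k\<le>l. of_nat (a k) * nb 1 l k) = (\<Sum>k\<le>l. of_nat (b k) * nb 1 l k)"
    using arg_cong[OF fun_cong[OF eq, of l], of "HE 1"] by (simp add: seq_elem_def HE_Newton HE_int_in)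
  moreover have "(\<Sum>k<l. of_nat (a k) * nb 1 l k) = (\<Sum>k<l. of_nat (b k) * nb 1 l k)" by (rule sum.cong) (simp_all add: lt)
  moreover have "{..l} = insert l {..<l}" by auto
  ultimately have "of_nat (a l) * nb 1 l l = of_nat (b l) * nb 1 l l" by simp
  then show False using l nb_diag_nz[of 1 l] by (simp add: fps_of_nat[symmetric])
qed

text \<open>Integer Newton coefficients put the whole image into \<open>q_laurent_lim\<close>, so
  the condition on specializations in the theorem is met for every f.\<close>

lemma injection_exists:
  "\<exists>\<Phi>. inj_on \<Phi> (carrier XX) & (\<forall>f. \<Phi> f \<in> carrier (habiro_lim \<zeta>) & \<Phi> f \<in> q_laurent_lim \<zeta>)"
proof (intro exI conjI allI)
  \<comment> \<open>All coefficients of all components are listed in one sequence, each coded by an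
    enumeration of the countable ring that contains it.\<close>
  define code where "code = (%f n. case prod_decode n of (m, k) => to_nat_on (carrier (XT m)) (f m k))"
  show "inj_on (%f. HZ.Phi (seq_elem (code f))) (carrier XX)"
  proof (rule inj_onI)
    fix f g assume f: "f \<in> carrier XX" and g: "g \<in> carrier XX" and "HZ.Phi (seq_elem (code f)) = HZ.Phi (seq_elem (code g))"
    then have c: "code f = code g" by (intro seq_elem_inj HZ.Phi_inj[OF seq_elem_nonempty(1)])
    show "f = g"
    proof (rule extensionalityI[OF XX_extensional[OF f] XX_extensional[OF g]], rule ext)
      fix m :: nat and k assume "m \<in> {1..}"
      then show "f m k = g m k"
        using fun_cong[OF c, of "prod_encode (m, k)"] XX_component[OF f] XX_component[OF g] countable_XT[of m]
        by (simp add: code_def inj_on_eq_iff[OF inj_on_to_nat_on])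
    qed
  qed
  show "HZ.Phi (seq_elem (code f)) \<in> carrier (habiro_lim \<zeta>)" for f
    unfolding habiro_lim_def by (rule HZ.Phi_lim[OF seq_elem_nonempty(1)])
  show "HZ.Phi (seq_elem (code f)) \<in> q_laurent_lim \<zeta>" for f
    using QL.Phi_L[OF seq_elem_nonempty(2)] unfolding q_laurent_lim_def Let_def .
qed

end

section \<open>Injectivity\<close>

definition polyfun :: "nat => (nat => complex) set" where
  "polyfun d = {f. \<exists>p. Polynomial.degree p \<le> d & (\<forall>n. f n = poly p (of_nat n))}"

lemma polyfunI: "Polynomial.degree p \<le> d ==> (!!n. f n = poly p (of_nat n)) ==> f \<in> polyfun d"
  unfolding polyfun_def by blast

lemma polyfunE: assumes "f \<in> polyfun d" obtains p where "Polynomial.degree p \<le> d" "!!n. f n = poly p (of_nat n)"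
  using assms unfolding polyfun_def by blast

lemma polyfun_const: "(%n. c) \<in> polyfun d" by (rule polyfunI[of "[:c:]"]) simp_all

lemma polyfun_add: "f \<in> polyfun d ==> g \<in> polyfun d ==> (%n. f n + g n) \<in> polyfun d"
  by (elim polyfunE, rule polyfunI[OF degree_add_le]) simp_all

lemma polyfun_mult: "f \<in> polyfun d ==> g \<in> polyfun e ==> (%n. f n * g n) \<in> polyfun (d + e)"
  by (elim polyfunE, rule polyfunI[OF order.trans[OF degree_mult_le add_mono]]) simp_all

lemma polyfun_mono: "f \<in> polyfun d ==> d \<le> e ==> f \<in> polyfun e"
  unfolding polyfun_def using order.trans by blast

lemma polyfun_sum: "(!!i. i \<in> A ==> f i \<in> polyfun d) ==> (%n. \<Sum>i\<in>A. f i n) \<in> polyfun d"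
  by (induction A rule: infinite_finite_induct) (auto intro: polyfun_const polyfun_add)

lemma polyfun_choose: "(%n. of_nat ((i + m * n) choose k)) \<in> polyfun k"
proof -
  have "(%n. \<Prod>l = 0..<k. of_nat (i + m * n) - of_nat l) \<in> polyfun k"
  proof (induction k)
    case (Suc k)
    have "(%n. of_nat (i + m * n) - of_nat k) \<in> polyfun 1"
      by (rule polyfunI[of "[:of_nat i - of_nat k, of_nat m:]"]) simp_all
    from polyfun_mult[OF Suc this] show ?case by simp
  qed (simp add: polyfun_const)
  from polyfun_mult[OF polyfun_const[of "1 / fact k" 0] this] show ?thesis
    by (simp add: binomial_gbinomial gbinomial_prod_rev)
qed

text \<open>Bounding the degree in n by the index of the coefficient is stable under products and
  under substitution into a fixed series.\<close>

definition tame :: "(nat => complex fps) set" where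
  "tame = {F. \<forall>k. (%n. F n $ k) \<in> polyfun k}"

lemma tame_const: "(%n. G) \<in> tame" by (simp add: tame_def polyfun_const)

lemma tame_add: "F \<in> tame ==> G \<in> tame ==> (%n. F n + G n) \<in> tame" by (simp add: tame_def polyfun_add)

lemma tame_mult: assumes "F \<in> tame" "G \<in> tame" shows "(%n. F n * G n) \<in> tame"
proof -
  have "(%n. F n $ i * G n $ (k - i)) \<in> polyfun k" if "i \<le> k" for i k
    using polyfun_mult[of "%n. F n $ i" i "%n. G n $ (k - i)" "k - i"] assms that by (simp add: tame_def)
  then show ?thesis by (auto simp: tame_def fps_mult_nth intro!: polyfun_sum)
qed

lemma tame_power: "F \<in> tame ==> (%n. F n ^ k) \<in> tame" by (induction k) (auto intro: tame_const tame_mult)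

lemma tame_compose: "F \<in> tame ==> (%n. G oo F n) \<in> tame"
  using tame_power[of F] unfolding tame_def mem_Collect_eq fps_compose_nth
  by (auto intro!: polyfun_sum polyfun_mult[where d = 0, simplified, OF polyfun_const])

text \<open>The coefficient of \<open>H oo B n\<close> at the order \<open>v\<close> of \<open>H\<close> is a polynomial in \<open>n\<close> of degree exactly \<open>v\<close>.\<close>

lemma tame_leading:
  assumes B: "!!n. B n $ 0 = 0" "!!n. B n $ 1 = c * of_nat (i + m * n)" "c ~= 0" "m \<ge> 1"
    and T: "T \<in> tame" and z: "!!n. (H oo B n) + fps_X * T n = 0"
  shows "H = 0"
proof (rule ccontr)
  assume H: "H ~= 0"
  define v where "v = subdegree H"
  have Hv: "H $ v ~= 0" using H by (simp add: v_def)
  have lo: "H $ l = 0" if "l < v" for l using that unfolding v_def by (rule nth_less_subdegree_zero)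
  have "(H oo B n) $ v = (\<Sum>l = 0..v. if l = v then H $ v * (B n ^ v) $ v else 0)" for n
    unfolding fps_compose_nth
  proof (rule sum.cong)
    show "H $ l * (B n ^ l) $ v = (if l = v then H $ v * (B n ^ v) $ v else 0)" if "l \<in> {0..v}" for l
      using lo[of l] that by (cases "l = v") simp_all
  qed simp
  then have c: "(H oo B n) $ v = H $ v * (c * of_nat (i + m * n)) ^ v" for n
    using startsby_zero_power_nth_same[OF B(1), of n v] B(2)[of n] by simp
  show False
  proof (cases v)
    case 0
    then show False using arg_cong[OF z[of 0], of "%F. F $ 0"] c[of 0] Hv by simp
  next
    case (Suc w)
    \<comment> \<open>Because of the factor X, only coefficient v - 1 of T enters, so its degree in
      n stays below v.\<close>
    have "(%n. T n $ w) \<in> polyfun w" using T by (simp add: tame_def)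
    then obtain q where q: "Polynomial.degree q \<le> w" "!!n. T n $ w = poly q (of_nat n)" unfolding polyfun_def by blast
    define l where "l = [:of_nat i, of_nat m :: complex:]"
    have l: "Polynomial.degree (l ^ v) = v" "Polynomial.coeff (l ^ v) v = of_nat m ^ v"
      using B(4) lead_coeff_power[of l v] by (auto simp: l_def degree_power_eq)
    define P where "P = smult (H $ v * c ^ v) (l ^ v) + q"
    have "poly P (of_nat n) = 0" for n
    proof -
      have "H $ v * (c * of_nat (i + m * n)) ^ v + poly q (of_nat n) = 0"
        using arg_cong[OF z[of n], of "%F. F $ v"] unfolding fps_add_nth c using Suc q(2)[of n] by simp
      moreover have "poly l (of_nat n) = of_nat (i + m * n)" by (simp add: l_def)
      ultimately show ?thesis by (simp add: P_def poly_power power_mult_distrib mult.assoc del: of_nat_add of_nat_mult)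
    qed
    then have "range of_nat <= {x. poly P x = 0}" by auto
    then have "infinite {x. poly P x = 0}"
      using finite_subset[of "range (of_nat :: nat => complex)"] range_inj_infinite[OF inj_of_nat] by blast
    then have "P = 0" using poly_roots_finite by blast
    then have "Polynomial.coeff P v = 0" by simp
    moreover have "Polynomial.coeff q v = 0" using q(1) Suc by (intro coeff_eq_0) simp
    ultimately show False using Hv B(3,4) by (simp add: P_def l(2))
  qed
qed

section \<open>Vanishing of all specializations\<close>

context habiro_etale
begin

lemma XT_gens:
  "a \<in> carrier R ==> ext_const \<zeta> R \<tau> m m a \<in> carrier (XT m)" "ext_num \<zeta> R \<tau> m m (\<zeta> m) \<in> carrier (XT m)"
  "ext_root \<zeta> R \<tau> m m \<in> carrier (XT m)"
  using ring_hom_closed[OF ext_const_hom[OF cring_R tau_closed]] ring_hom_closed[OF ext_num_hom[OF cring_R tau_closed]]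
    ext_root_closed[OF cring_R tau_closed] by simp_all

abbreviation "xmon m a k j \<equiv> ext_const \<zeta> R \<tau> m m a \<otimes>\<^bsub>XT m\<^esub> ext_num \<zeta> R \<tau> m m (\<zeta> m) [^]\<^bsub>XT m\<^esub> (k::nat)
  \<otimes>\<^bsub>XT m\<^esub> ext_root \<zeta> R \<tau> m m [^]\<^bsub>XT m\<^esub> (j::nat)"

lemma sg_mon:
  assumes m: "m \<ge> 1" and a: "a \<in> carrier R"
  shows "sg m i (xmon m a k j) = Q m ^ (i * j) * (fps_const (\<zeta> m) ^ k * LL m i a)"
proof -
  interpret G: ring_hom_cring "XT m" "rg (W m)" "sg m i"
    by (rule ring_hom_cringI[OF cring_XT cring_rg[OF subring_W] sg_map(2)[OF m]])
  show ?thesis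
    using XT_gens(1)[OF a, of m] XT_gens(2,3) sg_map(3)[OF m a, of i] sg_map(4)[OF m Zz_zeta, of i] sg_map(5)[OF m, of i]
    by (simp add: nat_pow_rg power_mult)
qed

text \<open>On the residue class of i modulo m the power of zeta_m is constant, so only the binomial
  coefficient varies with n.\<close>

lemma Q_tame: "m \<ge> 1 ==> (%n. Q m ^ (i + m * n)) \<in> tame"
proof -
  assume m: "m \<ge> 1"
  have "Q m ^ (i + m * n) $ k = of_nat ((i + m * n) choose k) * (\<zeta> m ^ i / \<zeta> m ^ k)" for n k
  proof (cases "k \<le> i + m * n")
    case True
    then have "\<zeta> m ^ (i + m * n - k) = \<zeta> m ^ i / \<zeta> m ^ k"
      using m zeta_nz[OF m] by (simp add: power_diff power_add power_mult)
    then show ?thesis by (simp add: Q_nth)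
  qed (simp add: Q_nth binomial_eq_0)
  then show ?thesis
    using polyfun_mult[OF polyfun_choose polyfun_const, where e = 0] unfolding tame_def mem_Collect_eq by (simp only: add_0_right) blast
qed

lemma sg_tame:
  assumes m: "m \<ge> 1" and x: "x \<in> carrier (XT m)"
  shows "(%n. sg m (i + m * n) x) \<in> tame" using x
proof (induction rule: ext_induct[OF cring_R tau_closed, consumes 1, case_names monom add])
  case (monom a k j)
  have Q: "(%n. Q m ^ ((i + m * n) * j)) \<in> tame" for j
    using Q_tame[OF m, of "i * j"] tame_power[OF Q_tame[OF m, of i], of j] by (simp add: power_mult)
  have "(%n. LL m (i + m * n) a) \<in> tame"
    unfolding LL_def using tame_compose[OF tame_add[OF Q[of m] tame_const[of "-1"]]] by (simp add: mult.commute)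
  then show ?case unfolding sg_mon[OF m monom] by (intro tame_mult tame_const Q)
next
  case (add x y)
  then show ?case using ring_hom_add[OF sg_map(2)[OF m] add(1,2)] tame_add[OF add(3,4)] by simp
qed

lemma Spec_tame:
  assumes m: "m \<ge> 1" and a: "!!k. a k \<in> carrier (XT m)"
  shows "(%n. Spec m (i + m * n) a) \<in> tame"
proof -
  have "(%n. sg m (i + m * n) (a k) $ (j - k)) \<in> polyfun j" for j k
    using sg_tame[OF m a, of i k] unfolding tame_def by (auto intro: polyfun_mono[of _ "j - k"])
  then show ?thesis unfolding tame_def Spec_def by (auto intro!: polyfun_sum)
qed

text \<open>Powers of zeta_m are reduced modulo the monic minimal polynomial, and powers of y =
  t^(1/m) through y^m = t.\<close>

lemma XT_span:
  assumes m: "m \<ge> 1" and x: "x \<in> carrier (XT m)"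
  shows "\<exists>r. (\<forall>k j. r k j \<in> carrier R)
    & x = finsum (XT m) (%(k, j). xmon m (r k j) k j) ({..<Polynomial.degree (minpoly m)} \<times> {..<m})"
proof -
  interpret E: cring "XT m" by (rule cring_XT)
  let ?d = "Polynomial.degree (minpoly m)" and ?c = "ext_const \<zeta> R \<tau> m m" and ?z = "ext_num \<zeta> R \<tau> m m"
    and ?y = "ext_root \<zeta> R \<tau> m m"
  note c = ext_const_hom[OF cring_R tau_closed, of \<zeta> m m] and z = ext_num_hom[OF cring_R tau_closed, of \<zeta> m m]
  note g = XT_gens[where m = m]
  define D where "D = {..<?d} \<times> {..<m}"
  define S where "S = {finsum (XT m) (%(k, j). xmon m (r k j) k j) D | r. \<forall>k j. r k j \<in> carrier R}"
  have D: "finite D" by (simp add: D_def)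
  have SI: "finsum (XT m) (%(k, j). xmon m (r k j) k j) D \<in> S" if "!!k j. r k j \<in> carrier R" for r
    unfolding S_def using that by blast
  have add: "u \<oplus>\<^bsub>XT m\<^esub> v \<in> S" if uv: "u \<in> S" "v \<in> S" for u v
  proof -
    obtain r r' where r: "!!k j. r k j \<in> carrier R" "!!k j. r' k j \<in> carrier R"
      "u = finsum (XT m) (%(k, j). xmon m (r k j) k j) D" "v = finsum (XT m) (%(k, j). xmon m (r' k j) k j) D"
      using uv unfolding S_def by blast
    have "u \<oplus>\<^bsub>XT m\<^esub> v = finsum (XT m) (%(k, j). xmon m (r k j \<oplus>\<^bsub>R\<^esub> r' k j) k j) D"
      unfolding r(3,4) by (rule trans[OF E.finsum_addf[symmetric] E.finsum_cong'])
        (simp_all add: Pi_def g r(1,2) ring_hom_add[OF c] E.l_distr split: prod.split)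
    then show ?thesis using SI[of "%k j. r k j \<oplus>\<^bsub>R\<^esub> r' k j"] r(1,2) by simp
  qed
  have mon: "xmon m b k j \<in> S" if b: "b \<in> carrier R" and kj: "(k, j) \<in> D" for b k j
  proof -
    let ?r = "%k' j'. if (k, j) = (k', j') then b else \<zero>\<^bsub>R\<^esub>"
    have "finsum (XT m) (%(k', j'). xmon m (?r k' j') k' j') D
        = finsum (XT m) (%kj. if (k, j) = kj then (%(k, j). xmon m b k j) kj else \<zero>\<^bsub>XT m\<^esub>) D"
      by (rule E.finsum_cong') (use b in \<open>simp_all add: Pi_def g ring_hom_0[OF cring_R cring_XT c] split: prod.split\<close>)
    also have "... = xmon m b k j"
      using E.add.finprod_singleton[OF kj D, of "%(k, j). xmon m b k j"] b by (simp add: g Pi_def split: prod.splits)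
    finally show ?thesis using SI[of ?r] b by simp
  qed
  have "finsum (XT m) (%(k, j). xmon m \<zero>\<^bsub>R\<^esub> k j) D = \<zero>\<^bsub>XT m\<^esub>"
    by (rule E.add.finprod_one_eqI) (auto simp: g ring_hom_0[OF cring_R cring_XT c])
  then have zero: "\<zero>\<^bsub>XT m\<^esub> \<in> S" using SI[of "%k j. \<zero>\<^bsub>R\<^esub>"] by simp
  have sum: "finsum (XT m) f A \<in> S" if "finite A" "!!k. k \<in> A ==> f k \<in> S \<inter> carrier (XT m)" for A :: "nat set" and f
    using that by (induction A rule: finite_induct) (auto simp: zero Pi_def intro: add)
  have "x \<in> S" using x
  proof (induction rule: ext_induct[OF cring_R tau_closed, consumes 1, case_names monom add])
    case (monom a i j)
    obtain F P where P: "Polynomial.monom 1 i = minpoly m * F + P" "P = 0 \<or> Polynomial.degree P < ?d"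
      by (rule monic_division[OF minpoly(2)[OF m]])
    define b where "b = a \<otimes>\<^bsub>R\<^esub> \<tau> [^]\<^bsub>R\<^esub> (j div m)"
    define n where "n = (%k. int_in R (Polynomial.coeff P k))"
    have b: "b \<in> carrier R" "n k \<in> carrier R" for k unfolding b_def n_def using monom tau_closed by simp_all
    have "\<zeta> m ^ i = ipoly P (\<zeta> m)" using arg_cong[OF P(1), of "%F. ipoly F (\<zeta> m)"] minpoly(3)[OF m] by simp
    also have "... = (\<Sum>k<?d. of_int (Polynomial.coeff P k) * \<zeta> m ^ k)"
    proof (cases "P = 0")
      case False
      then have "Polynomial.degree P < ?d" using P(2) by simp
      then show ?thesis unfolding ipoly_def poly_altdef using degree_map_poly[of "of_int :: int => complex" P]
        by (intro sum.mono_neutral_cong_left) (auto simp: coeff_map_poly coeff_eq_0)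
    qed simp
    finally have e: "\<zeta> m ^ i = (\<Sum>k<?d. of_int (Polynomial.coeff P k) * \<zeta> m ^ k)" .
    have zp: "?z (\<zeta> m ^ k) = ?z (\<zeta> m) [^]\<^bsub>XT m\<^esub> k" for k
      using ring_hom_nat_pow[OF cring_rg[OF subring_Zz] cring_XT z, of "\<zeta> m" k] by simp
    have zc: "?z (of_int q) = ?c (int_in R q)" for q
      using ring_hom_int_in[OF cring_rg[OF subring_Zz] cring_XT z, of q] ring_hom_int_in[OF cring_R cring_XT c, of q]
      by (simp add: int_in_rg[OF subring_Zz])
    have "?z (\<zeta> m ^ i) = finsum (XT m) (%k. ?c (n k) \<otimes>\<^bsub>XT m\<^esub> ?z (\<zeta> m) [^]\<^bsub>XT m\<^esub> k) {..<?d}"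
      unfolding e n_def
      using ring_hom_finsum[OF cring_rg[OF subring_Zz] cring_XT z, of "%k. of_int (Polynomial.coeff P k) * \<zeta> m ^ k" "{..<?d}"]
        finsum_rg[OF subring_Zz, of "{..<?d}" "%k. of_int (Polynomial.coeff P k) * \<zeta> m ^ k" \<zeta> m]
        ring_hom_mult[OF z, of "of_int _" "\<zeta> m ^ _"] by (simp add: Zz_closed zc zp)
    moreover have "?y [^]\<^bsub>XT m\<^esub> j = ?c (\<tau> [^]\<^bsub>R\<^esub> (j div m)) \<otimes>\<^bsub>XT m\<^esub> ?y [^]\<^bsub>XT m\<^esub> (j mod m)"
      using E.nat_pow_mult[OF g(3), of "m * (j div m)" "j mod m"] E.nat_pow_pow[OF g(3), of m "j div m"]
        ring_hom_nat_pow[OF cring_R cring_XT c tau_closed, of "j div m"] ext_root_pow[OF cring_R tau_closed, of \<zeta> m m] by simp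
    moreover have "(?c a \<otimes>\<^bsub>XT m\<^esub> finsum (XT m) (%k. ?c (n k) \<otimes>\<^bsub>XT m\<^esub> ?z (\<zeta> m) [^]\<^bsub>XT m\<^esub> k) {..<?d})
        \<otimes>\<^bsub>XT m\<^esub> (?c (\<tau> [^]\<^bsub>R\<^esub> (j div m)) \<otimes>\<^bsub>XT m\<^esub> ?y [^]\<^bsub>XT m\<^esub> (j mod m))
      = finsum (XT m) (%k. xmon m (n k \<otimes>\<^bsub>R\<^esub> b) k (j mod m)) {..<?d}"
      using monom tau_closed b unfolding b_def
      by (simp add: g E.finsum_rdistr E.finsum_ldistr ring_hom_mult[OF c] E.m_ac Pi_def)
    moreover have "finsum (XT m) (%k. xmon m (n k \<otimes>\<^bsub>R\<^esub> b) k (j mod m)) {..<?d} \<in> S"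
      by (rule sum) (use b m in \<open>auto intro!: mon simp: g D_def\<close>)
    ultimately show ?case by (simp add: zp)
  qed (rule add)
  then show ?thesis unfolding S_def D_def by blast
qed

text \<open>Orthogonality of the characters of Z/m; the exponent m - b' stands for -b' so that
  powers stay natural.\<close>

lemma root_sum:
  assumes m: "m \<ge> 1" and b: "b < m" "b' < m"
  shows "(\<Sum>i<m. \<zeta> m ^ (i * (m - b')) * \<zeta> m ^ (i * b)) = (if b = b' then of_nat m else 0)"
proof -
  define w where "w = \<zeta> m ^ (m - b' + b)"
  have "w = 1 \<longleftrightarrow> b = b'" unfolding w_def zeta_pow_iff[OF m]
  proof
    assume "m dvd m - b' + b"
    then obtain k where k: "m - b' + b = m * k" by (elim dvdE)
    have "m * k < m * 2" "0 < m * k" unfolding k[symmetric] using b by arith+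
    then have "k < 2" "0 < k" by simp_all
    then have "k = 1" by simp
    then show "b = b'" using k b by simp
  qed (use b in simp)
  moreover have "(\<Sum>i<m. \<zeta> m ^ (i * (m - b')) * \<zeta> m ^ (i * b)) = (\<Sum>i<m. w ^ i)"
    unfolding w_def by (rule sum.cong) (simp_all add: mult.commute add.commute distrib_left flip: power_add power_mult)
  moreover have "w ^ m = 1" unfolding w_def using zeta_pow_self[OF m] by (metis mult.commute power_mult power_one)
  ultimately show ?thesis using sum_gp_strict[of w m] by auto
qed

text \<open>At the exponents i + m n, a_0 contributes a fixed series \<open>H i\<close> composed
  with \<open>B n\<close>, and the other coefficients contribute q - zeta_m times a tame sequence;
  so \<open>tame_leading\<close> gives \<open>H i\<close> = 0. Fourier inversion over i separates
  the powers of t^(1/m), and independence of the powers of zeta_m isolates \<open>psi\<close> of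
  each coefficient.\<close>

lemma sg_inj:
  assumes dom: "domain R" and m: "m \<ge> 1" and a: "!!k. a k \<in> carrier (XT m)" and z: "!!i. Spec m i a = 0"
  shows "a 0 = \<zero>\<^bsub>XT m\<^esub>"
proof -
  let ?d = "Polynomial.degree (minpoly m)"
  interpret E: cring "XT m" by (rule cring_XT)
  obtain r where r: "!!k j. r k j \<in> carrier R" "a 0 = finsum (XT m) (%(k, j). xmon m (r k j) k j) ({..<?d} \<times> {..<m})"
    using XT_span[OF m a] by blast
  \<comment> \<open>\<open>G j\<close> collects the coefficients of t^(j/m), transported to power
    series in t - 1.\<close>
  define G where "G = (%j. \<Sum>k<?d. fps_const (\<zeta> m ^ k) * psiC (r k j))"
  \<comment> \<open>This is t - 1 in terms of X when 1 + X is t^(1/m) up to an m-th root of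
    unity.\<close>
  let ?A = "(1 + fps_X) ^ m - 1 :: complex fps"
  have A: "?A $ 0 = 0" "?A $ 1 = of_nat m"
    using fps_binomial_nth[of 1 m 0] fps_binomial_nth[of 1 m 1] by (simp_all add: add.commute)
  define H where "H = (%i. \<Sum>j<m. fps_const (\<zeta> m ^ (i * j)) * (1 + fps_X) ^ j * (G j oo ?A))"
  have H0: "H i = 0" for i
  proof (rule tame_leading[OF _ _ _ m])
    \<comment> \<open>Dividing q^(i+mn) by zeta_m^i gives constant term 1; after subtracting 1 the
      series can be substituted, and its linear coefficient is proportional to i + m n.\<close>
    define B where "B = (%n. fps_const (inverse (\<zeta> m ^ i)) * Q m ^ (i + m * n) - 1)"
    have zi: "\<zeta> m ^ (i + m * n) = \<zeta> m ^ i" for n using m by (simp add: power_add power_mult)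
    have nz: "\<zeta> m ^ i ~= 0" using zeta_nz[OF m] by simp
    show B0: "B n $ 0 = 0" for n using nz by (simp add: B_def Q_nth zi)
    show "inverse (\<zeta> m) ~= 0" using zeta_nz[OF m] by simp
    show "B n $ 1 = inverse (\<zeta> m) * of_nat (i + m * n)" for n
    proof (cases "i + m * n")
      case (Suc l)
      have e: "\<zeta> m ^ i = \<zeta> m * \<zeta> m ^ l" unfolding zi[of n, symmetric] Suc by simp
      have q: "Q m ^ (i + m * n) $ 1 = of_nat (i + m * n) * \<zeta> m ^ l" unfolding Q_nth Suc by simp
      have "B n $ 1 = inverse (\<zeta> m ^ i) * (Q m ^ (i + m * n) $ 1)" by (simp add: B_def)
      then show ?thesis unfolding q e using zeta_nz[OF m] by (simp add: field_simps del: of_nat_add of_nat_mult)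
    next
      case 0
      show ?thesis unfolding B_def 0 by simp
    qed
    show "(%n. Spec m (i + m * n) (%k. a (Suc k))) \<in> tame" by (rule Spec_tame[OF m a])
    fix n
    have E: "1 + B n = fps_const (inverse (\<zeta> m ^ i)) * Q m ^ (i + m * n)" by (simp add: B_def)
    have Ej: "fps_const (\<zeta> m ^ (i * j)) * (1 + B n) ^ j = Q m ^ ((i + m * n) * j)" for j
    proof -
      have "fps_const (\<zeta> m ^ (i * j)) * (1 + B n) ^ j = fps_const (\<zeta> m ^ (i * j) * inverse (\<zeta> m ^ (i * j))) * Q m ^ ((i + m * n) * j)"
        unfolding E power_mult_distrib by (simp add: fps_const_power power_inverse flip: power_mult fps_const_mult)
      then show ?thesis using zeta_nz[OF m] by simp
    qed
    have Em: "?A oo B n = Q m ^ (m * (i + m * n)) - 1" using Ej[of m] zeta_pow_self[OF m]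
      by (simp add: fps_compose_add_distrib fps_compose_sub_distrib fps_compose_power[OF B0, symmetric] fps_X_fps_compose_startby0[OF B0] mult.commute[of _ m] power_mult)
    have "H i oo B n = (\<Sum>j<m. Q m ^ ((i + m * n) * j) * (G j oo (?A oo B n)))"
      unfolding H_def Ej[symmetric] fps_compose_sum_distrib fps_compose_mult_distrib[OF B0] fps_compose_assoc[OF B0 A(1)]
      by (simp add: fps_compose_add_distrib fps_compose_power[OF B0, symmetric] fps_X_fps_compose_startby0[OF B0])
    also have "... = (\<Sum>(k, j)\<in>{..<?d} \<times> {..<m}. sg m (i + m * n) (xmon m (r k j) k j))"
      unfolding sg_mon[OF m r(1)] LL_def G_def fps_compose_sum_distrib fps_compose_mult_distrib[OF Qm_0[OF m]] Em sum_distrib_left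
      by (subst sum.swap) (simp add: sum.cartesian_product fps_const_power)
    also have "... = sg m (i + m * n) (a 0)"
    proof -
      have c: "xmon m (r k j) k j \<in> carrier (XT m)" for k j using XT_gens(1)[OF r(1)] XT_gens(2,3) by simp
      have s: "sg m l x \<in> W m" if "x \<in> carrier (XT m)" for l x using ring_hom_closed[OF sg_map(2)[OF m] that] by simp
      show ?thesis
        unfolding r(2) using ring_hom_finsum[OF cring_XT cring_rg[OF subring_W] sg_map(2)[OF m], of "%(k, j). xmon m (r k j) k j" "{..<?d} \<times> {..<m}"]
          finsum_rg[OF subring_W, of "{..<?d} \<times> {..<m}" "%(k, j). sg m (i + m * n) (xmon m (r k j) k j)" m] c s
        by (simp add: Pi_def case_prod_unfold)
    qed
    finally show "(H i oo B n) + fps_X * Spec m (i + m * n) (%k. a (Suc k)) = 0"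
      using Spec_Suc[of m "i + m * n" a] z[of "i + m * n"] by simp
  qed
  have fc: "fps_const (sum f A) = (\<Sum>i\<in>A. fps_const (f i))" for f :: "nat => complex" and A
    by (rule fps_ext) (simp add: fps_sum_nth)
  have G0: "G j = 0" if j: "j < m" for j
  proof -
    \<comment> \<open>Discrete Fourier inversion isolates the j-th summand of
      \<open>H\<close>.\<close>
    have "0 = (\<Sum>i<m. fps_const (\<zeta> m ^ (i * (m - j))) * H i)" by (simp add: H0)
    also have "... = (\<Sum>l<m. fps_const (\<Sum>i<m. \<zeta> m ^ (i * (m - j)) * \<zeta> m ^ (i * l)) * ((1 + fps_X) ^ l * (G l oo ?A)))"
      unfolding H_def sum_distrib_left by (subst sum.swap) (simp add: mult.assoc sum_distrib_right fc flip: fps_const_mult)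
    also have "... = (\<Sum>l<m. if l = j then of_nat m * ((1 + fps_X) ^ l * (G l oo ?A)) else 0)"
      by (rule sum.cong) (use j in \<open>simp_all add: root_sum[OF m _ j] fps_of_nat\<close>)
    also have "... = of_nat m * ((1 + fps_X) ^ j * (G j oo ?A))" using j by simp
    finally have "of_nat m * ((1 + fps_X) ^ j * (G j oo ?A)) = 0" by simp
    moreover have "(1 + fps_X :: complex fps) ~= 0" by (auto dest: arg_cong[of _ _ "%F. F $ 0"])
    ultimately have "G j oo ?A = 0 oo ?A" using m by simp
    then show ?thesis using fps_compose_inj_right[OF A(1), of "G j" 0] A(2) m by simp
  qed
  have "r k j = \<zero>\<^bsub>R\<^esub>" if kj: "k < ?d" "j < m" for k j
  proof (rule psi_inj[OF dom r(1)], rule fps_ext)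
    fix n
    have "(\<Sum>k<?d. of_int (psi (r k j) $ n) * \<zeta> m ^ k) = G j $ n"
      by (simp add: G_def fps_sum_nth psiC_def mult.commute)
    then show "psi (r k j) $ n = 0 $ n" using minpoly_independent[OF m _ kj(1), of "%k. psi (r k j) $ n"] G0[OF kj(2)] by simp
  qed
  then show ?thesis
    unfolding r(2) using ring_hom_0[OF cring_R cring_XT ext_const_hom[OF cring_R tau_closed]] XT_gens(2,3)
    by (intro E.add.finprod_one_eqI) auto
qed

lemma interp_inj:
  assumes dom: "domain R" shows "inj_on interp (carrier XX)"
proof (rule inj_onI)
  fix f g assume f: "f \<in> carrier XX" and g: "g \<in> carrier XX" and eq: "interp f = interp g"
  have s: "spec i f = spec i g" for i
    using fun_cong[OF HZ.Phi_inj[OF interp_nonempty[OF f] eq[unfolded interp_def]], of i] .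
  have e: "f m k = g m k" if m: "m \<ge> 1" for m k
  proof -
    interpret E: cring "XT m" by (rule cring_XT)
    define a where "a = (%k. f m k \<ominus>\<^bsub>XT m\<^esub> g m k)"
    note fc = XX_component[OF f m] and gc = XX_component[OF g m]
    have ac: "a k \<in> carrier (XT m)" for k unfolding a_def using fc gc by simp
    have "Spec m i a = 0" for i
    proof -
      have "Spec m i (f m) = Spec m i a + Spec m i (g m)"
        using Spec_add[of m a "g m" i, OF m ac gc] fc gc by (simp add: a_def E.minus_eq E.a_assoc E.l_neg)
      then show ?thesis using specialize_HZ(2)[OF f m, of i] specialize_HZ(2)[OF g m, of i] s[of i] by simp
    qed
    \<comment> \<open>Once the first coefficient vanishes, division by q - zeta_m gives the same
      statement for the shifted sequence.\<close>
    then have "\<forall>i. Spec m i (%l. a (l + k)) = 0"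
    proof (induction k)
      case (Suc k)
      have "sg m i (a k) = 0" for i
        using sg_inj[OF dom m ac Suc.IH[OF Suc.prems, rule_format]] ring_hom_0[OF cring_XT cring_rg[OF subring_W] sg_map(2)[OF m], of i] by simp
      then show ?case using Suc.IH[OF Suc.prems] Spec_Suc[of m _ "%l. a (l + k)"] by simp
    qed simp
    then have "a k = \<zero>\<^bsub>XT m\<^esub>" using sg_inj[OF dom m ac, of "%l. l + k"] by simp
    then show ?thesis unfolding a_def using E.r_right_minus_eq[OF fc gc] by simp
  qed
  show "f = g"
  proof (rule extensionalityI[of _ "{1..}"])
    show "f \<in> extensional {1..}" "g \<in> extensional {1..}" using XX_extensional f g by blast+
    show "f m = g m" if "m \<in> {1..}" for m using e[of m] that by auto
  qed
qed

end

theorem lemma1p2: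
  fixes R :: "'a ring" and \<eta> :: "(int \<Rightarrow> int) \<Rightarrow> 'a" and ev :: "'a \<Rightarrow> int"
    and \<zeta> :: "nat \<Rightarrow> complex"
  assumes "root_of_unity_system \<zeta>"
    and "etale_algebra (laurent \<Z>) R \<eta>"
    and "ev \<in> ring_hom R \<Z>"
    and "\<forall>P \<in> carrier (laurent \<Z>). ev (\<eta> P) = laurent_eval \<Z> \<Z> id 1 P"
  shows
    "(\<exists>\<Phi>. \<Phi> \<in> carrier (habiro_ext \<zeta> R \<eta>) \<rightarrow> carrier (habiro_lim \<zeta>)
        \<and> inj_on \<Phi> (carrier (habiro_ext \<zeta> R \<eta>))
        \<and> (\<forall>f \<in> carrier (habiro_ext \<zeta> R \<eta>).
             (\<forall>n::int. n > 0 \<longrightarrow> specialize \<zeta> R \<eta> ev (n - 1) f \<in> q_laurent \<zeta>)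
               \<longrightarrow> \<Phi> f \<in> q_laurent_lim \<zeta>))
   \<and> (\<exists>\<Phi>. \<Phi> \<in> ring_hom (habiro_ext \<zeta> R \<eta>) (habiro_lim \<zeta>)
        \<and> (\<forall>f \<in> carrier (habiro_ext \<zeta> R \<eta>). interpolates \<zeta> R \<eta> ev f (\<Phi> f))
        \<and> (domain R \<longrightarrow> inj_on \<Phi> (carrier (habiro_ext \<zeta> R \<eta>)))
        \<and> (\<forall>f \<in> carrier (habiro_ext \<zeta> R \<eta>).
             (\<forall>n::int. n > 0 \<longrightarrow> specialize \<zeta> R \<eta> ev (n - 1) f \<in> q_laurent \<zeta>)
               \<longrightarrow> \<Phi> f \<in> q_laurent_lim \<zeta>))"
proof -
  interpret habiro_etale R \<eta> \<zeta> ev by unfold_locales (fact assms)+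
  show ?thesis
    using injection_exists interp_hom interp_interpolates interp_inj interp_q_laurent by blast
qed

end
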